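(* Let $k$ be a field of characteristic $0$, let $n\ge 1$, and let $\mathfrak D_n=\mathrm{Spf}\,k[[x_1,\dots,x_n]]$ be the $n$-dimensional formal disk. The category $\mathrm{Bun}_\nabla(\mathfrak D_n)$ of finite rank vector bundles with (not necessarily flat) connection on $\mathfrak D_n$ is equivalent, as a tensor category, to the category of finite-dimensional representations over $k$ of the Lie algebra $\mathrm{FL}_{\ge 2}(k^n)$.
   Context: $\mathrm{FL}(V)=\bigoplus_{d\ge1}\mathrm{FL}_d(V)$ is the free Lie $k$-algebra generated by a vector space $V$, graded so that $\mathrm{FL}_d(V)$ is spanned by brackets of exactly $d$ elements of $V$; $\mathrm{FL}_{\ge2}(V)=\bigoplus_{d\ge2}\mathrm{FL}_d(V)$ is a Lie subalgebra. A vector bundle of finite rank on $\mathfrak D_n$ is a free $k[[x_1,\dots,x_n]]$-module $E$ of finite rank. A connection on $E$ is a collection of $k$-linear operators $\nabla_1,\dots,\nabla_n:E\to E$ with $\nabla_i(fe)=\frac{\partial f}{\partial x_i}e+f\nabla_i(e)$. In a trivialization $E\simeq k[[x]]^N$ one has $\nabla_i=\partial_i+A_i$ with $A_i\in\mathrm{Mat}_N\,k[[x_1,\dots,x_n]]$. Morphisms in $\mathrm{Bun}_\nabla(\mathfrak D_n)$ are module morphisms commuting with the $\nabla_i$. The tensor structure is the tensor product over $k[[x_1,\dots,x_n]]$ with connection $\nabla\otimes1+1\otimes\nabla'$; on representations it is the usual tensor product. *)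

theory Defs
  imports
    "HOL-Algebra.Algebraic_Closure_Type"
    "HOL-Analysis.Finite_Cartesian_Product"
begin

section \<open>Power series in finitely many variables\<close>

text \<open>
  The variables are indexed by a finite type \<open>'n\<close>; a series is its family of coefficients,
  indexed by exponent vectors.  As a type of class \<open>comm_ring_1\<close> it is turned into a
  ring with carrier by \<^const>\<open>ring_of_type_algebra\<close>.
\<close>

typedef ('k, 'n) mps = "UNIV :: (('n \<Rightarrow> nat) \<Rightarrow> 'k) set"
  morphisms mps_coeff Abs_mps ..

setup_lifting type_definition_mps

definition splittings :: "('n \<Rightarrow> nat) \<Rightarrow> (('n \<Rightarrow> nat) \<times> ('n \<Rightarrow> nat)) set" where
  "splittings e = {(a, b). \<forall>i. a i + b i = e i}"

lemma finite_splittings: "finite (splittings (e :: 'n::finite \<Rightarrow> nat))"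
proof -
  have "finite (PiE UNIV (\<lambda>i. {..e i}))" by (intro finite_PiE) auto
  moreover have "splittings e \<subseteq> PiE UNIV (\<lambda>i. {..e i}) \<times> PiE UNIV (\<lambda>i. {..e i})"
    unfolding splittings_def by (auto simp: PiE_def Pi_def) (metis le_add1 le_add2)+
  ultimately show ?thesis by (meson finite_SigmaI finite_subset)
qed

instantiation mps :: (comm_ring_1, finite) comm_ring_1
begin

lift_definition zero_mps :: "('a, 'b) mps" is "\<lambda>_. 0" .
lift_definition one_mps :: "('a, 'b) mps" is "\<lambda>e. if e = (\<lambda>_. 0) then 1 else 0" .
lift_definition plus_mps :: "('a, 'b) mps \<Rightarrow> ('a, 'b) mps \<Rightarrow> ('a, 'b) mps"
  is "\<lambda>f g e. f e + g e" .
lift_definition uminus_mps :: "('a, 'b) mps \<Rightarrow> ('a, 'b) mps" is "\<lambda>f e. - f e" .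
lift_definition minus_mps :: "('a, 'b) mps \<Rightarrow> ('a, 'b) mps \<Rightarrow> ('a, 'b) mps"
  is "\<lambda>f g e. f e - g e" .
lift_definition times_mps :: "('a, 'b) mps \<Rightarrow> ('a, 'b) mps \<Rightarrow> ('a, 'b) mps"
  is "\<lambda>f g e. \<Sum>(a, b)\<in>splittings e. f a * g b" .

instance
proof
  fix f g h :: "('a, 'b) mps"
  show "f * g * h = f * (g * h)"
  proof (transfer, rule ext)
    fix f g h :: "('b \<Rightarrow> nat) \<Rightarrow> 'a" and e
    have "(\<Sum>(p, c)\<in>splittings e. (\<Sum>(a, b)\<in>splittings p. f a * g b) * h c)
        = (\<Sum>(x, y)\<in>Sigma (splittings e) (\<lambda>x. splittings (fst x)).
             f (fst y) * g (snd y) * h (snd x))"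
      by (subst sum.Sigma[symmetric])
         (auto simp: finite_splittings sum_distrib_right case_prod_unfold)
    also have "\<dots> = (\<Sum>(x, y)\<in>Sigma (splittings e) (\<lambda>x. splittings (snd x)).
             f (fst x) * (g (fst y) * h (snd y)))"
      by (rule sum.reindex_bij_witness
            [where i = "\<lambda>((a, q), (b, c)). ((\<lambda>i. a i + b i, c), (a, b))"
               and j = "\<lambda>((p, c), (a, b)). ((a, \<lambda>i. b i + c i), (b, c))"])
         (auto simp: splittings_def mult.assoc add.assoc[symmetric], metis add.assoc)
    also have "\<dots> = (\<Sum>(a, q)\<in>splittings e. f a * (\<Sum>(b, c)\<in>splittings q. g b * h c))"
      by (subst sum.Sigma[symmetric])
         (auto simp: finite_splittings sum_distrib_left case_prod_unfold)
    finally show "(\<Sum>(p, c)\<in>splittings e. (\<Sum>(a, b)\<in>splittings p. f a * g b) * h c)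
        = (\<Sum>(a, q)\<in>splittings e. f a * (\<Sum>(b, c)\<in>splittings q. g b * h c))" .
  qed
  show "f * g = g * f"
  proof (transfer, rule ext)
    fix f g :: "('b \<Rightarrow> nat) \<Rightarrow> 'a" and e
    show "(\<Sum>(a, b)\<in>splittings e. f a * g b) = (\<Sum>(a, b)\<in>splittings e. g a * f b)"
      by (rule sum.reindex_bij_witness[where i = prod.swap and j = prod.swap])
         (auto simp: splittings_def mult.commute add.commute)
  qed
  show "1 * f = f"
  proof (transfer, rule ext)
    fix f :: "('b \<Rightarrow> nat) \<Rightarrow> 'a" and e
    have "(\<Sum>(a, b)\<in>splittings e. (if a = (\<lambda>_. 0) then 1 else 0) * f b)
        = (\<Sum>(a, b)\<in>{(\<lambda>_ :: 'b. 0 :: nat, e)}. (if a = (\<lambda>_. 0) then 1 else 0) * f b)"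
      by (rule sum.mono_neutral_right[OF finite_splittings])
         (auto simp: splittings_def fun_eq_iff split: if_splits)
    then show "(\<Sum>(a, b)\<in>splittings e. (if a = (\<lambda>_. 0) then 1 else 0) * f b) = f e"
      by simp
  qed
  show "(f + g) * h = f * h + g * h"
    by transfer (auto simp: fun_eq_iff sum.distrib distrib_right case_prod_unfold)
  show "(0 :: ('a, 'b) mps) \<noteq> 1"
    by transfer (auto simp: fun_eq_iff)
qed (transfer; auto simp: fun_eq_iff)+

end

lift_definition mps_const :: "'k::zero \<Rightarrow> ('k, 'n) mps"
  is "\<lambda>c e. if e = (\<lambda>_. 0) then c else 0" .

lift_definition mps_deriv :: "'n \<Rightarrow> ('k::semiring_1, 'n) mps \<Rightarrow> ('k, 'n) mps"
  is "\<lambda>i f e. of_nat (Suc (e i)) * f (e(i := Suc (e i)))" .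


section \<open>The free Lie algebra on \<open>k^n\<close>\<close>

text \<open>
  The universal construction by generators and relations: formal Lie expressions in the
  elements of the vector space \<open>'k ^ 'n\<close>, modulo the congruence generated by the axioms of
  a Lie algebra over \<open>'k\<close> and the linearity of the inclusion of generators.
\<close>

datatype (dead 'k, dead 'n::finite) lie_term =
    Gen "'k ^ 'n"
  | Zero
  | Add "('k, 'n) lie_term" "('k, 'n) lie_term"
  | Scale 'k "('k, 'n) lie_term"
  | Brk "('k, 'n) lie_term" "('k, 'n) lie_term"

inductive lie_eq :: "('k::field, 'n::finite) lie_term \<Rightarrow> ('k, 'n) lie_term \<Rightarrow> bool" where
  refl: "lie_eq x x"
| sym: "lie_eq x y \<Longrightarrow> lie_eq y x"
| trans: "lie_eq x y \<Longrightarrow> lie_eq y z \<Longrightarrow> lie_eq x z"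
| Add_cong: "lie_eq x x' \<Longrightarrow> lie_eq y y' \<Longrightarrow> lie_eq (Add x y) (Add x' y')"
| Scale_cong: "lie_eq x x' \<Longrightarrow> lie_eq (Scale c x) (Scale c x')"
| Brk_cong: "lie_eq x x' \<Longrightarrow> lie_eq y y' \<Longrightarrow> lie_eq (Brk x y) (Brk x' y')"
| Add_assoc: "lie_eq (Add (Add x y) z) (Add x (Add y z))"
| Add_commute: "lie_eq (Add x y) (Add y x)"
| Add_Zero: "lie_eq (Add Zero x) x"
| Add_inverse: "lie_eq (Add (Scale (- 1) x) x) Zero"
| Scale_Add: "lie_eq (Scale c (Add x y)) (Add (Scale c x) (Scale c y))"
| Scale_plus: "lie_eq (Scale (c + d) x) (Add (Scale c x) (Scale d x))"
| Scale_Scale: "lie_eq (Scale c (Scale d x)) (Scale (c * d) x)"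
| Scale_one: "lie_eq (Scale 1 x) x"
| Brk_Add_left: "lie_eq (Brk (Add x y) z) (Add (Brk x z) (Brk y z))"
| Brk_Add_right: "lie_eq (Brk x (Add y z)) (Add (Brk x y) (Brk x z))"
| Brk_Scale_left: "lie_eq (Brk (Scale c x) y) (Scale c (Brk x y))"
| Brk_Scale_right: "lie_eq (Brk x (Scale c y)) (Scale c (Brk x y))"
| Brk_self: "lie_eq (Brk x x) Zero"
| Jacobi: "lie_eq (Add (Brk x (Brk y z)) (Add (Brk y (Brk z x)) (Brk z (Brk x y)))) Zero"
| Gen_add: "lie_eq (Gen (v + w)) (Add (Gen v) (Gen w))"
| Gen_scale: "lie_eq (Gen (c *s v)) (Scale c (Gen v))"

quotient_type (overloaded) ('k, 'n) free_lie = "('k::field, 'n::finite) lie_term" / lie_eq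
  by (intro equivpI reflpI sympI transpI) (auto intro: lie_eq.refl lie_eq.sym lie_eq.trans)

lift_definition fl_gen :: "'k::field ^ 'n::finite \<Rightarrow> ('k, 'n) free_lie" is Gen .

lift_definition fl_bracket ::
    "('k::field, 'n::finite) free_lie \<Rightarrow> ('k, 'n) free_lie \<Rightarrow> ('k, 'n) free_lie"
  is Brk by (rule lie_eq.Brk_cong)

lift_definition fl_scale ::
    "'k::field \<Rightarrow> ('k, 'n::finite) free_lie \<Rightarrow> ('k, 'n) free_lie"
  is Scale by (rule lie_eq.Scale_cong)

instantiation free_lie :: (field, finite) ab_group_add
begin

lift_definition zero_free_lie :: "('a, 'b) free_lie" is Zero .
lift_definition plus_free_lie ::
    "('a, 'b) free_lie \<Rightarrow> ('a, 'b) free_lie \<Rightarrow> ('a, 'b) free_lie"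
  is Add by (rule lie_eq.Add_cong)
definition uminus_free_lie :: "('a, 'b) free_lie \<Rightarrow> ('a, 'b) free_lie"
  where "- x = fl_scale (- 1) x"
definition minus_free_lie :: "('a, 'b) free_lie \<Rightarrow> ('a, 'b) free_lie \<Rightarrow> ('a, 'b) free_lie"
  where "x - y = x + - (y :: ('a, 'b) free_lie)"

instance
proof
  fix x y z :: "('a, 'b) free_lie"
  show "x + y + z = x + (y + z)" by transfer (rule lie_eq.Add_assoc)
  show "x + y = y + x" by transfer (rule lie_eq.Add_commute)
  show "0 + x = x" by transfer (rule lie_eq.Add_Zero)
  show "- x + x = 0" unfolding uminus_free_lie_def by transfer (rule lie_eq.Add_inverse)
  show "x - y = x + - y" by (rule minus_free_lie_def)
qed

end

global_interpretation FL: vector_space "fl_scale :: 'k::field \<Rightarrow> ('k, 'n::finite) free_lie \<Rightarrow> _"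
  by unfold_locales
     (transfer; rule lie_eq.Scale_Add lie_eq.Scale_plus lie_eq.Scale_Scale lie_eq.Scale_one)+

inductive is_bracket_of :: "nat \<Rightarrow> ('k::field, 'n::finite) free_lie \<Rightarrow> bool" where
  "is_bracket_of 1 (fl_gen v)"
| "is_bracket_of p x \<Longrightarrow> is_bracket_of q y \<Longrightarrow> is_bracket_of (p + q) (fl_bracket x y)"

definition FL_deg :: "nat \<Rightarrow> ('k::field, 'n::finite) free_lie set" where
  "FL_deg d = FL.span {x. is_bracket_of d x}"

definition FL_ge2 :: "('k::field, 'n::finite) free_lie set" where
  "FL_ge2 = FL.span (\<Union>d\<in>{2..}. FL_deg d)"


section \<open>Tensor categories\<close>

record ('o, 'm) cat =
  Obj :: "'o set"
  Arr :: "'m set"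
  Dom :: "'m \<Rightarrow> 'o"
  Cod :: "'m \<Rightarrow> 'o"
  Ident :: "'o \<Rightarrow> 'm"
  Comp :: "'m \<Rightarrow> 'm \<Rightarrow> 'm" (infixr \<open>\<cdot>\<index>\<close> 70)

definition homset :: "('o, 'm, 'x) cat_scheme \<Rightarrow> 'o \<Rightarrow> 'o \<Rightarrow> 'm set" where
  "homset C A B = {f \<in> Arr C. Dom C f = A \<and> Cod C f = B}"

locale category =
  fixes C :: "('o, 'm, 'x) cat_scheme" (structure)
  assumes Dom_closed: "f \<in> Arr C \<Longrightarrow> Dom C f \<in> Obj C"
    and Cod_closed: "f \<in> Arr C \<Longrightarrow> Cod C f \<in> Obj C"
    and Ident_hom: "A \<in> Obj C \<Longrightarrow> Ident C A \<in> homset C A A"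
    and Comp_hom: "f \<in> homset C A B \<Longrightarrow> g \<in> homset C B D \<Longrightarrow> g \<cdot> f \<in> homset C A D"
    and Ident_left: "f \<in> homset C A B \<Longrightarrow> Ident C B \<cdot> f = f"
    and Ident_right: "f \<in> homset C A B \<Longrightarrow> f \<cdot> Ident C A = f"
    and Comp_assoc: "f \<in> homset C A B \<Longrightarrow> g \<in> homset C B D \<Longrightarrow> h \<in> homset C D E \<Longrightarrow>
      (h \<cdot> g) \<cdot> f = h \<cdot> (g \<cdot> f)"

definition is_iso :: "('o, 'm, 'x) cat_scheme \<Rightarrow> 'o \<Rightarrow> 'o \<Rightarrow> 'm \<Rightarrow> bool" where
  "is_iso C A B f \<longleftrightarrow> f \<in> homset C A B \<and>
     (\<exists>g \<in> homset C B A. g \<cdot>\<^bsub>C\<^esub> f = Ident C A \<and> f \<cdot>\<^bsub>C\<^esub> g = Ident C B)"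

locale category_functor = C: category C + D: category D
  for C :: "('o, 'm, 'x) cat_scheme" and D :: "('p, 'l, 'y) cat_scheme" +
  fixes Fo :: "'o \<Rightarrow> 'p" and Fm :: "'m \<Rightarrow> 'l"
  assumes Fo_closed: "A \<in> Obj C \<Longrightarrow> Fo A \<in> Obj D"
    and Fm_hom: "f \<in> homset C A B \<Longrightarrow> Fm f \<in> homset D (Fo A) (Fo B)"
    and Fm_Ident: "A \<in> Obj C \<Longrightarrow> Fm (Ident C A) = Ident D (Fo A)"
    and Fm_Comp: "f \<in> homset C A B \<Longrightarrow> g \<in> homset C B E \<Longrightarrow>
      Fm (g \<cdot>\<^bsub>C\<^esub> f) = Fm g \<cdot>\<^bsub>D\<^esub> Fm f"

definition natural_iso ::
    "('o, 'm, 'x) cat_scheme \<Rightarrow> ('p, 'l, 'y) cat_scheme \<Rightarrow> ('o \<Rightarrow> 'p) \<Rightarrow> ('m \<Rightarrow> 'l)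
      \<Rightarrow> ('o \<Rightarrow> 'p) \<Rightarrow> ('m \<Rightarrow> 'l) \<Rightarrow> ('o \<Rightarrow> 'l) \<Rightarrow> bool" where
  "natural_iso C D Fo Fm Go Gm \<eta> \<longleftrightarrow>
     (\<forall>A \<in> Obj C. is_iso D (Fo A) (Go A) (\<eta> A)) \<and>
     (\<forall>A B. \<forall>f \<in> homset C A B. \<eta> B \<cdot>\<^bsub>D\<^esub> Fm f = Gm f \<cdot>\<^bsub>D\<^esub> \<eta> A)"

definition is_equivalence ::
    "('o, 'm, 'x) cat_scheme \<Rightarrow> ('p, 'l, 'y) cat_scheme \<Rightarrow> ('o \<Rightarrow> 'p) \<Rightarrow> ('m \<Rightarrow> 'l) \<Rightarrow> bool"
  where
  "is_equivalence C D Fo Fm \<longleftrightarrow> category_functor C D Fo Fm \<and>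
     (\<exists>Go Gm \<eta> \<epsilon>. category_functor D C Go Gm \<and>
        natural_iso C C id id (Go \<circ> Fo) (Gm \<circ> Fm) \<eta> \<and>
        natural_iso D D (Fo \<circ> Go) (Fm \<circ> Gm) id id \<epsilon>)"

record ('o, 'm, 'k) tensor_cat = "('o, 'm) cat" +
  ZeroM :: "'o \<Rightarrow> 'o \<Rightarrow> 'm"
  AddM :: "'m \<Rightarrow> 'm \<Rightarrow> 'm"
  ScaleM :: "'k \<Rightarrow> 'm \<Rightarrow> 'm"
  TensO :: "'o \<Rightarrow> 'o \<Rightarrow> 'o"
  TensM :: "'m \<Rightarrow> 'm \<Rightarrow> 'm"
  UnitO :: "'o"
  Assoc :: "'o \<Rightarrow> 'o \<Rightarrow> 'o \<Rightarrow> 'm"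
  LUnit :: "'o \<Rightarrow> 'm"
  RUnit :: "'o \<Rightarrow> 'm"
  Braid :: "'o \<Rightarrow> 'o \<Rightarrow> 'm"

text \<open>A \<^typ>\<open>('k, 'm) module\<close> record must also have ring components; the \<^locale>\<open>Module.module\<close>
  axioms do not refer to them.\<close>

definition hom_space ::
    "('o, 'm, 'k, 'x) tensor_cat_scheme \<Rightarrow> 'o \<Rightarrow> 'o \<Rightarrow> ('k, 'm) module" where
  "hom_space C A B = \<lparr>carrier = homset C A B, monoid.mult = Comp C, one = Ident C A,
     ring.zero = ZeroM C A B, add = AddM C, module.smult = ScaleM C\<rparr>"

text \<open>A \<open>k\<close>-linear symmetric monoidal category.\<close>

locale tensor_category = category C
  for C :: "('o, 'm, 'k::field, 'x) tensor_cat_scheme" (structure) +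
  assumes hom_space_module: "A \<in> Obj C \<Longrightarrow> B \<in> Obj C \<Longrightarrow>
      Module.module (ring_of_type_algebra :: 'k ring) (hom_space C A B)"
    and Comp_add_left: "f \<in> homset C A B \<Longrightarrow> g \<in> homset C B D \<Longrightarrow> h \<in> homset C B D \<Longrightarrow>
      AddM C g h \<cdot> f = AddM C (g \<cdot> f) (h \<cdot> f)"
    and Comp_add_right: "f \<in> homset C A B \<Longrightarrow> g \<in> homset C A B \<Longrightarrow> h \<in> homset C B D \<Longrightarrow>
      h \<cdot> AddM C f g = AddM C (h \<cdot> f) (h \<cdot> g)"
    and Comp_scale_left: "f \<in> homset C A B \<Longrightarrow> g \<in> homset C B D \<Longrightarrow>
      ScaleM C c g \<cdot> f = ScaleM C c (g \<cdot> f)"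
    and Comp_scale_right: "f \<in> homset C A B \<Longrightarrow> g \<in> homset C B D \<Longrightarrow>
      g \<cdot> ScaleM C c f = ScaleM C c (g \<cdot> f)"
    and TensO_closed: "A \<in> Obj C \<Longrightarrow> B \<in> Obj C \<Longrightarrow> TensO C A B \<in> Obj C"
    and TensM_hom: "f \<in> homset C A A' \<Longrightarrow> g \<in> homset C B B' \<Longrightarrow>
      TensM C f g \<in> homset C (TensO C A B) (TensO C A' B')"
    and TensM_Ident: "A \<in> Obj C \<Longrightarrow> B \<in> Obj C \<Longrightarrow>
      TensM C (Ident C A) (Ident C B) = Ident C (TensO C A B)"
    and TensM_Comp: "f \<in> homset C A A' \<Longrightarrow> f' \<in> homset C A' A'' \<Longrightarrow>
      g \<in> homset C B B' \<Longrightarrow> g' \<in> homset C B' B'' \<Longrightarrow>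
      TensM C (f' \<cdot> f) (g' \<cdot> g) = TensM C f' g' \<cdot> TensM C f g"
    and TensM_add_left: "f \<in> homset C A A' \<Longrightarrow> f' \<in> homset C A A' \<Longrightarrow> g \<in> homset C B B' \<Longrightarrow>
      TensM C (AddM C f f') g = AddM C (TensM C f g) (TensM C f' g)"
    and TensM_add_right: "f \<in> homset C A A' \<Longrightarrow> g \<in> homset C B B' \<Longrightarrow> g' \<in> homset C B B' \<Longrightarrow>
      TensM C f (AddM C g g') = AddM C (TensM C f g) (TensM C f g')"
    and TensM_scale_left: "f \<in> homset C A A' \<Longrightarrow> g \<in> homset C B B' \<Longrightarrow>
      TensM C (ScaleM C c f) g = ScaleM C c (TensM C f g)"
    and TensM_scale_right: "f \<in> homset C A A' \<Longrightarrow> g \<in> homset C B B' \<Longrightarrow>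
      TensM C f (ScaleM C c g) = ScaleM C c (TensM C f g)"
    and UnitO_closed: "UnitO C \<in> Obj C"
    and Assoc_iso: "A \<in> Obj C \<Longrightarrow> B \<in> Obj C \<Longrightarrow> D \<in> Obj C \<Longrightarrow>
      is_iso C (TensO C (TensO C A B) D) (TensO C A (TensO C B D)) (Assoc C A B D)"
    and Assoc_natural: "f \<in> homset C A A' \<Longrightarrow> g \<in> homset C B B' \<Longrightarrow> h \<in> homset C D D' \<Longrightarrow>
      Assoc C A' B' D' \<cdot> TensM C (TensM C f g) h = TensM C f (TensM C g h) \<cdot> Assoc C A B D"
    and LUnit_iso: "A \<in> Obj C \<Longrightarrow> is_iso C (TensO C (UnitO C) A) A (LUnit C A)"
    and LUnit_natural: "f \<in> homset C A A' \<Longrightarrow>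
      LUnit C A' \<cdot> TensM C (Ident C (UnitO C)) f = f \<cdot> LUnit C A"
    and RUnit_iso: "A \<in> Obj C \<Longrightarrow> is_iso C (TensO C A (UnitO C)) A (RUnit C A)"
    and RUnit_natural: "f \<in> homset C A A' \<Longrightarrow>
      RUnit C A' \<cdot> TensM C f (Ident C (UnitO C)) = f \<cdot> RUnit C A"
    and Braid_iso: "A \<in> Obj C \<Longrightarrow> B \<in> Obj C \<Longrightarrow>
      is_iso C (TensO C A B) (TensO C B A) (Braid C A B)"
    and Braid_natural: "f \<in> homset C A A' \<Longrightarrow> g \<in> homset C B B' \<Longrightarrow>
      Braid C A' B' \<cdot> TensM C f g = TensM C g f \<cdot> Braid C A B"
    and pentagon: "A \<in> Obj C \<Longrightarrow> B \<in> Obj C \<Longrightarrow> D \<in> Obj C \<Longrightarrow> E \<in> Obj C \<Longrightarrow>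
      TensM C (Ident C A) (Assoc C B D E) \<cdot> Assoc C A (TensO C B D) E
          \<cdot> TensM C (Assoc C A B D) (Ident C E)
        = Assoc C A B (TensO C D E) \<cdot> Assoc C (TensO C A B) D E"
    and triangle: "A \<in> Obj C \<Longrightarrow> B \<in> Obj C \<Longrightarrow>
      TensM C (Ident C A) (LUnit C B) \<cdot> Assoc C A (UnitO C) B
        = TensM C (RUnit C A) (Ident C B)"
    and hexagon: "A \<in> Obj C \<Longrightarrow> B \<in> Obj C \<Longrightarrow> D \<in> Obj C \<Longrightarrow>
      Assoc C B D A \<cdot> Braid C A (TensO C B D) \<cdot> Assoc C A B D
        = TensM C (Ident C B) (Braid C A D) \<cdot> Assoc C B A D
            \<cdot> TensM C (Braid C A B) (Ident C D)"
    and symmetry: "A \<in> Obj C \<Longrightarrow> B \<in> Obj C \<Longrightarrow>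
      Braid C B A \<cdot> Braid C A B = Ident C (TensO C A B)"

text \<open>A \<open>k\<close>-linear (strong) symmetric monoidal functor.\<close>

locale tensor_functor = C: tensor_category C + D: tensor_category D + category_functor C D Fo Fm
  for C :: "('o, 'm, 'k::field, 'x) tensor_cat_scheme"
    and D :: "('p, 'l, 'k, 'y) tensor_cat_scheme"
    and Fo :: "'o \<Rightarrow> 'p" and Fm :: "'m \<Rightarrow> 'l" +
  fixes \<phi> :: "'o \<Rightarrow> 'o \<Rightarrow> 'l" and \<phi>\<^sub>1 :: "'l"
  assumes Fm_add: "f \<in> homset C A B \<Longrightarrow> g \<in> homset C A B \<Longrightarrow>
      Fm (AddM C f g) = AddM D (Fm f) (Fm g)"
    and Fm_scale: "f \<in> homset C A B \<Longrightarrow> Fm (ScaleM C c f) = ScaleM D c (Fm f)"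
    and \<phi>_iso: "A \<in> Obj C \<Longrightarrow> B \<in> Obj C \<Longrightarrow>
      is_iso D (TensO D (Fo A) (Fo B)) (Fo (TensO C A B)) (\<phi> A B)"
    and \<phi>_natural: "f \<in> homset C A A' \<Longrightarrow> g \<in> homset C B B' \<Longrightarrow>
      \<phi> A' B' \<cdot>\<^bsub>D\<^esub> TensM D (Fm f) (Fm g) = Fm (TensM C f g) \<cdot>\<^bsub>D\<^esub> \<phi> A B"
    and \<phi>\<^sub>1_iso: "is_iso D (UnitO D) (Fo (UnitO C)) \<phi>\<^sub>1"
    and \<phi>_Assoc: "A \<in> Obj C \<Longrightarrow> B \<in> Obj C \<Longrightarrow> E \<in> Obj C \<Longrightarrow>
      Fm (Assoc C A B E) \<cdot>\<^bsub>D\<^esub> \<phi> (TensO C A B) E \<cdot>\<^bsub>D\<^esub> TensM D (\<phi> A B) (Ident D (Fo E))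
        = \<phi> A (TensO C B E) \<cdot>\<^bsub>D\<^esub> TensM D (Ident D (Fo A)) (\<phi> B E)
            \<cdot>\<^bsub>D\<^esub> Assoc D (Fo A) (Fo B) (Fo E)"
    and \<phi>_LUnit: "A \<in> Obj C \<Longrightarrow>
      Fm (LUnit C A) \<cdot>\<^bsub>D\<^esub> \<phi> (UnitO C) A \<cdot>\<^bsub>D\<^esub> TensM D \<phi>\<^sub>1 (Ident D (Fo A)) = LUnit D (Fo A)"
    and \<phi>_RUnit: "A \<in> Obj C \<Longrightarrow>
      Fm (RUnit C A) \<cdot>\<^bsub>D\<^esub> \<phi> A (UnitO C) \<cdot>\<^bsub>D\<^esub> TensM D (Ident D (Fo A)) \<phi>\<^sub>1 = RUnit D (Fo A)"
    and \<phi>_Braid: "A \<in> Obj C \<Longrightarrow> B \<in> Obj C \<Longrightarrow>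
      Fm (Braid C A B) \<cdot>\<^bsub>D\<^esub> \<phi> A B = \<phi> B A \<cdot>\<^bsub>D\<^esub> Braid D (Fo A) (Fo B)"

definition tensor_equivalent ::
    "('o, 'm, 'k::field, 'x) tensor_cat_scheme \<Rightarrow> ('p, 'l, 'k, 'y) tensor_cat_scheme \<Rightarrow> bool"
  where
  "tensor_equivalent C D \<longleftrightarrow>
     (\<exists>Fo Fm \<phi> \<phi>\<^sub>1. tensor_functor C D Fo Fm \<phi> \<phi>\<^sub>1 \<and> is_equivalence C D Fo Fm)"


section \<open>Modules and tensor products\<close>

definition is_module :: "('r::comm_ring_1, 'u) module \<Rightarrow> bool" where
  "is_module M \<longleftrightarrow> Module.module (ring_of_type_algebra :: 'r ring) M"

definition is_finite_basis :: "('r::comm_ring_1, 'u) module \<Rightarrow> 'u set \<Rightarrow> bool" where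
  "is_finite_basis M B \<longleftrightarrow> finite B \<and> B \<subseteq> carrier M \<and>
     (\<forall>x \<in> carrier M. \<exists>!c. c \<in> extensional B \<and> x = (\<Oplus>\<^bsub>M\<^esub>b\<in>B. c b \<odot>\<^bsub>M\<^esub> b))"

definition finite_free :: "('r::comm_ring_1, 'u) module \<Rightarrow> bool" where
  "finite_free M \<longleftrightarrow> is_module M \<and> (\<exists>B. is_finite_basis M B)"

definition is_additive ::
    "('r, 'u) module \<Rightarrow> ('r, 'v) module \<Rightarrow> ('u \<Rightarrow> 'v) \<Rightarrow> bool" where
  "is_additive M N f \<longleftrightarrow> f \<in> carrier M \<rightarrow> carrier N \<and>
     (\<forall>x \<in> carrier M. \<forall>y \<in> carrier M. f (x \<oplus>\<^bsub>M\<^esub> y) = f x \<oplus>\<^bsub>N\<^esub> f y)"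

definition is_linear ::
    "('r, 'u) module \<Rightarrow> ('r, 'v) module \<Rightarrow> ('u \<Rightarrow> 'v) \<Rightarrow> bool" where
  "is_linear M N f \<longleftrightarrow> is_additive M N f \<and>
     (\<forall>r. \<forall>x \<in> carrier M. f (r \<odot>\<^bsub>M\<^esub> x) = r \<odot>\<^bsub>N\<^esub> f x)"

definition linear_maps ::
    "('r, 'u) module \<Rightarrow> ('r, 'v) module \<Rightarrow> ('u \<Rightarrow> 'v) set" where
  "linear_maps M N = {f \<in> extensional (carrier M). is_linear M N f}"

definition is_bilinear ::
    "('r, 'u) module \<Rightarrow> ('r, 'v) module \<Rightarrow> ('r, 'w) module \<Rightarrow> ('u \<Rightarrow> 'v \<Rightarrow> 'w) \<Rightarrow> bool" where
  "is_bilinear M N P b \<longleftrightarrow>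
     (\<forall>x \<in> carrier M. is_linear N P (b x)) \<and> (\<forall>y \<in> carrier N. is_linear M P (\<lambda>x. b x y))"

text \<open>
  All modules have their carriers inside one type \<open>'u\<close>, which plays the role of a universe;
  the universal property is tested against all modules in this universe.  When the base ring is
  infinite and injects into \<open>'u\<close>, every finite free module, over any type, is isomorphic to one
  with carrier in \<open>'u\<close>; hence tensor products of finite free modules exist there, and the choice
  below is well defined up to unique isomorphism.
\<close>

definition is_tensor_product ::
    "('r::comm_ring_1, 'u) module \<Rightarrow> ('r, 'u) module \<Rightarrow> ('r, 'u) module
      \<Rightarrow> ('u \<Rightarrow> 'u \<Rightarrow> 'u) \<Rightarrow> bool" where
  "is_tensor_product M N T t \<longleftrightarrow> is_module T \<and> is_bilinear M N T t \<and>
     (\<forall>(P :: ('r, 'u) module) b. is_module P \<and> is_bilinear M N P b \<longrightarrow>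
        (\<exists>!h. h \<in> linear_maps T P \<and> (\<forall>x \<in> carrier M. \<forall>y \<in> carrier N. h (t x y) = b x y)))"

definition chosen_tensor ::
    "('r::comm_ring_1, 'u) module \<Rightarrow> ('r, 'u) module \<Rightarrow> ('r, 'u) module \<times> ('u \<Rightarrow> 'u \<Rightarrow> 'u)"
  where "chosen_tensor M N = (SOME (T, t). is_tensor_product M N T t)"

definition tmod :: "('r::comm_ring_1, 'u) module \<Rightarrow> ('r, 'u) module \<Rightarrow> ('r, 'u) module" where
  "tmod M N = fst (chosen_tensor M N)"

definition tpair :: "('r::comm_ring_1, 'u) module \<Rightarrow> ('r, 'u) module \<Rightarrow> 'u \<Rightarrow> 'u \<Rightarrow> 'u" where
  "tpair M N = snd (chosen_tensor M N)"

text \<open>The ring itself as a module, transported into the universe along an injection.\<close>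

definition unit_mod :: "('r::comm_ring_1 \<Rightarrow> 'u) \<Rightarrow> ('r, 'u) module" where
  "unit_mod \<iota> = \<lparr>carrier = range \<iota>,
     monoid.mult = (\<lambda>a b. \<iota> (the_inv \<iota> a * the_inv \<iota> b)), one = \<iota> 1,
     ring.zero = \<iota> 0, add = (\<lambda>a b. \<iota> (the_inv \<iota> a + the_inv \<iota> b)),
     module.smult = (\<lambda>r a. \<iota> (r * the_inv \<iota> a))\<rparr>"


section \<open>Modules with operators\<close>

text \<open>
  Bundles with connection and representations are both modules with a family of additive
  operators: \<open>Act E i\<close> is the covariant derivative \<open>\<nabla>\<^sub>i\<close> of a bundle, and \<open>Act M x\<close> is the
  action of the Lie algebra element \<open>x\<close> on a representation.  In both cases the operators on
  a tensor product are \<open>D \<otimes> 1 + 1 \<otimes> D'\<close>, and this is the only additive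
  operator with the prescribed values on elementary tensors.
\<close>

record ('r, 'u, 'i) opmod =
  UMod :: "('r, 'u) module"
  Act :: "'i \<Rightarrow> 'u \<Rightarrow> 'u"

abbreviation Car :: "('r, 'u, 'i) opmod \<Rightarrow> 'u set" where
  "Car E \<equiv> carrier (UMod E)"

record ('o, 'u) arrow =
  Source :: 'o
  Target :: 'o
  Fun :: "'u \<Rightarrow> 'u"

definition tens_obj ::
    "('r::comm_ring_1, 'u, 'i) opmod \<Rightarrow> ('r, 'u, 'i) opmod \<Rightarrow> ('r, 'u, 'i) opmod" where
  "tens_obj E F = (let T = tmod (UMod E) (UMod F); t = tpair (UMod E) (UMod F) in
     \<lparr>UMod = T,
      Act = (\<lambda>i. THE D. D \<in> extensional (carrier T) \<and> is_additive T T D \<and>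
        (\<forall>x \<in> Car E. \<forall>y \<in> Car F. D (t x y) = t (Act E i x) y \<oplus>\<^bsub>T\<^esub> t x (Act F i y)))\<rparr>)"

definition tens ::
    "('r::comm_ring_1, 'u, 'i) opmod \<Rightarrow> ('r, 'u, 'i) opmod \<Rightarrow> 'u \<Rightarrow> 'u \<Rightarrow> 'u" where
  "tens E F = tpair (UMod E) (UMod F)"

definition tens_arr ::
    "(('r::comm_ring_1, 'u, 'i) opmod, 'u) arrow \<Rightarrow> (('r, 'u, 'i) opmod, 'u) arrow
      \<Rightarrow> (('r, 'u, 'i) opmod, 'u) arrow" where
  "tens_arr f g =
     (let E = Source f; F = Source g; E' = Target f; F' = Target g in
     \<lparr>Source = tens_obj E F, Target = tens_obj E' F',
      Fun = (THE h. h \<in> linear_maps (UMod (tens_obj E F)) (UMod (tens_obj E' F')) \<and>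
        (\<forall>x \<in> Car E. \<forall>y \<in> Car F. h (tens E F x y) = tens E' F' (Fun f x) (Fun g y)))\<rparr>)"

definition assoc_arr ::
    "('r::comm_ring_1, 'u, 'i) opmod \<Rightarrow> ('r, 'u, 'i) opmod \<Rightarrow> ('r, 'u, 'i) opmod
      \<Rightarrow> (('r, 'u, 'i) opmod, 'u) arrow" where
  "assoc_arr E F G =
     \<lparr>Source = tens_obj (tens_obj E F) G, Target = tens_obj E (tens_obj F G),
      Fun = (THE h. h \<in> linear_maps (UMod (tens_obj (tens_obj E F) G))
                                  (UMod (tens_obj E (tens_obj F G))) \<and>
        (\<forall>x \<in> Car E. \<forall>y \<in> Car F. \<forall>z \<in> Car G.
           h (tens (tens_obj E F) G (tens E F x y) z)
             = tens E (tens_obj F G) x (tens F G y z)))\<rparr>"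

definition braid_arr ::
    "('r::comm_ring_1, 'u, 'i) opmod \<Rightarrow> ('r, 'u, 'i) opmod \<Rightarrow> (('r, 'u, 'i) opmod, 'u) arrow"
  where
  "braid_arr E F =
     \<lparr>Source = tens_obj E F, Target = tens_obj F E,
      Fun = (THE h. h \<in> linear_maps (UMod (tens_obj E F)) (UMod (tens_obj F E)) \<and>
        (\<forall>x \<in> Car E. \<forall>y \<in> Car F. h (tens E F x y) = tens F E y x))\<rparr>"

definition unit_obj ::
    "('r::comm_ring_1 \<Rightarrow> 'u) \<Rightarrow> ('i \<Rightarrow> 'r \<Rightarrow> 'r) \<Rightarrow> ('r, 'u, 'i) opmod" where
  "unit_obj \<iota> \<delta> = \<lparr>UMod = unit_mod \<iota>, Act = (\<lambda>i a. \<iota> (\<delta> i (the_inv \<iota> a)))\<rparr>"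

definition lunit_arr ::
    "('r::comm_ring_1 \<Rightarrow> 'u) \<Rightarrow> ('i \<Rightarrow> 'r \<Rightarrow> 'r) \<Rightarrow> ('r, 'u, 'i) opmod
      \<Rightarrow> (('r, 'u, 'i) opmod, 'u) arrow" where
  "lunit_arr \<iota> \<delta> E =
     \<lparr>Source = tens_obj (unit_obj \<iota> \<delta>) E, Target = E,
      Fun = (THE h. h \<in> linear_maps (UMod (tens_obj (unit_obj \<iota> \<delta>) E)) (UMod E) \<and>
        (\<forall>r. \<forall>x \<in> Car E. h (tens (unit_obj \<iota> \<delta>) E (\<iota> r) x) = r \<odot>\<^bsub>UMod E\<^esub> x))\<rparr>"

definition runit_arr ::
    "('r::comm_ring_1 \<Rightarrow> 'u) \<Rightarrow> ('i \<Rightarrow> 'r \<Rightarrow> 'r) \<Rightarrow> ('r, 'u, 'i) opmod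
      \<Rightarrow> (('r, 'u, 'i) opmod, 'u) arrow" where
  "runit_arr \<iota> \<delta> E =
     \<lparr>Source = tens_obj E (unit_obj \<iota> \<delta>), Target = E,
      Fun = (THE h. h \<in> linear_maps (UMod (tens_obj E (unit_obj \<iota> \<delta>))) (UMod E) \<and>
        (\<forall>r. \<forall>x \<in> Car E. h (tens E (unit_obj \<iota> \<delta>) x (\<iota> r)) = r \<odot>\<^bsub>UMod E\<^esub> x))\<rparr>"

text \<open>
  The tensor category with object set \<open>Obs\<close>, whose arrows are the linear maps commuting with
  the operators indexed by \<open>I\<close>.  The unit object is the base ring, embedded by \<open>\<iota>\<close>, with
  operators \<open>\<delta>\<close>; the scalars \<open>'k\<close> act on arrows through \<open>\<kappa>\<close>.
\<close>

definition opmod_cat ::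
    "('r::comm_ring_1, 'u, 'i) opmod set \<Rightarrow> 'i set \<Rightarrow> ('r \<Rightarrow> 'u) \<Rightarrow> ('i \<Rightarrow> 'r \<Rightarrow> 'r)
      \<Rightarrow> ('k \<Rightarrow> 'r)
      \<Rightarrow> (('r, 'u, 'i) opmod, (('r, 'u, 'i) opmod, 'u) arrow, 'k) tensor_cat" where
  "opmod_cat Obs I \<iota> \<delta> \<kappa> =
     \<lparr>Obj = Obs,
      Arr = {f. Source f \<in> Obs \<and> Target f \<in> Obs \<and>
                Fun f \<in> linear_maps (UMod (Source f)) (UMod (Target f)) \<and>
                (\<forall>i \<in> I. \<forall>x \<in> Car (Source f).
                   Fun f (Act (Source f) i x) = Act (Target f) i (Fun f x))},
      Dom = Source,
      Cod = Target,
      Ident = (\<lambda>E. \<lparr>Source = E, Target = E, Fun = (\<lambda>x\<in>Car E. x)\<rparr>),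
      Comp = (\<lambda>g f. \<lparr>Source = Source f, Target = Target g,
                     Fun = (\<lambda>x\<in>Car (Source f). Fun g (Fun f x))\<rparr>),
      ZeroM = (\<lambda>E F. \<lparr>Source = E, Target = F, Fun = (\<lambda>x\<in>Car E. \<zero>\<^bsub>UMod F\<^esub>)\<rparr>),
      AddM = (\<lambda>f g. \<lparr>Source = Source f, Target = Target f,
                     Fun = (\<lambda>x\<in>Car (Source f). Fun f x \<oplus>\<^bsub>UMod (Target f)\<^esub> Fun g x)\<rparr>),
      ScaleM = (\<lambda>c f. \<lparr>Source = Source f, Target = Target f,
                     Fun = (\<lambda>x\<in>Car (Source f). \<kappa> c \<odot>\<^bsub>UMod (Target f)\<^esub> Fun f x)\<rparr>),
      TensO = tens_obj,
      TensM = tens_arr,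
      UnitO = unit_obj \<iota> \<delta>,
      Assoc = assoc_arr,
      LUnit = lunit_arr \<iota> \<delta>,
      RUnit = runit_arr \<iota> \<delta>,
      Braid = braid_arr\<rparr>"


section \<open>Bundles with connection on the formal disk\<close>

definition is_connection ::
    "(('k::field, 'n::finite) mps, 'u) module \<Rightarrow> ('n \<Rightarrow> 'u \<Rightarrow> 'u) \<Rightarrow> bool" where
  "is_connection E nabla \<longleftrightarrow>
     (\<forall>i. is_additive E E (nabla i) \<and>
        (\<forall>c. \<forall>e \<in> carrier E. nabla i (mps_const c \<odot>\<^bsub>E\<^esub> e) = mps_const c \<odot>\<^bsub>E\<^esub> nabla i e) \<and>
        (\<forall>f. \<forall>e \<in> carrier E.
           nabla i (f \<odot>\<^bsub>E\<^esub> e) = mps_deriv i f \<odot>\<^bsub>E\<^esub> e \<oplus>\<^bsub>E\<^esub> f \<odot>\<^bsub>E\<^esub> nabla i e))"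

definition bundles :: "(('k::field, 'n::finite) mps, 'u, 'n) opmod set" where
  "bundles = {E. finite_free (UMod E) \<and> is_connection (UMod E) (Act E)}"

definition Bun_conn ::
    "(('k::field, 'n::finite) mps \<Rightarrow> 'u)
      \<Rightarrow> ((('k, 'n) mps, 'u, 'n) opmod, ((('k, 'n) mps, 'u, 'n) opmod, 'u) arrow, 'k) tensor_cat"
  where "Bun_conn \<iota> = opmod_cat bundles UNIV \<iota> mps_deriv mps_const"


section \<open>Finite-dimensional representations\<close>

definition is_rep_FL_ge2 ::
    "('k::field, 'u) module \<Rightarrow> (('k, 'n::finite) free_lie \<Rightarrow> 'u \<Rightarrow> 'u) \<Rightarrow> bool" where
  "is_rep_FL_ge2 M \<rho> \<longleftrightarrow>
     (\<forall>x \<in> FL_ge2. is_linear M M (\<rho> x)) \<and>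
     (\<forall>m \<in> carrier M. \<forall>x \<in> FL_ge2. \<forall>y \<in> FL_ge2.
        \<rho> (x + y) m = \<rho> x m \<oplus>\<^bsub>M\<^esub> \<rho> y m \<and>
        (\<forall>c. \<rho> (fl_scale c x) m = c \<odot>\<^bsub>M\<^esub> \<rho> x m) \<and>
        \<rho> (fl_bracket x y) m = \<rho> x (\<rho> y m) \<ominus>\<^bsub>M\<^esub> \<rho> y (\<rho> x m))"

text \<open>Operators indexed by elements outside \<^const>\<open>FL_ge2\<close> are unconstrained, and are
  ignored by the morphisms.\<close>

definition representations :: "('k::field, 'u, ('k, 'n::finite) free_lie) opmod set" where
  "representations = {M. finite_free (UMod M) \<and> is_rep_FL_ge2 (UMod M) (Act M)}"

definition Rep_FL_ge2 ::
    "'n::finite itself \<Rightarrow> ('k::field \<Rightarrow> 'u)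
      \<Rightarrow> (('k, 'u, ('k, 'n) free_lie) opmod, (('k, 'u, ('k, 'n) free_lie) opmod, 'u) arrow, 'k)
           tensor_cat"
  where "Rep_FL_ge2 _ \<iota> = opmod_cat representations FL_ge2 \<iota> (\<lambda>_ _. 0) (\<lambda>c. c)"

end

theory Submission
  imports Defs "HOL-Library.Function_Algebras"
begin

text \<open>
  A connection lets the free Lie algebra on \<open>k^n\<close> act on the sections of a bundle, the generator \<open>e\<^sub>i\<close>
  acting by the covariant derivative along \<open>x\<^sub>i\<close>.  As the partial derivatives commute, elements of degree at
  least two act linearly over the power series, hence on the fibre at the origin, and the fibre
  functor is the equivalence.

  To reconstruct a bundle from its fibre, order the variables and trivialise by parallel transport from
  the origin along the axes, last variable first.  In this axial gauge the Taylor coefficient at \<open>a\<close> of a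
  section is its ordered covariant derivative of multi-index \<open>a\<close> at the origin, divided by \<open>a!\<close>, and the
  Taylor coefficient at \<open>a\<close> of the connection matrix \<open>A\<^sub>j\<close> is the action of \<open>(ad e)^a e\<^sub>j / a!\<close> on the fibre, or
  zero if no variable before \<open>x\<^sub>j\<close> occurs in \<open>a\<close>.  Otherwise \<open>(ad e)^a e\<^sub>j\<close> has degree at least two, so
  every representation defines such a connection, and linear maps of fibres that commute with
  the representations extend uniquely to maps of bundles.  By the Leibniz rule the action on a
  tensor product of bundles is the tensor product of the actions, so the functor is monoidal.
\<close>

text \<open>Covariant derivatives need not commute, so a Taylor expansion needs a fixed order of
  differentiation. The engine is that every nonzero exponent is in exactly one way
  \<open>inc k b\<close> with \<open>b \<in> tail_idx k\<close>, where \<open>k\<close> is its first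
  variable. Hence two series are equal once they agree at the origin and, for each \<open>k\<close>,
  their derivatives along \<open>x_k\<close> agree where the variables before \<open>x_k\<close>
  vanish; in characteristic zero this recovers the coefficients. On that locus the gauge kills
  \<open>A_k\<close>, differentiating an endomorphism along \<open>x_k\<close> becomes
  \<open>ad e_k\<close>, and each identity reduces to one in the free Lie algebra: the curvature
  formula to the Jacobi identity, the representation property to \<open>ad\<close> being a
  derivation. A second obstacle is that all objects are subsets of a fixed type, with quotients and
  tensor products available only up to a choice. Fibres are therefore described by a predicate,
  \<open>is_fibre\<close>, on a projection from the bundle, and arrows are pinned down by their
  values on projected sections and elementary tensors.\<close>

declare [[coercion_enabled = false]]

section \<open>Operators and the free Lie algebra\<close>

primrec lie_eval :: "('k \<Rightarrow> 'v \<Rightarrow> 'v::ab_group_add) \<Rightarrow> ('n::finite \<Rightarrow> 'v \<Rightarrow> 'v) \<Rightarrow> ('k, 'n) lie_term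
    \<Rightarrow> 'v \<Rightarrow> 'v" where
  "lie_eval sc D (Gen v) = (\<lambda>x. \<Sum>i\<in>UNIV. sc (vec_nth v i) (D i x))"
| "lie_eval sc D Zero = (\<lambda>x. 0)"
| "lie_eval sc D (Add s t) = (\<lambda>x. lie_eval sc D s x + lie_eval sc D t x)"
| "lie_eval sc D (Scale c t) = (\<lambda>x. sc c (lie_eval sc D t x))"
| "lie_eval sc D (Brk s t) = (\<lambda>x. lie_eval sc D s (lie_eval sc D t x) - lie_eval sc D t (lie_eval sc D s x))"

text \<open>Uses a representative instead of a lift to the quotient: \<open>lie_eval\<close>
  respects \<open>lie_eq\<close> only for linear operators (\<open>lie_eval_cong\<close>), and the
  type of \<open>D\<close> does not carry that hypothesis.\<close>

definition lie_act :: "('k::field \<Rightarrow> 'v \<Rightarrow> 'v::ab_group_add) \<Rightarrow> ('n::finite \<Rightarrow> 'v \<Rightarrow> 'v) \<Rightarrow> ('k, 'n) free_lie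
    \<Rightarrow> 'v \<Rightarrow> 'v" where
  "lie_act sc D x = lie_eval sc D (rep_free_lie x)"

lemma abs_rep_free_lie: "abs_free_lie (rep_free_lie x) = x"
  by (meson Quotient3_abs_rep Quotient3_free_lie)

lemma lie_eq_rep_abs: "lie_eq (rep_free_lie (abs_free_lie t)) t"
  by (metis abs_rep_free_lie free_lie.abs_eq_iff)

locale lie_ops = vector_space sc for sc :: "'k::field \<Rightarrow> 'v::ab_group_add \<Rightarrow> 'v" +
  fixes D :: "'n::finite \<Rightarrow> 'v \<Rightarrow> 'v"
  assumes lin_D: "Vector_Spaces.linear sc sc (D i)"
begin

lemma lin_lie_eval: "Vector_Spaces.linear sc sc (lie_eval sc D t)"
proof -
  have V: "vector_space sc" by unfold_locales
  have a: "D i (x + y) = D i x + D i y" "D i (sc c x) = sc c (D i x)" for i x y c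
    using lin_D[of i] by (auto simp: Vector_Spaces.linear_iff)
  have "(\<forall>x y. lie_eval sc D t (x + y) = lie_eval sc D t x + lie_eval sc D t y) \<and>
     (\<forall>c x. lie_eval sc D t (sc c x) = sc c (lie_eval sc D t x))"
    by (induct t) (auto simp: a scale_right_distrib sum.distrib scale_sum_right scale_scale
        scale_right_diff_distrib mult.commute)
  then show ?thesis using V by (auto simp: Vector_Spaces.linear_iff)
qed

lemma lie_eval_add: "lie_eval sc D t (x + y) = lie_eval sc D t x + lie_eval sc D t y"
  and lie_eval_scale: "lie_eval sc D t (sc c x) = sc c (lie_eval sc D t x)"
  using lin_lie_eval[of t] by (auto simp: Vector_Spaces.linear_iff)

lemma lie_eval_diff: "lie_eval sc D t (x - y) = lie_eval sc D t x - lie_eval sc D t y"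
  using lie_eval_add[of t "x - y" y] by simp

text \<open>Linear endomorphisms form a Lie algebra under the commutator, and \<open>D\<close>
  extends linearly to the generators, so every defining relation is respected: the universal
  property of the free Lie algebra. Linearity of the operators makes the commutator bilinear and
  gives the Jacobi identity.\<close>

lemma lie_eval_cong: "lie_eq s t \<Longrightarrow> lie_eval sc D s = lie_eval sc D t"
proof (induct rule: lie_eq.induct)
  case (Gen_add v w)
  show ?case by (rule ext) (simp add: scale_left_distrib sum.distrib)
next
  case (Gen_scale c v)
  show ?case by (rule ext) (simp add: scale_sum_right)
next
  case (Add_inverse x)
  show ?case by (rule ext) simp
next
  case (Brk_Add_left x y z)
  show ?case by (rule ext) (simp add: lie_eval_add)
next
  case (Brk_Add_right x y z)
  show ?case by (rule ext) (simp add: lie_eval_add)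
next
  case (Brk_Scale_left c x y)
  show ?case by (rule ext) (simp add: lie_eval_scale scale_right_diff_distrib)
next
  case (Brk_Scale_right x c y)
  show ?case by (rule ext) (simp add: lie_eval_scale scale_right_diff_distrib)
next
  case (Jacobi x y z)
  show ?case by (rule ext) (simp add: lie_eval_diff)
qed (simp_all add: fun_eq_iff scale_right_distrib scale_left_distrib ac_simps)

lemma lie_act_abs: "lie_act sc D (abs_free_lie t) = lie_eval sc D t"
  unfolding lie_act_def by (rule lie_eval_cong[OF lie_eq_rep_abs])

lemma lie_act_gen: "lie_act sc D (fl_gen v) x = (\<Sum>i\<in>UNIV. sc (vec_nth v i) (D i x))"
  by (simp add: fl_gen.abs_eq lie_act_abs)

lemma lie_act_plus: "lie_act sc D (x + y) = (\<lambda>v. lie_act sc D x v + lie_act sc D y v)"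
proof -
  have "x + y = abs_free_lie (Add (rep_free_lie x) (rep_free_lie y))"
    by (metis abs_rep_free_lie plus_free_lie.abs_eq)
  then show ?thesis by (simp add: lie_act_abs) (simp add: lie_act_def)
qed

lemma lie_act_fl_scale: "lie_act sc D (fl_scale c x) = (\<lambda>v. sc c (lie_act sc D x v))"
proof -
  have "fl_scale c x = abs_free_lie (Scale c (rep_free_lie x))"
    by (metis abs_rep_free_lie fl_scale.abs_eq)
  then show ?thesis by (simp add: lie_act_abs) (simp add: lie_act_def)
qed

lemma lie_act_bracket: "lie_act sc D (fl_bracket x y)
    = (\<lambda>v. lie_act sc D x (lie_act sc D y v) - lie_act sc D y (lie_act sc D x v))"
proof -
  have "fl_bracket x y = abs_free_lie (Brk (rep_free_lie x) (rep_free_lie y))"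
    by (metis abs_rep_free_lie fl_bracket.abs_eq)
  then show ?thesis by (simp add: lie_act_abs) (simp add: lie_act_def)
qed

lemma lie_act_zero: "lie_act sc D 0 = (\<lambda>v. 0)"
  by (simp add: zero_free_lie.abs_eq lie_act_abs)

lemma lie_act_add: "lie_act sc D x (v + w) = lie_act sc D x v + lie_act sc D x w"
  and lie_act_scale: "lie_act sc D x (sc c v) = sc c (lie_act sc D x v)"
  by (simp_all add: lie_act_def lie_eval_add lie_eval_scale)

lemma lie_act_axis: "lie_act sc D (fl_gen (axis j 1)) = D j"
  by (rule ext) (simp add: lie_act_gen axis_def if_distrib[where f = "\<lambda>c. sc c _"] cong: if_cong)

end

text \<open>A Lie expression is built from the operators by sums, scalars and composition, and
  \<open>h\<close> passes through all of these. The two sides may live on different spaces; with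
  \<open>h\<close> an operator on one space it yields that commuting generators have commuting Lie
  expressions.\<close>

lemma lie_eval_intertwine:
  assumes "\<And>x y. h (x + y) = h x + h y" "\<And>c x. h (sc c x) = sc' c (h x)"
    "\<And>i x. h (D i x) = D' i (h x)"
  shows "h (lie_eval sc D t x) = lie_eval sc' D' t (h x)"
proof -
  have z: "h 0 = 0" using assms(1)[of 0 0] by simp
  have d: "h (a - b) = h a - h b" for a b
    using assms(1)[of "a - b" b] by (simp add: algebra_simps)
  have s': "h (\<Sum>i\<in>I. f i) = (\<Sum>i\<in>I. h (f i))" for f and I :: "'e set"
    by (induct I rule: infinite_finite_induct) (auto simp: z assms)
  show ?thesis by (induct t arbitrary: x) (auto simp: z d s' assms)
qed

section \<open>Identities and induction principles in the free Lie algebra\<close>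

abbreviation fl_var :: "'n::finite \<Rightarrow> ('k::field, 'n) free_lie" where
  "fl_var j \<equiv> fl_gen (axis j 1)"

lemma fl_bracket_add_left: "fl_bracket (x + y) z = fl_bracket x z + fl_bracket y z"
  by transfer (rule lie_eq.Brk_Add_left)
lemma fl_bracket_add_right: "fl_bracket x (y + z) = fl_bracket x y + fl_bracket x z"
  by transfer (rule lie_eq.Brk_Add_right)
lemma fl_bracket_scale_left: "fl_bracket (fl_scale c x) y = fl_scale c (fl_bracket x y)"
  by transfer (rule lie_eq.Brk_Scale_left)
lemma fl_bracket_scale_right: "fl_bracket x (fl_scale c y) = fl_scale c (fl_bracket x y)"
  by transfer (rule lie_eq.Brk_Scale_right)
lemma fl_bracket_self: "fl_bracket x x = 0"
  by transfer (rule lie_eq.Brk_self)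
lemma fl_jacobi: "fl_bracket x (fl_bracket y z) + (fl_bracket y (fl_bracket z x) + fl_bracket z (fl_bracket x y)) = 0"
  by transfer (rule lie_eq.Jacobi)
lemma fl_gen_add: "fl_gen (v + w) = fl_gen v + fl_gen w"
  by transfer (rule lie_eq.Gen_add)
lemma fl_gen_scale: "fl_gen (c *s v) = fl_scale c (fl_gen v)"
  by transfer (rule lie_eq.Gen_scale)

lemma fl_bracket_zero_left: "fl_bracket 0 y = 0"
  using fl_bracket_add_left[of 0 0 y] by simp
lemma fl_bracket_zero_right: "fl_bracket x 0 = 0"
  using fl_bracket_add_right[of x 0 0] by simp

lemma fl_bracket_anti: "fl_bracket y x = - fl_bracket x y"
proof -
  have "0 = fl_bracket (x + y) (x + y)" by (simp only: fl_bracket_self)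
  also have "\<dots> = fl_bracket x y + fl_bracket y x"
    by (simp only: fl_bracket_add_left fl_bracket_add_right) (simp add: fl_bracket_self add.commute)
  finally show ?thesis by (metis add_eq_0_iff)
qed

lemma fl_bracket_minus_right: "fl_bracket x (- y) = - fl_bracket x y"
  by (simp only: uminus_free_lie_def fl_bracket_scale_right)

text \<open>Jacobi read as a Leibniz rule: \<open>ad x\<close> is a derivation. In this form it
  matches the differentiation of endomorphisms along a connection.\<close>

lemma fl_bracket_derivation:
  "fl_bracket x (fl_bracket y z) = fl_bracket (fl_bracket x y) z + fl_bracket y (fl_bracket x z)"
proof -
  have "fl_bracket x (fl_bracket y z) = - (fl_bracket y (fl_bracket z x) + fl_bracket z (fl_bracket x y))"
    using fl_jacobi[of x y z] by (simp only: eq_neg_iff_add_eq_0)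
  also have "\<dots> = - fl_bracket y (fl_bracket z x) - fl_bracket z (fl_bracket x y)"
    by simp
  also have "- fl_bracket y (fl_bracket z x) = fl_bracket y (fl_bracket x z)"
    by (subst fl_bracket_anti[of x z]) (simp add: fl_bracket_minus_right)
  also have "fl_bracket z (fl_bracket x y) = - fl_bracket (fl_bracket x y) z"
    by (rule fl_bracket_anti)
  finally show ?thesis by simp
qed

lemma fl_gen_zero: "fl_gen 0 = 0"
  using fl_gen_add[of 0 0] by simp

lemma fl_gen_expand: "fl_gen v = (\<Sum>i\<in>UNIV. fl_scale (vec_nth v i) (fl_var i))"
proof -
  have s: "fl_gen (sum f I) = (\<Sum>i\<in>I. fl_gen (f i))" for f :: "'b \<Rightarrow> 'a ^ 'b" and I
    by (induct I rule: infinite_finite_induct) (auto simp: fl_gen_zero fl_gen_add)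
  have "v = (\<Sum>i\<in>UNIV. vec_nth v i *s axis i 1)"
    by (simp add: vec_eq_iff axis_def if_distrib[where f = "(*) _"] cong: if_cong)
  then have "fl_gen v = fl_gen (\<Sum>i\<in>UNIV. vec_nth v i *s axis i 1)" by (rule arg_cong)
  also have "\<dots> = (\<Sum>i\<in>UNIV. fl_scale (vec_nth v i) (fl_var i))" by (simp only: s fl_gen_scale)
  finally show ?thesis .
qed

lemma is_bracket_of_pos: "is_bracket_of d x \<Longrightarrow> d \<ge> 1"
  by (induct rule: is_bracket_of.induct) auto

text \<open>Collapses the span of a union of spans to one span over bracket monomials, so that a
  single span induction reaches the monomials.\<close>

lemma FL_ge2_eq: "FL_ge2 = FL.span {x. \<exists>d\<ge>2. is_bracket_of d x}" (is "_ = FL.span ?S")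
proof
  have "FL_deg d \<subseteq> FL.span ?S" if "d \<ge> 2" for d
    unfolding FL_deg_def using that by (intro FL.span_mono) auto
  then show "FL_ge2 \<subseteq> FL.span ?S"
    unfolding FL_ge2_def by (intro FL.span_minimal) (auto simp: FL.subspace_span)
  show "FL.span ?S \<subseteq> FL_ge2"
    unfolding FL_ge2_def FL_deg_def by (intro FL.span_mono) (auto intro: FL.span_base)
qed

lemma FL_ge2_add: "x \<in> FL_ge2 \<Longrightarrow> y \<in> FL_ge2 \<Longrightarrow> x + y \<in> FL_ge2"
  unfolding FL_ge2_def by (rule FL.span_add)
lemma FL_ge2_scale: "x \<in> FL_ge2 \<Longrightarrow> fl_scale c x \<in> FL_ge2"
  unfolding FL_ge2_def by (rule FL.span_scale)
lemma FL_ge2_0: "0 \<in> FL_ge2"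
  unfolding FL_ge2_def by (rule FL.span_zero)

lemma FL_ge2_var_var: "fl_bracket (fl_var i) (fl_var j) \<in> FL_ge2"
proof -
  have "is_bracket_of (1 + 1) (fl_bracket (fl_var i) (fl_var j))"
    by (intro is_bracket_of.intros)
  then show ?thesis unfolding FL_ge2_eq by (intro FL.span_base CollectI exI[of _ "1 + 1"] conjI) auto
qed

text \<open>A generator raises the degree of a bracket monomial by one. Thus \<open>ad\<close> of a
  variable operates on the subalgebra although variables have degree one.\<close>

lemma FL_ge2_gen: "y \<in> FL_ge2 \<Longrightarrow> fl_bracket (fl_gen v) y \<in> FL_ge2"
  unfolding FL_ge2_eq
proof (induct rule: FL.span_induct_alt)
  case base then show ?case by (simp add: fl_bracket_zero_right FL.span_zero)
next
  case (step c x y)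
  then obtain d where d: "d \<ge> 2" "is_bracket_of d x" by auto
  have "is_bracket_of (1 + d) (fl_bracket (fl_gen v) x)"
    using d by (intro is_bracket_of.intros)
  then have "fl_bracket (fl_gen v) x \<in> FL.span {x. \<exists>d\<ge>2. is_bracket_of d x}"
    using d by (intro FL.span_base) (auto intro!: exI[of _ "1 + d"])
  then show ?case using step
    by (auto simp: fl_bracket_add_right fl_bracket_scale_right intro: FL.span_add FL.span_scale)
qed

lemma FL_ge2_bracket: "x \<in> FL_ge2 \<Longrightarrow> y \<in> FL_ge2 \<Longrightarrow> fl_bracket x y \<in> FL_ge2"
  unfolding FL_ge2_eq
proof (induct arbitrary: y rule: FL.span_induct_alt)
  case base then show ?case by (simp add: fl_bracket_zero_left FL.span_zero)
next
  case (step c x x' y)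
  obtain d where d: "d \<ge> 2" "is_bracket_of d x" using step by auto
  have "fl_bracket x y \<in> FL.span {x. \<exists>d\<ge>2. is_bracket_of d x}" using step(3)
  proof (induct rule: FL.span_induct_alt)
    case base then show ?case by (simp add: fl_bracket_zero_right FL.span_zero)
  next
    case (step c y y')
    then obtain e where e: "e \<ge> 2" "is_bracket_of e y" by auto
    have "is_bracket_of (d + e) (fl_bracket x y)"
      using d e by (intro is_bracket_of.intros)
    then have "fl_bracket x y \<in> FL.span {x. \<exists>d\<ge>2. is_bracket_of d x}"
      using d e by (intro FL.span_base) (auto intro!: exI[of _ "d + e"])
    then show ?case using step
      by (auto simp: fl_bracket_add_right fl_bracket_scale_right intro: FL.span_add FL.span_scale)
  qed
  then show ?case using step
    by (auto simp: fl_bracket_add_left fl_bracket_scale_left intro: FL.span_add FL.span_scale)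
qed

lemma is_bracket_cases:
  assumes "is_bracket_of d x"
  shows "(d = 1 \<and> (\<exists>v. x = fl_gen v)) \<or>
   (d \<ge> 2 \<and> (\<exists>p q y z. d = p + q \<and> is_bracket_of p y \<and> is_bracket_of q z \<and> x = fl_bracket y z))"
  using assms
proof cases
  case 1 then show ?thesis by auto
next
  case (2 p x q y)
  then show ?thesis using is_bracket_of_pos[of p x] is_bracket_of_pos[of q y] by force
qed

lemma FL_ge2_base: "is_bracket_of d x \<Longrightarrow> d \<ge> 2 \<Longrightarrow> x \<in> FL_ge2"
  unfolding FL_ge2_eq by (intro FL.span_base) blast

lemma FL_ge2_span_induct [consumes 1, case_names zero step]:
  assumes "x \<in> FL_ge2" and "P 0"
    and st: "\<And>c d x y. is_bracket_of d x \<Longrightarrow> d \<ge> 2 \<Longrightarrow> y \<in> FL_ge2 \<Longrightarrow> P y \<Longrightarrow> P (fl_scale c x + y)"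
  shows "P x"
proof -
  have "x \<in> FL.span {x. \<exists>d\<ge>2. is_bracket_of d x}" using assms(1) by (simp only: FL_ge2_eq)
  then have "x \<in> FL_ge2 \<and> P x"
  proof (induct rule: FL.span_induct_alt)
    case base
    show ?case using FL_ge2_0 assms(2) by (rule conjI)
  next
    case (step c x y)
    then obtain d where d: "is_bracket_of d x" "d \<ge> 2" by blast
    have "fl_scale c x + y \<in> FL_ge2"
      by (intro FL_ge2_add FL_ge2_scale FL_ge2_base[OF d] conjunct1[OF step(2)])
    then show ?case using st[OF d] step(2) by blast
  qed
  then show ?thesis by (rule conjunct2)
qed

text \<open>For properties shared by all brackets whatsoever: a bracket monomial of degree at least
  two is itself a bracket, so one span induction is enough.\<close>

lemma FL_ge2_bracket_induct [consumes 1, case_names zero add scale bracket]: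
  assumes x: "x \<in> FL_ge2" and z: "P 0" and a: "\<And>x y. x \<in> FL_ge2 \<Longrightarrow> y \<in> FL_ge2 \<Longrightarrow> P x \<Longrightarrow> P y \<Longrightarrow> P (x + y)"
    and s: "\<And>c x. x \<in> FL_ge2 \<Longrightarrow> P x \<Longrightarrow> P (fl_scale c x)"
    and b: "\<And>x y. P (fl_bracket x y)"
  shows "P x"
proof -
  show ?thesis using x
  proof (induct rule: FL_ge2_span_induct)
    case zero show ?case by (rule z)
  next
    case (step c d x y)
    have "P x" using is_bracket_cases[OF step(1)] step(2) b by fastforce
    then show ?case by (intro a s FL_ge2_scale FL_ge2_base[OF step(1,2)] step)
  qed
qed

text \<open>A representation only knows the subalgebra, while formulas for a connection are proved
  from the variables upwards. Strong induction on the degree splits a monomial into factors of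
  degrees 1+1, 1+more, more+1 or more+more; expanding generators in the variables leaves the three
  bracket cases of the rule.\<close>

lemma FL_ge2_induct [consumes 1, case_names zero add scale var_var var bracket]:
  assumes x: "x \<in> FL_ge2" and z: "P 0"
    and a: "\<And>x y. x \<in> FL_ge2 \<Longrightarrow> y \<in> FL_ge2 \<Longrightarrow> P x \<Longrightarrow> P y \<Longrightarrow> P (x + y)"
    and s: "\<And>c x. x \<in> FL_ge2 \<Longrightarrow> P x \<Longrightarrow> P (fl_scale c x)"
    and vv: "\<And>i j. P (fl_bracket (fl_var i) (fl_var j))"
    and v: "\<And>i y. y \<in> FL_ge2 \<Longrightarrow> P y \<Longrightarrow> P (fl_bracket (fl_var i) y)"
    and b: "\<And>x y. x \<in> FL_ge2 \<Longrightarrow> y \<in> FL_ge2 \<Longrightarrow> P x \<Longrightarrow> P y \<Longrightarrow> P (fl_bracket x y)"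
  shows "P x"
proof -
  define Q where "Q = {x. x \<in> FL_ge2 \<and> P x}"
  have Q0: "0 \<in> Q" using z FL_ge2_0 by (auto simp: Q_def)
  have Qa: "x + y \<in> Q" if "x \<in> Q" "y \<in> Q" for x y using that a FL_ge2_add by (auto simp: Q_def)
  have Qs: "fl_scale c x \<in> Q" if "x \<in> Q" for c x using that s FL_ge2_scale by (auto simp: Q_def)
  have Qm: "- x \<in> Q" if "x \<in> Q" for x using Qs[OF that, of "-1"] by (simp only: uminus_free_lie_def)
  have Qsum: "sum f I \<in> Q" if "\<And>i. i \<in> I \<Longrightarrow> f i \<in> Q" for f and I :: "'b set"
    using that by (induct I rule: infinite_finite_induct) (auto simp: Q0 Qa)
  have gl: "fl_bracket (\<Sum>i\<in>I. f i) y = (\<Sum>i\<in>I. fl_bracket (f i) y)" for f y and I :: "'b set"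
    by (induct I rule: infinite_finite_induct) (auto simp: fl_bracket_zero_left fl_bracket_add_left)
  have gr: "fl_bracket y (\<Sum>i\<in>I. f i) = (\<Sum>i\<in>I. fl_bracket y (f i))" for f y and I :: "'b set"
    by (induct I rule: infinite_finite_induct) (auto simp: fl_bracket_zero_right fl_bracket_add_right)
  have Qgg: "fl_bracket (fl_gen v) (fl_gen w) \<in> Q" for v w
    unfolding fl_gen_expand[of v] fl_gen_expand[of w] gl gr fl_bracket_scale_left fl_bracket_scale_right
    by (intro Qsum Qs) (simp add: Q_def vv FL_ge2_var_var)
  have Qg: "fl_bracket (fl_gen v) y \<in> Q" if "y \<in> Q" for v y
    unfolding fl_gen_expand[of v] gl fl_bracket_scale_left
    using that by (intro Qsum Qs) (auto simp: Q_def v FL_ge2_gen)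
  have key: "x \<in> Q" if "is_bracket_of d x" "d \<ge> 2" for d x using that
  proof (induct d arbitrary: x rule: less_induct)
    case (less d)
    then obtain p q y z where *: "d = p + q" "is_bracket_of p y" "is_bracket_of q z" "x = fl_bracket y z"
      using is_bracket_cases[of d x] by auto
    have pq: "p \<ge> 1" "q \<ge> 1" using * is_bracket_of_pos by auto
    have y: "p \<ge> 2 \<Longrightarrow> y \<in> Q" using less(1)[of p y] * pq by auto
    have zq: "q \<ge> 2 \<Longrightarrow> z \<in> Q" using less(1)[of q z] * pq by auto
    consider "p = 1" "q = 1" | "p = 1" "q \<ge> 2" | "p \<ge> 2" "q = 1" | "p \<ge> 2" "q \<ge> 2" using pq by linarith
    then show ?case
    proof cases
      case 1
      then show ?thesis using * is_bracket_cases[of 1 y] is_bracket_cases[of 1 z] Qgg by auto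
    next
      case 2
      then show ?thesis using * is_bracket_cases[of 1 y] zq Qg by auto
    next
      \<comment> \<open>Antisymmetry moves the factor of degree one to the left, where
        \<open>Qg\<close> applies.\<close>
      case 3
      then obtain v where "z = fl_gen v" using * is_bracket_cases[of 1 z] by auto
      then have "x = - fl_bracket (fl_gen v) y" using * fl_bracket_anti by auto
      then show ?thesis using y 3 Qg Qm by auto
    next
      case 4
      then show ?thesis using y zq * b FL_ge2_bracket by (auto simp: Q_def)
    qed
  qed
  have "x \<in> Q" using x
  proof (induct rule: FL_ge2_span_induct)
    case zero show ?case by (rule Q0)
  next
    case (step c d x y)
    then show ?case by (blast intro: Qa Qs key)
  qed
  then show ?thesis by (simp add: Q_def)
qed

section \<open>Formal series with coefficients in a vector space\<close>

definition var_ord :: "'n::finite \<Rightarrow> nat" where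
  "var_ord = (SOME f. inj f)"

lemma inj_var_ord: "inj (var_ord :: 'n::finite \<Rightarrow> nat)"
proof -
  obtain f :: "'n \<Rightarrow> nat" where "inj f"
    using finite_imp_inj_to_nat_seg[of "UNIV :: 'n set"] by auto
  then show ?thesis unfolding var_ord_def by (rule someI[of inj])
qed

lemma var_ord_eq: "var_ord i = var_ord j \<longleftrightarrow> i = j"
  using inj_var_ord by (auto simp: inj_def)

abbreviation inc :: "'n \<Rightarrow> ('n \<Rightarrow> nat) \<Rightarrow> 'n \<Rightarrow> nat" where
  "inc k a \<equiv> a(k := Suc (a k))"

definition idx0 :: "'n \<Rightarrow> nat" where "idx0 = (\<lambda>_. 0)"

definition idx_size :: "('n::finite \<Rightarrow> nat) \<Rightarrow> nat" where "idx_size a = (\<Sum>i\<in>UNIV. a i)"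

text \<open>Exponents in which only \<open>k\<close> and later variables occur: restricting a series to these means
  setting the variables before \<open>k\<close> to zero.\<close>

definition tail_idx :: "'n::finite \<Rightarrow> ('n \<Rightarrow> nat) set" where
  "tail_idx k = {a. \<forall>i. var_ord i < var_ord k \<longrightarrow> a i = 0}"

lemma idx_size_inc: "idx_size (inc k a) = Suc (idx_size a)"
proof -
  have "(\<Sum>i\<in>UNIV. inc k a i) = (\<Sum>i\<in>UNIV. a i + (if i = k then 1 else 0))"
    by (intro sum.cong) auto
  then show ?thesis by (simp add: idx_size_def sum.distrib)
qed

lemma idx_size_0: "idx_size a = 0 \<longleftrightarrow> a = idx0"
  by (auto simp: idx_size_def idx0_def fun_eq_iff)

lemma idx0_tail: "idx0 \<in> tail_idx k"
  by (simp add: idx0_def tail_idx_def)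

lemma inc_tail: "a \<in> tail_idx k \<Longrightarrow> var_ord k \<le> var_ord j \<Longrightarrow> inc j a \<in> tail_idx k"
  by (auto simp: tail_idx_def)

lemma tail_mono: "a \<in> tail_idx k \<Longrightarrow> var_ord j \<le> var_ord k \<Longrightarrow> a \<in> tail_idx j"
  by (auto simp: tail_idx_def)

lemma inc_ne_idx0: "inc k a \<noteq> idx0"
  by (auto simp: idx0_def fun_eq_iff)

text \<open>The variable \<open>k\<close> is the first one that occurs in \<open>a\<close>. Together
  with \<open>inc_tail_unique\<close> this makes \<open>inc k b\<close> with
  \<open>b \<in> tail_idx k\<close> a normal form of nonzero exponents.\<close>

lemma idx_split:
  fixes a :: "'n::finite \<Rightarrow> nat"
  assumes "a \<noteq> idx0"
  obtains k b where "b \<in> tail_idx k" "a = inc k b"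
proof -
  obtain i where i: "a i \<noteq> 0" using assms by (auto simp: idx0_def)
  obtain k where k: "a k \<noteq> 0" and min: "\<And>j. a j \<noteq> 0 \<Longrightarrow> var_ord k \<le> var_ord j"
    using ex_has_least_nat[of "\<lambda>i. a i \<noteq> 0" i var_ord] i by auto
  have "a(k := a k - 1) \<in> tail_idx k"
    unfolding tail_idx_def
  proof (intro CollectI allI impI)
    fix j :: 'n assume j: "var_ord j < var_ord k"
    then have "a j = 0" using min[of j] by linarith
    then show "(a(k := a k - 1)) j = 0" using j by auto
  qed
  moreover have "a = inc k (a(k := a k - 1))" using k by auto
  ultimately show ?thesis using that by blast
qed

lemma inc_tail_unique:
  assumes "b \<in> tail_idx k" "c \<in> tail_idx j" "inc k b = inc j c"
  shows "k = j \<and> b = c"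
proof -
  have *: "var_ord j \<le> var_ord k" if "b \<in> tail_idx k" "c \<in> tail_idx j" "inc k b = inc j c" for k j b c
  proof (rule ccontr)
    assume "\<not> var_ord j \<le> var_ord k"
    then have "var_ord k < var_ord j" by simp
    then have "c k = 0" "k \<noteq> j" using that(2) by (auto simp: tail_idx_def)
    then have "inc j c k = 0" by simp
    moreover have "inc k b k \<noteq> 0" by simp
    ultimately show False using that(3) by metis
  qed
  have "k = j" using *[OF assms] *[OF assms(2,1) assms(3)[symmetric]] by (simp add: var_ord_eq[symmetric])
  moreover have "b = c"
  proof
    fix i show "b i = c i" using assms(3) \<open>k = j\<close>
      by (cases "i = j") (auto simp: fun_eq_iff split: if_splits)
  qed
  ultimately show ?thesis by simp
qed

text \<open>Removes one copy of the first variable at a time. An identity of series proved in this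
  way needs its value at the origin and its derivative along \<open>x_k\<close> only at exponents in
  \<open>tail_idx k\<close>, where the gauge is simple.\<close>

lemma idx_induct [case_names zero inc]:
  assumes "P idx0" "\<And>k a. a \<in> tail_idx k \<Longrightarrow> P a \<Longrightarrow> P (inc k a)"
  shows "P a"
proof (induct "idx_size a" arbitrary: a rule: less_induct)
  case less
  show ?case
  proof (cases "a = idx0")
    case True then show ?thesis using assms by simp
  next
    case False
    then obtain k b where b: "b \<in> tail_idx k" "a = inc k b" by (rule idx_split)
    then show ?thesis using less[of b] assms(2) by (simp add: idx_size_inc)
  qed
qed

text \<open>The monomial of exponent \<open>a\<close> in operators that need not commute: the first
  variable acts first, so it stands innermost. Completeness and compatibility of the two equations
  are \<open>idx_split\<close> and \<open>inc_tail_unique\<close>.\<close>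

function ord_pow :: "('n::finite \<Rightarrow> 'x \<Rightarrow> 'x) \<Rightarrow> ('n \<Rightarrow> nat) \<Rightarrow> 'x \<Rightarrow> 'x" where
  "ord_pow D idx0 x = x"
| "b \<in> tail_idx k \<Longrightarrow> ord_pow D (inc k b) x = ord_pow D b (D k x)"
  apply atomize_elim
  subgoal for y by (cases y) (metis idx_split)
  subgoal by simp
  subgoal by (metis inc_ne_idx0 prod.inject)
  subgoal using inc_tail_unique by (metis prod.inject)
  done
termination by (relation "measure (\<lambda>(D, a, x). idx_size a)") (auto simp: idx_size_inc)

declare ord_pow.simps [simp del]

definition idx_fact :: "('n::finite \<Rightarrow> nat) \<Rightarrow> 'k::field_char_0" where
  "idx_fact a = (\<Prod>i\<in>UNIV. fact (a i))"

lemma idx_fact_inc: "idx_fact (inc k a) = of_nat (Suc (a k)) * (idx_fact a :: 'k::field_char_0)"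
proof -
  have "(\<Prod>i\<in>UNIV. fact (inc k a i)) = (\<Prod>i\<in>UNIV. (if i = k then of_nat (Suc (a k)) else 1) * (fact (a i) :: 'k))"
    by (intro prod.cong) auto
  then show ?thesis by (simp add: idx_fact_def prod.distrib)
qed

lemma idx_fact_0: "idx_fact idx0 = (1 :: 'k::field_char_0)"
  by (simp add: idx_fact_def idx0_def)

section \<open>Partial derivatives and products of coefficient families\<close>

definition pd :: "('k::semiring_1 \<Rightarrow> 'v \<Rightarrow> 'v) \<Rightarrow> 'n \<Rightarrow> (('n \<Rightarrow> nat) \<Rightarrow> 'v) \<Rightarrow> ('n \<Rightarrow> nat) \<Rightarrow> 'v" where
  "pd sc i f = (\<lambda>e. sc (of_nat (Suc (e i))) (f (inc i e)))"

text \<open>One product for three uses: power series with each other (\<open>\<mu>\<close> is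
  multiplication), a power series with a vector-valued series (scalar action), and an
  operator-valued series with a section (application).\<close>

definition conv :: "('a \<Rightarrow> 'b \<Rightarrow> 'c::ab_group_add) \<Rightarrow> (('n::finite \<Rightarrow> nat) \<Rightarrow> 'a) \<Rightarrow> (('n \<Rightarrow> nat) \<Rightarrow> 'b)
    \<Rightarrow> ('n \<Rightarrow> nat) \<Rightarrow> 'c" where
  "conv \<mu> f g = (\<lambda>e. \<Sum>(a, b)\<in>splittings e. \<mu> (f a) (g b))"

lemma mem_splittings: "p \<in> splittings e \<longleftrightarrow> (\<forall>i. fst p i + snd p i = e i)"
  by (cases p) (simp add: splittings_def)

lemma splittings_0: "splittings idx0 = {(idx0, idx0)}"
  by (auto simp: splittings_def idx0_def)

lemma conv_0: "conv \<mu> f g idx0 = \<mu> (f idx0) (g idx0)"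
  by (simp add: conv_def splittings_0)

lemma splittings_tail: "e \<in> tail_idx k \<Longrightarrow> (a, b) \<in> splittings e \<Longrightarrow> a \<in> tail_idx k \<and> b \<in> tail_idx k"
  by (auto simp: tail_idx_def splittings_def) (metis add_is_0)+

text \<open>Setting the variables before \<open>x_k\<close> to zero is multiplicative: two exponents
  whose sum lies in \<open>tail_idx k\<close> both lie there.\<close>

lemma conv_tail_cong:
  assumes "e \<in> tail_idx k" "\<And>a. a \<in> tail_idx k \<Longrightarrow> f a = f' a" "\<And>a. a \<in> tail_idx k \<Longrightarrow> g a = g' a"
  shows "conv \<mu> f g e = conv \<mu> f' g' e"
  unfolding conv_def using splittings_tail[OF assms(1)] assms(2,3) by (intro sum.cong) auto

text \<open>Splittings whose left part lacks \<open>x_i\<close> contribute nothing, and lowering the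
  left part matches the others with the splittings of \<open>e\<close>.\<close>

lemma sum_splittings_inc_left:
  fixes h :: "('n::finite \<Rightarrow> nat) \<times> ('n \<Rightarrow> nat) \<Rightarrow> 'c::ab_group_add"
  assumes "\<And>a b. a i = 0 \<Longrightarrow> h (a, b) = 0"
  shows "(\<Sum>p\<in>splittings (inc i e). h p) = (\<Sum>(a, b)\<in>splittings e. h (inc i a, b))"
proof -
  have "(\<Sum>p\<in>splittings (inc i e). h p) = (\<Sum>p\<in>{p \<in> splittings (inc i e). fst p i \<noteq> 0}. h p)"
  proof (rule sum.mono_neutral_right)
    show "\<forall>p\<in>splittings (inc i e) - {p \<in> splittings (inc i e). fst p i \<noteq> 0}. h p = 0"
      using assms by (metis (mono_tags, lifting) DiffE mem_Collect_eq prod.collapse)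
  qed (auto simp: finite_splittings)
  also have "\<dots> = (\<Sum>p\<in>splittings e. h (inc i (fst p), snd p))"
  proof (rule sum.reindex_bij_witness[where i = "\<lambda>p. (inc i (fst p), snd p)"
        and j = "\<lambda>p. ((fst p)(i := fst p i - 1), snd p)"])
    fix p assume p: "p \<in> {p \<in> splittings (inc i e). fst p i \<noteq> 0}"
    show "((fst p)(i := fst p i - 1), snd p) \<in> splittings e"
      unfolding mem_splittings
    proof
      fix j
      have "fst p j + snd p j = inc i e j" using p by (auto simp: mem_splittings)
      then show "fst ((fst p)(i := fst p i - 1), snd p) j + snd ((fst p)(i := fst p i - 1), snd p) j = e j"
        using p by (cases "j = i") auto
    qed
  next
    fix p assume "p \<in> splittings e"
    then show "(inc i (fst p), snd p) \<in> {p \<in> splittings (inc i e). fst p i \<noteq> 0}"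
      by (auto simp: mem_splittings)
  qed auto
  finally show ?thesis by (simp add: case_prod_unfold)
qed

lemma sum_splittings_swap: "(\<Sum>p\<in>splittings e. h p) = (\<Sum>p\<in>splittings e. h (snd p, fst p))"
  by (rule sum.reindex_bij_witness[where i = "\<lambda>p. (snd p, fst p)" and j = "\<lambda>p. (snd p, fst p)"])
     (auto simp: splittings_def add.commute)

lemma sum_splittings_inc_right:
  fixes h :: "('n::finite \<Rightarrow> nat) \<times> ('n \<Rightarrow> nat) \<Rightarrow> 'c::ab_group_add"
  assumes "\<And>a b. b i = 0 \<Longrightarrow> h (a, b) = 0"
  shows "(\<Sum>p\<in>splittings (inc i e). h p) = (\<Sum>(a, b)\<in>splittings e. h (a, inc i b))"
proof -
  have "(\<Sum>p\<in>splittings (inc i e). h p) = (\<Sum>p\<in>splittings (inc i e). h (snd p, fst p))"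
    by (rule sum_splittings_swap)
  also have "\<dots> = (\<Sum>(a, b)\<in>splittings e. h (b, inc i a))"
    by (subst sum_splittings_inc_left) (auto simp: assms)
  also have "\<dots> = (\<Sum>(a, b)\<in>splittings e. h (a, inc i b))"
    using sum_splittings_swap[of "\<lambda>(a, b). h (b, inc i a)" e] by (simp add: case_prod_unfold)
  finally show ?thesis .
qed

text \<open>The Leibniz rule. On a splitting of \<open>inc i e\<close> the factor
  \<open>e i + 1\<close> is the sum of the two exponents of \<open>x_i\<close>; each summand becomes
  one of the two derivatives after re-indexing.\<close>

lemma conv_pd:
  fixes \<mu> :: "'a \<Rightarrow> 'b \<Rightarrow> 'c::ab_group_add" and s1 s2 and s3 :: "'k::field \<Rightarrow> 'c \<Rightarrow> 'c"
  assumes "vector_space s3"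
    and s1: "\<And>c x y. \<mu> (s1 c x) y = s3 c (\<mu> x y)" and s2: "\<And>c x y. \<mu> x (s2 c y) = s3 c (\<mu> x y)"
  shows "pd s3 i (conv \<mu> f g) = (\<lambda>e. conv \<mu> (pd s1 i f) g e + conv \<mu> f (pd s2 i g) e)"
proof
  interpret vector_space s3 by fact
  fix e
  define h where "h = (\<lambda>(a, b). \<mu> (f a) (g b))"
  have "pd s3 i (conv \<mu> f g) e = (\<Sum>p\<in>splittings (inc i e). s3 (of_nat (Suc (e i))) (h p))"
    by (simp add: pd_def conv_def h_def scale_sum_right del: of_nat_Suc)
  also have "\<dots> = (\<Sum>p\<in>splittings (inc i e). s3 (of_nat (fst p i)) (h p) + s3 (of_nat (snd p i)) (h p))"
  proof (rule sum.cong[OF HOL.refl])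
    fix p assume "p \<in> splittings (inc i e)"
    then have "fst p i + snd p i = Suc (e i)" by (auto simp: splittings_def)
    then show "s3 (of_nat (Suc (e i))) (h p) = s3 (of_nat (fst p i)) (h p) + s3 (of_nat (snd p i)) (h p)"
      by (metis of_nat_add scale_left_distrib)
  qed
  also have "\<dots> = (\<Sum>p\<in>splittings (inc i e). s3 (of_nat (fst p i)) (h p))
      + (\<Sum>p\<in>splittings (inc i e). s3 (of_nat (snd p i)) (h p))"
    by (rule sum.distrib)
  also have "(\<Sum>p\<in>splittings (inc i e). s3 (of_nat (fst p i)) (h p)) = conv \<mu> (pd s1 i f) g e"
    by (subst sum_splittings_inc_left)
       (auto simp: conv_def pd_def h_def s1 simp del: of_nat_Suc intro!: sum.cong)
  also have "(\<Sum>p\<in>splittings (inc i e). s3 (of_nat (snd p i)) (h p)) = conv \<mu> f (pd s2 i g) e"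
    by (subst sum_splittings_inc_right)
       (auto simp: conv_def pd_def h_def s2 simp del: of_nat_Suc intro!: sum.cong)
  finally show "pd s3 i (conv \<mu> f g) e = conv \<mu> (pd s1 i f) g e + conv \<mu> f (pd s2 i g) e" .
qed

lemma conv_add_left: "(\<And>x x' y. \<mu> (x + x') y = \<mu> x y + \<mu> x' y) \<Longrightarrow>
    conv \<mu> (\<lambda>a. f a + f' a) g e = conv \<mu> f g e + conv \<mu> f' g e"
  by (simp add: conv_def case_prod_unfold sum.distrib)

lemma conv_add_right: "(\<And>a y y'. \<mu> (f a) (y + y') = \<mu> (f a) y + \<mu> (f a) y') \<Longrightarrow>
    conv \<mu> f (\<lambda>a. g a + g' a) e = conv \<mu> f g e + conv \<mu> f g' e"
  by (simp add: conv_def case_prod_unfold sum.distrib)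

lemma mps_coeff_deriv: "mps_coeff (mps_deriv i f) = pd (*) i (mps_coeff f)"
  by (simp add: mps_deriv.rep_eq pd_def)

lemma mps_coeff_mult: "mps_coeff (f * g) = conv (*) (mps_coeff f) (mps_coeff g)"
  by (simp add: times_mps.rep_eq conv_def)

lemma mps_eqI: "(\<And>e. mps_coeff f e = mps_coeff g e) \<Longrightarrow> f = g"
  by (meson ext mps_coeff_inject)

lemma vector_space_field: "vector_space ((*) :: 'k::field \<Rightarrow> 'k \<Rightarrow> 'k)"
  by unfold_locales (auto simp: algebra_simps)

lemma mps_deriv_mult:
  "mps_deriv i (f * g) = mps_deriv i f * g + f * mps_deriv i (g :: ('k::field, 'n::finite) mps)"
proof (rule mps_eqI)
  fix e
  show "mps_coeff (mps_deriv i (f * g)) e = mps_coeff (mps_deriv i f * g + f * mps_deriv i g) e"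
    unfolding mps_coeff_deriv mps_coeff_mult plus_mps.rep_eq
    by (subst conv_pd[OF vector_space_field, where ?s1.0 = "(*)" and ?s2.0 = "(*)"]) auto
qed

lemma mps_deriv_add: "mps_deriv i (f + g) = mps_deriv i f + mps_deriv i (g :: ('k::comm_ring_1, 'n::finite) mps)"
  by transfer (auto simp: fun_eq_iff algebra_simps)

lemma mps_deriv_const: "mps_deriv i (mps_const c) = (0 :: ('k::comm_ring_1, 'n::finite) mps)"
  by transfer (auto simp: fun_eq_iff)

lemma mps_const_add: "mps_const (c + d) = mps_const c + (mps_const d :: ('k::comm_ring_1, 'n::finite) mps)"
  by transfer (auto simp: fun_eq_iff)

lemma mps_const_1: "mps_const 1 = (1 :: ('k::comm_ring_1, 'n::finite) mps)"
  by transfer (auto simp: fun_eq_iff)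

lemma mps_coeff_const_mult:
  fixes f :: "('k::comm_ring_1, 'n::finite) mps"
  shows "mps_coeff (mps_const c * f) e = c * mps_coeff f e"
proof -
  have "mps_coeff (mps_const c * f) e = (\<Sum>p\<in>{(idx0 :: 'n \<Rightarrow> nat, e)}. mps_coeff (mps_const c) (fst p) * mps_coeff f (snd p))"
    unfolding mps_coeff_mult conv_def case_prod_unfold
  proof (rule sum.mono_neutral_right)
    show "{(idx0, e)} \<subseteq> splittings e" by (simp add: mem_splittings idx0_def)
  qed (auto simp: finite_splittings mem_splittings idx0_def mps_const.rep_eq fun_eq_iff)
  then show ?thesis by (simp add: mps_const.rep_eq idx0_def)
qed

lemma mps_const_mult: "mps_const (c * d) = mps_const c * (mps_const d :: ('k::comm_ring_1, 'n::finite) mps)"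
  by (rule mps_eqI) (simp add: mps_coeff_const_mult mps_const.rep_eq)

lemma mps_const_inj: "mps_const c = (mps_const d :: ('k::comm_ring_1, 'n::finite) mps) \<longleftrightarrow> c = d"
  by transfer (auto simp: fun_eq_iff)

lift_definition mps_var :: "'n \<Rightarrow> ('k::zero_neq_one, 'n) mps" is "\<lambda>i e. if e = inc i idx0 then 1 else 0" .

lemma pd_commute: "vector_space sc \<Longrightarrow> pd sc i (pd sc j f) = pd sc j (pd sc i f)"
proof
  fix e assume "vector_space sc"
  then interpret vector_space sc .
  show "pd sc i (pd sc j f) e = pd sc j (pd sc i f) e"
  proof (cases "i = j")
    case False
    then have "inc j (inc i e) = inc i (inc j e)" by (auto simp: fun_eq_iff)
    then show ?thesis using False by (simp add: pd_def mult.commute del: of_nat_Suc)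
  qed simp
qed

lemma mps_deriv_commute: "mps_deriv i (mps_deriv j f) = mps_deriv j (mps_deriv i (f :: ('k::field, 'n::finite) mps))"
  by (rule mps_eqI) (simp add: mps_coeff_deriv pd_commute[OF vector_space_field])

section \<open>The module of vector-valued series\<close>

locale series_space = vector_space sc for sc :: "'k::field_char_0 \<Rightarrow> 'v::ab_group_add \<Rightarrow> 'v"
begin

definition ssc :: "'k \<Rightarrow> (('n \<Rightarrow> nat) \<Rightarrow> 'v) \<Rightarrow> ('n \<Rightarrow> nat) \<Rightarrow> 'v" where
  "ssc c s = (\<lambda>a. sc c (s a))"

definition smul :: "('k, 'n::finite) mps \<Rightarrow> (('n \<Rightarrow> nat) \<Rightarrow> 'v) \<Rightarrow> ('n \<Rightarrow> nat) \<Rightarrow> 'v" where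
  "smul f s = conv sc (mps_coeff f) s"

abbreviation app :: "(('n::finite \<Rightarrow> nat) \<Rightarrow> 'v \<Rightarrow> 'v) \<Rightarrow> (('n \<Rightarrow> nat) \<Rightarrow> 'v) \<Rightarrow> ('n \<Rightarrow> nat) \<Rightarrow> 'v" where
  "app A s \<equiv> conv (\<lambda>T. T) A s"

abbreviation pdo :: "'n \<Rightarrow> (('n \<Rightarrow> nat) \<Rightarrow> 'v \<Rightarrow> 'v) \<Rightarrow> ('n \<Rightarrow> nat) \<Rightarrow> 'v \<Rightarrow> 'v" where
  "pdo i A \<equiv> pd (\<lambda>c T v. sc c (T v)) i A"

definition cst :: "'v \<Rightarrow> ('n \<Rightarrow> nat) \<Rightarrow> 'v" where
  "cst v = (\<lambda>a. if a = idx0 then v else 0)"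

lemma VS: "vector_space sc" by unfold_locales

lemma vector_space_ssc: "vector_space ssc"
  by unfold_locales (auto simp: ssc_def fun_eq_iff scale_right_distrib scale_left_distrib)

lemma smul_0: "smul f s idx0 = sc (mps_coeff f idx0) (s idx0)"
  by (simp add: smul_def conv_0)

lemma pd_smul: "pd sc i (smul f s) = smul (mps_deriv i f) s + smul f (pd sc i s)"
  unfolding smul_def mps_coeff_deriv plus_fun_def
  by (rule conv_pd[OF VS]) (auto simp: mult.commute)

lemma pd_app:
  assumes "\<And>a. Vector_Spaces.linear sc sc (A a)"
  shows "pd sc i (app A s) = app (pdo i A) s + app A (pd sc i s)"
proof -
  define A' where "A' = (\<lambda>a. if Vector_Spaces.linear sc sc (A a) then A a else (\<lambda>v. 0))"
  have A: "A' = A" using assms by (auto simp: A'_def)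
  \<comment> \<open>\<open>conv_pd\<close> asks for homogeneity in the second argument for every
    first argument, and application has it only at linear functions. So functions that are not
    linear are sent to zero and left unscaled by \<open>s1\<close>; the coefficients of
    \<open>A\<close> are linear, and on them \<open>\<mu>\<close> is application.\<close>
  define \<mu> where "\<mu> = (\<lambda>T v. if Vector_Spaces.linear sc sc T then T v else (0 :: 'v))"
  have lin: "Vector_Spaces.linear sc sc (\<lambda>v. sc c (T v))" if "Vector_Spaces.linear sc sc T" for c T
    using that VS by (auto simp: Vector_Spaces.linear_iff scale_right_distrib scale_scale mult.commute)
  define s1 where "s1 = (\<lambda>c T. if Vector_Spaces.linear sc sc T then (\<lambda>v. sc c (T v)) else T)"
  have "pd sc i (conv \<mu> A s) = (\<lambda>e. conv \<mu> (pd s1 i A) s e + conv \<mu> A (pd sc i s) e)"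
    by (rule conv_pd[OF VS]) (auto simp: \<mu>_def s1_def lin, auto simp: Vector_Spaces.linear_iff)
  moreover have "conv \<mu> A t = app A t" for t by (simp add: conv_def \<mu>_def assms)
  moreover have "conv \<mu> (pd s1 i A) t = app (pdo i A) t" for t
    by (simp add: conv_def \<mu>_def assms pd_def s1_def lin del: of_nat_Suc)
  ultimately show ?thesis by (simp add: plus_fun_def)
qed

lemma pd_add: "pd sc i (s + t) = pd sc i s + pd sc i t"
  by (auto simp: pd_def fun_eq_iff scale_right_distrib)

lemma pd_diff: "pd sc i (s - t) = pd sc i s - pd sc i t"
  by (auto simp: pd_def fun_eq_iff scale_right_diff_distrib)

text \<open>Division by \<open>e i + 1\<close>, possible in characteristic zero. It closes the
  inductive steps of identities between series proved by \<open>idx_induct\<close>.\<close>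

lemma pd_eqD:
  assumes "pd sc i s e = pd sc i t e" shows "s (inc i e) = t (inc i e)"
  using assms by (simp add: pd_def scale_cancel_left del: of_nat_Suc)

lemma smul_add_right: "smul f (s + t) = smul f s + smul f t"
  by (auto simp: smul_def fun_eq_iff plus_fun_def scale_right_distrib intro!: conv_add_right)

lemma smul_add_left: "smul (f + g) s = smul f s + smul g s"
  unfolding smul_def plus_mps.rep_eq
  by (auto simp: fun_eq_iff scale_left_distrib intro!: conv_add_left)

lemma app_add_left: "app (\<lambda>a v. A a v + B a v) s = app A s + app B s"
  by (simp add: conv_def fun_eq_iff case_prod_unfold sum.distrib)

lemma app_add_right:
  assumes "\<And>a. Vector_Spaces.linear sc sc (A a)"
  shows "app A (s + t) = app A s + app A t"
  using assms by (auto simp: fun_eq_iff plus_fun_def Vector_Spaces.linear_iff intro!: conv_add_right)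

lemma smul_const:
  fixes s :: "('n::finite \<Rightarrow> nat) \<Rightarrow> 'v"
  shows "smul (mps_const c) s = ssc c s"
proof
  fix e
  have "smul (mps_const c) s e = (\<Sum>p\<in>{(idx0 :: 'n \<Rightarrow> nat, e)}. sc (mps_coeff (mps_const c) (fst p)) (s (snd p)))"
    unfolding smul_def conv_def case_prod_unfold
  proof (rule sum.mono_neutral_right)
    show "{(idx0, e)} \<subseteq> splittings e" by (simp add: mem_splittings idx0_def)
  qed (auto simp: finite_splittings mem_splittings idx0_def mps_const.rep_eq fun_eq_iff)
  then show "smul (mps_const c) s e = ssc c s e" by (simp add: mps_const.rep_eq idx0_def ssc_def)
qed

lemma lin_pdo:
  assumes "\<And>a. Vector_Spaces.linear sc sc (A a)"
  shows "Vector_Spaces.linear sc sc (pdo k A a)"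
proof -
  have "A (inc k a) (x + y) = A (inc k a) x + A (inc k a) y" "A (inc k a) (sc c x) = sc c (A (inc k a) x)" for x y c
    using assms[of "inc k a"] by (simp_all only: Vector_Spaces.linear_iff)
  then show ?thesis
    unfolding pd_def Vector_Spaces.linear_iff
    by (simp add: VS scale_right_distrib mult.commute del: of_nat_Suc fun_upd_apply)
qed

text \<open>The sides agree at the origin by linearity of the coefficients, and by Leibniz their
  derivatives are sums of expressions of the same shape. Hence the induction varies
  \<open>A\<close>, \<open>f\<close> and \<open>s\<close>.\<close>

lemma smul_app:
  assumes "\<And>a. Vector_Spaces.linear sc sc (A a)"
  shows "app A (smul f s) = smul f (app A s)"
proof -
  have "app A (smul f s) e = smul f (app A s) e" for e
    using assms
  proof (induct e arbitrary: A f s rule: idx_induct)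
    case zero
    then show ?case by (simp add: conv_0 smul_0 Vector_Spaces.linear_iff)
  next
    case (inc k e)
    note l = lin_pdo[OF inc(3)]
    have "pd sc k (app A (smul f s)) e = pd sc k (smul f (app A s)) e"
      unfolding pd_smul pd_app[OF inc(3)] app_add_right[OF inc(3)] smul_add_right
      by (simp add: inc(2)[OF l] inc(2)[OF inc(3)])
    then show ?case by (rule pd_eqD)
  qed
  then show ?thesis by (rule ext)
qed

lemma smul_var: "smul (mps_var i) t a = (if a i = 0 then 0 else t (a(i := a i - 1)))"
proof (cases "a i = 0")
  case True
  have "mps_coeff (mps_var i) (fst p) = (0 :: 'k)" if "p \<in> splittings a" for p
  proof -
    have "fst p i + snd p i = a i" using that by (auto simp: splittings_def)
    then have "fst p i = 0" using True by simp
    then have "fst p \<noteq> inc i idx0" by auto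
    then show ?thesis by (simp add: mps_var.rep_eq)
  qed
  then have "smul (mps_var i) t a = 0"
    unfolding smul_def conv_def case_prod_unfold by (intro sum.neutral ballI) simp
  then show ?thesis using True by simp
next
  case False
  have "smul (mps_var i) t a = (\<Sum>p\<in>{(inc i idx0, a(i := a i - 1))}. sc (mps_coeff (mps_var i) (fst p)) (t (snd p)))"
    unfolding smul_def conv_def case_prod_unfold
  proof (rule sum.mono_neutral_right)
    show "{(inc i idx0, a(i := a i - 1))} \<subseteq> splittings a"
      using False by (auto simp: splittings_def idx0_def)
    show "\<forall>p\<in>splittings a - {(inc i idx0, a(i := a i - 1))}. sc (mps_coeff (mps_var i) (fst p)) (t (snd p)) = 0"
    proof
      fix p assume p: "p \<in> splittings a - {(inc i idx0, a(i := a i - 1))}"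
      have "fst p \<noteq> inc i idx0"
      proof
        assume f: "fst p = inc i idx0"
        have "snd p = a(i := a i - 1)"
        proof
          fix j
          have "fst p j + snd p j = a j" using p by (auto simp: splittings_def)
          then show "snd p j = (a(i := a i - 1)) j" using f by (auto simp: idx0_def split: if_splits)
        qed
        then show False using f p by (metis DiffD2 prod.collapse singletonI)
      qed
      then show "sc (mps_coeff (mps_var i) (fst p)) (t (snd p)) = 0" by (simp add: mps_var.rep_eq)
    qed
  qed (simp add: finite_splittings)
  then show ?thesis using False by (simp add: mps_var.rep_eq)
qed

text \<open>The part of \<open>s\<close> whose monomials have first variable \<open>x_i\<close>,
  divided by \<open>x_i\<close>.\<close>

definition shift :: "'n::finite \<Rightarrow> (('n \<Rightarrow> nat) \<Rightarrow> 'v) \<Rightarrow> ('n \<Rightarrow> nat) \<Rightarrow> 'v" where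
  "shift i s = (\<lambda>a. if a \<in> tail_idx i then s (inc i a) else 0)"

lemma sum_fun_apply: "(\<Sum>i\<in>I. f i) x = (\<Sum>i\<in>I. f i x)" for f :: "'i \<Rightarrow> 'a \<Rightarrow> 'b::comm_monoid_add"
  by (induct I rule: infinite_finite_induct) auto

text \<open>Hadamard's lemma: every nonzero exponent is counted exactly once, at its first variable.
  So a section vanishing at the origin lies in the maximal ideal times the module.\<close>

lemma shift_decompose:
  assumes "s idx0 = 0"
  shows "s = (\<Sum>i\<in>UNIV. smul (mps_var i) (shift i s))"
proof
  fix a
  have "(\<Sum>i\<in>UNIV. smul (mps_var i) (shift i s)) a = (\<Sum>i\<in>UNIV. smul (mps_var i) (shift i s) a)"
    by (rule sum_fun_apply)
  also have "\<dots> = s a"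
  proof (cases "a = idx0")
    case True
    then show ?thesis using assms by (simp add: smul_var idx0_def)
  next
    case False
    then obtain k b where b: "b \<in> tail_idx k" "a = inc k b" by (rule idx_split)
    have "smul (mps_var i) (shift i s) a = (if i = k then s a else 0)" for i
    proof (cases "a i = 0")
      case True
      then show ?thesis using b by (auto simp: smul_var)
    next
      case False
      define c where "c = a(i := a i - Suc 0)"
      have a: "a = inc i c" using False by (auto simp: c_def)
      show ?thesis
      proof (cases "c \<in> tail_idx i")
        case True
        then have "i = k" using inc_tail_unique[of c i b k] a b by metis
        moreover have "smul (mps_var i) (shift i s) a = s (inc i c)"
          using True False by (simp add: smul_var shift_def c_def[symmetric])
        moreover have "s (inc i c) = s a" using a by (rule arg_cong[OF HOL.sym])
        ultimately show ?thesis by (simp only: if_True simp_thms)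
      next
        case f: False
        have "i \<noteq> k" using f b by (auto simp: c_def)
        then show ?thesis using f by (simp add: smul_var shift_def c_def[symmetric])
      qed
    qed
    then show ?thesis by simp
  qed
  finally show "s a = (\<Sum>i\<in>UNIV. smul (mps_var i) (shift i s)) a" by simp
qed

end

section \<open>The standard connection of a representation\<close>

lemma ord_pow_add:
  assumes "\<And>k x y. D k (x + y) = D k x + D k (y :: 'x::plus)"
  shows "ord_pow D a (x + y) = ord_pow D a x + ord_pow D a y"
  by (induct a arbitrary: x y rule: idx_induct) (simp_all add: ord_pow.simps assms)

lemma ord_pow_scale:
  assumes "\<And>k x. D k (h x) = h (D k x)"
  shows "ord_pow D a (h x) = h (ord_pow D a x)"
  by (induct a arbitrary: x rule: idx_induct) (simp_all add: ord_pow.simps assms)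

lemma ord_pow_intertwine:
  assumes "\<And>k x. h (D k x) = D' k (h x)"
  shows "h (ord_pow D a x) = ord_pow D' a (h x)"
  by (induct a arbitrary: x rule: idx_induct) (simp_all add: ord_pow.simps assms)

definition fl_ad :: "'n::finite \<Rightarrow> ('k::field, 'n) free_lie \<Rightarrow> ('k, 'n) free_lie" where
  "fl_ad k y = fl_bracket (fl_var k) y"

lemma fl_ad_add: "fl_ad k (x + y) = fl_ad k x + fl_ad k y"
  by (simp add: fl_ad_def fl_bracket_add_right)

lemma fl_ad_FL: "y \<in> FL_ge2 \<Longrightarrow> fl_ad k y \<in> FL_ge2"
  by (simp add: fl_ad_def FL_ge2_gen)

lemma fl_ad_var_FL: "fl_ad k (fl_var j) \<in> FL_ge2"
  by (simp add: fl_ad_def FL_ge2_var_var)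

lemma fl_ad_bracket: "fl_ad k (fl_bracket x y) = fl_bracket (fl_ad k x) y + fl_bracket x (fl_ad k y)"
  unfolding fl_ad_def by (rule fl_bracket_derivation)

text \<open>Exchanging two adjoint operators costs the adjoint of \<open>[e_k, e_j]\<close>, an
  element of degree two. This term is the source of curvature in the inductions on
  exponents.\<close>

lemma fl_ad_ad: "fl_ad k (fl_ad j y) = fl_bracket (fl_ad k (fl_var j)) y + fl_ad j (fl_ad k y)"
  unfolding fl_ad_def by (rule fl_bracket_derivation)

lemma ord_pow_ad_FL: "y \<in> FL_ge2 \<Longrightarrow> ord_pow fl_ad a y \<in> FL_ge2"
  by (induct a arbitrary: y rule: idx_induct) (simp_all add: ord_pow.simps fl_ad_FL)

lemma ord_pow_ad_var_FL: "a \<noteq> idx0 \<Longrightarrow> ord_pow fl_ad a (fl_var j) \<in> FL_ge2"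
  by (erule idx_split) (simp add: ord_pow.simps fl_ad_var_FL ord_pow_ad_FL)

context series_space begin

text \<open>Homogeneity over the field is contained in the Leibniz rule, because constants have zero
  derivative (\<open>D_ssc\<close>).\<close>

definition conn :: "('n::finite \<Rightarrow> (('n \<Rightarrow> nat) \<Rightarrow> 'v) \<Rightarrow> ('n \<Rightarrow> nat) \<Rightarrow> 'v) \<Rightarrow> bool" where
  "conn D \<longleftrightarrow> (\<forall>i s t. D i (s + t) = D i s + D i t) \<and>
     (\<forall>i f s. D i (smul f s) = smul (mps_deriv i f) s + smul f (D i s))"

text \<open>\<open>B'\<close> is the derivative of \<open>B\<close> along \<open>x\<^sub>k\<close> where the variables before \<open>x\<^sub>k\<close> vanish.\<close>

definition tail_deriv :: "'n::finite \<Rightarrow> (('n \<Rightarrow> nat) \<Rightarrow> 'v \<Rightarrow> 'v) \<Rightarrow> (('n \<Rightarrow> nat) \<Rightarrow> 'v \<Rightarrow> 'v) \<Rightarrow> bool" where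
  "tail_deriv k B B' \<longleftrightarrow> (\<forall>a. Vector_Spaces.linear sc sc (B a)) \<and> (\<forall>a\<in>tail_idx k. pdo k B a = B' a)"

lemma app_zero_right:
  assumes "\<And>a. Vector_Spaces.linear sc sc (A a)"
  shows "app A 0 = 0"
  using app_add_right[OF assms, where s = 0 and t = 0] by simp

lemma pd_app_tail:
  assumes "tail_deriv k B B'" "e \<in> tail_idx k"
  shows "pd sc k (app B s) e = app B' s e + app B (pd sc k s) e"
proof -
  have "app (pdo k B) s e = app B' s e"
    using assms by (intro conv_tail_cong[of e k]) (auto simp: tail_deriv_def)
  then show ?thesis using assms(1) by (simp add: pd_app tail_deriv_def)
qed

text \<open>The Leibniz rule for an inner factor is known only on \<open>tail_idx k\<close>; this
  lets it be used under an outer operator series.\<close>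

lemma app_add_tail:
  assumes "\<And>a. Vector_Spaces.linear sc sc (A a)" "e \<in> tail_idx k"
    "\<And>a. a \<in> tail_idx k \<Longrightarrow> r a = s a + t a"
  shows "app A r e = app A s e + app A t e"
proof -
  have "app A r e = app A (s + t) e"
    using assms by (intro conv_tail_cong[of e k]) auto
  then show ?thesis using assms by (simp add: app_add_right)
qed

lemma pd_app_app_tail:
  assumes A: "tail_deriv k A A'" and B: "tail_deriv k B B'" and e: "e \<in> tail_idx k"
  shows "pd sc k (app A (app B s)) e
    = app A' (app B s) e + app A (app B' s) e + app A (app B (pd sc k s)) e"
proof -
  have "app A (pd sc k (app B s)) e = app A (app B' s) e + app A (app B (pd sc k s)) e"
    using A pd_app_tail[OF B] by (intro app_add_tail[OF _ e]) (auto simp: tail_deriv_def)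
  then show ?thesis using pd_app_tail[OF A e, of "app B s"] by simp
qed

text \<open>Raising the exponent of an \<open>x_j\<close> that does not precede \<open>x_k\<close>
  stays inside \<open>tail_idx k\<close>, so an identity valid there may be differentiated along
  \<open>x_j\<close>; partial derivatives commute.\<close>

lemma tail_deriv_pdo:
  assumes B: "tail_deriv k B B'" and kj: "var_ord k \<le> var_ord j"
  shows "tail_deriv k (pdo j B) (pdo j B')"
  unfolding tail_deriv_def
proof (intro conjI allI ballI)
  show "Vector_Spaces.linear sc sc (pdo j B a)" for a
    using B by (intro lin_pdo) (simp add: tail_deriv_def)
  fix a assume a: "a \<in> tail_idx k"
  have "pdo k B (inc j a) = B' (inc j a)"
    using B inc_tail[OF a kj] by (simp add: tail_deriv_def)
  then have *: "(\<lambda>v. sc (of_nat (Suc (inc j a k))) (B (inc k (inc j a)) v)) = B' (inc j a)"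
    by (simp only: pd_def)
  show "pdo k (pdo j B) a = pdo j B' a"
  proof (cases "k = j")
    case True
    then show ?thesis using * unfolding pd_def by metis
  next
    case False
    then have t: "inc j (inc k a) = inc k (inc j a)" by (auto simp: fun_eq_iff)
    have "inc j a k = a k" "inc k a j = a j" using False by auto
    then show ?thesis using * unfolding pd_def t by (simp add: fun_eq_iff mult.commute del: of_nat_Suc fun_upd_apply)
        (metis (no_types, lifting) mult.commute scale_scale)
  qed
qed

end

section \<open>Covariant derivatives and curvature in the axial gauge\<close>

locale fl_rep = series_space sc for sc :: "'k::field_char_0 \<Rightarrow> 'v::ab_group_add \<Rightarrow> 'v" +
  fixes \<rho> :: "('k, 'n::finite) free_lie \<Rightarrow> 'v \<Rightarrow> 'v"
  assumes lin_rho: "x \<in> FL_ge2 \<Longrightarrow> Vector_Spaces.linear sc sc (\<rho> x)"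
    and rho_add: "x \<in> FL_ge2 \<Longrightarrow> y \<in> FL_ge2 \<Longrightarrow> \<rho> (x + y) v = \<rho> x v + \<rho> y v"
    and rho_scale: "x \<in> FL_ge2 \<Longrightarrow> \<rho> (fl_scale c x) v = sc c (\<rho> x v)"
    and rho_bracket: "x \<in> FL_ge2 \<Longrightarrow> y \<in> FL_ge2 \<Longrightarrow> \<rho> (fl_bracket x y) v = \<rho> x (\<rho> y v) - \<rho> y (\<rho> x v)"
begin

text \<open>The Taylor expansion, in the axial gauge, of the endomorphism by which \<open>y\<close> acts on a bundle
  with fibre representation \<open>\<rho>\<close>.\<close>

definition op_series :: "('k, 'n) free_lie \<Rightarrow> ('n \<Rightarrow> nat) \<Rightarrow> 'v \<Rightarrow> 'v" where
  "op_series y a v = sc (1 / idx_fact a) (\<rho> (ord_pow fl_ad a y) v)"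

text \<open>The connection matrix in the axial gauge: it vanishes where the variables before \<open>x\<^sub>j\<close> do.\<close>

definition gauge :: "'n \<Rightarrow> ('n \<Rightarrow> nat) \<Rightarrow> 'v \<Rightarrow> 'v" where
  "gauge j a = (if a \<in> tail_idx j then (\<lambda>v. 0) else op_series (fl_var j) a)"

definition std_conn :: "'n \<Rightarrow> (('n \<Rightarrow> nat) \<Rightarrow> 'v) \<Rightarrow> ('n \<Rightarrow> nat) \<Rightarrow> 'v" where
  "std_conn j s = pd sc j s + app (gauge j) s"

lemma rho_v_add: "x \<in> FL_ge2 \<Longrightarrow> \<rho> x (v + w) = \<rho> x v + \<rho> x w"
  and rho_v_scale: "x \<in> FL_ge2 \<Longrightarrow> \<rho> x (sc c v) = sc c (\<rho> x v)"
  using lin_rho by (auto simp: Vector_Spaces.linear_iff)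

lemma linear_op_series_aux:
  assumes "ord_pow fl_ad a y \<in> FL_ge2"
  shows "Vector_Spaces.linear sc sc (op_series y a)"
  using assms VS by (auto simp: Vector_Spaces.linear_iff op_series_def rho_v_add rho_v_scale
      scale_right_distrib mult.commute)

lemma linear_op_series: "y \<in> FL_ge2 \<Longrightarrow> Vector_Spaces.linear sc sc (op_series y a)"
  by (simp add: linear_op_series_aux ord_pow_ad_FL)

lemma linear_gauge: "Vector_Spaces.linear sc sc (gauge j a)"
proof (cases "a \<in> tail_idx j")
  case True
  then show ?thesis using VS by (simp add: gauge_def Vector_Spaces.linear_iff)
next
  case False
  then have "a \<noteq> idx0" using idx0_tail by metis
  then show ?thesis using False by (simp add: gauge_def linear_op_series_aux ord_pow_ad_var_FL)
qed

lemma op_series_0: "op_series y idx0 v = \<rho> y v"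
  by (simp add: op_series_def ord_pow.simps idx_fact_0)

text \<open>In the ordered power of \<open>inc k a\<close> the operator \<open>ad e_k\<close> is
  applied first, and the new factor of the factorial cancels the one produced by
  differentiation.\<close>

lemma pdo_op_series: "a \<in> tail_idx k \<Longrightarrow> pdo k (op_series y) a = op_series (fl_ad k y) a"
  by (simp add: pd_def op_series_def fun_eq_iff ord_pow.simps idx_fact_inc del: of_nat_Suc)

lemma tail_deriv_op_series: "y \<in> FL_ge2 \<Longrightarrow> tail_deriv k (op_series y) (op_series (fl_ad k y))"
  by (simp add: tail_deriv_def linear_op_series pdo_op_series)

text \<open>Where the variables before \<open>x_k\<close> vanish, so do \<open>A_k\<close> and its
  derivative along \<open>x_j\<close>, and the curvature reduces to the derivative of
  \<open>A_j\<close> along \<open>x_k\<close>. Raising \<open>x_k\<close> leaves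
  \<open>tail_idx j\<close>, so the coefficient falls in the second branch of
  \<open>gauge\<close>.\<close>

lemma tail_deriv_gauge:
  assumes "var_ord k < var_ord j"
  shows "tail_deriv k (gauge j) (op_series (fl_ad k (fl_var j)))"
  unfolding tail_deriv_def
proof (intro conjI allI ballI linear_gauge)
  fix a :: "'n \<Rightarrow> nat" assume a: "a \<in> tail_idx k"
  have "inc k a \<notin> tail_idx j" using assms by (auto simp: tail_idx_def)
  then have "pdo k (gauge j) a = pdo k (op_series (fl_var j)) a" by (simp add: pd_def gauge_def)
  then show "pdo k (gauge j) a = op_series (fl_ad k (fl_var j)) a"
    using pdo_op_series[OF a] by simp
qed

lemma op_series_add:
  assumes "x \<in> FL_ge2" "y \<in> FL_ge2"
  shows "app (op_series (x + y)) s = app (op_series x) s + app (op_series y) s"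
proof -
  have "op_series (x + y) = (\<lambda>a v. op_series x a v + op_series y a v)"
    using assms by (simp add: fun_eq_iff op_series_def ord_pow_add[of fl_ad, OF fl_ad_add] rho_add
        ord_pow_ad_FL scale_right_distrib)
  then show ?thesis by (simp add: app_add_left)
qed

lemma op_series_scale:
  assumes "x \<in> FL_ge2"
  shows "app (op_series (fl_scale c x)) s = ssc c (app (op_series x) s)"
proof -
  have "op_series (fl_scale c x) = (\<lambda>a v. sc c (op_series x a v))"
    using assms by (simp add: fun_eq_iff op_series_def rho_scale ord_pow_ad_FL mult.commute
        ord_pow_scale[of fl_ad "fl_scale c"] fl_ad_def fl_bracket_scale_right)
  then show ?thesis by (simp add: conv_def ssc_def case_prod_unfold scale_sum_right)
qed

lemma op_series_zero: "app (op_series 0) s = 0"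
  using op_series_add[OF FL_ge2_0 FL_ge2_0, of s] by simp

text \<open>At the origin this is the bracket relation of \<open>\<rho>\<close>. Differentiation
  along \<open>x_k\<close> replaces elements by their images under the derivation
  \<open>ad e_k\<close>, so the step is carried by the relation for \<open>(ad e_k x, y)\<close> and
  \<open>(x, ad e_k y)\<close>, and by the one for \<open>(x, y)\<close> on the derivative of
  \<open>s\<close>.\<close>

lemma op_series_bracket_at:
  assumes "x \<in> FL_ge2" "y \<in> FL_ge2"
  shows "app (op_series (fl_bracket x y)) s e
    = app (op_series x) (app (op_series y) s) e - app (op_series y) (app (op_series x) s) e"
  using assms
proof (induct e arbitrary: x y s rule: idx_induct)
  case zero
  then show ?case by (simp add: conv_0 op_series_0 rho_bracket)
next
  case (inc k e)
  note FL = inc(3,4) fl_ad_FL[OF inc(3), of k] fl_ad_FL[OF inc(4), of k]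
  note td = tail_deriv_op_series[OF inc(3), of k] tail_deriv_op_series[OF inc(4), of k]
  have "pd sc k (app (op_series (fl_bracket x y)) s) e
      = pd sc k (app (op_series x) (app (op_series y) s) - app (op_series y) (app (op_series x) s)) e"
    unfolding pd_diff minus_apply
      pd_app_tail[OF tail_deriv_op_series[OF FL_ge2_bracket[OF inc(3,4)]] inc(1)]
      pd_app_app_tail[OF td inc(1)] pd_app_app_tail[OF td(2,1) inc(1)]
      fl_ad_bracket op_series_add[OF FL_ge2_bracket[OF FL(3,2)] FL_ge2_bracket[OF FL(1,4)]]
    using inc(2)[OF FL(3,2)] inc(2)[OF FL(1,4)] inc(2)[OF FL(1,2)] by simp
  then show ?case unfolding minus_apply[symmetric] by (rule pd_eqD)
qed

lemma op_series_bracket: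
  assumes "x \<in> FL_ge2" "y \<in> FL_ge2"
  shows "app (op_series (fl_bracket x y)) s
    = app (op_series x) (app (op_series y) s) - app (op_series y) (app (op_series x) s)"
  using op_series_bracket_at[OF assms] by (auto simp: fun_eq_iff)

lemma app_gauge_tail: "e \<in> tail_idx j \<Longrightarrow> app (gauge j) s e = 0"
  using conv_tail_cong[of e j "gauge j" "\<lambda>_ _. 0" s s "\<lambda>T. T"]
  by (simp add: gauge_def) (simp add: conv_def)

text \<open>If the first variable of the exponent does not precede \<open>x_j\<close>, the gauge
  contributes nothing and \<open>pdo_op_series\<close> is the claim; otherwise the claim is
  differentiated along that variable. Geometrically, \<open>[e_j, y]\<close> acts as the covariant
  derivative of the endomorphism of \<open>y\<close>.\<close>

lemma op_series_var_at:
  assumes "y \<in> FL_ge2"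
  shows "app (op_series (fl_ad j y)) s e
    = app (pdo j (op_series y)) s e + app (gauge j) (app (op_series y) s) e
      - app (op_series y) (app (gauge j) s) e"
proof -
  have direct: "app (op_series (fl_ad j y)) s e
    = app (pdo j (op_series y)) s e + app (gauge j) (app (op_series y) s) e
      - app (op_series y) (app (gauge j) s) e" if e: "e \<in> tail_idx j" and "y \<in> FL_ge2" for y s e
  proof -
    have 1: "app (op_series (fl_ad j y)) s e = app (pdo j (op_series y)) s e"
      using pdo_op_series by (intro conv_tail_cong[OF e]) auto
    have "app (op_series y) (app (gauge j) s) e = app (op_series y) 0 e"
      using app_gauge_tail by (intro conv_tail_cong[OF e]) auto
    also have "\<dots> = 0"
      using app_zero_right[of "op_series y"] linear_op_series[OF \<open>y \<in> FL_ge2\<close>] by simp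
    finally show ?thesis using 1 app_gauge_tail[OF e] by simp
  qed
  show ?thesis using assms
  proof (induct e arbitrary: y s rule: idx_induct)
    case zero
    then show ?case using direct idx0_tail by blast
  next
    case (inc k e)
    show ?case
    proof (cases "var_ord j \<le> var_ord k")
      case True
      then have "inc k e \<in> tail_idx j" using inc_tail[OF inc(1), of k] tail_mono by blast
      then show ?thesis using direct inc(3) by blast
    next
      case False
      then have kj: "var_ord k < var_ord j" by simp
      define u :: "('k, 'n) free_lie" where "u = fl_ad k (fl_var j)"
      have FL: "u \<in> FL_ge2" "fl_ad k y \<in> FL_ge2" "fl_ad j (fl_ad k y) \<in> FL_ge2"
        using inc(3) by (simp_all add: u_def fl_ad_var_FL fl_ad_FL)
      note tX = tail_deriv_op_series[OF inc(3), of k]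
      note tA = tail_deriv_gauge[OF kj, folded u_def]
      note tP = tail_deriv_pdo[OF tX, of j, OF less_imp_le[OF kj]]
      \<comment> \<open>By \<open>fl_ad_ad\<close> the left side produces \<open>[u, y]\<close> and
        \<open>[e_j, [e_k, y]]\<close>. The second is covered by the induction hypothesis; the first
        matches the commutator with \<open>u\<close> on the right, which arises because the
        derivative of \<open>A_j\<close> along \<open>x_k\<close> is the operator series of
        \<open>u\<close>.\<close>
      have "pd sc k (app (op_series (fl_ad j y)) s) e
        = pd sc k (app (pdo j (op_series y)) s + app (gauge j) (app (op_series y) s)
            - app (op_series y) (app (gauge j) s)) e"
        unfolding pd_diff pd_add minus_apply plus_fun_apply
          pd_app_tail[OF tail_deriv_op_series[OF fl_ad_FL[OF inc(3)]] inc(1)]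
          pd_app_tail[OF tP inc(1)]
          pd_app_app_tail[OF tA tX inc(1)] pd_app_app_tail[OF tX tA inc(1)]
          fl_ad_ad[of k j] u_def[symmetric]
          op_series_add[OF FL_ge2_bracket[OF FL(1) inc(3)] FL(3)]
        using inc(2)[OF FL(2), of s] inc(2)[OF inc(3), of "pd sc k s"]
          op_series_bracket[OF FL(1) inc(3), of s, THEN fun_cong, of e]
        by simp
      then show ?thesis unfolding minus_apply[symmetric] plus_fun_apply[symmetric] by (rule pd_eqD)
    qed
  qed
qed

text \<open>The right side is the curvature of the standard connection. At exponents in
  \<open>tail_idx i\<close> the matrix \<open>A_i\<close> and its derivative along
  \<open>x_j\<close> vanish, and \<open>tail_deriv_gauge\<close> applies. Elsewhere the step along
  an earlier \<open>x_k\<close> is the second Bianchi identity, which on the Lie side is the Jacobi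
  identity for \<open>e_i\<close>, \<open>e_j\<close>, \<open>e_k\<close>.\<close>

lemma op_series_var_var_at:
  assumes ij: "var_ord i < var_ord j"
  shows "app (op_series (fl_ad i (fl_var j))) s e
    = app (pdo i (gauge j)) s e - app (pdo j (gauge i)) s e
      + app (gauge i) (app (gauge j) s) e - app (gauge j) (app (gauge i) s) e"
proof -
  have direct: "app (op_series (fl_ad i (fl_var j))) s e
    = app (pdo i (gauge j)) s e - app (pdo j (gauge i)) s e
      + app (gauge i) (app (gauge j) s) e - app (gauge j) (app (gauge i) s) e"
    if e: "e \<in> tail_idx i" for s e
  proof -
    have 1: "app (op_series (fl_ad i (fl_var j))) s e = app (pdo i (gauge j)) s e"
      using tail_deriv_gauge[OF ij] by (intro conv_tail_cong[OF e]) (auto simp: tail_deriv_def)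
    have "pdo j (gauge i) a = (\<lambda>v. 0)" if "a \<in> tail_idx i" for a
      using inc_tail[OF that, of j] ij by (simp add: pd_def gauge_def)
    then have "app (pdo j (gauge i)) s e = app (\<lambda>_ _. 0) s e"
      by (intro conv_tail_cong[OF e]) auto
    then have 2: "app (pdo j (gauge i)) s e = 0" by (simp add: conv_def)
    have "app (gauge j) (app (gauge i) s) e = app (gauge j) 0 e"
      using app_gauge_tail by (intro conv_tail_cong[OF e]) auto
    also have "\<dots> = 0"
      using app_zero_right[of "gauge j"] linear_gauge by simp
    finally show ?thesis using 1 2 app_gauge_tail[OF e] by simp
  qed
  show ?thesis
  proof (induct e arbitrary: s rule: idx_induct)
    case zero
    then show ?case using direct idx0_tail by blast
  next
    case (inc k e)
    show ?case
    proof (cases "var_ord i \<le> var_ord k")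
      case True
      then have "inc k e \<in> tail_idx i" using inc_tail[OF inc(1), of k] tail_mono by blast
      then show ?thesis using direct by blast
    next
      case False
      then have ki: "var_ord k < var_ord i" and kj: "var_ord k < var_ord j" using ij by simp_all
      define u :: "('k, 'n) free_lie" where "u = fl_ad k (fl_var j)"
      define w :: "('k, 'n) free_lie" where "w = fl_ad k (fl_var i)"
      have FL: "u \<in> FL_ge2" "w \<in> FL_ge2" "fl_ad i u \<in> FL_ge2" "fl_ad j w \<in> FL_ge2"
        by (simp_all add: u_def w_def fl_ad_var_FL fl_ad_FL)
      note tj = tail_deriv_gauge[OF kj, folded u_def]
      note ti = tail_deriv_gauge[OF ki, folded w_def]
      note tij = tail_deriv_pdo[OF tj, of i, OF less_imp_le[OF ki]]
      note tji = tail_deriv_pdo[OF ti, of j, OF less_imp_le[OF kj]]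
      have "fl_bracket w (fl_var j) = - fl_ad j w"
        unfolding fl_ad_def by (rule fl_bracket_anti)
      \<comment> \<open>Jacobi in the shape that fits the rules for \<open>op_series\<close>, which
        treat sums and scalar multiples; hence the factor \<open>- 1\<close> in place of a
        negation.\<close>
      then have jac: "fl_ad k (fl_ad i (fl_var j)) = fl_scale (- 1) (fl_ad j w) + fl_ad i u"
        unfolding fl_ad_ad[of k i] u_def[symmetric] w_def[symmetric]
        by (simp only: uminus_free_lie_def)
      have m1: "ssc (- 1) t = - t" for t :: "('n \<Rightarrow> nat) \<Rightarrow> 'v" by (simp add: ssc_def fun_eq_iff)
      have "pd sc k (app (op_series (fl_ad i (fl_var j))) s) e
        = pd sc k (app (pdo i (gauge j)) s - app (pdo j (gauge i)) s
            + app (gauge i) (app (gauge j) s) - app (gauge j) (app (gauge i) s)) e"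
        unfolding pd_diff pd_add minus_apply plus_fun_apply
          pd_app_tail[OF tail_deriv_op_series[OF fl_ad_var_FL] inc(1)]
          pd_app_tail[OF tij inc(1)] pd_app_tail[OF tji inc(1)]
          pd_app_app_tail[OF ti tj inc(1)] pd_app_app_tail[OF tj ti inc(1)]
          jac op_series_add[OF FL_ge2_scale[OF FL(4)] FL(3)] op_series_scale[OF FL(4)] m1
        using inc(2)[of "pd sc k s"] op_series_var_at[OF FL(1), of i s e]
          op_series_var_at[OF FL(2), of j s e]
        by simp
      then show ?thesis unfolding minus_apply[symmetric] plus_fun_apply[symmetric] by (rule pd_eqD)
    qed
  qed
qed

lemma conn_std_conn: "conn std_conn"
  unfolding conn_def
  by (auto simp: std_conn_def pd_add app_add_right[OF linear_gauge] pd_smul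
      smul_app[OF linear_gauge] smul_add_right algebra_simps)

end

section \<open>Connections in coordinates and their Taylor maps\<close>

locale series_conn = series_space sc for sc :: "'k::field_char_0 \<Rightarrow> 'v::ab_group_add \<Rightarrow> 'v" +
  fixes D :: "'n::finite \<Rightarrow> (('n \<Rightarrow> nat) \<Rightarrow> 'v) \<Rightarrow> ('n \<Rightarrow> nat) \<Rightarrow> 'v"
  assumes conn: "conn D"
begin

lemma D_add: "D i (s + t) = D i s + D i t"
  and D_smul: "D i (smul f s) = smul (mps_deriv i f) s + smul f (D i s)"
  using conn by (auto simp: conn_def)

lemma smul_zero_left: "smul 0 s = 0"
  using smul_add_left[of 0 0 s] by simp

lemma smul_zero_right: "smul f 0 = 0"
  using smul_add_right[of f 0 0] by simp

lemma D_ssc: "D i (ssc c s) = ssc c (D i s)"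
  using D_smul[of i "mps_const c" s] by (simp add: smul_const mps_deriv_const smul_zero_left)

sublocale L: lie_ops ssc D
proof (intro lie_ops.intro vector_space_ssc lie_ops_axioms.intro)
  show "Vector_Spaces.linear ssc ssc (D i)" for i
    using vector_space_ssc by (auto simp: Vector_Spaces.linear_iff D_add D_ssc)
qed

end

abbreviation mps_scale :: "'k \<Rightarrow> ('k::field_char_0, 'n::finite) mps \<Rightarrow> ('k, 'n) mps" where
  "mps_scale c f \<equiv> mps_const c * f"

lemma vector_space_mps: "vector_space (mps_scale :: 'k::field_char_0 \<Rightarrow> ('k, 'n::finite) mps \<Rightarrow> _)"
  by unfold_locales (auto simp: algebra_simps mps_const_add mps_const_mult mps_const_1)

interpretation mps_lie: lie_ops "mps_scale :: 'k::field_char_0 \<Rightarrow> ('k, 'n::finite) mps \<Rightarrow> _" mps_deriv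
proof (intro lie_ops.intro vector_space_mps lie_ops_axioms.intro)
  show "Vector_Spaces.linear mps_scale mps_scale (mps_deriv i :: ('k, 'n) mps \<Rightarrow> _)" for i
    using vector_space_mps by (auto simp: Vector_Spaces.linear_iff mps_deriv_add mps_deriv_mult mps_deriv_const)
qed

text \<open>The free Lie algebra acts on the coordinate ring through commuting derivations.\<close>

lemma mps_lie_bracket: "lie_act mps_scale mps_deriv (fl_bracket x y) f = 0"
  for f :: "('k::field_char_0, 'n::finite) mps"
proof -
  have 1: "mps_deriv i (lie_eval mps_scale mps_deriv t f) = lie_eval mps_scale mps_deriv t (mps_deriv i f)"
    for i t and f :: "('k, 'n) mps"
    by (rule lie_eval_intertwine)
       (auto simp: mps_deriv_add mps_deriv_mult mps_deriv_const mps_deriv_commute)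
  have "lie_eval mps_scale mps_deriv s (lie_eval mps_scale mps_deriv t f)
      = lie_eval mps_scale mps_deriv t (lie_eval mps_scale mps_deriv s f)" for s t
    by (rule lie_eval_intertwine) (auto simp: mps_lie.lie_eval_add mps_lie.lie_eval_scale 1)
  then show ?thesis by (simp add: mps_lie.lie_act_bracket) (simp add: lie_act_def)
qed

lemma mps_lie_FL_ge2: "x \<in> FL_ge2 \<Longrightarrow> lie_act mps_scale mps_deriv x f = 0"
  for f :: "('k::field_char_0, 'n::finite) mps"
  by (induct rule: FL_ge2_bracket_induct)
     (simp_all add: mps_lie.lie_act_zero mps_lie.lie_act_plus mps_lie.lie_act_fl_scale mps_lie_bracket)

section \<open>Maps linear over the power series\<close>

context series_space begin

lemma smul_ssc: "smul f (ssc c s) = ssc c (smul f s)"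
  by (simp add: smul_def conv_def ssc_def fun_eq_iff case_prod_unfold scale_sum_right mult.commute)

lemma smul_mps_scale: "smul (mps_scale c f) s = ssc c (smul f s)"
  by (simp add: smul_def conv_def ssc_def fun_eq_iff case_prod_unfold scale_sum_right mps_coeff_const_mult)

lemma ssc_add: "ssc c (s + t) = ssc c s + ssc c t"
  by (simp add: ssc_def fun_eq_iff scale_right_distrib)

lemma cst_add: "cst (v + w) = cst v + cst w" and cst_scale: "cst (sc c v) = ssc c (cst v)"
  and cst_0: "cst v idx0 = v"
  by (auto simp: cst_def ssc_def fun_eq_iff)

definition rlin :: "((('n::finite \<Rightarrow> nat) \<Rightarrow> 'v) \<Rightarrow> ('n \<Rightarrow> nat) \<Rightarrow> 'v) \<Rightarrow> bool" where
  "rlin U \<longleftrightarrow> (\<forall>s t. U (s + t) = U s + U t) \<and> (\<forall>f s. U (smul f s) = smul f (U s))"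

lemma additive_sum:
  fixes U :: "'x::ab_group_add \<Rightarrow> 'y::ab_group_add"
  assumes "\<And>s t. U (s + t) = U s + U t"
  shows "U (sum f I) = (\<Sum>i\<in>I. U (f i))"
proof -
  have "U 0 = 0" using assms[of 0 0] by simp
  then show ?thesis by (induct I rule: infinite_finite_induct) (simp_all add: assms)
qed

lemma rlin_sum: "rlin U \<Longrightarrow> U (sum f I) = (\<Sum>i\<in>I. U (f i))"
  unfolding rlin_def by (rule additive_sum[of U]) blast

text \<open>Hadamard's lemma writes \<open>s\<close> as a combination with the variables as scalars,
  and \<open>U\<close> lets these through.\<close>

lemma rlin_idx0_zero:
  assumes "rlin U" "s idx0 = 0" shows "U s idx0 = 0"
proof -
  have "U s idx0 = (\<Sum>i\<in>UNIV. U (smul (mps_var i) (shift i s))) idx0"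
    using rlin_sum[OF assms(1), of "\<lambda>i. smul (mps_var i) (shift i s)" UNIV] shift_decompose[of s] assms(2)
    by simp
  also have "(\<Sum>i\<in>UNIV. U (smul (mps_var i) (shift i s))) idx0 = 0"
    using assms(1) by (simp add: sum_fun_apply rlin_def smul_var) (simp add: idx0_def)
  finally show ?thesis .
qed

lemma rlin_diff: "rlin U \<Longrightarrow> U (s - t) = U s - U t"
  unfolding rlin_def by (metis add_diff_cancel diff_add_cancel)

lemma rlin_idx0:
  assumes "rlin U" shows "U s idx0 = U (cst (s idx0)) idx0"
  using rlin_idx0_zero[OF assms, of "s - cst (s idx0)"]
  by (simp add: cst_0 rlin_diff[OF assms])

text \<open>A map that is zero modulo the maximal ideal raises the order of vanishing. Writing
  \<open>s\<close> as a combination of the variables, each coefficient has order one less, the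
  induction applies to it, and multiplying by the variable restores the loss.\<close>

lemma rlin_order:
  assumes U: "rlin U" and U0: "\<And>s. U s idx0 = 0"
    and s: "\<And>a. idx_size a < k \<Longrightarrow> s a = 0"
  shows "idx_size a < Suc k \<Longrightarrow> U s a = 0"
  using s
proof (induct k arbitrary: s a)
  case 0
  then have "a = idx0" by (simp add: idx_size_0)
  then show ?case using U0 by simp
next
  case (Suc k)
  have "s idx0 = 0" using Suc(3)[of idx0] idx_size_0[of idx0, THEN iffD2, OF HOL.refl]
    by (metis zero_less_Suc)
  then have "U s = (\<Sum>i\<in>UNIV. smul (mps_var i) (U (shift i s)))"
    using rlin_sum[OF U, of "\<lambda>i. smul (mps_var i) (shift i s)" UNIV] shift_decompose[of s] U
    by (simp add: rlin_def)
  moreover have "smul (mps_var i) (U (shift i s)) a = 0" for i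
  proof (cases "a i = 0")
    case False
    define c where "c = a(i := a i - Suc 0)"
    have "a = inc i c" using False by (auto simp: c_def)
    then have "idx_size c < Suc k" using Suc(2) idx_size_inc by (metis Suc_less_eq)
    then have "U (shift i s) c = 0"
    proof (rule Suc(1))
      fix b :: "'a \<Rightarrow> nat" assume "idx_size b < k"
      then show "shift i s b = 0" using Suc(3)[of "inc i b"] unfolding idx_size_inc by (simp add: shift_def del: fun_upd_apply)
    qed
    then show ?thesis using False by (simp add: smul_var c_def)
  qed (simp add: smul_var)
  ultimately show ?case by (simp add: sum_fun_apply)
qed

lemma smul_diff: "smul f (s - t) = smul f s - smul f t"
  using smul_add_right[of f "s - t" t] by (simp add: algebra_simps)

text \<open>With \<open>U = 1 - T\<close>, an element of the kernel satisfies \<open>s = U s\<close>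
  and therefore vanishes to every order.\<close>

lemma rlin_inj:
  assumes T: "rlin T" and T0: "\<And>s. T s idx0 = s idx0" and "T s = 0"
  shows "s = 0"
proof -
  define U where "U s = s - T s" for s
  have U: "rlin U" using T by (auto simp: rlin_def U_def smul_diff)
  have U0: "U s idx0 = 0" for s by (simp add: U_def T0)
  have "\<forall>a. idx_size a < k \<longrightarrow> s a = 0" for k
  proof (induct k)
    case (Suc k)
    then have "\<forall>a. idx_size a < Suc k \<longrightarrow> U s a = 0" using rlin_order[OF U U0, of k s] by blast
    then show ?case using assms(3) by (simp add: U_def)
  qed simp
  then show ?thesis by (auto simp: fun_eq_iff)
qed

text \<open>Geometric series: \<open>T\<close> is the identity modulo the maximal ideal.\<close>

lemma rlin_surj:
  assumes T: "rlin T" and T0: "\<And>s. T s idx0 = s idx0"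
  shows "\<exists>s. T s = t"
proof -
  define U where "U s = s - T s" for s
  have U: "rlin U" using T by (auto simp: rlin_def U_def smul_diff)
  have U0: "U s idx0 = 0" for s by (simp add: U_def T0)
  have ord: "\<forall>a. idx_size a < k \<longrightarrow> (U ^^ k) t a = 0" for k
  proof (induct k)
    case (Suc k)
    then show ?case using rlin_order[OF U U0, of k "(U ^^ k) t"] by simp
  qed simp
  define S where "S n = (\<Sum>k<n. (U ^^ k) t)" for n
  \<comment> \<open>The terms of index greater than \<open>idx_size a\<close> vanish at
    \<open>a\<close>, so the partial sums are constant there from \<open>Suc (idx_size a)\<close> on
    and the limit is read off coefficientwise.\<close>
  define s where "s a = S (Suc (idx_size a)) a" for a
  have S: "S m a = S n a" if "idx_size a < n" "n \<le> m" for a m n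
    using that(2)
  proof (induct m rule: dec_induct)
    case (step m)
    then show ?case using ord[of m] that(1) by (simp add: S_def)
  qed simp
  have TS: "T (S n) = t - (U ^^ n) t" for n
  proof (induct n)
    case 0
    have "T 0 = 0" using rlin_diff[OF T, of 0 0] by simp
    moreover have "S 0 = 0" by (simp add: S_def)
    ultimately have "T (S 0) = t - (U ^^ 0) t" by simp
    then show ?case .
  next
    case (Suc n)
    then have IH: "T (S n) = t - (U ^^ n) t" .
    have "S (Suc n) = S n + (U ^^ n) t" by (simp add: S_def)
    then have "T (S (Suc n)) = T (S n) + T ((U ^^ n) t)" using T by (simp add: rlin_def)
    then have "T (S (Suc n)) = t - (U ^^ Suc n) t"
      unfolding IH using U_def[of "(U ^^ n) t"] by simp
    then show ?case .
  qed
  have "T s a = t a" for a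
  proof -
    define n where "n = Suc (idx_size a)"
    have d: "(s - S n) b = 0" if "idx_size b < n" for b
      using S[of b "Suc (idx_size b)" n] that by (simp add: s_def)
    \<comment> \<open>The limit differs from \<open>S n\<close> only in degrees above that of
      \<open>a\<close>, and by \<open>rlin_order\<close> this difference does not reach the
      coefficient of \<open>T s\<close> at \<open>a\<close>.\<close>
    have "U (s - S n) a = 0"
      by (rule rlin_order[OF U U0, of n]) (use d in \<open>auto simp: n_def\<close>)
    then have "T (s - S n) a = 0" using d[of a] by (simp add: U_def n_def)
    then have "T s a = T (S n) a" by (simp add: rlin_diff[OF T])
    also have "\<dots> = t a" using ord[of n] by (simp add: TS n_def)
    finally show ?thesis .
  qed
  then show ?thesis by (auto simp: fun_eq_iff)
qed

end

section \<open>The Lie algebra action of the standard connection\<close>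

context fl_rep begin

interpretation std: series_conn sc std_conn
  by unfold_locales (rule conn_std_conn)

text \<open>\<open>FL_ge2_induct\<close> with one computation per case: the curvature for two
  variables, the covariant derivative of endomorphisms for a variable against \<open>y\<close>, and
  the representation property inside the subalgebra.\<close>

lemma lie_act_std_conn:
  assumes "y \<in> FL_ge2"
  shows "lie_act ssc std_conn y s = app (op_series y) s"
proof -
  have ord: "lie_act ssc std_conn (fl_bracket (fl_var i) (fl_var j)) s
      = app (op_series (fl_bracket (fl_var i) (fl_var j))) s" if "var_ord i < var_ord j" for i j s
  proof
    fix e
    show "lie_act ssc std_conn (fl_bracket (fl_var i) (fl_var j)) s e
      = app (op_series (fl_bracket (fl_var i) (fl_var j))) s e"
      using op_series_var_var_at[OF that, of s e]
      by (simp add: std.L.lie_act_bracket std.L.lie_act_axis fl_ad_def std_conn_def pd_add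
          pd_app[OF linear_gauge] app_add_right[OF linear_gauge] pd_commute[OF VS, of i j])
  qed
  have m: "ssc (- 1) t = - t" for t :: "('n \<Rightarrow> nat) \<Rightarrow> 'v" by (simp add: ssc_def fun_eq_iff)
  show ?thesis using assms
  proof (induct arbitrary: s rule: FL_ge2_induct)
    case zero
    then show ?case by (simp add: std.L.lie_act_zero op_series_zero zero_fun_def)
  next
    case (add x y)
    then show ?case by (simp add: std.L.lie_act_plus op_series_add)
  next
    case (scale c x)
    then show ?case by (simp add: std.L.lie_act_fl_scale op_series_scale)
  next
    case (var_var i j)
    consider "var_ord i < var_ord j" | "i = j" | "var_ord j < var_ord i"
      using var_ord_eq[of i j] by linarith
    then show ?case
    proof cases
      case 1 then show ?thesis by (rule ord)
    next
      case 2 then show ?thesis by (simp add: fl_bracket_self std.L.lie_act_zero op_series_zero zero_fun_def)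
    next
      \<comment> \<open>The curvature formula is available for ordered pairs; antisymmetry gives the
        reversed pair.\<close>
      case 3
      have "fl_bracket (fl_var i) (fl_var j) = fl_scale (- 1) (fl_bracket (fl_var j) (fl_var i :: ('k, 'n) free_lie))"
        by (subst fl_bracket_anti) (simp only: uminus_free_lie_def)
      then show ?thesis
        by (simp only: std.L.lie_act_fl_scale op_series_scale[OF FL_ge2_var_var] ord[OF 3])
    qed
  next
    case (var i y)
    show ?case
    proof
      fix e
      show "lie_act ssc std_conn (fl_bracket (fl_var i) y) s e = app (op_series (fl_bracket (fl_var i) y)) s e"
        using op_series_var_at[OF var(1), of i s e] linear_op_series[OF var(1)]
        by (simp add: std.L.lie_act_bracket std.L.lie_act_axis var fl_ad_def std_conn_def
            pd_app app_add_right[unfolded plus_fun_def])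
    qed
  next
    case (bracket x y)
    then show ?case by (simp add: std.L.lie_act_bracket op_series_bracket)
  qed
qed

lemma lie_act_std_conn_0: "y \<in> FL_ge2 \<Longrightarrow> lie_act ssc std_conn y s idx0 = \<rho> y (s idx0)"
  by (simp add: lie_act_std_conn conv_0 op_series_0)

end

section \<open>The fibre representation and the Taylor map\<close>

context series_conn begin

text \<open>Each expression acts as a derivation over its own action on power series: for
  commutators the mixed terms cancel. In degree at least two the action on power series is zero, and
  what remains is linearity.\<close>

lemma lie_eval_leibniz:
  "lie_eval ssc D t (smul f s) = smul (lie_eval mps_scale mps_deriv t f) s + smul f (lie_eval ssc D t s)"
proof (induct t arbitrary: f s)
  case (Gen v)
  have 1: "smul (\<Sum>i\<in>I. g i) s = (\<Sum>i\<in>I. smul (g i) s)" for g and I :: "'n set"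
    by (rule additive_sum[where U = "\<lambda>f. smul f s"]) (rule smul_add_left)
  have 2: "smul f (\<Sum>i\<in>I. g i) = (\<Sum>i\<in>I. smul f (g i))" for g and I :: "'n set"
    by (rule additive_sum[where U = "smul f"]) (rule smul_add_right)
  show ?case by (simp add: D_smul ssc_add 1 2 sum.distrib smul_mps_scale smul_ssc)
next
  case Zero
  have "lie_eval ssc D Zero (smul f s) = smul 0 s + smul f 0"
    unfolding smul_zero_left smul_zero_right by (simp add: zero_fun_def)
  then show ?case by (simp add: zero_fun_def)
next
  case (Add t1 t2)
  show ?case by (simp only: lie_eval.simps Add smul_add_left smul_add_right ac_simps)
next
  case (Scale c t)
  show ?case by (simp only: lie_eval.simps Scale smul_mps_scale smul_ssc ssc_add)
next
  case (Brk t1 t2)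
  have dl: "smul (g - h) s = smul g s - smul h s" for g h s
    using smul_add_left[of "g - h" h s] by (simp add: algebra_simps)
  show ?case
    by (simp only: lie_eval.simps Brk L.lie_eval_add dl smul_diff)
       (simp add: fun_eq_iff diff_add_eq diff_diff_eq2 diff_diff_eq add_diff_eq add_ac eq_diff_eq diff_eq_eq)
qed

lemma rlin_lie_act: "x \<in> FL_ge2 \<Longrightarrow> rlin (lie_act ssc D x)"
  using lie_eval_leibniz[of "rep_free_lie x"] mps_lie_FL_ge2[of x]
  by (simp add: rlin_def L.lie_act_add) (simp add: lie_act_def smul_zero_left)

text \<open>Evaluated on constant sections; by linearity over the power series (\<open>rlin_lie_act\<close>) the choice of
  section with the given value at the origin does not matter.\<close>

definition fibre :: "('k, 'n) free_lie \<Rightarrow> 'v \<Rightarrow> 'v" where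
  "fibre x v = lie_act ssc D x (cst v) idx0"

lemma lie_act_idx0: "x \<in> FL_ge2 \<Longrightarrow> lie_act ssc D x s idx0 = fibre x (s idx0)"
  unfolding fibre_def by (rule rlin_idx0[OF rlin_lie_act])

lemma linear_fibre: "Vector_Spaces.linear sc sc (fibre x)"
  unfolding Vector_Spaces.linear_iff using VS
  by (simp add: fibre_def cst_add cst_scale L.lie_act_add L.lie_act_scale) (simp add: ssc_def)

text \<open>By \<open>lie_act_idx0\<close> the outer operator sees only the value of the inner
  result at the origin, which turns a commutator of operators on sections into a commutator on the
  fibre.\<close>

sublocale F: fl_rep sc fibre
proof (intro fl_rep.intro series_space_axioms fl_rep_axioms.intro linear_fibre)
  fix x y :: "('k, 'n) free_lie" and v c
  show "fibre (x + y) v = fibre x v + fibre y v"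
    by (simp add: fibre_def L.lie_act_plus)
  show "fibre (fl_scale c x) v = sc c (fibre x v)"
    by (simp add: fibre_def L.lie_act_fl_scale) (simp add: ssc_def)
  assume "x \<in> FL_ge2" "y \<in> FL_ge2"
  then show "fibre (fl_bracket x y) v = fibre x (fibre y v) - fibre y (fibre x v)"
    by (simp add: fibre_def[of "fl_bracket x y"] L.lie_act_bracket lie_act_idx0 cst_0)
qed

text \<open>The isomorphism onto the standard connection of the fibre (\<open>taylor_D\<close>).\<close>

definition taylor :: "(('n \<Rightarrow> nat) \<Rightarrow> 'v) \<Rightarrow> ('n \<Rightarrow> nat) \<Rightarrow> 'v" where
  "taylor s a = sc (1 / idx_fact a) (ord_pow D a s idx0)"

lemma taylor_add: "taylor (s + t) = taylor s + taylor t"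
  by (simp add: fun_eq_iff taylor_def ord_pow_add[of D, OF D_add] scale_right_distrib)

lemma taylor_0: "taylor s idx0 = s idx0"
  by (simp add: taylor_def ord_pow.simps idx_fact_0)

lemma pd_taylor: "e \<in> tail_idx k \<Longrightarrow> pd sc k (taylor s) e = taylor (D k s) e"
  by (simp add: pd_def taylor_def ord_pow.simps idx_fact_inc del: of_nat_Suc)

lemma D_act: "D k (lie_act ssc D y s) = lie_act ssc D (fl_ad k y) s + lie_act ssc D y (D k s)"
  by (simp add: fl_ad_def L.lie_act_bracket L.lie_act_axis)

text \<open>\<open>D_act\<close> moves \<open>D_k\<close> past the action of \<open>y\<close> at the
  price of \<open>[e_k, y]\<close>, just as \<open>op_series y\<close> is differentiated along
  \<open>x_k\<close>. The case at the origin is \<open>lie_act_idx0\<close>.\<close>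

lemma taylor_act:
  assumes "y \<in> FL_ge2"
  shows "taylor (lie_act ssc D y s) e = app (F.op_series y) (taylor s) e"
  using assms
proof (induct e arbitrary: y s rule: idx_induct)
  case zero
  then show ?case by (simp add: conv_0 taylor_0 F.op_series_0 lie_act_idx0)
next
  case (inc k e)
  have "app (F.op_series y) (pd sc k (taylor s)) e = app (F.op_series y) (taylor (D k s)) e"
    using pd_taylor by (intro conv_tail_cong[OF inc(1)]) auto
  then have "pd sc k (taylor (lie_act ssc D y s)) e = pd sc k (app (F.op_series y) (taylor s)) e"
    by (simp add: pd_taylor[OF inc(1)] D_act taylor_add inc(2) inc(3) fl_ad_FL
        pd_app_tail[OF F.tail_deriv_op_series[OF inc(3)] inc(1)])
  then show ?case by (rule pd_eqD)
qed

text \<open>At an exponent in \<open>tail_idx j\<close>, \<open>D_j\<close> is the next factor of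
  the ordered monomial and the gauge contributes nothing. Otherwise, moving \<open>D_j\<close> past
  an earlier \<open>D_k\<close> produces the action of \<open>[e_k, e_j]\<close>, which is matched
  by the derivative of \<open>A_j\<close> along \<open>x_k\<close>.\<close>

lemma taylor_D: "taylor (D j s) e = F.std_conn j (taylor s) e"
proof -
  have direct: "taylor (D j s) e = F.std_conn j (taylor s) e" if "e \<in> tail_idx j" for s e
    by (simp add: F.std_conn_def pd_taylor that F.app_gauge_tail)
  show ?thesis
  proof (induct e arbitrary: s rule: idx_induct)
    case zero
    then show ?case using direct idx0_tail by blast
  next
    case (inc k e)
    show ?case
    proof (cases "var_ord j \<le> var_ord k")
      case True
      then have "inc k e \<in> tail_idx j" using inc_tail[OF inc(1), of k] tail_mono by blast
      then show ?thesis using direct by blast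
    next
      case False
      then have kj: "var_ord k < var_ord j" by simp
      have 1: "app (F.gauge j) (pd sc k (taylor s)) e = app (F.gauge j) (taylor (D k s)) e"
        using pd_taylor by (intro conv_tail_cong[OF inc(1)]) auto
      have "pd sc j (pd sc k (taylor s)) e = pd sc j (taylor (D k s)) e"
        using pd_taylor[OF inc_tail[OF inc(1), of j]] kj by (simp add: pd_def[of sc j])
      then have 2: "pd sc k (pd sc j (taylor s)) e = pd sc j (taylor (D k s)) e"
        by (simp add: pd_commute[OF VS])
      have 3: "D k (D j s) = lie_act ssc D (fl_ad k (fl_var j)) s + D j (D k s)"
        using D_act[of k "fl_var j" s] by (simp add: L.lie_act_axis)
      have "pd sc k (taylor (D j s)) e = pd sc k (F.std_conn j (taylor s)) e"
        by (simp add: pd_taylor[OF inc(1)] 3 taylor_add taylor_act fl_ad_var_FL F.std_conn_def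
            pd_add pd_app_tail[OF F.tail_deriv_gauge[OF kj] inc(1)] 1 2 inc(2))
      then show ?thesis by (rule pd_eqD)
    qed
  qed
qed

text \<open>The ordered derivatives are not linear over the power series, but they obey Leibniz one
  factor at a time, exactly as partial derivatives do. Linearity of the Taylor map is what brings
  \<open>rlin_surj\<close> and \<open>rlin_inj\<close> to bear on it.\<close>

lemma taylor_smul: "taylor (smul f s) = smul f (taylor s)"
proof
  fix e
  show "taylor (smul f s) e = smul f (taylor s) e"
  proof (induct e arbitrary: f s rule: idx_induct)
    case zero
    then show ?case by (simp add: smul_0 taylor_0)
  next
    case (inc k e)
    have "smul f (pd sc k (taylor s)) e = smul f (taylor (D k s)) e"
      unfolding smul_def using pd_taylor by (intro conv_tail_cong[OF inc(1)]) auto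
    then have "pd sc k (taylor (smul f s)) e = pd sc k (smul f (taylor s)) e"
      by (simp add: pd_taylor[OF inc(1)] D_smul taylor_add inc(2) pd_smul)
    then show ?case by (rule pd_eqD)
  qed
qed

lemma rlin_taylor: "rlin taylor"
  by (simp add: rlin_def taylor_add taylor_smul)

lemma taylor_surj: "\<exists>s. taylor s = t"
  by (rule rlin_surj[OF rlin_taylor taylor_0])

lemma taylor_inj: "taylor s = taylor t \<Longrightarrow> s = t"
  using rlin_inj[of taylor "s - t", OF rlin_taylor taylor_0] rlin_diff[OF rlin_taylor, of s t] by simp

end

section \<open>Finite free modules in coordinates\<close>

lemma scalar_ring_simps [simp]:
  "carrier (ring_of_type_algebra :: 'r::comm_ring_1 ring) = UNIV"
  "x \<otimes>\<^bsub>(ring_of_type_algebra :: 'r ring)\<^esub> y = x * y"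
  "x \<oplus>\<^bsub>(ring_of_type_algebra :: 'r ring)\<^esub> y = x + y"
  "\<one>\<^bsub>(ring_of_type_algebra :: 'r ring)\<^esub> = 1"
  "\<zero>\<^bsub>(ring_of_type_algebra :: 'r ring)\<^esub> = 0"
  by (simp_all add: ring_of_type_algebra_def)

lemma is_moduleI:
  fixes M :: "('r::comm_ring_1, 'u) module" (structure)
  assumes "\<And>x y. x \<in> carrier M \<Longrightarrow> y \<in> carrier M \<Longrightarrow> x \<oplus> y \<in> carrier M"
    and "\<zero> \<in> carrier M"
    and "\<And>x y z. x \<in> carrier M \<Longrightarrow> y \<in> carrier M \<Longrightarrow> z \<in> carrier M \<Longrightarrow> (x \<oplus> y) \<oplus> z = x \<oplus> (y \<oplus> z)"
    and "\<And>x y. x \<in> carrier M \<Longrightarrow> y \<in> carrier M \<Longrightarrow> x \<oplus> y = y \<oplus> x"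
    and "\<And>x. x \<in> carrier M \<Longrightarrow> \<zero> \<oplus> x = x"
    and "\<And>r x. x \<in> carrier M \<Longrightarrow> r \<odot>\<^bsub>M\<^esub> x \<in> carrier M"
    and "\<And>x. x \<in> carrier M \<Longrightarrow> (- 1) \<odot>\<^bsub>M\<^esub> x \<oplus> x = \<zero>"
    and "\<And>r s x. x \<in> carrier M \<Longrightarrow> (r + s) \<odot>\<^bsub>M\<^esub> x = r \<odot>\<^bsub>M\<^esub> x \<oplus> s \<odot>\<^bsub>M\<^esub> x"
    and "\<And>r x y. x \<in> carrier M \<Longrightarrow> y \<in> carrier M \<Longrightarrow> r \<odot>\<^bsub>M\<^esub> (x \<oplus> y) = r \<odot>\<^bsub>M\<^esub> x \<oplus> r \<odot>\<^bsub>M\<^esub> y"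
    and "\<And>r s x. x \<in> carrier M \<Longrightarrow> (r * s) \<odot>\<^bsub>M\<^esub> x = r \<odot>\<^bsub>M\<^esub> (s \<odot>\<^bsub>M\<^esub> x)"
    and "\<And>x. x \<in> carrier M \<Longrightarrow> 1 \<odot>\<^bsub>M\<^esub> x = x"
  shows "is_module M"
  unfolding is_module_def
proof (rule moduleI)
  show "cring (ring_of_type_algebra :: 'r ring)" by (rule cring_from_type_algebra)
  show "abelian_group M"
    by (rule abelian_groupI) (use assms in \<open>auto\<close>, metis)
qed (use assms in auto)

locale umod =
  fixes M :: "('r::comm_ring_1, 'u) module" (structure)
  assumes is_module: "is_module M"
begin

lemma module_axioms': "Module.module (ring_of_type_algebra :: 'r ring) M"
  using is_module by (simp add: is_module_def)

sublocale abelian_group M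
  using module_axioms' by (simp add: Module.module_def)

lemma smult_closed [simp]: "x \<in> carrier M \<Longrightarrow> r \<odot>\<^bsub>M\<^esub> x \<in> carrier M"
  using module.smult_closed[OF module_axioms', of r x] by simp
lemma smult_l_distr: "x \<in> carrier M \<Longrightarrow> (r + s) \<odot>\<^bsub>M\<^esub> x = r \<odot>\<^bsub>M\<^esub> x \<oplus> s \<odot>\<^bsub>M\<^esub> x"
  using module.smult_l_distr[OF module_axioms', of r s x] by simp
lemma smult_r_distr: "x \<in> carrier M \<Longrightarrow> y \<in> carrier M \<Longrightarrow> r \<odot>\<^bsub>M\<^esub> (x \<oplus> y) = r \<odot>\<^bsub>M\<^esub> x \<oplus> r \<odot>\<^bsub>M\<^esub> y"
  using module.smult_r_distr[OF module_axioms', of r x y] by simp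
lemma smult_assoc: "x \<in> carrier M \<Longrightarrow> r \<odot>\<^bsub>M\<^esub> (s \<odot>\<^bsub>M\<^esub> x) = (r * s) \<odot>\<^bsub>M\<^esub> x"
  using module.smult_assoc1[OF module_axioms', of r s x] by simp
lemma smult_one [simp]: "x \<in> carrier M \<Longrightarrow> 1 \<odot>\<^bsub>M\<^esub> x = x"
  using module.smult_one[OF module_axioms', of x] by simp
lemma smult_l_null [simp]: "x \<in> carrier M \<Longrightarrow> 0 \<odot>\<^bsub>M\<^esub> x = \<zero>"
  using module.smult_l_null[OF module_axioms', of x] by simp
lemma smult_r_null [simp]: "r \<odot>\<^bsub>M\<^esub> \<zero> = \<zero>"
  using module.smult_r_null[OF module_axioms', of r] by simp
lemma minus_eq_smult: "x \<in> carrier M \<Longrightarrow> \<ominus> x = (- 1) \<odot>\<^bsub>M\<^esub> x"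
proof -
  assume x: "x \<in> carrier M"
  have "(- 1) \<odot>\<^bsub>M\<^esub> x \<oplus> x = \<zero>" using smult_l_distr[OF x, of "- 1" 1] x by simp
  then show ?thesis using x minus_equality[of "(- 1) \<odot>\<^bsub>M\<^esub> x" x] by simp
qed

end

lemma finite_free_is_module: "finite_free M \<Longrightarrow> is_module M"
  by (simp add: finite_free_def)

lemma is_linearD:
  assumes "is_linear M N f"
  shows "x \<in> carrier M \<Longrightarrow> f x \<in> carrier N"
    "x \<in> carrier M \<Longrightarrow> y \<in> carrier M \<Longrightarrow> f (x \<oplus>\<^bsub>M\<^esub> y) = f x \<oplus>\<^bsub>N\<^esub> f y"
    "x \<in> carrier M \<Longrightarrow> f (r \<odot>\<^bsub>M\<^esub> x) = r \<odot>\<^bsub>N\<^esub> f x"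
  using assms by (auto simp: is_linear_def is_additive_def)

lemma is_linearI:
  assumes "\<And>x. x \<in> carrier M \<Longrightarrow> f x \<in> carrier N"
    "\<And>x y. x \<in> carrier M \<Longrightarrow> y \<in> carrier M \<Longrightarrow> f (x \<oplus>\<^bsub>M\<^esub> y) = f x \<oplus>\<^bsub>N\<^esub> f y"
    "\<And>r x. x \<in> carrier M \<Longrightarrow> f (r \<odot>\<^bsub>M\<^esub> x) = r \<odot>\<^bsub>N\<^esub> f x"
  shows "is_linear M N f"
  using assms by (auto simp: is_linear_def is_additive_def)

lemma linear_mapsI: "is_linear M N f \<Longrightarrow> f \<in> extensional (carrier M) \<Longrightarrow> f \<in> linear_maps M N"
  by (simp add: linear_maps_def)

lemma linear_mapsD: "f \<in> linear_maps M N \<Longrightarrow> is_linear M N f" "f \<in> linear_maps M N \<Longrightarrow> f \<in> extensional (carrier M)"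
  by (simp_all add: linear_maps_def)

lemma is_linear_restrict:
  assumes "is_module M" "is_linear M N f" shows "restrict f (carrier M) \<in> linear_maps M N"
proof -
  interpret umod M by unfold_locales fact
  show ?thesis using assms(2) by (intro linear_mapsI is_linearI) (auto simp: is_linearD)
qed

lemma linear_maps_eqI:
  assumes "f \<in> linear_maps M N" "g \<in> linear_maps M N'" "\<And>x. x \<in> carrier M \<Longrightarrow> f x = g x"
  shows "f = g"
  by (rule extensionalityI[OF linear_mapsD(2)[OF assms(1)] linear_mapsD(2)[OF assms(2)] assms(3)])

lemma is_linear_zero:
  assumes "is_module M" "is_module N" "is_linear M N f" shows "f \<zero>\<^bsub>M\<^esub> = \<zero>\<^bsub>N\<^esub>"
proof -
  interpret M: umod M by unfold_locales fact
  interpret N: umod N by unfold_locales fact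
  show ?thesis
    using is_linearD(3)[OF assms(3), of "\<zero>\<^bsub>M\<^esub>" 0] is_linearD(1)[OF assms(3), of "\<zero>\<^bsub>M\<^esub>"]
    by simp
qed

section \<open>Coordinates on finite free modules\<close>

definition supp_on :: "'b set \<Rightarrow> ('b \<Rightarrow> 'r::zero) set" where
  "supp_on B = {f. \<forall>b. b \<notin> B \<longrightarrow> f b = 0}"

text \<open>An isomorphism with \<open>R^B\<close> in place of a basis inside the carrier. The index
  set may have any type, so that it can be a product for tensor products and an initial segment of
  the naturals for bundles.\<close>

definition coords :: "('r::comm_ring_1, 'u) module \<Rightarrow> 'b set \<Rightarrow> ('u \<Rightarrow> 'b \<Rightarrow> 'r) \<Rightarrow> bool" where
  "coords M B \<gamma> \<longleftrightarrow> finite B \<and> bij_betw \<gamma> (carrier M) (supp_on B) \<and>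
     (\<forall>x \<in> carrier M. \<forall>y \<in> carrier M. \<gamma> (x \<oplus>\<^bsub>M\<^esub> y) = (\<lambda>b. \<gamma> x b + \<gamma> y b)) \<and>
     (\<forall>r. \<forall>x \<in> carrier M. \<gamma> (r \<odot>\<^bsub>M\<^esub> x) = (\<lambda>b. r * \<gamma> x b))"

definition basis_vec :: "('r::comm_ring_1, 'u) module \<Rightarrow> ('u \<Rightarrow> 'b \<Rightarrow> 'r) \<Rightarrow> 'b \<Rightarrow> 'u" where
  "basis_vec M \<gamma> b = inv_into (carrier M) \<gamma> (\<lambda>b'. if b' = b then 1 else 0)"

lemma coordsD:
  assumes "coords M B \<gamma>"
  shows "finite B" "x \<in> carrier M \<Longrightarrow> b \<notin> B \<Longrightarrow> \<gamma> x b = 0"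
    "x \<in> carrier M \<Longrightarrow> y \<in> carrier M \<Longrightarrow> \<gamma> (x \<oplus>\<^bsub>M\<^esub> y) b = \<gamma> x b + \<gamma> y b"
    "x \<in> carrier M \<Longrightarrow> \<gamma> (r \<odot>\<^bsub>M\<^esub> x) b = r * \<gamma> x b"
    "x \<in> carrier M \<Longrightarrow> y \<in> carrier M \<Longrightarrow> (\<And>b. \<gamma> x b = \<gamma> y b) \<Longrightarrow> x = y"
    "f \<in> supp_on B \<Longrightarrow> \<exists>x\<in>carrier M. \<gamma> x = f"
proof -
  show "x = y" if "x \<in> carrier M" "y \<in> carrier M" "\<And>b. \<gamma> x b = \<gamma> y b"
  proof -
    have "\<gamma> x = \<gamma> y" using that(3) by (rule ext)
    then show ?thesis using assms that by (auto simp: coords_def bij_betw_def inj_on_def)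
  qed
  show "\<exists>x\<in>carrier M. \<gamma> x = f" if "f \<in> supp_on B"
    using assms that by (force simp: coords_def bij_betw_def)
qed (use assms in \<open>auto simp: coords_def bij_betw_def supp_on_def\<close>)

lemma basis_vec:
  assumes "coords M B \<gamma>" "b \<in> B"
  shows "basis_vec M \<gamma> b \<in> carrier M" "\<gamma> (basis_vec M \<gamma> b) = (\<lambda>b'. if b' = b then 1 else 0)"
proof -
  have "(\<lambda>b'. if b' = b then 1 else 0) \<in> \<gamma> ` carrier M"
    using assms by (auto simp: coords_def bij_betw_def supp_on_def)
  then show "basis_vec M \<gamma> b \<in> carrier M" "\<gamma> (basis_vec M \<gamma> b) = (\<lambda>b'. if b' = b then 1 else 0)"
    unfolding basis_vec_def by (auto intro: inv_into_into f_inv_into_f)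
qed

lemma coords_zero:
  assumes "is_module M" "coords M B \<gamma>" shows "\<gamma> \<zero>\<^bsub>M\<^esub> b = 0"
proof -
  interpret umod M by unfold_locales fact
  show ?thesis using coordsD(4)[OF assms(2), of "\<zero>\<^bsub>M\<^esub>" 0 b] by simp
qed

lemma coords_finsum:
  assumes "is_module M" "coords M B \<gamma>" "finite I" "f \<in> I \<rightarrow> carrier M"
  shows "\<gamma> (\<Oplus>\<^bsub>M\<^esub>i\<in>I. f i) b = (\<Sum>i\<in>I. \<gamma> (f i) b)"
proof -
  interpret umod M by unfold_locales fact
  show ?thesis using assms(3,4)
    by (induct I) (auto simp: coords_zero[OF assms(1,2)] finsum_insert coordsD(3)[OF assms(2)] Pi_def)
qed

lemma coords_induct:
  assumes M: "is_module M" and c: "coords M B \<gamma>"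
    and z: "P \<zero>\<^bsub>M\<^esub>"
    and a: "\<And>x y. x \<in> carrier M \<Longrightarrow> y \<in> carrier M \<Longrightarrow> P x \<Longrightarrow> P y \<Longrightarrow> P (x \<oplus>\<^bsub>M\<^esub> y)"
    and b: "\<And>r b. b \<in> B \<Longrightarrow> P (r \<odot>\<^bsub>M\<^esub> basis_vec M \<gamma> b)"
    and x: "x \<in> carrier M"
  shows "P x"
proof -
  interpret umod M by unfold_locales fact
  have "P x" if "finite B'" "B' \<subseteq> B" "x \<in> carrier M" "\<And>b. b \<notin> B' \<Longrightarrow> \<gamma> x b = 0" for B' x
    using that
  proof (induct B' arbitrary: x)
    case empty
    then have "x = \<zero>\<^bsub>M\<^esub>" by (intro coordsD(5)[OF c]) (auto simp: coords_zero[OF M c])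
    then show ?case using z by simp
  next
    case (insert b' B')
    define e where "e = basis_vec M \<gamma> b'"
    have e: "e \<in> carrier M" "\<gamma> e = (\<lambda>b''. if b'' = b' then 1 else 0)"
      using basis_vec[OF c, of b'] insert by (auto simp: e_def)
    \<comment> \<open>Subtracting the component of \<open>x\<close> at \<open>b'\<close> shrinks its
      support to \<open>B'\<close>.\<close>
    define y where "y = x \<oplus>\<^bsub>M\<^esub> (- \<gamma> x b') \<odot>\<^bsub>M\<^esub> e"
    have y: "y \<in> carrier M" using e insert by (simp add: y_def)
    have "P y"
      using insert e y by (intro insert(3)) (auto simp: y_def coordsD[OF c])
    moreover have "P (\<gamma> x b' \<odot>\<^bsub>M\<^esub> e)" unfolding e_def using insert by (intro b) auto
    ultimately have "P (y \<oplus>\<^bsub>M\<^esub> \<gamma> x b' \<odot>\<^bsub>M\<^esub> e)" using y e by (intro a) auto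
    also have "y \<oplus>\<^bsub>M\<^esub> \<gamma> x b' \<odot>\<^bsub>M\<^esub> e = x"
      using insert e y by (intro coordsD(5)[OF c]) (auto simp: y_def coordsD[OF c])
    finally show ?case .
  qed
  then show ?thesis using x coordsD(1,2)[OF c] by blast
qed

lemma coords_extend:
  fixes M :: "('r::comm_ring_1, 'u) module" and P :: "('r, 'w) module"
  assumes P: "is_module P" and c: "coords M B \<gamma>" and p: "\<And>b. b \<in> B \<Longrightarrow> p b \<in> carrier P"
  shows "\<exists>h. is_linear M P h \<and> (\<forall>b\<in>B. h (basis_vec M \<gamma> b) = p b)"
proof -
  interpret P: umod P by unfold_locales fact
  define h where "h x = (\<Oplus>\<^bsub>P\<^esub>b\<in>B. \<gamma> x b \<odot>\<^bsub>P\<^esub> p b)" for x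
  have "is_linear M P h"
  proof (rule is_linearI)
    show "h x \<in> carrier P" for x unfolding h_def by (rule P.finsum_closed) (auto simp: p)
    fix x y assume x: "x \<in> carrier M"
    show "h (x \<oplus>\<^bsub>M\<^esub> y) = h x \<oplus>\<^bsub>P\<^esub> h y" if y: "y \<in> carrier M"
    proof -
      have "h (x \<oplus>\<^bsub>M\<^esub> y) = (\<Oplus>\<^bsub>P\<^esub>b\<in>B. \<gamma> x b \<odot>\<^bsub>P\<^esub> p b \<oplus>\<^bsub>P\<^esub> \<gamma> y b \<odot>\<^bsub>P\<^esub> p b)"
        unfolding h_def using x y
        by (intro P.finsum_cong') (auto simp: p coordsD(3)[OF c] P.smult_l_distr)
      also have "\<dots> = h x \<oplus>\<^bsub>P\<^esub> h y"
        unfolding h_def by (rule P.finsum_addf) (auto simp: p)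
      finally show ?thesis .
    qed
    fix r
    have "h (r \<odot>\<^bsub>M\<^esub> x) = (\<Oplus>\<^bsub>P\<^esub>b\<in>B. r \<odot>\<^bsub>P\<^esub> (\<gamma> x b \<odot>\<^bsub>P\<^esub> p b))"
      unfolding h_def using x
      by (intro P.finsum_cong') (auto simp: p coordsD(4)[OF c] P.smult_assoc)
    also have "\<dots> = r \<odot>\<^bsub>P\<^esub> h x"
      unfolding h_def
      using module.finsum_smult_ldistr[OF P.module_axioms', of B r "\<lambda>b. \<gamma> x b \<odot>\<^bsub>P\<^esub> p b"] coordsD(1)[OF c]
      by (simp add: p Pi_def)
    finally show "h (r \<odot>\<^bsub>M\<^esub> x) = r \<odot>\<^bsub>P\<^esub> h x" .
  qed
  moreover have "h (basis_vec M \<gamma> b) = p b" if "b \<in> B" for b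
  proof -
    have "h (basis_vec M \<gamma> b) = (\<Oplus>\<^bsub>P\<^esub>b'\<in>B. if b = b' then p b' else \<zero>\<^bsub>P\<^esub>)"
      unfolding h_def basis_vec(2)[OF c that]
      by (intro P.finsum_cong') (auto simp: p)
    also have "\<dots> = p b"
      using P.finsum_singleton[OF that coordsD(1)[OF c], of p] by (simp add: p Pi_def)
    finally show ?thesis .
  qed
  ultimately show ?thesis by blast
qed

lemma finite_free_coords:
  assumes "finite_free (M :: ('r::comm_ring_1, 'u) module)"
  shows "\<exists>(B :: 'u set) \<gamma>. coords M B \<gamma>"
proof -
  interpret umod M by unfold_locales (rule finite_free_is_module[OF assms])
  obtain B where B: "is_finite_basis M B" using assms by (auto simp: finite_free_def)
  then have fin: "finite B" and BM: "B \<subseteq> carrier M"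
    and ex: "\<And>x. x \<in> carrier M \<Longrightarrow> \<exists>!c. c \<in> extensional B \<and> x = (\<Oplus>\<^bsub>M\<^esub>b\<in>B. c b \<odot>\<^bsub>M\<^esub> b)"
    by (auto simp: is_finite_basis_def)
  \<comment> \<open>The coordinate map will be the inverse of \<open>comb\<close> on functions
    vanishing off \<open>B\<close>; these replace the extensional coefficient functions in the
    definition of a basis.\<close>
  define comb where "comb c = (\<Oplus>\<^bsub>M\<^esub>b\<in>B. c b \<odot>\<^bsub>M\<^esub> b)" for c :: "'u \<Rightarrow> 'r"
  have Bc: "b \<in> B \<Longrightarrow> b \<in> carrier M" for b using BM by auto
  have comb_closed: "comb c \<in> carrier M" for c
    unfolding comb_def by (rule finsum_closed) (auto simp: Bc)
  have comb_add: "comb (\<lambda>b. c b + d b) = comb c \<oplus>\<^bsub>M\<^esub> comb d" for c d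
  proof -
    have "comb (\<lambda>b. c b + d b) = (\<Oplus>\<^bsub>M\<^esub>b\<in>B. c b \<odot>\<^bsub>M\<^esub> b \<oplus>\<^bsub>M\<^esub> d b \<odot>\<^bsub>M\<^esub> b)"
      unfolding comb_def by (intro finsum_cong') (auto simp: Bc smult_l_distr)
    also have "\<dots> = comb c \<oplus>\<^bsub>M\<^esub> comb d"
      unfolding comb_def by (rule finsum_addf) (auto simp: Bc)
    finally show ?thesis .
  qed
  have comb_smult: "comb (\<lambda>b. r * c b) = r \<odot>\<^bsub>M\<^esub> comb c" for r c
  proof -
    have "comb (\<lambda>b. r * c b) = (\<Oplus>\<^bsub>M\<^esub>b\<in>B. r \<odot>\<^bsub>M\<^esub> (c b \<odot>\<^bsub>M\<^esub> b))"
      unfolding comb_def by (intro finsum_cong') (auto simp: Bc smult_assoc)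
    also have "\<dots> = r \<odot>\<^bsub>M\<^esub> comb c"
      unfolding comb_def
      using module.finsum_smult_ldistr[OF module_axioms', of B r "\<lambda>b. c b \<odot>\<^bsub>M\<^esub> b"] fin
      by (simp add: Bc Pi_def)
    finally show ?thesis .
  qed
  have comb_cong: "comb c = comb d" if "\<And>b. b \<in> B \<Longrightarrow> c b = d b" for c d
    unfolding comb_def using that by (intro finsum_cong') (auto simp: Bc)
  have inj: "inj_on comb (supp_on B)"
  proof (rule inj_onI)
    fix c d assume cd: "c \<in> supp_on B" "d \<in> supp_on B" "comb c = comb d"
    have "comb (restrict c B) = comb c" "comb (restrict d B) = comb d"
      by (rule comb_cong, simp)+
    then have "comb c = comb (restrict c B)" "comb c = comb (restrict d B)"
      using cd(3) by simp_all
    then have "restrict c B = restrict d B"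
      using ex[OF comb_closed[of c]] unfolding comb_def[symmetric]
      by (metis restrict_extensional)
    then have eq: "restrict c B b = restrict d B b" for b by simp
    show "c = d"
    proof
      fix b show "c b = d b" using eq[of b] cd(1,2) by (cases "b \<in> B") (auto simp: supp_on_def)
    qed
  qed
  have bij: "bij_betw comb (supp_on B) (carrier M)"
    unfolding bij_betw_def
  proof (intro conjI inj equalityI subsetI)
    show "x \<in> carrier M" if "x \<in> comb ` supp_on B" for x using that comb_closed by auto
    fix x assume "x \<in> carrier M"
    then obtain c where c: "x = comb c" using ex[of x] by (auto simp: comb_def)
    have "comb (\<lambda>b. if b \<in> B then c b else 0) = x" unfolding c by (rule comb_cong) simp
    moreover have "(\<lambda>b. if b \<in> B then c b else 0) \<in> supp_on B" by (simp add: supp_on_def)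
    ultimately show "x \<in> comb ` supp_on B" by force
  qed
  define \<gamma> where "\<gamma> = inv_into (supp_on B) comb"
  have \<gamma>bij: "bij_betw \<gamma> (carrier M) (supp_on B)" unfolding \<gamma>_def by (rule bij_betw_inv_into[OF bij])
  have g1: "\<gamma> x \<in> supp_on B" "comb (\<gamma> x) = x" if "x \<in> carrier M" for x
    using bij_betwE[OF \<gamma>bij] that bij_betw_inv_into_right[OF bij] by (auto simp: \<gamma>_def)
  have g2: "\<gamma> (comb c) = c" if "c \<in> supp_on B" for c
    using bij_betw_inv_into_left[OF bij that] by (simp add: \<gamma>_def)
  have "coords M B \<gamma>"
    unfolding coords_def
  proof (intro conjI ballI allI fin \<gamma>bij)
    fix x y assume x: "x \<in> carrier M"
    show "\<gamma> (x \<oplus>\<^bsub>M\<^esub> y) = (\<lambda>b. \<gamma> x b + \<gamma> y b)" if y: "y \<in> carrier M"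
      using g2[of "\<lambda>b. \<gamma> x b + \<gamma> y b"] g1[OF x] g1[OF y] by (simp add: comb_add supp_on_def)
    fix r
    show "\<gamma> (r \<odot>\<^bsub>M\<^esub> x) = (\<lambda>b. r * \<gamma> x b)"
      using g2[of "\<lambda>b. r * \<gamma> x b"] g1[OF x] by (simp add: comb_smult supp_on_def)
  qed
  then show ?thesis by blast
qed

lemma coords_reindex:
  fixes M :: "('r::comm_ring_1, 'u) module" and B' :: "'c set"
  assumes c: "coords M B \<gamma>" and h: "bij_betw h B' B"
  shows "coords M B' (\<lambda>x b. if b \<in> B' then \<gamma> x (h b) else 0)" (is "coords M B' ?g")
  unfolding coords_def
proof (intro conjI ballI allI)
  show "finite B'" using coordsD(1)[OF c] h by (simp add: bij_betw_finite)
  have inj: "inj_on ?g (carrier M)"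
  proof (rule inj_onI)
    fix x y assume xy: "x \<in> carrier M" "y \<in> carrier M" "?g x = ?g y"
    show "x = y"
    proof (rule coordsD(5)[OF c xy(1,2)])
      fix b
      show "\<gamma> x b = \<gamma> y b"
      proof (cases "b \<in> B")
        case True
        then obtain b' where "b' \<in> B'" "b = h b'" using h by (auto simp: bij_betw_def)
        then show ?thesis using fun_cong[OF xy(3), of b'] by simp
      qed (use xy coordsD(2)[OF c] in auto)
    qed
  qed
  have "?g ` carrier M = supp_on B'"
  proof (intro equalityI subsetI)
    fix f :: "'c \<Rightarrow> 'r" assume f: "f \<in> supp_on B'"
    define f' where "f' = (\<lambda>b. if b \<in> B then f (inv_into B' h b) else 0)"
    have "f' \<in> supp_on B" by (simp add: f'_def supp_on_def)
    then obtain x where x: "x \<in> carrier M" "\<gamma> x = f'" using coordsD(6)[OF c] by blast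
    have "?g x = f"
    proof
      fix b show "?g x b = f b"
        using x(2) f h bij_betw_inv_into_left[OF h] by (auto simp: f'_def supp_on_def bij_betw_def)
    qed
    then show "f \<in> ?g ` carrier M" using x(1) by blast
  qed (auto simp: supp_on_def)
  then show "bij_betw ?g (carrier M) (supp_on B')" using inj by (simp add: bij_betw_def)
qed (auto simp: coordsD[OF c] fun_eq_iff)

text \<open>With an initial segment of \<open>nat\<close> as index set, bundles of every rank are
  described by vectors of the one type \<open>nat \<Rightarrow> 'k\<close>.\<close>

lemma finite_free_nat_coords:
  assumes "finite_free (M :: ('r::comm_ring_1, 'u) module)"
  shows "\<exists>N \<gamma>. coords M {..<N::nat} \<gamma>"
proof -
  obtain B :: "'u set" and \<gamma> where c: "coords M B \<gamma>" using finite_free_coords[OF assms] by blast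
  obtain h where "bij_betw h {0..<card B} B" using ex_bij_betw_nat_finite[OF coordsD(1)[OF c]] by blast
  then show ?thesis using coords_reindex[OF c] by (auto simp: lessThan_atLeast0)
qed

text \<open>The unit vectors form the basis. They are distinct because \<open>0 \<noteq> 1\<close>,
  and the coordinates of a combination are its coefficients.\<close>

lemma coords_finite_free:
  assumes M: "is_module (M :: ('r::comm_ring_1, 'u) module)" and c: "coords M B \<gamma>"
  shows "finite_free M"
proof -
  interpret umod M by unfold_locales fact
  define e where "e = basis_vec M \<gamma>"
  have e: "e b \<in> carrier M" "\<gamma> (e b) = (\<lambda>b'. if b' = b then 1 else 0)" if "b \<in> B" for b
    using basis_vec[OF c that] by (auto simp: e_def)
  have einj: "inj_on e B"
  proof (rule inj_onI)
    fix a b assume ab: "a \<in> B" "b \<in> B" "e a = e b"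
    then have "(\<lambda>b'. if b' = a then 1 else 0) = (\<lambda>b'. if b' = b then 1 else (0::'r))" using e(2) by metis
    from fun_cong[OF this, of a] show "a = b" by (simp split: if_splits)
  qed
  have coef: "\<gamma> (\<Oplus>\<^bsub>M\<^esub>u\<in>e ` B. d u \<odot>\<^bsub>M\<^esub> u) b = (if b \<in> B then d (e b) else 0)" for d b
  proof -
    have "\<gamma> (\<Oplus>\<^bsub>M\<^esub>u\<in>e ` B. d u \<odot>\<^bsub>M\<^esub> u) b = (\<Sum>u\<in>e ` B. \<gamma> (d u \<odot>\<^bsub>M\<^esub> u) b)"
      using e coordsD(1)[OF c] by (intro coords_finsum[OF M c]) auto
    also have "\<dots> = (\<Sum>b'\<in>B. \<gamma> (d (e b') \<odot>\<^bsub>M\<^esub> e b') b)" by (simp add: sum.reindex[OF einj])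
    also have "\<dots> = (\<Sum>b'\<in>B. if b' = b then d (e b') else 0)"
      by (intro sum.cong) (auto simp: coordsD(4)[OF c] e)
    also have "\<dots> = (if b \<in> B then d (e b) else 0)" using coordsD(1)[OF c] by simp
    finally show ?thesis .
  qed
  have cl: "(\<Oplus>\<^bsub>M\<^esub>u\<in>e ` B. d u \<odot>\<^bsub>M\<^esub> u) \<in> carrier M" for d
    by (rule finsum_closed) (auto simp: e)
  have "is_finite_basis M (e ` B)"
    unfolding is_finite_basis_def
  proof (intro conjI ballI ex_ex1I)
    show "finite (e ` B)" "e ` B \<subseteq> carrier M" using coordsD(1)[OF c] e by auto
    fix x assume x: "x \<in> carrier M"
    define d where "d = restrict (\<lambda>u. \<gamma> x (inv_into B e u)) (e ` B)"
    have "x = (\<Oplus>\<^bsub>M\<^esub>u\<in>e ` B. d u \<odot>\<^bsub>M\<^esub> u)"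
      by (rule coordsD(5)[OF c x cl]) (auto simp: coef d_def einj coordsD(2)[OF c x])
    then show "\<exists>d. d \<in> extensional (e ` B) \<and> x = (\<Oplus>\<^bsub>M\<^esub>u\<in>e ` B. d u \<odot>\<^bsub>M\<^esub> u)"
      by (intro exI[of _ d]) (auto simp: d_def)
    fix d d' assume d: "d \<in> extensional (e ` B) \<and> x = (\<Oplus>\<^bsub>M\<^esub>u\<in>e ` B. d u \<odot>\<^bsub>M\<^esub> u)"
      "d' \<in> extensional (e ` B) \<and> x = (\<Oplus>\<^bsub>M\<^esub>u\<in>e ` B. d' u \<odot>\<^bsub>M\<^esub> u)"
    show "d = d'"
    proof (rule extensionalityI)
      fix u assume "u \<in> e ` B"
      then obtain b where "b \<in> B" "u = e b" by blast
      then show "d u = d' u" using coef[of d b] coef[of d' b] d by simp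
    qed (use d in auto)
  qed
  then show ?thesis using M by (auto simp: finite_free_def)
qed

text \<open>Since \<open>R\<close> is infinite, \<open>R \<times> R\<close> and hence every \<open>R ^ B\<close> embeds into a universe containing \<open>R\<close>.\<close>

lemma encode_exists:
  includes cardinal_syntax
  fixes \<iota> :: "'r::zero \<Rightarrow> 'u"
  assumes "inj \<iota>" "infinite (UNIV :: 'r set)" "finite B"
  shows "\<exists>enc :: ('b \<Rightarrow> 'r) \<Rightarrow> 'u. inj_on enc (supp_on B)"
proof -
  have "|UNIV \<times> UNIV :: ('r \<times> 'r) set| =o |UNIV :: 'r set|"
    by (rule card_of_Times_same_infinite[OF assms(2)])
  then obtain pr :: "'r \<times> 'r \<Rightarrow> 'r" where pr: "inj pr"
    by (auto simp: card_of_ordIso[symmetric] bij_betw_def)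
  have "\<exists>enc :: ('b \<Rightarrow> 'r) \<Rightarrow> 'r. inj_on enc (supp_on B)" using assms(3)
  proof (induct B)
    case empty
    show ?case by (rule exI[of _ "\<lambda>_. 0"]) (auto simp: inj_on_def supp_on_def fun_eq_iff)
  next
    case (insert b B)
    then obtain enc :: "('b \<Rightarrow> 'r) \<Rightarrow> 'r" where enc: "inj_on enc (supp_on B)" by blast
    \<comment> \<open>One coordinate is split off and paired with the code of the rest.\<close>
    have "inj_on (\<lambda>f. pr (f b, enc (f(b := 0)))) (supp_on (insert b B))"
    proof (rule inj_onI)
      fix f g :: "'b \<Rightarrow> 'r"
      assume fg: "f \<in> supp_on (insert b B)" "g \<in> supp_on (insert b B)"
        "pr (f b, enc (f(b := 0))) = pr (g b, enc (g(b := 0)))"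
      have "(f b, enc (f(b := 0))) = (g b, enc (g(b := 0)))" using pr fg(3) by (rule injD)
      then have 1: "f b = g b" and 2: "enc (f(b := 0)) = enc (g(b := 0))" by simp_all
      have "f(b := 0) \<in> supp_on B" "g(b := 0) \<in> supp_on B" using fg by (auto simp: supp_on_def)
      then have fg0: "f(b := 0) = g(b := 0)" using 2 enc unfolding inj_on_def by blast
      show "f = g"
      proof
        fix x show "f x = g x" using fun_cong[OF fg0, of x] 1 by (cases "x = b") auto
      qed
    qed
    then show ?case by blast
  qed
  then obtain enc :: "('b \<Rightarrow> 'r) \<Rightarrow> 'r" where "inj_on enc (supp_on B)" by blast
  then have "inj_on (\<iota> \<circ> enc) (supp_on B)"
    using assms(1) by (intro comp_inj_on) (auto intro: inj_on_subset)
  then show ?thesis by blast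
qed

text \<open>\<open>R^B\<close> transported along an encoding into the universe; the components
  \<open>mult\<close> and \<open>one\<close> of the record are fillers.\<close>

definition free_mod :: "(('b \<Rightarrow> 'r) \<Rightarrow> 'u) \<Rightarrow> 'b set \<Rightarrow> ('r::comm_ring_1, 'u) module" where
  "free_mod enc B = (let dec = inv_into (supp_on B) enc in
     \<lparr>carrier = enc ` supp_on B, monoid.mult = (\<lambda>x y. x), one = enc (\<lambda>_. 0),
      ring.zero = enc (\<lambda>_. 0), add = (\<lambda>x y. enc (\<lambda>b. dec x b + dec y b)),
      module.smult = (\<lambda>r x. enc (\<lambda>b. r * dec x b))\<rparr>)"

lemma free_mod:
  fixes enc :: "('b \<Rightarrow> 'r::comm_ring_1) \<Rightarrow> 'u"
  assumes inj: "inj_on enc (supp_on B)" and fin: "finite B"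
  shows "is_module (free_mod enc B)" "coords (free_mod enc B) B (inv_into (supp_on B) enc)"
    "carrier (free_mod enc B) = enc ` supp_on B"
proof -
  define dec where "dec = inv_into (supp_on B) enc"
  have F: "free_mod enc B = \<lparr>carrier = enc ` supp_on B, monoid.mult = (\<lambda>x y. x), one = enc (\<lambda>_. 0),
      ring.zero = enc (\<lambda>_. 0), add = (\<lambda>x y. enc (\<lambda>b. dec x b + dec y b)),
      module.smult = (\<lambda>r x. enc (\<lambda>b. r * dec x b))\<rparr>" by (simp add: free_mod_def Let_def dec_def)
  have dec: "f \<in> supp_on B \<Longrightarrow> dec (enc f) = f" for f
    unfolding dec_def using inj by simp
  have s: "(\<lambda>b. f b + g b) \<in> supp_on B" "(\<lambda>b. r * f b) \<in> supp_on B" "(\<lambda>b. - f b) \<in> supp_on B"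
    if "f \<in> supp_on B" "g \<in> supp_on B" for f g :: "'b \<Rightarrow> 'r" and r
    using that by (auto simp: supp_on_def)
  have z: "(\<lambda>b. 0 :: 'r) \<in> supp_on B" by (simp add: supp_on_def)
  show "is_module (free_mod enc B)"
    by (rule is_moduleI) (auto simp: F dec s z algebra_simps)
  show "carrier (free_mod enc B) = enc ` supp_on B" by (simp add: F)
  have "bij_betw dec (enc ` supp_on B) (supp_on B)"
    unfolding dec_def by (rule bij_betw_inv_into) (simp add: bij_betw_def inj)
  then show "coords (free_mod enc B) B (inv_into (supp_on B) enc)"
    unfolding dec_def[symmetric] by (auto simp: coords_def F dec s fin)
qed

section \<open>Tensor products of finite free modules\<close>

lemma is_bilinearD:
  assumes "is_bilinear M N P b"
  shows "x \<in> carrier M \<Longrightarrow> is_linear N P (b x)" "y \<in> carrier N \<Longrightarrow> is_linear M P (\<lambda>x. b x y)"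
  using assms by (auto simp: is_bilinear_def)

lemma is_linear_eq_on_basis:
  assumes "is_module M" "is_module P" "coords M B \<gamma>" "is_linear M P f" "is_linear M P g"
    "\<And>b. b \<in> B \<Longrightarrow> f (basis_vec M \<gamma> b) = g (basis_vec M \<gamma> b)" "x \<in> carrier M"
  shows "f x = g x"
  using assms(1,3) _ _ _ assms(7)
proof (rule coords_induct)
  show "f \<zero>\<^bsub>M\<^esub> = g \<zero>\<^bsub>M\<^esub>" using is_linear_zero[OF assms(1,2,4)] is_linear_zero[OF assms(1,2,5)] by simp
  show "f (x \<oplus>\<^bsub>M\<^esub> y) = g (x \<oplus>\<^bsub>M\<^esub> y)" if "x \<in> carrier M" "y \<in> carrier M" "f x = g x" "f y = g y" for x y
    using that by (simp add: is_linearD(2)[OF assms(4)] is_linearD(2)[OF assms(5)])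
  show "f (r \<odot>\<^bsub>M\<^esub> basis_vec M \<gamma> b) = g (r \<odot>\<^bsub>M\<^esub> basis_vec M \<gamma> b)" if "b \<in> B" for r b
    using basis_vec(1)[OF assms(3) that]
    by (simp add: is_linearD(3)[OF assms(4)] is_linearD(3)[OF assms(5)] assms(6)[OF that])
qed

text \<open>The definition of tensor products only tests modules in the universe of \<open>M\<close> and \<open>N\<close>; here \<open>P\<close> may
  live over any type.\<close>

lemma coords_tensor_universal:
  fixes P :: "('r::comm_ring_1, 'w) module"
  assumes M: "is_module M" and N: "is_module N" and T: "is_module T"
    and cM: "coords M B \<gamma>1" and cN: "coords N C \<gamma>2" and cT: "coords T (B \<times> C) \<gamma>"
    and t: "\<And>x y. x \<in> carrier M \<Longrightarrow> y \<in> carrier N \<Longrightarrow> t x y \<in> carrier T"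
    and \<gamma>t: "\<And>x y. x \<in> carrier M \<Longrightarrow> y \<in> carrier N \<Longrightarrow> \<gamma> (t x y) = (\<lambda>(i, j). \<gamma>1 x i * \<gamma>2 y j)"
    and P: "is_module P" and b: "is_bilinear M N P b"
  shows "\<exists>!h. h \<in> linear_maps T P \<and> (\<forall>x \<in> carrier M. \<forall>y \<in> carrier N. h (t x y) = b x y)"
proof -
  interpret T: umod T by unfold_locales fact
  have lin1: "is_linear M T (\<lambda>x. t x y)" if "y \<in> carrier N" for y
  proof -
    interpret umod M by unfold_locales fact
    show ?thesis using that
      by (intro is_linearI coordsD(5)[OF cT])
         (auto simp: t \<gamma>t coordsD[OF cT] coordsD[OF cM] algebra_simps)
  qed
  have lin2: "is_linear N T (t x)" if "x \<in> carrier M" for x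
  proof -
    interpret umod N by unfold_locales fact
    show ?thesis using that
      by (intro is_linearI coordsD(5)[OF cT])
         (auto simp: t \<gamma>t coordsD[OF cT] coordsD[OF cN] algebra_simps)
  qed
  have bas: "t (basis_vec M \<gamma>1 i) (basis_vec N \<gamma>2 j) = basis_vec T \<gamma> (i, j)" if "i \<in> B" "j \<in> C" for i j
    using basis_vec[OF cM that(1)] basis_vec[OF cN that(2)] basis_vec[OF cT, of "(i, j)"] that
    by (intro coordsD(5)[OF cT]) (auto simp: t \<gamma>t split: if_splits)
  have p: "b (basis_vec M \<gamma>1 (fst i)) (basis_vec N \<gamma>2 (snd i)) \<in> carrier P" if "i \<in> B \<times> C" for i
  proof -
    have "fst i \<in> B" "snd i \<in> C" using that by auto
    note bas = basis_vec(1)[OF cM this(1)] basis_vec(1)[OF cN this(2)]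
    show ?thesis by (rule is_linearD(1)[OF is_bilinearD(1)[OF b bas(1)] bas(2)])
  qed
  have "\<exists>h. is_linear T P h \<and> (\<forall>i\<in>B \<times> C.
      h (basis_vec T \<gamma> i) = b (basis_vec M \<gamma>1 (fst i)) (basis_vec N \<gamma>2 (snd i)))"
    by (rule coords_extend[OF P cT p])
  then obtain h where h: "is_linear T P h"
    and hb: "\<And>i. i \<in> B \<times> C \<Longrightarrow> h (basis_vec T \<gamma> i) = b (basis_vec M \<gamma>1 (fst i)) (basis_vec N \<gamma>2 (snd i))"
    by blast
  have comp: "is_linear A P (\<lambda>x. h (f x))" if "is_linear A T f" for A :: "('r, 'z) module" and f
    using that h by (auto simp: is_linear_def is_additive_def Pi_def)
  \<comment> \<open>Both sides are linear in each argument separately, so the comparison passes to a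
    basis of \<open>M\<close> and then to one of \<open>N\<close>.\<close>
  have ht: "h (t x y) = b x y" if x: "x \<in> carrier M" and y: "y \<in> carrier N" for x y
  proof (rule is_linear_eq_on_basis[OF M P cM _ _ _ x])
    show "is_linear M P (\<lambda>x. h (t x y))" "is_linear M P (\<lambda>x. b x y)"
      using comp[OF lin1[OF y]] is_bilinearD(2)[OF b y] by auto
    fix i assume i: "i \<in> B"
    note bi = basis_vec(1)[OF cM i]
    show "h (t (basis_vec M \<gamma>1 i) y) = b (basis_vec M \<gamma>1 i) y"
    proof (rule is_linear_eq_on_basis[OF N P cN _ _ _ y])
      show "is_linear N P (\<lambda>y. h (t (basis_vec M \<gamma>1 i) y))" "is_linear N P (b (basis_vec M \<gamma>1 i))"
        using comp[OF lin2[OF bi]] is_bilinearD(1)[OF b bi] by auto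
      show "h (t (basis_vec M \<gamma>1 i) (basis_vec N \<gamma>2 j)) = b (basis_vec M \<gamma>1 i) (basis_vec N \<gamma>2 j)" if "j \<in> C" for j
        using hb[of "(i, j)"] i that by (simp add: bas)
    qed
  qed
  show ?thesis
  proof (rule ex1I[of _ "restrict h (carrier T)"])
    show "restrict h (carrier T) \<in> linear_maps T P \<and>
        (\<forall>x\<in>carrier M. \<forall>y\<in>carrier N. restrict h (carrier T) (t x y) = b x y)"
      using is_linear_restrict[OF T h] t ht by auto
    fix g assume g: "g \<in> linear_maps T P \<and> (\<forall>x\<in>carrier M. \<forall>y\<in>carrier N. g (t x y) = b x y)"
    show "g = restrict h (carrier T)"
    proof (rule linear_maps_eqI[OF _ is_linear_restrict[OF T h]])
      fix z assume z: "z \<in> carrier T"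
      have "g z = h z"
      proof (rule is_linear_eq_on_basis[OF T P cT _ h _ z])
        show "is_linear T P g" using g by (simp add: linear_mapsD)
        fix i assume "i \<in> B \<times> C"
        then show "g (basis_vec T \<gamma> i) = h (basis_vec T \<gamma> i)"
          using g hb basis_vec(1)[OF cM] basis_vec(1)[OF cN] by (auto simp: bas[symmetric] ht)
      qed
      then show "g z = restrict h (carrier T) z" using z by simp
    qed (use g in auto)
  qed
qed

text \<open>\<open>free_mod\<close> over \<open>B \<times> C\<close> shows that a tensor product
  exists in the universe, hence that the chosen one is a tensor product. Uniqueness up to
  isomorphism then carries the coordinates of this model over to the chosen one.\<close>

lemma tmod_is_tensor_product:
  fixes \<iota> :: "'r::comm_ring_1 \<Rightarrow> 'u" and M N :: "('r, 'u) module"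
    and B :: "'b set" and C :: "'c set"
  assumes \<iota>: "inj \<iota>" "infinite (UNIV :: 'r set)" and M: "is_module M" and N: "is_module N"
    and cM: "coords M B \<gamma>1" and cN: "coords N C \<gamma>2"
  shows "is_tensor_product M N (tmod M N) (tpair M N)"
    and "\<exists>\<gamma>. coords (tmod M N) (B \<times> C) \<gamma> \<and>
       (\<forall>x\<in>carrier M. \<forall>y\<in>carrier N. \<gamma> (tpair M N x y) = (\<lambda>(i, j). \<gamma>1 x i * \<gamma>2 y j))"
proof -
  have fin: "finite (B \<times> C)" using coordsD(1)[OF cM] coordsD(1)[OF cN] by simp
  obtain enc :: "('b \<times> 'c \<Rightarrow> 'r) \<Rightarrow> 'u" where enc: "inj_on enc (supp_on (B \<times> C))"
    using encode_exists[OF \<iota> fin] by blast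
  define T where "T = free_mod enc (B \<times> C)"
  define dec where "dec = inv_into (supp_on (B \<times> C)) enc"
  define t where "t x y = enc (\<lambda>(i, j). \<gamma>1 x i * \<gamma>2 y j)" for x y
  note T = free_mod[OF enc fin, folded T_def dec_def]
  have supp: "(\<lambda>(i, j). \<gamma>1 x i * \<gamma>2 y j) \<in> supp_on (B \<times> C)" if "x \<in> carrier M" "y \<in> carrier N" for x y
    using coordsD(2)[OF cM that(1)] coordsD(2)[OF cN that(2)] by (auto simp: supp_on_def)
  have t: "t x y \<in> carrier T" "dec (t x y) = (\<lambda>(i, j). \<gamma>1 x i * \<gamma>2 y j)" if "x \<in> carrier M" "y \<in> carrier N" for x y
    unfolding t_def dec_def using supp[OF that] T(3) enc by auto
  interpret Mm: umod M by unfold_locales fact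
  interpret Nm: umod N by unfold_locales fact
  interpret Tm: umod T by unfold_locales (rule T(1))
  have bil: "is_bilinear M N T t"
    unfolding is_bilinear_def
    by (intro conjI ballI is_linearI coordsD(5)[OF T(2)])
       (auto simp: t coordsD[OF T(2)] coordsD[OF cM] coordsD[OF cN] algebra_simps)
  have T0: "is_tensor_product M N T t"
    unfolding is_tensor_product_def
    using T(1) bil coords_tensor_universal[OF M N T(1) cM cN T(2) t] by blast
  have "case chosen_tensor M N of (T, t) \<Rightarrow> is_tensor_product M N T t"
    unfolding chosen_tensor_def by (rule someI[of _ "(T, t)"]) (simp add: T0)
  then show tp: "is_tensor_product M N (tmod M N) (tpair M N)"
    by (simp add: tmod_def tpair_def case_prod_unfold)
  define T' where "T' = tmod M N"
  define t' where "t' = tpair M N"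
  have T': "is_module T'" "is_bilinear M N T' t'"
    using tp by (auto simp: is_tensor_product_def T'_def t'_def)
  interpret T'm: umod T' by unfold_locales (rule T'(1))
  have U: "\<exists>!h. h \<in> linear_maps T P \<and> (\<forall>x \<in> carrier M. \<forall>y \<in> carrier N. h (t x y) = b x y)"
    "\<exists>!h. h \<in> linear_maps T' P \<and> (\<forall>x \<in> carrier M. \<forall>y \<in> carrier N. h (t' x y) = b x y)"
    if "is_module P" "is_bilinear M N P b" for P :: "('r, 'u) module" and b
    using T0 tp that by (auto simp: is_tensor_product_def T'_def t'_def)
  have t'c: "t' x y \<in> carrier T'" if "x \<in> carrier M" "y \<in> carrier N" for x y
    using is_linearD(1)[OF is_bilinearD(1)[OF T'(2) that(1)] that(2)] .
  obtain f where f: "f \<in> linear_maps T T'" "\<And>x y. x \<in> carrier M \<Longrightarrow> y \<in> carrier N \<Longrightarrow> f (t x y) = t' x y"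
    using U(1)[OF T'] by blast
  obtain g where g: "g \<in> linear_maps T' T" "\<And>x y. x \<in> carrier M \<Longrightarrow> y \<in> carrier N \<Longrightarrow> g (t' x y) = t x y"
    using U(2)[OF T(1) bil] by blast
  note fl = is_linearD[OF linear_mapsD(1)[OF f(1)]] and gl = is_linearD[OF linear_mapsD(1)[OF g(1)]]
  \<comment> \<open>Uniqueness in the universal property compares the composite with the identity,
    since both fix the elementary tensors.\<close>
  have "restrict (\<lambda>z. g (f z)) (carrier T) = restrict (\<lambda>z. z) (carrier T)"
  proof -
    have "restrict (\<lambda>z. g (f z)) (carrier T) \<in> linear_maps T T"
      using T(1) by (intro is_linear_restrict is_linearI) (auto simp: fl gl)
    moreover have "restrict (\<lambda>z. z) (carrier T) \<in> linear_maps T T"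
      using T(1) by (intro is_linear_restrict is_linearI) auto
    moreover have "h = h'" if "h \<in> linear_maps T T" "h' \<in> linear_maps T T"
      "\<forall>x\<in>carrier M. \<forall>y\<in>carrier N. h (t x y) = t x y" "\<forall>x\<in>carrier M. \<forall>y\<in>carrier N. h' (t x y) = t x y" for h h'
      using U(1)[OF T(1) bil] that by blast
    ultimately show ?thesis by (simp add: f(2) g(2) t(1))
  qed
  then have gf: "g (f z) = z" if "z \<in> carrier T" for z using that by (metis restrict_apply')
  have "restrict (\<lambda>z. f (g z)) (carrier T') = restrict (\<lambda>z. z) (carrier T')"
  proof -
    have "restrict (\<lambda>z. f (g z)) (carrier T') \<in> linear_maps T' T'"
      using T'(1) by (intro is_linear_restrict is_linearI) (auto simp: fl gl)
    moreover have "restrict (\<lambda>z. z) (carrier T') \<in> linear_maps T' T'"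
      using T'(1) by (intro is_linear_restrict is_linearI) auto
    moreover have "h = h'" if "h \<in> linear_maps T' T'" "h' \<in> linear_maps T' T'"
      "\<forall>x\<in>carrier M. \<forall>y\<in>carrier N. h (t' x y) = t' x y" "\<forall>x\<in>carrier M. \<forall>y\<in>carrier N. h' (t' x y) = t' x y" for h h'
      using U(2)[OF T'] that by blast
    ultimately show ?thesis by (simp add: f(2) g(2) t'c)
  qed
  then have fg: "f (g z) = z" if "z \<in> carrier T'" for z using that by (metis restrict_apply')
  have gb: "bij_betw g (carrier T') (carrier T)"
    by (rule bij_betw_byWitness[where f' = f]) (auto simp: gf fg fl gl)
  have "coords T' (B \<times> C) (\<lambda>z. dec (g z))"
    unfolding coords_def
  proof (intro conjI ballI allI fin)
    show "bij_betw (\<lambda>z. dec (g z)) (carrier T') (supp_on (B \<times> C))"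
      using bij_betw_trans[OF gb] T(2) by (auto simp: coords_def comp_def)
  qed (auto simp: gl coordsD[OF T(2)] fun_eq_iff)
  moreover have "dec (g (t' x y)) = (\<lambda>(i, j). \<gamma>1 x i * \<gamma>2 y j)" if "x \<in> carrier M" "y \<in> carrier N" for x y
    using that by (simp add: g(2) t)
  ultimately show "\<exists>\<gamma>. coords (tmod M N) (B \<times> C) \<gamma> \<and>
       (\<forall>x\<in>carrier M. \<forall>y\<in>carrier N. \<gamma> (tpair M N x y) = (\<lambda>(i, j). \<gamma>1 x i * \<gamma>2 y j))"
    unfolding T'_def t'_def by blast
qed

text \<open>Covers both kinds of operators: covariant derivatives, with \<open>d\<close> a partial
  derivative, and the linear operators of a representation, with \<open>d\<close> zero.\<close>

definition is_der :: "('r::comm_ring_1 \<Rightarrow> 'r) \<Rightarrow> ('r, 'u) module \<Rightarrow> ('u \<Rightarrow> 'u) \<Rightarrow> bool" where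
  "is_der d M D \<longleftrightarrow> is_additive M M D \<and>
     (\<forall>r. \<forall>x \<in> carrier M. D (r \<odot>\<^bsub>M\<^esub> x) = d r \<odot>\<^bsub>M\<^esub> x \<oplus>\<^bsub>M\<^esub> r \<odot>\<^bsub>M\<^esub> D x)"

lemma is_additiveD:
  assumes "is_additive M N f"
  shows "x \<in> carrier M \<Longrightarrow> f x \<in> carrier N"
    "x \<in> carrier M \<Longrightarrow> y \<in> carrier M \<Longrightarrow> f (x \<oplus>\<^bsub>M\<^esub> y) = f x \<oplus>\<^bsub>N\<^esub> f y"
  using assms by (auto simp: is_additive_def)

lemma is_derD:
  assumes "is_der d M D"
  shows "x \<in> carrier M \<Longrightarrow> D x \<in> carrier M"
    "x \<in> carrier M \<Longrightarrow> y \<in> carrier M \<Longrightarrow> D (x \<oplus>\<^bsub>M\<^esub> y) = D x \<oplus>\<^bsub>M\<^esub> D y"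
    "x \<in> carrier M \<Longrightarrow> D (r \<odot>\<^bsub>M\<^esub> x) = d r \<odot>\<^bsub>M\<^esub> x \<oplus>\<^bsub>M\<^esub> r \<odot>\<^bsub>M\<^esub> D x"
  using assms by (auto simp: is_der_def is_additive_def)

lemma is_linear_additive: "is_linear M N f \<Longrightarrow> is_additive M N f"
  by (simp add: is_linear_def)

text \<open>The description under \<open>THE\<close> in \<open>tens_obj\<close>, named so that its
  existence and uniqueness can be stated.\<close>

definition leibniz_op :: "('r::comm_ring_1, 'u) module \<Rightarrow> ('r, 'u) module \<Rightarrow> ('u \<Rightarrow> 'u) \<Rightarrow> ('u \<Rightarrow> 'u)
    \<Rightarrow> ('u \<Rightarrow> 'u) \<Rightarrow> bool" where
  "leibniz_op M N D1 D2 D \<longleftrightarrow> D \<in> extensional (carrier (tmod M N)) \<and> is_additive (tmod M N) (tmod M N) D \<and>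
     (\<forall>x\<in>carrier M. \<forall>y\<in>carrier N.
        D (tpair M N x y) = tpair M N (D1 x) y \<oplus>\<^bsub>tmod M N\<^esub> tpair M N x (D2 y))"

locale universe =
  fixes \<iota> :: "'r::comm_ring_1 \<Rightarrow> 'u"
  assumes inj_\<iota>: "inj \<iota>" and inf_r: "infinite (UNIV :: 'r set)"
begin

context
  fixes M N :: "('r, 'u) module"
  assumes M: "finite_free M" and N: "finite_free N"
begin

lemma tmod_coords:
  "\<exists>(B :: 'u set) (C :: 'u set) \<gamma>1 \<gamma>2 \<gamma>. coords M B \<gamma>1 \<and> coords N C \<gamma>2 \<and> coords (tmod M N) (B \<times> C) \<gamma> \<and>
     (\<forall>x\<in>carrier M. \<forall>y\<in>carrier N. \<gamma> (tpair M N x y) = (\<lambda>(i, j). \<gamma>1 x i * \<gamma>2 y j))"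
proof -
  obtain B :: "'u set" and \<gamma>1 where 1: "coords M B \<gamma>1" using finite_free_coords[OF M] by blast
  obtain C :: "'u set" and \<gamma>2 where 2: "coords N C \<gamma>2" using finite_free_coords[OF N] by blast
  show ?thesis
    using tmod_is_tensor_product(2)[OF inj_\<iota> inf_r finite_free_is_module[OF M] finite_free_is_module[OF N] 1 2] 1 2
    by blast
qed

lemma tmod_tensor: "is_tensor_product M N (tmod M N) (tpair M N)"
proof -
  obtain B :: "'u set" and \<gamma>1 where 1: "coords M B \<gamma>1" using finite_free_coords[OF M] by blast
  obtain C :: "'u set" and \<gamma>2 where 2: "coords N C \<gamma>2" using finite_free_coords[OF N] by blast
  show ?thesis
    by (rule tmod_is_tensor_product(1)[OF inj_\<iota> inf_r finite_free_is_module[OF M] finite_free_is_module[OF N] 1 2])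
qed

lemma tmod_module: "is_module (tmod M N)"
  using tmod_tensor by (simp add: is_tensor_product_def)

lemma tpair_bilinear: "is_bilinear M N (tmod M N) (tpair M N)"
  using tmod_tensor by (simp add: is_tensor_product_def)

lemma tmod_finite_free: "finite_free (tmod M N)"
  using tmod_coords coords_finite_free[OF tmod_module] by blast

lemma tpair_closed: "x \<in> carrier M \<Longrightarrow> y \<in> carrier N \<Longrightarrow> tpair M N x y \<in> carrier (tmod M N)"
  by (rule is_linearD(1)[OF is_bilinearD(1)[OF tpair_bilinear]])

lemma tpair_linear:
  "x \<in> carrier M \<Longrightarrow> y \<in> carrier N \<Longrightarrow> y' \<in> carrier N \<Longrightarrow>
     tpair M N x (y \<oplus>\<^bsub>N\<^esub> y') = tpair M N x y \<oplus>\<^bsub>tmod M N\<^esub> tpair M N x y'"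
  "x \<in> carrier M \<Longrightarrow> x' \<in> carrier M \<Longrightarrow> y \<in> carrier N \<Longrightarrow>
     tpair M N (x \<oplus>\<^bsub>M\<^esub> x') y = tpair M N x y \<oplus>\<^bsub>tmod M N\<^esub> tpair M N x' y"
  "x \<in> carrier M \<Longrightarrow> y \<in> carrier N \<Longrightarrow> tpair M N (r \<odot>\<^bsub>M\<^esub> x) y = r \<odot>\<^bsub>tmod M N\<^esub> tpair M N x y"
  "x \<in> carrier M \<Longrightarrow> y \<in> carrier N \<Longrightarrow> tpair M N x (r \<odot>\<^bsub>N\<^esub> y) = r \<odot>\<^bsub>tmod M N\<^esub> tpair M N x y"
  using is_linearD(2,3)[OF is_bilinearD(1)[OF tpair_bilinear]]
    is_linearD(2,3)[OF is_bilinearD(2)[OF tpair_bilinear]] by blast+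

text \<open>Through coordinates the test module \<open>P\<close> may have its carrier in any type.
  This is used for pairs in \<open>tensor_op\<close> and for fibres, which live in another
  universe.\<close>

lemma tmod_universal:
  fixes P :: "('r, 'w) module"
  assumes P: "is_module P" and b: "is_bilinear M N P b"
  shows "\<exists>!h. h \<in> linear_maps (tmod M N) P \<and> (\<forall>x \<in> carrier M. \<forall>y \<in> carrier N. h (tpair M N x y) = b x y)"
proof -
  obtain B C :: "'u set" and \<gamma>1 \<gamma>2 \<gamma> where c: "coords M B \<gamma>1" "coords N C \<gamma>2" "coords (tmod M N) (B \<times> C) \<gamma>"
    "\<And>x y. x\<in>carrier M \<Longrightarrow> y\<in>carrier N \<Longrightarrow> \<gamma> (tpair M N x y) = (\<lambda>(i, j). \<gamma>1 x i * \<gamma>2 y j)"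
    using tmod_coords by blast
  show ?thesis
    by (rule coords_tensor_universal[OF finite_free_is_module[OF M] finite_free_is_module[OF N] tmod_module c(1-3)
          tpair_closed c(4) P b])
qed

text \<open>A scalar multiple of a basis tensor is again an elementary tensor, so sums suffice.
  Without a scalar case the rule also serves for operators that are only additive.\<close>

lemma tmod_induct:
  assumes z: "z \<in> carrier (tmod M N)"
    and t: "\<And>x y. x \<in> carrier M \<Longrightarrow> y \<in> carrier N \<Longrightarrow> Q (tpair M N x y)"
    and a: "\<And>u v. u \<in> carrier (tmod M N) \<Longrightarrow> v \<in> carrier (tmod M N) \<Longrightarrow> Q u \<Longrightarrow> Q v \<Longrightarrow> Q (u \<oplus>\<^bsub>tmod M N\<^esub> v)"
  shows "Q z"
proof -
  interpret M: umod M by unfold_locales (rule finite_free_is_module[OF M])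
  interpret N: umod N by unfold_locales (rule finite_free_is_module[OF N])
  interpret T: umod "tmod M N" by unfold_locales (rule tmod_module)
  obtain B C :: "'u set" and \<gamma>1 \<gamma>2 \<gamma> where c: "coords M B \<gamma>1" "coords N C \<gamma>2" "coords (tmod M N) (B \<times> C) \<gamma>"
    and g: "\<And>x y. x\<in>carrier M \<Longrightarrow> y\<in>carrier N \<Longrightarrow> \<gamma> (tpair M N x y) = (\<lambda>(i, j). \<gamma>1 x i * \<gamma>2 y j)"
    using tmod_coords by blast
  show ?thesis
  proof (rule coords_induct[where P = Q, OF tmod_module c(3) _ a _ z])
    have "tpair M N (0 \<odot>\<^bsub>M\<^esub> \<zero>\<^bsub>M\<^esub>) \<zero>\<^bsub>N\<^esub> = 0 \<odot>\<^bsub>tmod M N\<^esub> tpair M N \<zero>\<^bsub>M\<^esub> \<zero>\<^bsub>N\<^esub>"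
      by (rule tpair_linear(3)) auto
    then have "tpair M N \<zero>\<^bsub>M\<^esub> \<zero>\<^bsub>N\<^esub> = \<zero>\<^bsub>tmod M N\<^esub>" by (simp add: tpair_closed)
    then show "Q \<zero>\<^bsub>tmod M N\<^esub>" using t[of "\<zero>\<^bsub>M\<^esub>" "\<zero>\<^bsub>N\<^esub>"] by simp
    fix r b assume "b \<in> B \<times> C"
    then obtain i j where b: "b = (i, j)" "i \<in> B" "j \<in> C" by auto
    note e = basis_vec[OF c(1) b(2)] basis_vec[OF c(2) b(3)]
    have "b \<in> B \<times> C" using b by simp
    note e' = basis_vec[OF c(3) this]
    have "tpair M N (basis_vec M \<gamma>1 i) (basis_vec N \<gamma>2 j) = basis_vec (tmod M N) \<gamma> b"
      by (rule coordsD(5)[OF c(3) tpair_closed[OF e(1) e(3)] e'(1)])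
         (auto simp: g e(1,3), simp_all add: e(2,4) e'(2)[unfolded b(1)] b)
    then have "r \<odot>\<^bsub>tmod M N\<^esub> basis_vec (tmod M N) \<gamma> b = tpair M N (r \<odot>\<^bsub>M\<^esub> basis_vec M \<gamma>1 i) (basis_vec N \<gamma>2 j)"
      using e by (simp add: tpair_linear(3))
    then show "Q (r \<odot>\<^bsub>tmod M N\<^esub> basis_vec (tmod M N) \<gamma> b)"
      using e by (simp add: t)
  qed
qed

text \<open>The operator \<open>D \<otimes> 1 + 1 \<otimes> D'\<close> is not linear; it is the second component of a linear map into
  \<open>T \<times> T\<close> with scalar multiplication twisted by the derivation.\<close>

lemma tensor_op:
  assumes d: "\<And>r s. d (r + s) = d r + d s" "\<And>r s. d (r * s) = d r * s + r * d s"
    and D1: "is_der d M D1" and D2: "is_der d N D2"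
  shows "\<exists>!D. leibniz_op M N D1 D2 D" and "leibniz_op M N D1 D2 D' \<Longrightarrow> is_der d (tmod M N) D'"
proof -
  define T where "T = tmod M N"
  define t where "t = tpair M N"
  interpret M: umod M by unfold_locales (rule finite_free_is_module[OF M])
  interpret N: umod N by unfold_locales (rule finite_free_is_module[OF N])
  interpret T: umod T unfolding T_def by unfold_locales (rule tmod_module)
  note tc = tpair_closed[folded T_def t_def] and tl = tpair_linear[folded T_def t_def]
    and ti = tmod_induct[folded T_def t_def]
  note D1' = is_derD[OF D1] and D2' = is_derD[OF D2]
  have d1: "d 1 = 0" using d(2)[of 1 1] by simp
  have d0: "d 0 = 0" using d(1)[of 0 0] by simp
  define P :: "('r, 'u \<times> 'u) module" where
    "P = \<lparr>carrier = carrier T \<times> carrier T, monoid.mult = (\<lambda>x y. x), one = (\<zero>\<^bsub>T\<^esub>, \<zero>\<^bsub>T\<^esub>),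
      ring.zero = (\<zero>\<^bsub>T\<^esub>, \<zero>\<^bsub>T\<^esub>), add = (\<lambda>(s, u) (s', u'). (s \<oplus>\<^bsub>T\<^esub> s', u \<oplus>\<^bsub>T\<^esub> u')),
      module.smult = (\<lambda>r (s, u). (r \<odot>\<^bsub>T\<^esub> s, d r \<odot>\<^bsub>T\<^esub> s \<oplus>\<^bsub>T\<^esub> r \<odot>\<^bsub>T\<^esub> u))\<rparr>"
  have dm: "d (- 1) = 0" using d(1)[of 1 "-1"] d1 d0 by simp
  have Pm: "is_module P"
  proof (rule is_moduleI)
    show "(- 1) \<odot>\<^bsub>P\<^esub> x \<oplus>\<^bsub>P\<^esub> x = \<zero>\<^bsub>P\<^esub>" if "x \<in> carrier P" for x
      using that by (auto simp: P_def dm T.minus_eq_smult[symmetric] T.l_neg)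
  qed (auto simp: P_def d d1 T.a_ac T.smult_l_distr T.smult_r_distr T.smult_assoc mult.commute)
  have bil: "is_bilinear M N P (\<lambda>x y. (t x y, t (D1 x) y \<oplus>\<^bsub>T\<^esub> t x (D2 y)))"
    unfolding is_bilinear_def
    by (intro conjI ballI is_linearI)
       (auto simp: P_def tc tl D1' D2' T.a_ac T.smult_r_distr)
  obtain h where h: "h \<in> linear_maps T P"
    and ht: "\<And>x y. x \<in> carrier M \<Longrightarrow> y \<in> carrier N \<Longrightarrow> h (t x y) = (t x y, t (D1 x) y \<oplus>\<^bsub>T\<^esub> t x (D2 y))"
    using tmod_universal[OF Pm bil, folded T_def t_def] by blast
  note hl = is_linearD[OF linear_mapsD(1)[OF h]]
  have hc: "h z \<in> carrier T \<times> carrier T" if "z \<in> carrier T" for z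
    using hl(1)[OF that] by (simp add: P_def)
  \<comment> \<open>The first component is additive and fixes elementary tensors, hence is the
    identity. Linearity for the twisted multiplication then reads as the Leibniz rule for the second
    component.\<close>
  have h1: "fst (h z) = z" if "z \<in> carrier T" for z
    using that
  proof (rule ti)
    fix u v assume uv: "u \<in> carrier T" "v \<in> carrier T" "fst (h u) = u" "fst (h v) = v"
    show "fst (h (u \<oplus>\<^bsub>T\<^esub> v)) = u \<oplus>\<^bsub>T\<^esub> v"
      using uv hc by (simp add: hl(2)) (simp add: P_def case_prod_unfold)
  qed (simp add: ht)
  define D where "D = restrict (\<lambda>z. snd (h z)) (carrier T)"
  have D: "D z = snd (h z)" if "z \<in> carrier T" for z using that by (simp add: D_def)
  have Dc: "D z \<in> carrier T" if "z \<in> carrier T" for z using hc[OF that] that by (auto simp: D)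
  have Dadd: "is_additive T T D"
    unfolding is_additive_def
    using hc by (auto simp: Dc) (auto simp: D hl(2) P_def case_prod_unfold)
  have Dder: "is_der d T D"
    unfolding is_der_def
  proof (intro conjI Dadd allI ballI)
    fix r z assume z: "z \<in> carrier T"
    have "h (r \<odot>\<^bsub>T\<^esub> z) = r \<odot>\<^bsub>P\<^esub> h z" using hl(3)[OF z] .
    then show "D (r \<odot>\<^bsub>T\<^esub> z) = d r \<odot>\<^bsub>T\<^esub> z \<oplus>\<^bsub>T\<^esub> r \<odot>\<^bsub>T\<^esub> D z"
      using z h1[OF z] by (simp add: D) (simp add: P_def case_prod_unfold)
  qed
  have DP: "leibniz_op M N D1 D2 D" unfolding leibniz_op_def T_def[symmetric] t_def[symmetric]
    using Dadd by (auto simp: D_def tc ht)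
  have uniq: "D' = D" if "leibniz_op M N D1 D2 D'" for D'
  proof (rule extensionalityI[of _ "carrier T"])
    show "D' \<in> extensional (carrier T)" "D \<in> extensional (carrier T)"
      using that by (auto simp: leibniz_op_def T_def D_def)
    have D'a: "is_additive T T D'" and D't: "\<And>x y. x \<in> carrier M \<Longrightarrow> y \<in> carrier N \<Longrightarrow>
        D' (t x y) = t (D1 x) y \<oplus>\<^bsub>T\<^esub> t x (D2 y)"
      using that by (auto simp: leibniz_op_def T_def t_def)
    fix z assume "z \<in> carrier T"
    then show "D' z = D z"
    proof (rule ti)
      show "D' (t x y) = D (t x y)" if "x \<in> carrier M" "y \<in> carrier N" for x y
        using that by (simp add: D't D tc ht)
      show "D' (u \<oplus>\<^bsub>T\<^esub> v) = D (u \<oplus>\<^bsub>T\<^esub> v)" if "u \<in> carrier T" "v \<in> carrier T" "D' u = D u" "D' v = D v" for u v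
        using that by (simp add: is_additiveD(2)[OF D'a] is_additiveD(2)[OF Dadd])
    qed
  qed
  show "\<exists>!D. leibniz_op M N D1 D2 D" using DP uniq by blast
  show "is_der d (tmod M N) D'" if "leibniz_op M N D1 D2 D'"
    using uniq[OF that] Dder by (simp add: T_def)
qed

end

end

section \<open>The tensor category of modules with operators\<close>

text \<open>Bundles are the case of all indices with the partial derivatives, representations the
  case \<open>FL_ge2\<close> with zero derivations and the bracket relations added.\<close>

definition opm :: "'i set \<Rightarrow> ('i \<Rightarrow> 'r \<Rightarrow> 'r) \<Rightarrow> ('r::comm_ring_1, 'u, 'i) opmod \<Rightarrow> bool" where
  "opm I \<delta> E \<longleftrightarrow> finite_free (UMod E) \<and> (\<forall>i\<in>I. is_der (\<delta> i) (UMod E) (Act E i))"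

locale opmods = universe \<iota> for \<iota> :: "'r::comm_ring_1 \<Rightarrow> 'u" +
  fixes I :: "'i set" and \<delta> :: "'i \<Rightarrow> 'r \<Rightarrow> 'r"
  assumes \<delta>_add: "i \<in> I \<Longrightarrow> \<delta> i (r + s) = \<delta> i r + \<delta> i s"
    and \<delta>_mult: "i \<in> I \<Longrightarrow> \<delta> i (r * s) = \<delta> i r * s + r * \<delta> i s"
begin

abbreviation opmi :: "('r, 'u, 'i) opmod \<Rightarrow> bool" where "opmi \<equiv> opm I \<delta>"

lemma \<delta>_1: "i \<in> I \<Longrightarrow> \<delta> i 1 = 0"
  using \<delta>_mult[of i 1 1] by simp

lemma opm_ff: "opmi E \<Longrightarrow> finite_free (UMod E)"
  by (simp add: opm_def)

lemma opm_umod: "opmi E \<Longrightarrow> umod (UMod E)"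
  by unfold_locales (rule finite_free_is_module[OF opm_ff])

lemma Act_closed: "opmi E \<Longrightarrow> i \<in> I \<Longrightarrow> x \<in> Car E \<Longrightarrow> Act E i x \<in> Car E"
  and Act_add: "opmi E \<Longrightarrow> i \<in> I \<Longrightarrow> x \<in> Car E \<Longrightarrow> y \<in> Car E \<Longrightarrow>
    Act E i (x \<oplus>\<^bsub>UMod E\<^esub> y) = Act E i x \<oplus>\<^bsub>UMod E\<^esub> Act E i y"
  and Act_smult: "opmi E \<Longrightarrow> i \<in> I \<Longrightarrow> x \<in> Car E \<Longrightarrow>
    Act E i (r \<odot>\<^bsub>UMod E\<^esub> x) = \<delta> i r \<odot>\<^bsub>UMod E\<^esub> x \<oplus>\<^bsub>UMod E\<^esub> r \<odot>\<^bsub>UMod E\<^esub> Act E i x"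
  unfolding opm_def by (blast intro: is_derD)+

lemma UMod_tens: "UMod (tens_obj E F) = tmod (UMod E) (UMod F)"
  by (simp add: tens_obj_def Let_def)

lemma tens_closed: "opmi E \<Longrightarrow> opmi F \<Longrightarrow> x \<in> Car E \<Longrightarrow> y \<in> Car F \<Longrightarrow> tens E F x y \<in> Car (tens_obj E F)"
  by (simp add: UMod_tens tens_def tpair_closed opm_ff)

lemma tens_linear:
  "opmi E \<Longrightarrow> opmi F \<Longrightarrow> x \<in> Car E \<Longrightarrow> y \<in> Car F \<Longrightarrow> y' \<in> Car F \<Longrightarrow>
     tens E F x (y \<oplus>\<^bsub>UMod F\<^esub> y') = tens E F x y \<oplus>\<^bsub>UMod (tens_obj E F)\<^esub> tens E F x y'"
  "opmi E \<Longrightarrow> opmi F \<Longrightarrow> x \<in> Car E \<Longrightarrow> x' \<in> Car E \<Longrightarrow> y \<in> Car F \<Longrightarrow>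
     tens E F (x \<oplus>\<^bsub>UMod E\<^esub> x') y = tens E F x y \<oplus>\<^bsub>UMod (tens_obj E F)\<^esub> tens E F x' y"
  "opmi E \<Longrightarrow> opmi F \<Longrightarrow> x \<in> Car E \<Longrightarrow> y \<in> Car F \<Longrightarrow>
     tens E F (r \<odot>\<^bsub>UMod E\<^esub> x) y = r \<odot>\<^bsub>UMod (tens_obj E F)\<^esub> tens E F x y"
  "opmi E \<Longrightarrow> opmi F \<Longrightarrow> x \<in> Car E \<Longrightarrow> y \<in> Car F \<Longrightarrow>
     tens E F x (r \<odot>\<^bsub>UMod F\<^esub> y) = r \<odot>\<^bsub>UMod (tens_obj E F)\<^esub> tens E F x y"
  by (simp_all add: UMod_tens tens_def tpair_linear opm_ff)

lemma tens_induct [consumes 3, case_names tens add]: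
  assumes "opmi E" "opmi F" "z \<in> Car (tens_obj E F)"
    and "\<And>x y. x \<in> Car E \<Longrightarrow> y \<in> Car F \<Longrightarrow> Q (tens E F x y)"
    and "\<And>u v. u \<in> Car (tens_obj E F) \<Longrightarrow> v \<in> Car (tens_obj E F) \<Longrightarrow> Q u \<Longrightarrow> Q v
      \<Longrightarrow> Q (u \<oplus>\<^bsub>UMod (tens_obj E F)\<^esub> v)"
  shows "Q z"
  by (rule tmod_induct[OF opm_ff[OF assms(1)] opm_ff[OF assms(2)] assms(3)[unfolded UMod_tens]])
     (use assms(4,5) in \<open>auto simp: UMod_tens tens_def\<close>)

lemma Act_tens_aux:
  assumes "opmi E" "opmi F" "i \<in> I"
  shows "Act (tens_obj E F) i \<in> extensional (Car (tens_obj E F))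
      \<and> is_additive (UMod (tens_obj E F)) (UMod (tens_obj E F)) (Act (tens_obj E F) i)
      \<and> (\<forall>x\<in>Car E. \<forall>y\<in>Car F. Act (tens_obj E F) i (tens E F x y)
         = tens E F (Act E i x) y \<oplus>\<^bsub>UMod (tens_obj E F)\<^esub> tens E F x (Act F i y))"
    and "is_der (\<delta> i) (UMod (tens_obj E F)) (Act (tens_obj E F) i)"
proof -
  note * = tensor_op[OF opm_ff[OF assms(1)] opm_ff[OF assms(2)], of "\<delta> i" "Act E i" "Act F i",
      OF \<delta>_add[OF assms(3)] \<delta>_mult[OF assms(3)]]
  have d: "is_der (\<delta> i) (UMod E) (Act E i)" "is_der (\<delta> i) (UMod F) (Act F i)"
    using assms by (auto simp: opm_def)
  note 1 = theI'[OF *(1)[OF d]]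
  show "Act (tens_obj E F) i \<in> extensional (Car (tens_obj E F))
      \<and> is_additive (UMod (tens_obj E F)) (UMod (tens_obj E F)) (Act (tens_obj E F) i)
      \<and> (\<forall>x\<in>Car E. \<forall>y\<in>Car F. Act (tens_obj E F) i (tens E F x y)
         = tens E F (Act E i x) y \<oplus>\<^bsub>UMod (tens_obj E F)\<^esub> tens E F x (Act F i y))"
    using 1 by (simp add: leibniz_op_def tens_obj_def Let_def tens_def)
  show "is_der (\<delta> i) (UMod (tens_obj E F)) (Act (tens_obj E F) i)"
    using *(2)[OF d 1] by (simp add: leibniz_op_def tens_obj_def Let_def)
qed

lemma Act_tens: "opmi E \<Longrightarrow> opmi F \<Longrightarrow> i \<in> I \<Longrightarrow> x \<in> Car E \<Longrightarrow> y \<in> Car F \<Longrightarrow>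
  Act (tens_obj E F) i (tens E F x y) = tens E F (Act E i x) y \<oplus>\<^bsub>UMod (tens_obj E F)\<^esub> tens E F x (Act F i y)"
  using Act_tens_aux(1) by blast

lemma opm_tens: "opmi E \<Longrightarrow> opmi F \<Longrightarrow> opmi (tens_obj E F)"
  using Act_tens_aux(2) tmod_finite_free[OF opm_ff opm_ff] by (auto simp: opm_def[of _ _ "tens_obj E F"] UMod_tens)

lemma tens_lift:
  fixes P :: "('r, 'w) module"
  assumes "opmi E" "opmi F" "is_module P" "is_bilinear (UMod E) (UMod F) P b"
  shows "\<exists>!h. h \<in> linear_maps (UMod (tens_obj E F)) P \<and> (\<forall>x \<in> Car E. \<forall>y \<in> Car F. h (tens E F x y) = b x y)"
  unfolding UMod_tens tens_def
  by (rule tmod_universal[OF opm_ff[OF assms(1)] opm_ff[OF assms(2)] assms(3,4)])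

lemma unit_mod_ring: "is_module (unit_mod \<iota>)"
  by (rule is_moduleI) (auto simp: unit_mod_def the_inv_f_f[OF inj_\<iota>] algebra_simps)

lemma opm_unit: "opmi (unit_obj \<iota> \<delta>)"
proof -
  have c: "coords (unit_mod \<iota>) {()} (\<lambda>x _. the_inv \<iota> x)"
    unfolding coords_def
  proof (intro conjI)
    show "bij_betw (\<lambda>x _. the_inv \<iota> x) (carrier (unit_mod \<iota>)) (supp_on {()})"
    proof (rule bij_betw_byWitness[where f' = "\<lambda>f. \<iota> (f ())"])
      show "(\<lambda>x _. the_inv \<iota> x) ` carrier (unit_mod \<iota>) \<subseteq> supp_on {()}"
        by (auto simp: supp_on_def)
    qed (auto simp: unit_mod_def the_inv_f_f[OF inj_\<iota>])
  qed (auto simp: unit_mod_def the_inv_f_f[OF inj_\<iota>])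
  have "finite_free (unit_mod \<iota>)" by (rule coords_finite_free[OF unit_mod_ring c])
  moreover have "is_der (\<delta> i) (unit_mod \<iota>) (Act (unit_obj \<iota> \<delta>) i)" if "i \<in> I" for i
    using that
    by (auto simp: is_der_def is_additive_def unit_obj_def unit_mod_def the_inv_f_f[OF inj_\<iota>] \<delta>_add \<delta>_mult)
  ultimately show ?thesis by (simp add: opm_def) (simp add: unit_obj_def)
qed

lemma Car_unit: "Car (unit_obj \<iota> \<delta>) = range \<iota>"
  by (simp add: unit_obj_def unit_mod_def)

lemma unit_ops: "\<iota> r \<oplus>\<^bsub>UMod (unit_obj \<iota> \<delta>)\<^esub> \<iota> s = \<iota> (r + s)" "r \<odot>\<^bsub>UMod (unit_obj \<iota> \<delta>)\<^esub> \<iota> s = \<iota> (r * s)"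
  "Act (unit_obj \<iota> \<delta>) i (\<iota> r) = \<iota> (\<delta> i r)" "\<zero>\<^bsub>UMod (unit_obj \<iota> \<delta>)\<^esub> = \<iota> 0"
  by (simp_all add: unit_obj_def unit_mod_def the_inv_f_f[OF inj_\<iota>])

end

section \<open>Arrows between modules with operators\<close>

locale opmod_category = opmods \<iota> I \<delta>
  for \<iota> :: "'r::comm_ring_1 \<Rightarrow> 'u" and I :: "'i set" and \<delta> :: "'i \<Rightarrow> 'r \<Rightarrow> 'r" +
  fixes Obs :: "('r, 'u, 'i) opmod set" and \<kappa> :: "'k::field \<Rightarrow> 'r"
  assumes Obs_opm: "E \<in> Obs \<Longrightarrow> opm I \<delta> E"
    and Obs_tens: "E \<in> Obs \<Longrightarrow> F \<in> Obs \<Longrightarrow> tens_obj E F \<in> Obs"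
    and Obs_unit: "unit_obj \<iota> \<delta> \<in> Obs"
    and \<kappa>_add: "\<kappa> (c + d) = \<kappa> c + \<kappa> d" and \<kappa>_mult: "\<kappa> (c * d) = \<kappa> c * \<kappa> d"
    and \<kappa>_1: "\<kappa> 1 = 1" and \<delta>_\<kappa>: "i \<in> I \<Longrightarrow> \<delta> i (\<kappa> c) = 0"
begin

abbreviation C where "C \<equiv> opmod_cat Obs I \<iota> \<delta> \<kappa>"

lemma C_simps [simp]:
  "Obj C = Obs" "Dom C = Source" "Cod C = Target"
  "Ident C E = \<lparr>Source = E, Target = E, Fun = (\<lambda>x\<in>Car E. x)\<rparr>"
  "Comp C g f = \<lparr>Source = Source f, Target = Target g, Fun = (\<lambda>x\<in>Car (Source f). Fun g (Fun f x))\<rparr>"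
  "ZeroM C E F = \<lparr>Source = E, Target = F, Fun = (\<lambda>x\<in>Car E. \<zero>\<^bsub>UMod F\<^esub>)\<rparr>"
  "AddM C f g = \<lparr>Source = Source f, Target = Target f,
     Fun = (\<lambda>x\<in>Car (Source f). Fun f x \<oplus>\<^bsub>UMod (Target f)\<^esub> Fun g x)\<rparr>"
  "ScaleM C c f = \<lparr>Source = Source f, Target = Target f,
     Fun = (\<lambda>x\<in>Car (Source f). \<kappa> c \<odot>\<^bsub>UMod (Target f)\<^esub> Fun f x)\<rparr>"
  "TensO C = tens_obj" "TensM C = tens_arr" "UnitO C = unit_obj \<iota> \<delta>" "Assoc C = assoc_arr"
  "LUnit C = lunit_arr \<iota> \<delta>" "RUnit C = runit_arr \<iota> \<delta>" "Braid C = braid_arr"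
  by (simp_all add: opmod_cat_def)

abbreviation arr :: "(('r, 'u, 'i) opmod, 'u) arrow \<Rightarrow> bool" where "arr f \<equiv> f \<in> Arr C"

lemma arr_iff: "arr f \<longleftrightarrow> Source f \<in> Obs \<and> Target f \<in> Obs \<and>
    Fun f \<in> linear_maps (UMod (Source f)) (UMod (Target f)) \<and>
    (\<forall>i \<in> I. \<forall>x \<in> Car (Source f). Fun f (Act (Source f) i x) = Act (Target f) i (Fun f x))"
  by (simp add: opmod_cat_def)

lemma homset_iff: "f \<in> homset C A B \<longleftrightarrow> arr f \<and> Source f = A \<and> Target f = B"
  by (auto simp: homset_def)

lemma Obs_umod: "E \<in> Obs \<Longrightarrow> umod (UMod E)"
  by (simp add: opm_umod Obs_opm)

lemma arrD:
  assumes "arr f"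
  shows "Source f \<in> Obs" "Target f \<in> Obs" "Fun f \<in> extensional (Car (Source f))"
    "is_linear (UMod (Source f)) (UMod (Target f)) (Fun f)"
  using assms by (auto simp: arr_iff linear_maps_def)

lemma Fun_closed [simp]: "arr f \<Longrightarrow> Target f = B \<Longrightarrow> x \<in> Car (Source f) \<Longrightarrow> Fun f x \<in> Car B"
  using is_linearD(1)[OF arrD(4)] by blast
lemma Fun_add: "arr f \<Longrightarrow> Source f = A \<Longrightarrow> x \<in> Car A \<Longrightarrow> y \<in> Car A \<Longrightarrow>
    Fun f (x \<oplus>\<^bsub>UMod A\<^esub> y) = Fun f x \<oplus>\<^bsub>UMod (Target f)\<^esub> Fun f y"
  using is_linearD(2)[OF arrD(4)] by blast
lemma Fun_smult: "arr f \<Longrightarrow> Source f = A \<Longrightarrow> x \<in> Car A \<Longrightarrow>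
    Fun f (r \<odot>\<^bsub>UMod A\<^esub> x) = r \<odot>\<^bsub>UMod (Target f)\<^esub> Fun f x"
  using is_linearD(3)[OF arrD(4)] by blast
lemma Fun_Act: "arr f \<Longrightarrow> Source f = A \<Longrightarrow> i \<in> I \<Longrightarrow> x \<in> Car A \<Longrightarrow>
    Fun f (Act A i x) = Act (Target f) i (Fun f x)"
  by (auto simp: arr_iff)

lemma arrI:
  assumes "Source f \<in> Obs" "Target f \<in> Obs" "is_linear (UMod (Source f)) (UMod (Target f)) (Fun f)"
    "Fun f \<in> extensional (Car (Source f))"
    "\<And>i x. i \<in> I \<Longrightarrow> x \<in> Car (Source f) \<Longrightarrow> Fun f (Act (Source f) i x) = Act (Target f) i (Fun f x)"
  shows "arr f"
  using assms by (auto simp: arr_iff linear_maps_def)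

lemma arr_eqI:
  assumes "arr f" "arr g" "Source f = Source g" "Target f = Target g"
    "\<And>x. x \<in> Car (Source f) \<Longrightarrow> Fun f x = Fun g x"
  shows "f = g"
proof -
  have "Fun f = Fun g"
    using assms by (intro extensionalityI[OF arrD(3)[OF assms(1)]]) (auto dest: arrD(3))
  then show ?thesis using assms(3,4) by (cases f, cases g) simp
qed

lemmas tens_rules = tens_linear[OF Obs_opm Obs_opm] Act_tens[OF Obs_opm Obs_opm]

lemma tens_closedO [simp]: "A \<in> Obs \<Longrightarrow> B \<in> Obs \<Longrightarrow> x \<in> Car A \<Longrightarrow> y \<in> Car B \<Longrightarrow>
    tens A B x y \<in> Car (tens_obj A B)"
  by (simp add: tens_closed Obs_opm)

lemma umod_group: "umod M \<Longrightarrow> abelian_group M"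
  by (simp add: umod_def is_module_def Module.module_def)

lemma add_closedO [simp]: "A \<in> Obs \<Longrightarrow> x \<in> Car A \<Longrightarrow> y \<in> Car A \<Longrightarrow> x \<oplus>\<^bsub>UMod A\<^esub> y \<in> Car A"
  by (rule abelian_monoid.a_closed[OF abelian_group.axioms(1)[OF umod_group[OF Obs_umod]]])

lemma smult_closedO [simp]: "A \<in> Obs \<Longrightarrow> x \<in> Car A \<Longrightarrow> r \<odot>\<^bsub>UMod A\<^esub> x \<in> Car A"
  by (rule umod.smult_closed[OF Obs_umod])

lemma Act_closedO [simp]: "A \<in> Obs \<Longrightarrow> i \<in> I \<Longrightarrow> x \<in> Car A \<Longrightarrow> Act A i x \<in> Car A"
  by (simp add: Act_closed Obs_opm)

lemma tens_inductO [consumes 3, case_names tens add]: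
  assumes "A \<in> Obs" "B \<in> Obs" "z \<in> Car (tens_obj A B)"
    and "\<And>x y. x \<in> Car A \<Longrightarrow> y \<in> Car B \<Longrightarrow> Q (tens A B x y)"
    and "\<And>u v. u \<in> Car (tens_obj A B) \<Longrightarrow> v \<in> Car (tens_obj A B) \<Longrightarrow> Q u \<Longrightarrow> Q v
      \<Longrightarrow> Q (u \<oplus>\<^bsub>UMod (tens_obj A B)\<^esub> v)"
  shows "Q z"
  by (rule tens_induct[OF Obs_opm[OF assms(1)] Obs_opm[OF assms(2)] assms(3-5)])

declare Obs_tens [simp] Obs_unit [simp]

text \<open>Elementary tensors generate additively. Asking only for additivity covers expressions
  such as \<open>Act Y i (h z)\<close>, which need not be linear; iterated tensor products are
  handled by repeated use.\<close>

lemma tens_additive_eq: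
  fixes Y :: "('r, 'w) module"
  assumes A: "A \<in> Obs" "B \<in> Obs" and z: "z \<in> Car (tens_obj A B)"
    and f: "\<And>u v. u \<in> Car (tens_obj A B) \<Longrightarrow> v \<in> Car (tens_obj A B) \<Longrightarrow>
       f (u \<oplus>\<^bsub>UMod (tens_obj A B)\<^esub> v) = f u \<oplus>\<^bsub>Y\<^esub> f v"
    and g: "\<And>u v. u \<in> Car (tens_obj A B) \<Longrightarrow> v \<in> Car (tens_obj A B) \<Longrightarrow>
       g (u \<oplus>\<^bsub>UMod (tens_obj A B)\<^esub> v) = g u \<oplus>\<^bsub>Y\<^esub> g v"
    and t: "\<And>x y. x \<in> Car A \<Longrightarrow> y \<in> Car B \<Longrightarrow> f (tens A B x y) = g (tens A B x y)"
  shows "f z = g z"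
  using A z by (induct rule: tens_inductO) (auto simp: f g t)

lemma arr_eq_tensI:
  assumes "arr f" "arr g" "Source f = tens_obj A B" "Source g = tens_obj A B" "Target f = Target g"
    "A \<in> Obs" "B \<in> Obs"
    "\<And>x y. x \<in> Car A \<Longrightarrow> y \<in> Car B \<Longrightarrow> Fun f (tens A B x y) = Fun g (tens A B x y)"
  shows "f = g"
proof (rule arr_eqI)
  fix x assume "x \<in> Car (Source f)"
  then have "x \<in> Car (tens_obj A B)" using assms by simp
  then show "Fun f x = Fun g x"
    by (rule tens_additive_eq[OF assms(6,7), where Y = "UMod (Target f)"]) (use assms in \<open>auto simp: Fun_add\<close>)
qed (use assms in auto)

lemma arr_eq_tens3I:
  assumes f: "arr f" "arr g" "Source f = tens_obj (tens_obj A B) D" "Source g = tens_obj (tens_obj A B) D"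
      "Target f = Target g" and A: "A \<in> Obs" "B \<in> Obs" "D \<in> Obs"
    and eq: "\<And>x y z. x \<in> Car A \<Longrightarrow> y \<in> Car B \<Longrightarrow> z \<in> Car D \<Longrightarrow>
      Fun f (tens (tens_obj A B) D (tens A B x y) z) = Fun g (tens (tens_obj A B) D (tens A B x y) z)"
  shows "f = g"
proof (rule arr_eq_tensI[OF f])
  fix u z assume u: "u \<in> Car (tens_obj A B)" and z: "z \<in> Car D"
  show "Fun f (tens (tens_obj A B) D u z) = Fun g (tens (tens_obj A B) D u z)"
    by (rule tens_additive_eq[OF A(1,2) u, where Y = "UMod (Target f)"])
       (use assms z in \<open>auto simp: Fun_add tens_rules\<close>)
qed (use A in auto)

lemma arr_eq_tens4I:
  assumes f: "arr f" "arr g" "Source f = tens_obj (tens_obj (tens_obj A B) D) E"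
      "Source g = tens_obj (tens_obj (tens_obj A B) D) E"
      "Target f = Target g" and A: "A \<in> Obs" "B \<in> Obs" "D \<in> Obs" "E \<in> Obs"
    and eq: "\<And>x y z w. x \<in> Car A \<Longrightarrow> y \<in> Car B \<Longrightarrow> z \<in> Car D \<Longrightarrow> w \<in> Car E \<Longrightarrow>
      Fun f (tens (tens_obj (tens_obj A B) D) E (tens (tens_obj A B) D (tens A B x y) z) w)
      = Fun g (tens (tens_obj (tens_obj A B) D) E (tens (tens_obj A B) D (tens A B x y) z) w)"
  shows "f = g"
proof (rule arr_eq_tens3I[OF f])
  fix u z w assume u: "u \<in> Car (tens_obj A B)" and z: "z \<in> Car D" and w: "w \<in> Car E"
  show "Fun f (tens (tens_obj (tens_obj A B) D) E (tens (tens_obj A B) D u z) w)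
      = Fun g (tens (tens_obj (tens_obj A B) D) E (tens (tens_obj A B) D u z) w)"
    by (rule tens_additive_eq[OF A(1,2) u, where Y = "UMod (Target f)"])
       (use assms z w in \<open>auto simp: Fun_add tens_rules\<close>)
qed (use A in auto)

text \<open>Both composites with an operator are additive, so compatibility on elementary tensors is
  enough.\<close>

lemma arr_tensI:
  assumes A: "A \<in> Obs" "B \<in> Obs" "Y \<in> Obs"
    and h: "h \<in> linear_maps (UMod (tens_obj A B)) (UMod Y)"
    and eq: "\<And>i x y. i \<in> I \<Longrightarrow> x \<in> Car A \<Longrightarrow> y \<in> Car B \<Longrightarrow>
      h (Act (tens_obj A B) i (tens A B x y)) = Act Y i (h (tens A B x y))"
  shows "arr \<lparr>Source = tens_obj A B, Target = Y, Fun = h\<rparr>"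
proof (rule arrI)
  note hl = is_linearD[OF linear_mapsD(1)[OF h]]
  fix i z assume i: "i \<in> I" and z: "z \<in> Car (Source \<lparr>Source = tens_obj A B, Target = Y, Fun = h\<rparr>)"
  have "h (Act (tens_obj A B) i z) = Act Y i (h z)"
    by (rule tens_additive_eq[OF A(1,2), where Y = "UMod Y"])
       (use z i A in \<open>auto simp: hl eq Act_add Obs_opm\<close>)
  then show "Fun \<lparr>Source = tens_obj A B, Target = Y, Fun = h\<rparr> (Act (Source \<lparr>Source = tens_obj A B, Target = Y, Fun = h\<rparr>) i z)
      = Act (Target \<lparr>Source = tens_obj A B, Target = Y, Fun = h\<rparr>) i (Fun \<lparr>Source = tens_obj A B, Target = Y, Fun = h\<rparr> z)"
    by simp
qed (use A h in \<open>auto simp: linear_maps_def\<close>)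

lemma arr_tens3I:
  assumes A: "A \<in> Obs" "B \<in> Obs" "D \<in> Obs" "Y \<in> Obs"
    and h: "h \<in> linear_maps (UMod (tens_obj (tens_obj A B) D)) (UMod Y)"
    and eq: "\<And>i x y z. i \<in> I \<Longrightarrow> x \<in> Car A \<Longrightarrow> y \<in> Car B \<Longrightarrow> z \<in> Car D \<Longrightarrow>
      h (Act (tens_obj (tens_obj A B) D) i (tens (tens_obj A B) D (tens A B x y) z))
        = Act Y i (h (tens (tens_obj A B) D (tens A B x y) z))"
  shows "arr \<lparr>Source = tens_obj (tens_obj A B) D, Target = Y, Fun = h\<rparr>"
proof (rule arr_tensI[OF _ A(3,4) h])
  note hl = is_linearD[OF linear_mapsD(1)[OF h]]
  fix i u z assume i: "i \<in> I" and u: "u \<in> Car (tens_obj A B)" and z: "z \<in> Car D"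
  show "h (Act (tens_obj (tens_obj A B) D) i (tens (tens_obj A B) D u z))
      = Act Y i (h (tens (tens_obj A B) D u z))"
  proof (rule tens_additive_eq[OF A(1,2) u, where Y = "UMod Y"])
    fix u v assume uv: "u \<in> Car (tens_obj A B)" "v \<in> Car (tens_obj A B)"
    define w where "w u = tens (tens_obj A B) D u z" for u
    have w: "w (u \<oplus>\<^bsub>UMod (tens_obj A B)\<^esub> v) = w u \<oplus>\<^bsub>UMod (tens_obj (tens_obj A B) D)\<^esub> w v"
      "w u \<in> Car (tens_obj (tens_obj A B) D)" "w v \<in> Car (tens_obj (tens_obj A B) D)"
      using A uv z by (simp_all add: w_def tens_rules)
    show "h (Act (tens_obj (tens_obj A B) D) i (tens (tens_obj A B) D (u \<oplus>\<^bsub>UMod (tens_obj A B)\<^esub> v) z))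
      = h (Act (tens_obj (tens_obj A B) D) i (tens (tens_obj A B) D u z)) \<oplus>\<^bsub>UMod Y\<^esub>
        h (Act (tens_obj (tens_obj A B) D) i (tens (tens_obj A B) D v z))"
      "Act Y i (h (tens (tens_obj A B) D (u \<oplus>\<^bsub>UMod (tens_obj A B)\<^esub> v) z))
      = Act Y i (h (tens (tens_obj A B) D u z)) \<oplus>\<^bsub>UMod Y\<^esub> Act Y i (h (tens (tens_obj A B) D v z))"
      unfolding w_def[symmetric] w(1) using w(2,3) A i
      by (simp_all add: Act_add Obs_opm hl)
  qed (use A z i eq in auto)
qed (use A in auto)

section \<open>Structure arrows of the tensor product\<close>

lemma Source_simps [simp]:
  "Source (tens_arr f g) = tens_obj (Source f) (Source g)" "Target (tens_arr f g) = tens_obj (Target f) (Target g)"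
  "Source (assoc_arr A B D) = tens_obj (tens_obj A B) D" "Target (assoc_arr A B D) = tens_obj A (tens_obj B D)"
  "Source (braid_arr A B) = tens_obj A B" "Target (braid_arr A B) = tens_obj B A"
  "Source (lunit_arr \<iota> \<delta> A) = tens_obj (unit_obj \<iota> \<delta>) A" "Target (lunit_arr \<iota> \<delta> A) = A"
  "Source (runit_arr \<iota> \<delta> A) = tens_obj A (unit_obj \<iota> \<delta>)" "Target (runit_arr \<iota> \<delta> A) = A"
  by (simp_all add: tens_arr_def Let_def assoc_arr_def braid_arr_def lunit_arr_def runit_arr_def)

lemma is_moduleO: "A \<in> Obs \<Longrightarrow> is_module (UMod A)"
  using Obs_umod by (simp add: umod_def)

lemma tens_liftO:
  assumes "A \<in> Obs" "B \<in> Obs" "Y \<in> Obs" "is_bilinear (UMod A) (UMod B) (UMod Y) b"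
  shows "\<exists>!h. h \<in> linear_maps (UMod (tens_obj A B)) (UMod Y) \<and> (\<forall>x \<in> Car A. \<forall>y \<in> Car B. h (tens A B x y) = b x y)"
  by (rule tens_lift[OF Obs_opm[OF assms(1)] Obs_opm[OF assms(2)] is_moduleO[OF assms(3)] assms(4)])

lemma tens_arr:
  assumes f: "arr f" and g: "arr g"
  shows "arr (tens_arr f g)"
    and "Source f = A \<Longrightarrow> Source g = B \<Longrightarrow> x \<in> Car A \<Longrightarrow> y \<in> Car B \<Longrightarrow>
      Fun (tens_arr f g) (tens A B x y) = tens (Target f) (Target g) (Fun f x) (Fun g y)"
proof -
  note O = arrD(1,2)[OF f] arrD(1,2)[OF g]
  have "is_bilinear (UMod (Source f)) (UMod (Source g)) (UMod (tens_obj (Target f) (Target g)))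
    (\<lambda>x y. tens (Target f) (Target g) (Fun f x) (Fun g y))"
    unfolding is_bilinear_def using f g O
    by (intro conjI ballI is_linearI) (auto simp: Fun_add Fun_smult tens_rules)
  from theI'[OF tens_liftO[OF O(1,3) _ this]]
  have h: "Fun (tens_arr f g) \<in> linear_maps (UMod (tens_obj (Source f) (Source g))) (UMod (tens_obj (Target f) (Target g)))"
    and ht: "\<And>x y. x \<in> Car (Source f) \<Longrightarrow> y \<in> Car (Source g) \<Longrightarrow>
      Fun (tens_arr f g) (tens (Source f) (Source g) x y) = tens (Target f) (Target g) (Fun f x) (Fun g y)"
    using O by (simp_all add: tens_arr_def Let_def)
  have "arr \<lparr>Source = tens_obj (Source f) (Source g), Target = tens_obj (Target f) (Target g), Fun = Fun (tens_arr f g)\<rparr>"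
    by (rule arr_tensI[OF O(1,3) _ h])
       (use O f g in \<open>auto simp: tens_rules is_linearD(2)[OF linear_mapsD(1)[OF h]] ht Fun_Act\<close>)
  also have "\<lparr>Source = tens_obj (Source f) (Source g), Target = tens_obj (Target f) (Target g), Fun = Fun (tens_arr f g)\<rparr> = tens_arr f g"
    by (rule arrow.equality) simp_all
  finally show "arr (tens_arr f g)" .
  show "Source f = A \<Longrightarrow> Source g = B \<Longrightarrow> x \<in> Car A \<Longrightarrow> y \<in> Car B \<Longrightarrow>
      Fun (tens_arr f g) (tens A B x y) = tens (Target f) (Target g) (Fun f x) (Fun g y)" using ht by blast
qed

lemma braid_arr:
  assumes O: "A \<in> Obs" "B \<in> Obs"
  shows "arr (braid_arr A B)"
    and "x \<in> Car A \<Longrightarrow> y \<in> Car B \<Longrightarrow> Fun (braid_arr A B) (tens A B x y) = tens B A y x"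
proof -
  have "is_bilinear (UMod A) (UMod B) (UMod (tens_obj B A)) (\<lambda>x y. tens B A y x)"
    unfolding is_bilinear_def using O
    by (intro conjI ballI is_linearI) (auto simp: tens_rules)
  from theI'[OF tens_liftO[OF O _ this]]
  have h: "Fun (braid_arr A B) \<in> linear_maps (UMod (tens_obj A B)) (UMod (tens_obj B A))"
    and ht: "\<And>x y. x \<in> Car A \<Longrightarrow> y \<in> Car B \<Longrightarrow> Fun (braid_arr A B) (tens A B x y) = tens B A y x"
    using O by (simp_all add: braid_arr_def)
  interpret umod "UMod (tens_obj B A)" using O by (intro Obs_umod) simp
  have "arr \<lparr>Source = tens_obj A B, Target = tens_obj B A, Fun = Fun (braid_arr A B)\<rparr>"
    by (rule arr_tensI[OF O _ h])
       (use O in \<open>auto simp: tens_rules is_linearD(2)[OF linear_mapsD(1)[OF h]] ht a_comm\<close>)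
  also have "\<lparr>Source = tens_obj A B, Target = tens_obj B A, Fun = Fun (braid_arr A B)\<rparr> = braid_arr A B"
    by (rule arrow.equality) simp_all
  finally show "arr (braid_arr A B)" .
  show "x \<in> Car A \<Longrightarrow> y \<in> Car B \<Longrightarrow> Fun (braid_arr A B) (tens A B x y) = tens B A y x" by (rule ht)
qed

lemma lunit_arr:
  assumes O: "A \<in> Obs"
  shows "arr (lunit_arr \<iota> \<delta> A)"
    and "x \<in> Car A \<Longrightarrow> Fun (lunit_arr \<iota> \<delta> A) (tens (unit_obj \<iota> \<delta>) A (\<iota> r) x) = r \<odot>\<^bsub>UMod A\<^esub> x"
proof -
  interpret umod "UMod A" by (rule Obs_umod[OF O])
  have "is_bilinear (UMod (unit_obj \<iota> \<delta>)) (UMod A) (UMod A) (\<lambda>u x. the_inv \<iota> u \<odot>\<^bsub>UMod A\<^esub> x)"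
    unfolding is_bilinear_def using O
    by (intro conjI ballI is_linearI)
       (auto simp: Car_unit unit_ops the_inv_f_f[OF inj_\<iota>] smult_l_distr smult_r_distr smult_assoc mult.commute)
  note * = tens_liftO[OF Obs_unit O O this]
  have ex: "\<exists>!h. h \<in> linear_maps (UMod (tens_obj (unit_obj \<iota> \<delta>) A)) (UMod A) \<and>
        (\<forall>r. \<forall>x \<in> Car A. h (tens (unit_obj \<iota> \<delta>) A (\<iota> r) x) = r \<odot>\<^bsub>UMod A\<^esub> x)"
    using * by (auto simp: Car_unit the_inv_f_f[OF inj_\<iota>])
  from theI'[OF ex]
  have h: "Fun (lunit_arr \<iota> \<delta> A) \<in> linear_maps (UMod (tens_obj (unit_obj \<iota> \<delta>) A)) (UMod A)"
    and ht: "\<And>r x. x \<in> Car A \<Longrightarrow> Fun (lunit_arr \<iota> \<delta> A) (tens (unit_obj \<iota> \<delta>) A (\<iota> r) x) = r \<odot>\<^bsub>UMod A\<^esub> x"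
    by (simp_all add: lunit_arr_def)
  have "arr \<lparr>Source = tens_obj (unit_obj \<iota> \<delta>) A, Target = A, Fun = Fun (lunit_arr \<iota> \<delta> A)\<rparr>"
    by (rule arr_tensI[OF Obs_unit O O h])
       (use O in \<open>auto simp: Car_unit tens_rules is_linearD(2)[OF linear_mapsD(1)[OF h]] unit_ops ht
          Act_smult Obs_opm\<close>)
  also have "\<lparr>Source = tens_obj (unit_obj \<iota> \<delta>) A, Target = A, Fun = Fun (lunit_arr \<iota> \<delta> A)\<rparr> = lunit_arr \<iota> \<delta> A"
    by (rule arrow.equality) simp_all
  finally show "arr (lunit_arr \<iota> \<delta> A)" .
  show "x \<in> Car A \<Longrightarrow> Fun (lunit_arr \<iota> \<delta> A) (tens (unit_obj \<iota> \<delta>) A (\<iota> r) x) = r \<odot>\<^bsub>UMod A\<^esub> x" by (rule ht)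
qed

lemma runit_arr:
  assumes O: "A \<in> Obs"
  shows "arr (runit_arr \<iota> \<delta> A)"
    and "x \<in> Car A \<Longrightarrow> Fun (runit_arr \<iota> \<delta> A) (tens A (unit_obj \<iota> \<delta>) x (\<iota> r)) = r \<odot>\<^bsub>UMod A\<^esub> x"
proof -
  interpret umod "UMod A" by (rule Obs_umod[OF O])
  have "is_bilinear (UMod A) (UMod (unit_obj \<iota> \<delta>)) (UMod A) (\<lambda>x u. the_inv \<iota> u \<odot>\<^bsub>UMod A\<^esub> x)"
    unfolding is_bilinear_def using O
    by (intro conjI ballI is_linearI)
       (auto simp: Car_unit unit_ops the_inv_f_f[OF inj_\<iota>] smult_l_distr smult_r_distr smult_assoc mult.commute)
  note * = tens_liftO[OF O Obs_unit O this]
  have ex: "\<exists>!h. h \<in> linear_maps (UMod (tens_obj A (unit_obj \<iota> \<delta>))) (UMod A) \<and>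
        (\<forall>r. \<forall>x \<in> Car A. h (tens A (unit_obj \<iota> \<delta>) x (\<iota> r)) = r \<odot>\<^bsub>UMod A\<^esub> x)"
  proof -
    have "(\<forall>r. \<forall>x \<in> Car A. h (tens A (unit_obj \<iota> \<delta>) x (\<iota> r)) = r \<odot>\<^bsub>UMod A\<^esub> x) \<longleftrightarrow>
      (\<forall>x \<in> Car A. \<forall>u \<in> Car (unit_obj \<iota> \<delta>). h (tens A (unit_obj \<iota> \<delta>) x u) = the_inv \<iota> u \<odot>\<^bsub>UMod A\<^esub> x)" for h
      by (auto simp: Car_unit the_inv_f_f[OF inj_\<iota>])
    then show ?thesis using * by simp
  qed
  from theI'[OF ex]
  have h: "Fun (runit_arr \<iota> \<delta> A) \<in> linear_maps (UMod (tens_obj A (unit_obj \<iota> \<delta>))) (UMod A)"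
    and ht: "\<And>r x. x \<in> Car A \<Longrightarrow> Fun (runit_arr \<iota> \<delta> A) (tens A (unit_obj \<iota> \<delta>) x (\<iota> r)) = r \<odot>\<^bsub>UMod A\<^esub> x"
    by (simp_all add: runit_arr_def)
  have "arr \<lparr>Source = tens_obj A (unit_obj \<iota> \<delta>), Target = A, Fun = Fun (runit_arr \<iota> \<delta> A)\<rparr>"
    by (rule arr_tensI[OF O Obs_unit O h])
       (use O in \<open>auto simp: Car_unit tens_rules is_linearD(2)[OF linear_mapsD(1)[OF h]] unit_ops ht
          Act_smult Obs_opm a_comm\<close>)
  also have "\<lparr>Source = tens_obj A (unit_obj \<iota> \<delta>), Target = A, Fun = Fun (runit_arr \<iota> \<delta> A)\<rparr> = runit_arr \<iota> \<delta> A"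
    by (rule arrow.equality) simp_all
  finally show "arr (runit_arr \<iota> \<delta> A)" .
  show "x \<in> Car A \<Longrightarrow> Fun (runit_arr \<iota> \<delta> A) (tens A (unit_obj \<iota> \<delta>) x (\<iota> r)) = r \<odot>\<^bsub>UMod A\<^esub> x" by (rule ht)
qed

text \<open>For each \<open>z\<close> the universal property of \<open>A \<otimes> B\<close> gives a
  map \<open>p z\<close>. These maps are linear in \<open>z\<close>, as maps out of a tensor product
  are determined on elementary tensors, and the universal property for the third factor joins them
  into one.\<close>

lemma assoc_exists:
  assumes O: "A \<in> Obs" "B \<in> Obs" "D \<in> Obs"
  shows "\<exists>!h. h \<in> linear_maps (UMod (tens_obj (tens_obj A B) D)) (UMod (tens_obj A (tens_obj B D))) \<and>
    (\<forall>x \<in> Car A. \<forall>y \<in> Car B. \<forall>z \<in> Car D. h (tens (tens_obj A B) D (tens A B x y) z)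
      = tens A (tens_obj B D) x (tens B D y z))"
proof (rule ex_ex1I)
  let ?Y = "tens_obj A (tens_obj B D)"
  have "\<exists>!h. h \<in> linear_maps (UMod (tens_obj A B)) (UMod ?Y) \<and>
      (\<forall>x \<in> Car A. \<forall>y \<in> Car B. h (tens A B x y) = tens A (tens_obj B D) x (tens B D y z))"
    if z: "z \<in> Car D" for z
    using O z by (intro tens_liftO) (auto simp: is_bilinear_def tens_rules intro!: is_linearI)
  note ex = ex1_implies_ex[OF this]
  define p where "p z = (SOME h. h \<in> linear_maps (UMod (tens_obj A B)) (UMod ?Y) \<and>
      (\<forall>x \<in> Car A. \<forall>y \<in> Car B. h (tens A B x y) = tens A (tens_obj B D) x (tens B D y z)))" for z
  have pp: "p z \<in> linear_maps (UMod (tens_obj A B)) (UMod ?Y) \<and>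
      (\<forall>x \<in> Car A. \<forall>y \<in> Car B. p z (tens A B x y) = tens A (tens_obj B D) x (tens B D y z))"
    if "z \<in> Car D" for z
    unfolding p_def by (rule someI_ex[OF ex[OF that]])
  have p: "p z \<in> linear_maps (UMod (tens_obj A B)) (UMod ?Y)" if "z \<in> Car D" for z
    using pp[OF that] by (rule conjunct1)
  have pt: "p z (tens A B x y) = tens A (tens_obj B D) x (tens B D y z)"
    if "z \<in> Car D" "x \<in> Car A" "y \<in> Car B" for x y z
    by (rule bspec[OF bspec[OF conjunct2[OF pp[OF that(1)]] that(2)] that(3)])
  note pl = is_linearD[OF linear_mapsD(1)[OF p]]
  interpret Ym: umod "UMod ?Y" using O by (intro Obs_umod) simp
  have padd: "p (z \<oplus>\<^bsub>UMod D\<^esub> z') u = p z u \<oplus>\<^bsub>UMod ?Y\<^esub> p z' u"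
    if "z \<in> Car D" "z' \<in> Car D" "u \<in> Car (tens_obj A B)" for z z' u
    by (rule tens_additive_eq[OF O(1,2) that(3), where Y = "UMod ?Y"])
       (use that O in \<open>auto simp: pl pt tens_rules Ym.a_ac\<close>)
  have psm: "p (r \<odot>\<^bsub>UMod D\<^esub> z) u = r \<odot>\<^bsub>UMod ?Y\<^esub> p z u"
    if "z \<in> Car D" "u \<in> Car (tens_obj A B)" for z r u
    by (rule tens_additive_eq[OF O(1,2) that(2), where Y = "UMod ?Y"])
       (use that O in \<open>auto simp: pl pt tens_rules Ym.smult_r_distr\<close>)
  have "is_bilinear (UMod (tens_obj A B)) (UMod D) (UMod ?Y) (\<lambda>u z. p z u)"
    unfolding is_bilinear_def by (intro conjI ballI is_linearI) (auto simp: pl padd psm)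
  then obtain h where h: "h \<in> linear_maps (UMod (tens_obj (tens_obj A B) D)) (UMod ?Y)"
    and ht: "\<And>u z. u \<in> Car (tens_obj A B) \<Longrightarrow> z \<in> Car D \<Longrightarrow> h (tens (tens_obj A B) D u z) = p z u"
    using tens_liftO[of "tens_obj A B" D ?Y "\<lambda>u z. p z u"] O by auto
  show "\<exists>h. h \<in> linear_maps (UMod (tens_obj (tens_obj A B) D)) (UMod ?Y) \<and>
    (\<forall>x \<in> Car A. \<forall>y \<in> Car B. \<forall>z \<in> Car D. h (tens (tens_obj A B) D (tens A B x y) z)
      = tens A (tens_obj B D) x (tens B D y z))"
    using h ht pt O by (intro exI[of _ h]) auto
  fix h h' assume *: "h \<in> linear_maps (UMod (tens_obj (tens_obj A B) D)) (UMod ?Y) \<and>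
    (\<forall>x \<in> Car A. \<forall>y \<in> Car B. \<forall>z \<in> Car D. h (tens (tens_obj A B) D (tens A B x y) z)
      = tens A (tens_obj B D) x (tens B D y z))"
   "h' \<in> linear_maps (UMod (tens_obj (tens_obj A B) D)) (UMod ?Y) \<and>
    (\<forall>x \<in> Car A. \<forall>y \<in> Car B. \<forall>z \<in> Car D. h' (tens (tens_obj A B) D (tens A B x y) z)
      = tens A (tens_obj B D) x (tens B D y z))"
  then have hh: "h \<in> linear_maps (UMod (tens_obj (tens_obj A B) D)) (UMod ?Y)"
    "h' \<in> linear_maps (UMod (tens_obj (tens_obj A B) D)) (UMod ?Y)" by auto
  note hl = is_linearD(2)[OF linear_mapsD(1)[OF hh(1)]] is_linearD(2)[OF linear_mapsD(1)[OF hh(2)]]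
  show "h = h'"
  proof (rule linear_maps_eqI[OF hh])
    fix w assume w: "w \<in> Car (tens_obj (tens_obj A B) D)"
    show "h w = h' w"
    proof (rule tens_additive_eq[OF _ O(3) w, where Y = "UMod ?Y"])
      fix u z assume u: "u \<in> Car (tens_obj A B)" and z: "z \<in> Car D"
      show "h (tens (tens_obj A B) D u z) = h' (tens (tens_obj A B) D u z)"
        by (rule tens_additive_eq[OF O(1,2) u, where Y = "UMod ?Y"])
           (use O z * in \<open>auto simp: tens_rules hl\<close>)
    qed (use O in \<open>auto simp: hl\<close>)
  qed
qed

lemma assoc_arr:
  assumes O: "A \<in> Obs" "B \<in> Obs" "D \<in> Obs"
  shows "arr (assoc_arr A B D)"
    and "x \<in> Car A \<Longrightarrow> y \<in> Car B \<Longrightarrow> z \<in> Car D \<Longrightarrow>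
      Fun (assoc_arr A B D) (tens (tens_obj A B) D (tens A B x y) z) = tens A (tens_obj B D) x (tens B D y z)"
proof -
  let ?Y = "tens_obj A (tens_obj B D)"
  from theI'[OF assoc_exists[OF O]]
  have h: "Fun (assoc_arr A B D) \<in> linear_maps (UMod (tens_obj (tens_obj A B) D)) (UMod ?Y)"
    and ht: "\<And>x y z. x \<in> Car A \<Longrightarrow> y \<in> Car B \<Longrightarrow> z \<in> Car D \<Longrightarrow>
      Fun (assoc_arr A B D) (tens (tens_obj A B) D (tens A B x y) z) = tens A (tens_obj B D) x (tens B D y z)"
    by (simp_all add: assoc_arr_def)
  interpret umod "UMod ?Y" using O by (intro Obs_umod) simp
  have "arr \<lparr>Source = tens_obj (tens_obj A B) D, Target = ?Y, Fun = Fun (assoc_arr A B D)\<rparr>"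
    by (rule arr_tens3I[OF O _ h])
       (use O in \<open>auto simp: tens_rules is_linearD(2)[OF linear_mapsD(1)[OF h]] ht a_assoc\<close>)
  also have "\<lparr>Source = tens_obj (tens_obj A B) D, Target = ?Y, Fun = Fun (assoc_arr A B D)\<rparr> = assoc_arr A B D"
    by (rule arrow.equality) simp_all
  finally show "arr (assoc_arr A B D)" .
  show "x \<in> Car A \<Longrightarrow> y \<in> Car B \<Longrightarrow> z \<in> Car D \<Longrightarrow>
      Fun (assoc_arr A B D) (tens (tens_obj A B) D (tens A B x y) z) = tens A (tens_obj B D) x (tens B D y z)"
    by (rule ht)
qed

section \<open>Composition, isomorphisms and the linear structure on arrows\<close>

lemma arr_comp: "arr f \<Longrightarrow> arr g \<Longrightarrow> Target f = Source g \<Longrightarrow>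
    arr \<lparr>Source = Source f, Target = Target g, Fun = (\<lambda>x\<in>Car (Source f). Fun g (Fun f x))\<rparr>"
  by (intro arrI is_linearI) (simp_all add: Fun_add Fun_smult Fun_Act arrD(1,2))

lemma arr_ident: "A \<in> Obs \<Longrightarrow> arr \<lparr>Source = A, Target = A, Fun = (\<lambda>x\<in>Car A. x)\<rparr>"
  by (intro arrI is_linearI) auto

lemma arr_isoI:
  assumes "arr f" "arr g" "Source f = A" "Target f = B" "Source g = B" "Target g = A"
    "\<And>x. x \<in> Car A \<Longrightarrow> Fun g (Fun f x) = x" "\<And>y. y \<in> Car B \<Longrightarrow> Fun f (Fun g y) = y"
  shows "is_iso C A B f"
  unfolding is_iso_def homset_iff
  using assms by (auto intro!: bexI[of _ g] simp: homset_iff restrict_def fun_eq_iff)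

text \<open>The inverse of a bijective arrow is again linear and compatible with the operators, as
  is seen by applying the arrow to both sides.\<close>

lemma arr_bij_iso:
  assumes f: "arr f" "Source f = A" "Target f = B" and b: "bij_betw (Fun f) (Car A) (Car B)"
  shows "is_iso C A B f"
proof -
  define g where "g = restrict (inv_into (Car A) (Fun f)) (Car B)"
  have O: "A \<in> Obs" "B \<in> Obs" using f arrD by auto
  have g1: "g y \<in> Car A" "Fun f (g y) = y" if "y \<in> Car B" for y
    using that b bij_betw_inv_into_right[OF b that] bij_betwE[OF bij_betw_inv_into[OF b]] by (auto simp: g_def)
  have g2: "g (Fun f x) = x" if "x \<in> Car A" for x
    using that b bij_betwE[OF b] by (auto simp: g_def bij_betw_inv_into_left[OF b])
  have eq: "g y = x" if "x \<in> Car A" "y = Fun f x" for x y using g2 that by simp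
  have "arr \<lparr>Source = B, Target = A, Fun = g\<rparr>"
  proof (intro arrI is_linearI)
    fix x y assume x: "x \<in> Car (Source \<lparr>Source = B, Target = A, Fun = g\<rparr>)"
    show "Fun \<lparr>Source = B, Target = A, Fun = g\<rparr> x \<in> Car (Target \<lparr>Source = B, Target = A, Fun = g\<rparr>)"
      using x g1 by simp
    show "Fun \<lparr>Source = B, Target = A, Fun = g\<rparr> (x \<oplus>\<^bsub>UMod (Source \<lparr>Source = B, Target = A, Fun = g\<rparr>)\<^esub> y)
      = Fun \<lparr>Source = B, Target = A, Fun = g\<rparr> x \<oplus>\<^bsub>UMod (Target \<lparr>Source = B, Target = A, Fun = g\<rparr>)\<^esub>
        Fun \<lparr>Source = B, Target = A, Fun = g\<rparr> y" if "y \<in> Car (Source \<lparr>Source = B, Target = A, Fun = g\<rparr>)"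
      using x that g1 f O by (auto intro!: eq simp: Fun_add)
    show "Fun \<lparr>Source = B, Target = A, Fun = g\<rparr> (r \<odot>\<^bsub>UMod (Source \<lparr>Source = B, Target = A, Fun = g\<rparr>)\<^esub> x)
      = r \<odot>\<^bsub>UMod (Target \<lparr>Source = B, Target = A, Fun = g\<rparr>)\<^esub> Fun \<lparr>Source = B, Target = A, Fun = g\<rparr> x" for r
      using x g1 f O by (auto intro!: eq simp: Fun_smult)
    show "Fun \<lparr>Source = B, Target = A, Fun = g\<rparr> (Act (Source \<lparr>Source = B, Target = A, Fun = g\<rparr>) i x)
      = Act (Target \<lparr>Source = B, Target = A, Fun = g\<rparr>) i (Fun \<lparr>Source = B, Target = A, Fun = g\<rparr> x)" if "i \<in> I" for i
      using x g1 f O that by (auto intro!: eq simp: Fun_Act)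
  qed (use O in \<open>auto simp: g_def\<close>)
  then show ?thesis using f g1 g2 by (intro arr_isoI) auto
qed

lemma is_isoD: "is_iso C A B f \<Longrightarrow> arr f \<and> Source f = A \<and> Target f = B \<and> bij_betw (Fun f) (Car A) (Car B)"
proof -
  assume "is_iso C A B f"
  then obtain g where f: "arr f" "Source f = A" "Target f = B" and g: "arr g" "Source g = B" "Target g = A"
    and 1: "Comp C g f = Ident C A" and 2: "Comp C f g = Ident C B"
    by (auto simp: is_iso_def homset_iff)
  have "Fun g (Fun f x) = x" if "x \<in> Car A" for x
    using arg_cong[OF 1, of Fun] f that by (simp add: fun_eq_iff restrict_def) metis
  moreover have "Fun f (Fun g x) = x" if "x \<in> Car B" for x
    using arg_cong[OF 2, of Fun] g that by (simp add: fun_eq_iff restrict_def) metis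
  ultimately have "bij_betw (Fun f) (Car A) (Car B)"
    using f g by (intro bij_betw_byWitness[where f' = "Fun g"]) (auto)
  then show ?thesis using f by simp
qed

declare C_simps(4-8) [simp del]

lemma comp_simps [simp]:
  "Source (Comp C g f) = Source f" "Target (Comp C g f) = Target g"
  "x \<in> Car (Source f) \<Longrightarrow> Fun (Comp C g f) x = Fun g (Fun f x)"
  "Source (Ident C A) = A" "Target (Ident C A) = A" "x \<in> Car A \<Longrightarrow> Fun (Ident C A) x = x"
  "Source (AddM C f f') = Source f" "Target (AddM C f f') = Target f"
  "x \<in> Car (Source f) \<Longrightarrow> Fun (AddM C f f') x = Fun f x \<oplus>\<^bsub>UMod (Target f)\<^esub> Fun f' x"
  "Source (ScaleM C c f) = Source f" "Target (ScaleM C c f) = Target f"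
  "x \<in> Car (Source f) \<Longrightarrow> Fun (ScaleM C c f) x = \<kappa> c \<odot>\<^bsub>UMod (Target f)\<^esub> Fun f x"
  "Source (ZeroM C A B) = A" "Target (ZeroM C A B) = B" "x \<in> Car A \<Longrightarrow> Fun (ZeroM C A B) x = \<zero>\<^bsub>UMod B\<^esub>"
  by (simp_all add: C_simps)

lemma arr_Comp: "arr f \<Longrightarrow> arr g \<Longrightarrow> Target f = Source g \<Longrightarrow> arr (Comp C g f)"
  using arr_comp by (simp add: C_simps)

lemma arr_Ident: "A \<in> Obs \<Longrightarrow> arr (Ident C A)"
  using arr_ident by (simp add: C_simps)

lemma arr_AddM:
  assumes f: "arr f" "arr f'" "Source f' = Source f" "Target f' = Target f"
  shows "arr (AddM C f f')"
proof -
  interpret T: umod "UMod (Target f)" by (rule Obs_umod[OF arrD(2)[OF f(1)]])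
  show ?thesis using f arrD[OF f(1)] arrD[OF f(2)]
    by (intro arrI is_linearI)
       (simp_all add: Fun_add Fun_smult Fun_Act T.a_ac T.smult_r_distr Act_add Obs_opm, simp add: C_simps)
qed

lemma Act_\<kappa>: "A \<in> Obs \<Longrightarrow> i \<in> I \<Longrightarrow> x \<in> Car A \<Longrightarrow> Act A i (\<kappa> c \<odot>\<^bsub>UMod A\<^esub> x) = \<kappa> c \<odot>\<^bsub>UMod A\<^esub> Act A i x"
proof -
  assume A: "A \<in> Obs" "i \<in> I" "x \<in> Car A"
  interpret umod "UMod A" by (rule Obs_umod[OF A(1)])
  show ?thesis using A by (simp add: Act_smult Obs_opm \<delta>_\<kappa>)
qed

lemma arr_ScaleM:
  assumes f: "arr f"
  shows "arr (ScaleM C c f)"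
proof -
  interpret T: umod "UMod (Target f)" by (rule Obs_umod[OF arrD(2)[OF f(1)]])
  show ?thesis using f arrD[OF f(1)]
    by (intro arrI is_linearI)
       (simp_all add: Fun_add Fun_smult Fun_Act T.smult_r_distr T.smult_assoc mult.commute Act_\<kappa>, simp add: C_simps)
qed

lemma Act_zero: "A \<in> Obs \<Longrightarrow> i \<in> I \<Longrightarrow> Act A i \<zero>\<^bsub>UMod A\<^esub> = \<zero>\<^bsub>UMod A\<^esub>"
proof -
  assume A: "A \<in> Obs" "i \<in> I"
  interpret umod "UMod A" by (rule Obs_umod[OF A(1)])
  show ?thesis using Act_add[OF Obs_opm[OF A(1)] A(2), of "\<zero>\<^bsub>UMod A\<^esub>" "\<zero>\<^bsub>UMod A\<^esub>"] A by simp
qed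

lemma arr_ZeroM:
  assumes "A \<in> Obs" "B \<in> Obs"
  shows "arr (ZeroM C A B)"
proof -
  interpret T: umod "UMod B" by (rule Obs_umod[OF assms(2)])
  show ?thesis using assms
    by (intro arrI is_linearI) (simp_all add: Act_zero, simp add: C_simps)
qed

lemmas arrs [simp] = tens_arr(1) braid_arr(1) lunit_arr(1) runit_arr(1) assoc_arr(1) arr_Comp arr_Ident
  arr_AddM arr_ScaleM arr_ZeroM
lemmas Fun_tens [simp] = tens_arr(2) braid_arr(2) lunit_arr(2) runit_arr(2) assoc_arr(2)

section \<open>Verification of the tensor category axioms\<close>

lemma category_C: "category C"
proof
  fix f g h A B D E
  show "f \<in> Arr C \<Longrightarrow> Dom C f \<in> Obj C" "f \<in> Arr C \<Longrightarrow> Cod C f \<in> Obj C" by (simp_all add: arrD)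
  show "A \<in> Obj C \<Longrightarrow> Ident C A \<in> homset C A A" by (simp add: homset_iff)
  show "f \<in> homset C A B \<Longrightarrow> g \<in> homset C B D \<Longrightarrow> Comp C g f \<in> homset C A D" by (simp add: homset_iff)
  show "f \<in> homset C A B \<Longrightarrow> Comp C (Ident C B) f = f"
    by (rule arr_eqI) (auto simp: homset_iff arrD)
  show "f \<in> homset C A B \<Longrightarrow> Comp C f (Ident C A) = f"
    by (rule arr_eqI) (auto simp: homset_iff arrD)
  show "f \<in> homset C A B \<Longrightarrow> g \<in> homset C B D \<Longrightarrow> h \<in> homset C D E \<Longrightarrow>
      Comp C (Comp C h g) f = Comp C h (Comp C g f)"
    by (rule arr_eqI) (auto simp: homset_iff arrD)
qed

lemma hom_space_C:
  assumes A: "A \<in> Obs" "B \<in> Obs"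
  shows "is_module (hom_space C A B)"
proof -
  interpret T: umod "UMod B" by (rule Obs_umod[OF A(2)])
  note h = hom_space_def homset_iff
  have c: "Fun f x \<in> Car B" if "f \<in> homset C A B" "x \<in> Car A" for f x
    using that by (simp add: homset_iff)
  show ?thesis
  proof (rule is_moduleI)
    fix f assume f: "f \<in> carrier (hom_space C A B)"
    show "(- 1) \<odot>\<^bsub>hom_space C A B\<^esub> f \<oplus>\<^bsub>hom_space C A B\<^esub> f = \<zero>\<^bsub>hom_space C A B\<^esub>"
    proof -
      have k: "\<kappa> (- 1) = - 1"
      proof -
        have "\<kappa> (- 1) + \<kappa> 1 = \<kappa> 0" using \<kappa>_add[of "- 1" 1] by simp
        moreover have "\<kappa> 0 = 0" using \<kappa>_add[of 0 0] by simp
        ultimately show ?thesis using \<kappa>_1 by (simp add: add_eq_0_iff2)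
      qed
      show ?thesis using f A unfolding h
        by (intro arr_eqI) (auto simp: homset_iff k T.minus_eq_smult[symmetric] T.l_neg)
    qed
    fix c d
    show "(c + d) \<odot>\<^bsub>hom_space C A B\<^esub> f = c \<odot>\<^bsub>hom_space C A B\<^esub> f \<oplus>\<^bsub>hom_space C A B\<^esub> d \<odot>\<^bsub>hom_space C A B\<^esub> f"
      using f A unfolding h by (intro arr_eqI) (auto simp: homset_iff \<kappa>_add T.smult_l_distr)
    show "(c * d) \<odot>\<^bsub>hom_space C A B\<^esub> f = c \<odot>\<^bsub>hom_space C A B\<^esub> (d \<odot>\<^bsub>hom_space C A B\<^esub> f)"
      using f A unfolding h by (intro arr_eqI) (auto simp: homset_iff \<kappa>_mult T.smult_assoc)
    show "1 \<odot>\<^bsub>hom_space C A B\<^esub> f = f"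
      using f A unfolding h by (intro arr_eqI) (auto simp: homset_iff \<kappa>_1)
    show "\<zero>\<^bsub>hom_space C A B\<^esub> \<oplus>\<^bsub>hom_space C A B\<^esub> f = f"
      using f A unfolding h by (intro arr_eqI) (auto simp: homset_iff)
    show "c \<odot>\<^bsub>hom_space C A B\<^esub> f \<in> carrier (hom_space C A B)"
      using f A unfolding h by (simp add: homset_iff)
    fix g assume g: "g \<in> carrier (hom_space C A B)"
    show "f \<oplus>\<^bsub>hom_space C A B\<^esub> g \<in> carrier (hom_space C A B)" using f g A unfolding h by (simp add: homset_iff)
    show "f \<oplus>\<^bsub>hom_space C A B\<^esub> g = g \<oplus>\<^bsub>hom_space C A B\<^esub> f"
      using f g A unfolding h by (intro arr_eqI) (auto simp: homset_iff T.a_comm)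
    show "c \<odot>\<^bsub>hom_space C A B\<^esub> (f \<oplus>\<^bsub>hom_space C A B\<^esub> g)
        = c \<odot>\<^bsub>hom_space C A B\<^esub> f \<oplus>\<^bsub>hom_space C A B\<^esub> c \<odot>\<^bsub>hom_space C A B\<^esub> g"
      using f g A unfolding h by (intro arr_eqI) (auto simp: homset_iff T.smult_r_distr)
    fix h' assume h': "h' \<in> carrier (hom_space C A B)"
    show "f \<oplus>\<^bsub>hom_space C A B\<^esub> g \<oplus>\<^bsub>hom_space C A B\<^esub> h' = f \<oplus>\<^bsub>hom_space C A B\<^esub> (g \<oplus>\<^bsub>hom_space C A B\<^esub> h')"
      using f g h' A unfolding h by (intro arr_eqI) (auto simp: homset_iff T.a_assoc)
  next
    show "\<zero>\<^bsub>hom_space C A B\<^esub> \<in> carrier (hom_space C A B)" using A unfolding h by (simp add: homset_iff)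
  qed
qed

lemma braid_inv: "A \<in> Obs \<Longrightarrow> B \<in> Obs \<Longrightarrow> Comp C (braid_arr B A) (braid_arr A B) = Ident C (tens_obj A B)"
  by (rule arr_eq_tensI[of _ _ A B]) auto

lemma braid_iso: "A \<in> Obs \<Longrightarrow> B \<in> Obs \<Longrightarrow> is_iso C (tens_obj A B) (tens_obj B A) (braid_arr A B)"
  unfolding is_iso_def by (intro conjI bexI[of _ "braid_arr B A"]) (auto simp: homset_iff braid_inv)

lemma assoc_iso:
  assumes O: "A \<in> Obs" "B \<in> Obs" "D \<in> Obs"
  shows "is_iso C (tens_obj (tens_obj A B) D) (tens_obj A (tens_obj B D)) (assoc_arr A B D)"
proof -
  \<comment> \<open>The inverse associator as a composite
    \<open>A(BD) -> (BD)A -> B(DA) -> (DA)B -> D(AB) -> (AB)D\<close> of braidings and associators,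
    which saves a second universal property in three factors.\<close>
  define g where "g = Comp C (braid_arr D (tens_obj A B)) (Comp C (assoc_arr D A B)
      (Comp C (braid_arr B (tens_obj D A)) (Comp C (assoc_arr B D A) (braid_arr A (tens_obj B D)))))"
  have g: "arr g" "Source g = tens_obj A (tens_obj B D)" "Target g = tens_obj (tens_obj A B) D"
    using O by (auto simp: g_def)
  have 1: "Comp C g (assoc_arr A B D) = Ident C (tens_obj (tens_obj A B) D)"
    by (rule arr_eq_tens3I[of _ _ A B D]) (use O g in \<open>auto simp: g_def\<close>)
  have 2: "Comp C (assoc_arr A B D) g = Ident C (tens_obj A (tens_obj B D))"
  proof (rule arr_eq_tensI[of _ _ A "tens_obj B D"])
    fix x u assume x: "x \<in> Car A" and u: "u \<in> Car (tens_obj B D)"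
    have gu: "Fun g (tens A (tens_obj B D) x u) \<in> Car (tens_obj (tens_obj A B) D)" if "u \<in> Car (tens_obj B D)" for u
      using g O x that by simp
    have "Fun (assoc_arr A B D) (Fun g (tens A (tens_obj B D) x u)) = tens A (tens_obj B D) x u"
    proof (rule tens_additive_eq[OF O(2,3) u, where Y = "UMod (tens_obj A (tens_obj B D))"])
      fix u v assume uv: "u \<in> Car (tens_obj B D)" "v \<in> Car (tens_obj B D)"
      show "Fun (assoc_arr A B D) (Fun g (tens A (tens_obj B D) x (u \<oplus>\<^bsub>UMod (tens_obj B D)\<^esub> v)))
        = Fun (assoc_arr A B D) (Fun g (tens A (tens_obj B D) x u)) \<oplus>\<^bsub>UMod (tens_obj A (tens_obj B D))\<^esub>
          Fun (assoc_arr A B D) (Fun g (tens A (tens_obj B D) x v))"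
        using uv x O g gu by (simp add: tens_rules Fun_add)
    qed (use x O in \<open>auto simp: g_def tens_rules\<close>)
    then show "Fun (Comp C (assoc_arr A B D) g) (tens A (tens_obj B D) x u)
        = Fun (Ident C (tens_obj A (tens_obj B D))) (tens A (tens_obj B D) x u)"
      using x u O g by simp
  qed (use O g in auto)
  show ?thesis unfolding is_iso_def
    using 1 2 O g by (intro conjI bexI[of _ g]) (auto simp: homset_iff)
qed

lemma lunit_iso:
  assumes O: "A \<in> Obs"
  shows "is_iso C (tens_obj (unit_obj \<iota> \<delta>) A) A (lunit_arr \<iota> \<delta> A)"
proof -
  define g where "g = \<lparr>Source = A, Target = tens_obj (unit_obj \<iota> \<delta>) A,
    Fun = (\<lambda>x\<in>Car A. tens (unit_obj \<iota> \<delta>) A (\<iota> 1) x)\<rparr>"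
  interpret umod "UMod A" by (rule Obs_umod[OF O])
  interpret T: umod "UMod (tens_obj (unit_obj \<iota> \<delta>) A)" by (rule Obs_umod) (simp add: O)
  have i: "\<iota> r \<in> Car (unit_obj \<iota> \<delta>)" for r by (simp add: Car_unit)
  \<comment> \<open>The inverse sends \<open>x\<close> to \<open>1 \<otimes> x\<close>. It commutes
    with the operators because \<open>\<delta> i 1 = 0\<close>, and \<open>z\<close> removes the
    resulting summand.\<close>
  have z: "tens (unit_obj \<iota> \<delta>) A (\<iota> 0) x = \<zero>\<^bsub>UMod (tens_obj (unit_obj \<iota> \<delta>) A)\<^esub>" if "x \<in> Car A" for x
    using tens_rules(3)[OF Obs_unit O i that, of 0 1] that O i by (simp add: unit_ops)
  have g: "arr g"
    by (intro arrI is_linearI) (use O i in \<open>simp_all add: g_def tens_rules unit_ops \<delta>_1 z\<close>)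
  have gs: "Source g = A" "Target g = tens_obj (unit_obj \<iota> \<delta>) A" by (auto simp: g_def)
  have 2: "Comp C (lunit_arr \<iota> \<delta> A) g = Ident C A"
    by (rule arr_eqI) (use O g gs i in \<open>auto simp: g_def[THEN arg_cong, of Fun]\<close>)
  have 1: "Comp C g (lunit_arr \<iota> \<delta> A) = Ident C (tens_obj (unit_obj \<iota> \<delta>) A)"
  proof (rule arr_eq_tensI[of _ _ "unit_obj \<iota> \<delta>" A])
    fix u x assume u: "u \<in> Car (unit_obj \<iota> \<delta>)" and x: "x \<in> Car A"
    then obtain r where r: "u = \<iota> r" by (auto simp: Car_unit)
    have "tens (unit_obj \<iota> \<delta>) A (\<iota> 1) (r \<odot>\<^bsub>UMod A\<^esub> x) = tens (unit_obj \<iota> \<delta>) A (\<iota> r) x"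
      using tens_rules(3)[OF Obs_unit O i x, of r 1] tens_rules(4)[OF Obs_unit O i x, of 1 r]
      by (simp add: unit_ops)
    then show "Fun (Comp C g (lunit_arr \<iota> \<delta> A)) (tens (unit_obj \<iota> \<delta>) A u x)
      = Fun (Ident C (tens_obj (unit_obj \<iota> \<delta>) A)) (tens (unit_obj \<iota> \<delta>) A u x)"
      using x r O i by (simp add: g_def)
  qed (use O g gs in auto)
  show ?thesis unfolding is_iso_def
    using 1 2 O g gs by (intro conjI bexI[of _ g]) (auto simp: homset_iff)
qed

text \<open>Reduces the right unit to the left one, from which it inherits being an
  isomorphism.\<close>

lemma runit_eq:
  assumes O: "A \<in> Obs"
  shows "runit_arr \<iota> \<delta> A = Comp C (lunit_arr \<iota> \<delta> A) (braid_arr A (unit_obj \<iota> \<delta>))"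
  by (rule arr_eq_tensI[of _ _ A "unit_obj \<iota> \<delta>"]) (use O in \<open>auto simp: Car_unit\<close>)

lemma is_iso_comp:
  assumes f: "is_iso C A B f" and g: "is_iso C B D g"
  shows "is_iso C A D (Comp C g f)"
proof -
  note f' = is_isoD[OF f] and g' = is_isoD[OF g]
  show ?thesis
  proof (rule arr_bij_iso)
    have "bij_betw (Fun g \<circ> Fun f) (Car A) (Car D)" using bij_betw_trans f' g' by blast
    then show "bij_betw (Fun (Comp C g f)) (Car A) (Car D)"
      by (rule iffD1[OF bij_betw_cong, rotated]) (use f' in simp)
  qed (use f' g' in auto)
qed

text \<open>Arrows out of an iterated tensor product are determined on iterated elementary tensors,
  where the two sides of a coherence diagram give the same rebracketed or permuted tensor.\<close>

theorem tensor_category_C: "tensor_category C"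
proof (intro tensor_category.intro category_C tensor_category_axioms.intro)
  note h = homset_iff
  fix f f' g g' h' A A' A'' B B' B'' D D' E c
  let ?u = "unit_obj \<iota> \<delta>"
  have i: "\<iota> r \<in> Car ?u" for r by (simp add: Car_unit)
  show "A \<in> Obj C \<Longrightarrow> B \<in> Obj C \<Longrightarrow> Module.module (ring_of_type_algebra :: 'k ring) (hom_space C A B)"
    using hom_space_C by (simp add: is_module_def)
  show "f \<in> homset C A B \<Longrightarrow> g \<in> homset C B D \<Longrightarrow> h' \<in> homset C B D \<Longrightarrow>
      Comp C (AddM C g h') f = AddM C (Comp C g f) (Comp C h' f)"
    unfolding h by (intro arr_eqI) auto
  show "f \<in> homset C A B \<Longrightarrow> g \<in> homset C A B \<Longrightarrow> h' \<in> homset C B D \<Longrightarrow>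
      Comp C h' (AddM C f g) = AddM C (Comp C h' f) (Comp C h' g)"
    unfolding h by (intro arr_eqI) (auto simp: Fun_add)
  show "f \<in> homset C A B \<Longrightarrow> g \<in> homset C B D \<Longrightarrow> Comp C (ScaleM C c g) f = ScaleM C c (Comp C g f)"
    unfolding h by (intro arr_eqI) auto
  show "f \<in> homset C A B \<Longrightarrow> g \<in> homset C B D \<Longrightarrow> Comp C g (ScaleM C c f) = ScaleM C c (Comp C g f)"
    unfolding h by (intro arr_eqI) (auto simp: Fun_smult)
  show "A \<in> Obj C \<Longrightarrow> B \<in> Obj C \<Longrightarrow> TensO C A B \<in> Obj C" by simp
  show "f \<in> homset C A A' \<Longrightarrow> g \<in> homset C B B' \<Longrightarrow> TensM C f g \<in> homset C (TensO C A B) (TensO C A' B')"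
    unfolding h by simp
  show "A \<in> Obj C \<Longrightarrow> B \<in> Obj C \<Longrightarrow> TensM C (Ident C A) (Ident C B) = Ident C (TensO C A B)"
    by (rule arr_eq_tensI[of _ _ A B]) auto
  show "f \<in> homset C A A' \<Longrightarrow> f' \<in> homset C A' A'' \<Longrightarrow> g \<in> homset C B B' \<Longrightarrow> g' \<in> homset C B' B'' \<Longrightarrow>
      TensM C (Comp C f' f) (Comp C g' g) = Comp C (TensM C f' g') (TensM C f g)"
    unfolding h by (rule arr_eq_tensI[of _ _ A B]) (auto simp: arrD)
  show "f \<in> homset C A A' \<Longrightarrow> f' \<in> homset C A A' \<Longrightarrow> g \<in> homset C B B' \<Longrightarrow>
      TensM C (AddM C f f') g = AddM C (TensM C f g) (TensM C f' g)"
    unfolding h by (rule arr_eq_tensI[of _ _ A B]) (auto simp: arrD tens_rules)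
  show "f \<in> homset C A A' \<Longrightarrow> g \<in> homset C B B' \<Longrightarrow> g' \<in> homset C B B' \<Longrightarrow>
      TensM C f (AddM C g g') = AddM C (TensM C f g) (TensM C f g')"
    unfolding h by (rule arr_eq_tensI[of _ _ A B]) (auto simp: arrD tens_rules)
  show "f \<in> homset C A A' \<Longrightarrow> g \<in> homset C B B' \<Longrightarrow> TensM C (ScaleM C c f) g = ScaleM C c (TensM C f g)"
    unfolding h by (rule arr_eq_tensI[of _ _ A B]) (auto simp: arrD tens_rules)
  show "f \<in> homset C A A' \<Longrightarrow> g \<in> homset C B B' \<Longrightarrow> TensM C f (ScaleM C c g) = ScaleM C c (TensM C f g)"
    unfolding h by (rule arr_eq_tensI[of _ _ A B]) (auto simp: arrD tens_rules)
  show "UnitO C \<in> Obj C" by simp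
  show "A \<in> Obj C \<Longrightarrow> B \<in> Obj C \<Longrightarrow> D \<in> Obj C \<Longrightarrow>
      is_iso C (TensO C (TensO C A B) D) (TensO C A (TensO C B D)) (Assoc C A B D)"
    by (simp add: assoc_iso)
  show "f \<in> homset C A A' \<Longrightarrow> g \<in> homset C B B' \<Longrightarrow> h' \<in> homset C D D' \<Longrightarrow>
      Comp C (Assoc C A' B' D') (TensM C (TensM C f g) h') = Comp C (TensM C f (TensM C g h')) (Assoc C A B D)"
    unfolding h by (rule arr_eq_tens3I[of _ _ A B D]) (auto simp: arrD)
  show "A \<in> Obj C \<Longrightarrow> is_iso C (TensO C (UnitO C) A) A (LUnit C A)" by (simp add: lunit_iso)
  show "f \<in> homset C A A' \<Longrightarrow> Comp C (LUnit C A') (TensM C (Ident C (UnitO C)) f) = Comp C f (LUnit C A)"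
    unfolding h by (rule arr_eq_tensI[of _ _ ?u A]) (auto simp: arrD Car_unit Fun_smult)
  show "A \<in> Obj C \<Longrightarrow> is_iso C (TensO C A (UnitO C)) A (RUnit C A)"
    by (simp add: runit_eq is_iso_comp[OF braid_iso lunit_iso])
  show "f \<in> homset C A A' \<Longrightarrow> Comp C (RUnit C A') (TensM C f (Ident C (UnitO C))) = Comp C f (RUnit C A)"
    unfolding h by (rule arr_eq_tensI[of _ _ A ?u]) (auto simp: arrD Car_unit Fun_smult)
  show "A \<in> Obj C \<Longrightarrow> B \<in> Obj C \<Longrightarrow> is_iso C (TensO C A B) (TensO C B A) (Braid C A B)"
    by (simp add: braid_iso)
  show "f \<in> homset C A A' \<Longrightarrow> g \<in> homset C B B' \<Longrightarrow>
      Comp C (Braid C A' B') (TensM C f g) = Comp C (TensM C g f) (Braid C A B)"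
    unfolding h by (rule arr_eq_tensI[of _ _ A B]) (auto simp: arrD)
  show "A \<in> Obj C \<Longrightarrow> B \<in> Obj C \<Longrightarrow> D \<in> Obj C \<Longrightarrow> E \<in> Obj C \<Longrightarrow>
      Comp C (TensM C (Ident C A) (Assoc C B D E)) (Comp C (Assoc C A (TensO C B D) E)
          (TensM C (Assoc C A B D) (Ident C E)))
        = Comp C (Assoc C A B (TensO C D E)) (Assoc C (TensO C A B) D E)"
    by (rule arr_eq_tens4I[of _ _ A B D E]) auto
  show "A \<in> Obj C \<Longrightarrow> B \<in> Obj C \<Longrightarrow>
      Comp C (TensM C (Ident C A) (LUnit C B)) (Assoc C A (UnitO C) B) = TensM C (RUnit C A) (Ident C B)"
    by (rule arr_eq_tens3I[of _ _ A ?u B]) (auto simp: Car_unit tens_rules)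
  show "A \<in> Obj C \<Longrightarrow> B \<in> Obj C \<Longrightarrow> D \<in> Obj C \<Longrightarrow>
      Comp C (Assoc C B D A) (Comp C (Braid C A (TensO C B D)) (Assoc C A B D))
        = Comp C (TensM C (Ident C B) (Braid C A D)) (Comp C (Assoc C B A D) (TensM C (Braid C A B) (Ident C D)))"
    by (rule arr_eq_tens3I[of _ _ A B D]) auto
  show "A \<in> Obj C \<Longrightarrow> B \<in> Obj C \<Longrightarrow> Comp C (Braid C B A) (Braid C A B) = Ident C (TensO C A B)"
    by (simp add: braid_inv)
qed

end

section \<open>Fully faithful and essentially surjective functors\<close>

text \<open>The inverse functor chooses for each object a preimage with an isomorphism
  \<open>\<epsilon>\<close> and lifts the conjugate of each arrow. Faithfulness pulls functoriality
  and naturality back from \<open>D\<close>, where they are identities about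
  \<open>\<epsilon>\<close> and its inverse.\<close>

lemma ff_ess_surj_is_equivalence:
  assumes F: "category_functor C D Fo Fm"
    and full: "\<And>A B g. A \<in> Obj C \<Longrightarrow> B \<in> Obj C \<Longrightarrow> g \<in> homset D (Fo A) (Fo B) \<Longrightarrow> \<exists>f \<in> homset C A B. Fm f = g"
    and faith: "\<And>A B f f'. f \<in> homset C A B \<Longrightarrow> f' \<in> homset C A B \<Longrightarrow> Fm f = Fm f' \<Longrightarrow> f = f'"
    and ess: "\<And>M. M \<in> Obj D \<Longrightarrow> \<exists>A e. A \<in> Obj C \<and> is_iso D (Fo A) M e"
  shows "is_equivalence C D Fo Fm"
proof -
  interpret F: category_functor C D Fo Fm by fact
  define Go where "Go M = (SOME A. A \<in> Obj C \<and> (\<exists>e. is_iso D (Fo A) M e))" for M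
  define \<epsilon> where "\<epsilon> M = (SOME e. is_iso D (Fo (Go M)) M e)" for M
  have Go: "Go M \<in> Obj C \<and> (\<exists>e. is_iso D (Fo (Go M)) M e)" if "M \<in> Obj D" for M
    unfolding Go_def by (rule someI_ex) (use ess[OF that] in blast)
  have \<epsilon>: "is_iso D (Fo (Go M)) M (\<epsilon> M)" if "M \<in> Obj D" for M
    unfolding \<epsilon>_def by (rule someI_ex) (use Go[OF that] in blast)
  define \<epsilon>' where "\<epsilon>' M = (SOME g. g \<in> homset D M (Fo (Go M)) \<and>
     Comp D g (\<epsilon> M) = Ident D (Fo (Go M)) \<and> Comp D (\<epsilon> M) g = Ident D M)" for M
  have \<epsilon>': "\<epsilon>' M \<in> homset D M (Fo (Go M)) \<and>
     Comp D (\<epsilon>' M) (\<epsilon> M) = Ident D (Fo (Go M)) \<and> Comp D (\<epsilon> M) (\<epsilon>' M) = Ident D M" if "M \<in> Obj D" for M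
    unfolding \<epsilon>'_def by (rule someI_ex) (use \<epsilon>[OF that] in \<open>unfold is_iso_def, blast\<close>)
  have \<epsilon>h: "\<epsilon> M \<in> homset D (Fo (Go M)) M" if "M \<in> Obj D" for M
    using \<epsilon>[OF that] by (simp add: is_iso_def)
  define lft where "lft A B g = (SOME f. f \<in> homset C A B \<and> Fm f = g)" for A B g
  have lft: "lft A B g \<in> homset C A B" "Fm (lft A B g) = g"
    if "A \<in> Obj C" "B \<in> Obj C" "g \<in> homset D (Fo A) (Fo B)" for A B g
  proof -
    have "lft A B g \<in> homset C A B \<and> Fm (lft A B g) = g"
      unfolding lft_def by (rule someI_ex) (use full[OF that] in blast)
    then show "lft A B g \<in> homset C A B" "Fm (lft A B g) = g" by auto
  qed
  define Gm where "Gm g = lft (Go (Dom D g)) (Go (Cod D g)) (Comp D (\<epsilon>' (Cod D g)) (Comp D g (\<epsilon> (Dom D g))))" for g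
  have obj: "A \<in> Obj D \<and> B \<in> Obj D" if "f \<in> homset D A B" for f A B
    using that F.D.Dom_closed F.D.Cod_closed by (auto simp: homset_def)
  have objC: "A \<in> Obj C \<and> B \<in> Obj C" if "f \<in> homset C A B" for f A B
    using that F.C.Dom_closed F.C.Cod_closed by (auto simp: homset_def)
  note DC = F.D.Comp_hom and DA = F.D.Comp_assoc
  have Gm: "Gm g \<in> homset C (Go M) (Go N)" "Fm (Gm g) = Comp D (\<epsilon>' N) (Comp D g (\<epsilon> M))"
    if g: "g \<in> homset D M N" for g M N
  proof -
    note o = obj[OF g]
    have "Comp D (\<epsilon>' N) (Comp D g (\<epsilon> M)) \<in> homset D (Fo (Go M)) (Fo (Go N))"
      using g o \<epsilon>' \<epsilon>h by (blast intro: DC)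
    moreover have "Dom D g = M" "Cod D g = N" using g by (auto simp: homset_def)
    ultimately show "Gm g \<in> homset C (Go M) (Go N)" "Fm (Gm g) = Comp D (\<epsilon>' N) (Comp D g (\<epsilon> M))"
      unfolding Gm_def using lft Go o by auto
  qed
  have e1: "Comp D (\<epsilon> N) (Comp D (\<epsilon>' N) h) = h" if "h \<in> homset D M N" for h M N
  proof -
    note o = obj[OF that]
    have "Comp D (\<epsilon> N) (Comp D (\<epsilon>' N) h) = Comp D (Comp D (\<epsilon> N) (\<epsilon>' N)) h"
      using DA[OF that] \<epsilon>' \<epsilon>h o by (metis (no_types, lifting))
    then show ?thesis using \<epsilon>' o F.D.Ident_left[OF that] by simp
  qed
  have G: "category_functor D C Go Gm"
  proof (intro category_functor.intro F.C.category_axioms F.D.category_axioms category_functor_axioms.intro)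
    show "Go M \<in> Obj C" if "M \<in> Obj D" for M using Go[OF that] by blast
    show "Gm g \<in> homset C (Go M) (Go N)" if "g \<in> homset D M N" for g M N using Gm(1)[OF that] .
    show "Gm (Ident D M) = Ident C (Go M)" if M: "M \<in> Obj D" for M
    proof (rule faith)
      show "Gm (Ident D M) \<in> homset C (Go M) (Go M)" using Gm(1)[OF F.D.Ident_hom[OF M]] .
      show "Ident C (Go M) \<in> homset C (Go M) (Go M)" using Go[OF M] F.C.Ident_hom by blast
      show "Fm (Gm (Ident D M)) = Fm (Ident C (Go M))"
        using Gm(2)[OF F.D.Ident_hom[OF M]] F.D.Ident_left[OF \<epsilon>h[OF M]] \<epsilon>'[OF M] F.Fm_Ident Go[OF M] by auto
    qed
    fix f g M N L assume f: "f \<in> homset D M N" and g: "g \<in> homset D N L"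
    note o = obj[OF f] obj[OF g]
    show "Gm (Comp D g f) = Comp C (Gm g) (Gm f)"
    proof (rule faith)
      show "Gm (Comp D g f) \<in> homset C (Go M) (Go L)" using Gm(1)[OF DC[OF f g]] .
      show "Comp C (Gm g) (Gm f) \<in> homset C (Go M) (Go L)" using F.C.Comp_hom[OF Gm(1)[OF f] Gm(1)[OF g]] .
      have fe: "Comp D f (\<epsilon> M) \<in> homset D (Fo (Go M)) N" using DC \<epsilon>h o f by blast
      have efe: "Comp D (\<epsilon>' N) (Comp D f (\<epsilon> M)) \<in> homset D (Fo (Go M)) (Fo (Go N))" using DC[OF fe] \<epsilon>' o by blast
      have ge: "Comp D g (\<epsilon> N) \<in> homset D (Fo (Go N)) L" using DC \<epsilon>h o g by blast
      have "Fm (Comp C (Gm g) (Gm f)) = Comp D (Comp D (\<epsilon>' L) (Comp D g (\<epsilon> N))) (Comp D (\<epsilon>' N) (Comp D f (\<epsilon> M)))"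
        using F.Fm_Comp[OF Gm(1)[OF f] Gm(1)[OF g]] Gm(2)[OF f] Gm(2)[OF g] by simp
      also have "\<dots> = Comp D (\<epsilon>' L) (Comp D (Comp D g (\<epsilon> N)) (Comp D (\<epsilon>' N) (Comp D f (\<epsilon> M))))"
        using DA[OF efe ge] \<epsilon>' o by blast
      also have "Comp D (Comp D g (\<epsilon> N)) (Comp D (\<epsilon>' N) (Comp D f (\<epsilon> M)))
          = Comp D g (Comp D (\<epsilon> N) (Comp D (\<epsilon>' N) (Comp D f (\<epsilon> M))))"
        using DA[OF efe \<epsilon>h g] o by blast
      also have "\<dots> = Comp D g (Comp D f (\<epsilon> M))" by (simp only: e1[OF fe])
      also have "\<dots> = Comp D (Comp D g f) (\<epsilon> M)" using DA[OF \<epsilon>h f g] o by auto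
      finally show "Fm (Gm (Comp D g f)) = Fm (Comp C (Gm g) (Gm f))" using Gm(2)[OF DC[OF f g]] by simp
    qed
  qed
  define \<eta> where "\<eta> A = lft A (Go (Fo A)) (\<epsilon>' (Fo A))" for A
  have FA: "Fo A \<in> Obj D" if "A \<in> Obj C" for A using F.Fo_closed[OF that] .
  have \<eta>: "\<eta> A \<in> homset C A (Go (Fo A))" "Fm (\<eta> A) = \<epsilon>' (Fo A)" if "A \<in> Obj C" for A
    using lft[OF that, of "Go (Fo A)" "\<epsilon>' (Fo A)"] Go[OF FA[OF that]] \<epsilon>'[OF FA[OF that]] by (auto simp: \<eta>_def)
  have nat_\<eta>: "natural_iso C C id id (Go \<circ> Fo) (Gm \<circ> Fm) \<eta>"
    unfolding natural_iso_def
  proof (intro conjI ballI allI)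
    fix A assume A: "A \<in> Obj C"
    note GA = Go[OF FA[OF A]]
    define z where "z = lft (Go (Fo A)) A (\<epsilon> (Fo A))"
    have z: "z \<in> homset C (Go (Fo A)) A" "Fm z = \<epsilon> (Fo A)"
      using lft[of "Go (Fo A)" A "\<epsilon> (Fo A)"] GA A \<epsilon>h[OF FA[OF A]] by (auto simp: z_def)
    have "Comp C z (\<eta> A) = Ident C A"
      by (rule faith[OF F.C.Comp_hom[OF \<eta>(1)[OF A] z(1)] F.C.Ident_hom[OF A]])
         (use F.Fm_Comp[OF \<eta>(1)[OF A] z(1)] z(2) \<eta>(2)[OF A] \<epsilon>'[OF FA[OF A]] F.Fm_Ident[OF A] in simp)
    moreover have "Comp C (\<eta> A) z = Ident C (Go (Fo A))"
      by (rule faith[OF F.C.Comp_hom[OF z(1) \<eta>(1)[OF A]] F.C.Ident_hom])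
         (use F.Fm_Comp[OF z(1) \<eta>(1)[OF A]] z(2) \<eta>(2)[OF A] \<epsilon>'[OF FA[OF A]] F.Fm_Ident GA in auto)
    ultimately show "is_iso C (id A) ((Go \<circ> Fo) A) (\<eta> A)"
      using \<eta>(1)[OF A] z(1) by (auto simp: is_iso_def)
  next
    fix A B f assume f: "f \<in> homset C A B"
    note o = objC[OF f]
    note Ff = F.Fm_hom[OF f]
    have "Comp C (\<eta> B) f = Comp C (Gm (Fm f)) (\<eta> A)"
    proof (rule faith)
      show "Comp C (\<eta> B) f \<in> homset C A (Go (Fo B))" using F.C.Comp_hom[OF f] \<eta>(1) o by blast
      show "Comp C (Gm (Fm f)) (\<eta> A) \<in> homset C A (Go (Fo B))" using F.C.Comp_hom \<eta>(1) Gm(1)[OF Ff] o by blast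
      have "Fm (Comp C (Gm (Fm f)) (\<eta> A)) = Comp D (Comp D (\<epsilon>' (Fo B)) (Comp D (Fm f) (\<epsilon> (Fo A)))) (\<epsilon>' (Fo A))"
        using F.Fm_Comp[OF \<eta>(1) Gm(1)[OF Ff]] o \<eta>(2) Gm(2)[OF Ff] by auto
      also have "\<dots> = Comp D (\<epsilon>' (Fo B)) (Comp D (Comp D (Fm f) (\<epsilon> (Fo A))) (\<epsilon>' (Fo A)))"
        using DA \<epsilon>' FA o DC[OF \<epsilon>h Ff] by blast
      also have "Comp D (Comp D (Fm f) (\<epsilon> (Fo A))) (\<epsilon>' (Fo A)) = Comp D (Fm f) (Comp D (\<epsilon> (Fo A)) (\<epsilon>' (Fo A)))"
        using DA[OF _ \<epsilon>h Ff] \<epsilon>' FA o by blast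
      also have "\<dots> = Fm f" using \<epsilon>' FA o F.D.Ident_right[OF Ff] by simp
      finally show "Fm (Comp C (\<eta> B) f) = Fm (Comp C (Gm (Fm f)) (\<eta> A))"
        using F.Fm_Comp[OF f \<eta>(1)] \<eta>(2) o by auto
    qed
    then show "Comp C (\<eta> B) (id f) = Comp C ((Gm \<circ> Fm) f) (\<eta> A)" by simp
  qed
  have nat_\<epsilon>: "natural_iso D D (Fo \<circ> Go) (Fm \<circ> Gm) id id \<epsilon>"
    unfolding natural_iso_def
  proof (intro conjI ballI allI)
    show "is_iso D ((Fo \<circ> Go) M) (id M) (\<epsilon> M)" if "M \<in> Obj D" for M using \<epsilon>[OF that] by simp
    fix M N g assume g: "g \<in> homset D M N"
    have "Comp D g (\<epsilon> M) \<in> homset D (Fo (Go M)) N" using DC[OF \<epsilon>h g] obj[OF g] by blast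
    then show "Comp D (\<epsilon> N) ((Fm \<circ> Gm) g) = Comp D (id g) (\<epsilon> M)"
      using e1 by (simp add: Gm(2)[OF g])
  qed
  show ?thesis unfolding is_equivalence_def using F G nat_\<eta> nat_\<epsilon> by blast
qed

section \<open>The two tensor categories\<close>

lemma infinite_mps: "infinite (UNIV :: ('k::field_char_0, 'n::finite) mps set)"
proof
  assume "finite (UNIV :: ('k, 'n) mps set)"
  then have "finite (range (mps_const :: 'k \<Rightarrow> ('k, 'n) mps))" by (rule finite_subset[rotated]) simp
  moreover have "inj (mps_const :: 'k \<Rightarrow> ('k, 'n) mps)" by (auto simp: inj_def mps_const_inj)
  ultimately have "finite (UNIV :: 'k set)" by (simp add: finite_image_iff)
  then show False using infinite_UNIV_char_0 by blast
qed

text \<open>Homogeneity over constants is a case of the Leibniz rule, since constants have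
  derivative zero; so a connection is exactly a family of derivations.\<close>

lemma bundles_eq: "bundles = {E. opm UNIV mps_deriv (E :: (('k::field, 'n::finite) mps, 'u, 'n) opmod)}"
proof -
  have "is_connection (UMod E) (Act E) \<longleftrightarrow> (\<forall>i. is_der (mps_deriv i) (UMod E) (Act E i))"
    if "is_module (UMod E)" for E :: "(('k, 'n) mps, 'u, 'n) opmod"
  proof -
    interpret umod "UMod E" by unfold_locales fact
    show ?thesis
      by (auto simp: is_connection_def is_der_def is_additive_def mps_deriv_const Pi_def)
  qed
  then show ?thesis by (auto simp: bundles_def opm_def finite_free_is_module)
qed

locale disk =
  fixes \<iota> :: "('k::field_char_0, 'n::finite) mps \<Rightarrow> 'u" and \<kappa> :: "'k \<Rightarrow> 'w"
  assumes inj_iota: "inj \<iota>" and inj_kappa: "inj \<kappa>"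
begin

sublocale Bo: opmods \<iota> "UNIV :: 'n set" mps_deriv
  by unfold_locales (simp_all add: inj_iota infinite_mps mps_deriv_add mps_deriv_mult)

sublocale Ro: opmods \<kappa> "FL_ge2 :: ('k, 'n) free_lie set" "\<lambda>_ _. 0"
  by unfold_locales (simp_all add: inj_kappa infinite_UNIV_char_0)

sublocale B: opmod_category \<iota> "UNIV :: 'n set" mps_deriv bundles "mps_const :: 'k \<Rightarrow> _"
  by unfold_locales
     (auto simp: bundles_eq Bo.opm_tens Bo.opm_unit mps_const_add mps_const_mult mps_const_1 mps_deriv_const)

text \<open>Linear operators are derivations over the zero map, and a difference is a sum with a
  multiple by \<open>- 1\<close>; in this form the rules for modules with operators and for
  coordinates apply directly.\<close>

lemma rep_iff: "(M :: ('k, 'w, ('k, 'n) free_lie) opmod) \<in> representations \<longleftrightarrow> Ro.opmi M \<and>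
     (\<forall>m \<in> Car M. \<forall>x \<in> FL_ge2. \<forall>y \<in> FL_ge2.
        Act M (x + y) m = Act M x m \<oplus>\<^bsub>UMod M\<^esub> Act M y m \<and>
        (\<forall>c. Act M (fl_scale c x) m = c \<odot>\<^bsub>UMod M\<^esub> Act M x m) \<and>
        Act M (fl_bracket x y) m = Act M x (Act M y m) \<oplus>\<^bsub>UMod M\<^esub> (- 1) \<odot>\<^bsub>UMod M\<^esub> Act M y (Act M x m))"
  (is "_ \<longleftrightarrow> _ \<and> ?R")
proof (cases "finite_free (UMod M)")
  case True
  interpret umod "UMod M" by unfold_locales (rule finite_free_is_module[OF True])
  have lin: "is_linear (UMod M) (UMod M) D \<longleftrightarrow> is_der (\<lambda>_. 0) (UMod M) D" for D
  proof -
    have key: "0 \<odot>\<^bsub>UMod M\<^esub> x \<oplus>\<^bsub>UMod M\<^esub> r \<odot>\<^bsub>UMod M\<^esub> D x = r \<odot>\<^bsub>UMod M\<^esub> D x"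
      if "is_additive (UMod M) (UMod M) D" "x \<in> Car M" for r x
      by (simp only: smult_l_null l_zero smult_closed is_additiveD(1)[OF that] that(2))
    show ?thesis
    proof
      assume l: "is_linear (UMod M) (UMod M) D"
      note a = is_linear_additive[OF l]
      show "is_der (\<lambda>_. 0) (UMod M) D"
        unfolding is_der_def using a key[OF a] is_linearD(3)[OF l] by (intro conjI allI ballI) (assumption, metis)
    next
      assume d: "is_der (\<lambda>_. 0) (UMod M) D"
      then have a: "is_additive (UMod M) (UMod M) D" by (simp only: is_der_def)
      show "is_linear (UMod M) (UMod M) D"
        unfolding is_linear_def using a key[OF a] is_derD(3)[OF d] by (intro conjI allI ballI) (assumption, metis)
    qed
  qed
  have m: "x \<ominus>\<^bsub>UMod M\<^esub> y = x \<oplus>\<^bsub>UMod M\<^esub> (- 1) \<odot>\<^bsub>UMod M\<^esub> y" if "y \<in> Car M" for x y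
    using that by (simp add: a_minus_def minus_eq_smult)
  have c: "Act M x m \<in> Car M" if "\<forall>x\<in>FL_ge2. is_linear (UMod M) (UMod M) (Act M x)" "x \<in> FL_ge2" "m \<in> Car M" for x m
    by (rule is_linearD(1)[OF bspec[OF that(1,2)] that(3)])
  have "is_rep_FL_ge2 (UMod M) (Act M) \<longleftrightarrow> (\<forall>x\<in>FL_ge2. is_linear (UMod M) (UMod M) (Act M x)) \<and> ?R"
    unfolding is_rep_FL_ge2_def
  proof (rule conj_cong[OF HOL.refl], rule ball_cong[OF HOL.refl], rule ball_cong[OF HOL.refl], rule ball_cong[OF HOL.refl],
      rule conj_cong[OF HOL.refl], rule conj_cong[OF HOL.refl])
    fix m and x y :: "('k, 'n) free_lie"
    assume *: "\<forall>x\<in>FL_ge2. is_linear (UMod M) (UMod M) (Act M x)" "m \<in> Car M" "x \<in> FL_ge2" "y \<in> FL_ge2"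
    have "Act M y (Act M x m) \<in> Car M" by (intro c[OF *(1)] *)
    from m[OF this, of "Act M x (Act M y m)"]
    show "(Act M (fl_bracket x y) m = Act M x (Act M y m) \<ominus>\<^bsub>UMod M\<^esub> Act M y (Act M x m)) =
      (Act M (fl_bracket x y) m = Act M x (Act M y m) \<oplus>\<^bsub>UMod M\<^esub> (- 1) \<odot>\<^bsub>UMod M\<^esub> Act M y (Act M x m))"
      by (simp only:)
  qed
  then show ?thesis
    using True by (simp only: representations_def opm_def mem_Collect_eq lin[symmetric] simp_thms conj_assoc)
next
  case False
  then show ?thesis by (auto simp: representations_def opm_def)
qed

text \<open>The identities are additive in the vector and are checked on elementary tensors. In the
  commutator the mixed terms, with \<open>x\<close> on one factor and \<open>y\<close> on the other,
  cancel.\<close>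

lemma rep_tens:
  assumes M: "(M :: ('k, 'w, ('k, 'n) free_lie) opmod) \<in> representations" and N: "N \<in> representations"
  shows "tens_obj M N \<in> representations"
proof -
  have o: "Ro.opmi M" "Ro.opmi N" using M N by (auto simp: rep_iff)
  define T where "T = tens_obj M N"
  have oT: "Ro.opmi T" unfolding T_def by (rule Ro.opm_tens[OF o])
  interpret Mm: umod "UMod M" by (rule Ro.opm_umod[OF o(1)])
  interpret Nm: umod "UMod N" by (rule Ro.opm_umod[OF o(2)])
  interpret Tm: umod "UMod T" by (rule Ro.opm_umod[OF oT])
  obtain Bs :: "'w set" and \<gamma> where c: "coords (UMod T) Bs \<gamma>"
    using finite_free_coords[OF Ro.opm_ff[OF oT]] by blast
  note cD = coordsD[OF c]
  define t where "t = tens M N"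
  note tl = Ro.tens_linear[OF o, folded T_def t_def] and tc = Ro.tens_closed[OF o, folded T_def t_def]
    and at = Ro.Act_tens[OF o, folded T_def t_def]
  note ca = Ro.Act_closed[OF o(1)] Ro.Act_closed[OF o(2)] Ro.Act_closed[OF oT]
  note aT = Ro.Act_add[OF oT] and sT = Ro.Act_smult[OF oT]
  note FL = FL_ge2_add FL_ge2_scale FL_ge2_bracket
  have rM: "Act M (x + y) m = Act M x m \<oplus>\<^bsub>UMod M\<^esub> Act M y m" "Act M (fl_scale k x) m = k \<odot>\<^bsub>UMod M\<^esub> Act M x m"
    "Act M (fl_bracket x y) m = Act M x (Act M y m) \<oplus>\<^bsub>UMod M\<^esub> (- 1) \<odot>\<^bsub>UMod M\<^esub> Act M y (Act M x m)"
    if "x \<in> FL_ge2" "y \<in> FL_ge2" "m \<in> Car M" for x y m k using M that by (auto simp: rep_iff)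
  have rN: "Act N (x + y) m = Act N x m \<oplus>\<^bsub>UMod N\<^esub> Act N y m" "Act N (fl_scale k x) m = k \<odot>\<^bsub>UMod N\<^esub> Act N x m"
    "Act N (fl_bracket x y) m = Act N x (Act N y m) \<oplus>\<^bsub>UMod N\<^esub> (- 1) \<odot>\<^bsub>UMod N\<^esub> Act N y (Act N x m)"
    if "x \<in> FL_ge2" "y \<in> FL_ge2" "m \<in> Car N" for x y m k using N that by (auto simp: rep_iff)
  have 1: "Act T (x + y) z = Act T x z \<oplus>\<^bsub>UMod T\<^esub> Act T y z"
    if xy: "x \<in> FL_ge2" "y \<in> FL_ge2" and z: "z \<in> Car T" for x y z
    using z unfolding T_def
  proof (rule Ro.tens_induct[OF o], unfold T_def[symmetric] t_def[symmetric])
    show "Act T (x + y) (t m n) = Act T x (t m n) \<oplus>\<^bsub>UMod T\<^esub> Act T y (t m n)"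
      if mn: "m \<in> Car M" "n \<in> Car N" for m n
      using mn xy by (simp add: FL at rM rN tl tc ca Tm.a_ac)
    show "Act T (x + y) (u \<oplus>\<^bsub>UMod T\<^esub> v) = Act T x (u \<oplus>\<^bsub>UMod T\<^esub> v) \<oplus>\<^bsub>UMod T\<^esub> Act T y (u \<oplus>\<^bsub>UMod T\<^esub> v)"
      if "u \<in> Car T" "v \<in> Car T" "Act T (x + y) u = Act T x u \<oplus>\<^bsub>UMod T\<^esub> Act T y u"
        "Act T (x + y) v = Act T x v \<oplus>\<^bsub>UMod T\<^esub> Act T y v" for u v
      using that xy by (simp add: FL aT ca Tm.a_ac)
  qed
  have 2: "Act T (fl_scale k x) z = k \<odot>\<^bsub>UMod T\<^esub> Act T x z"
    if xy: "x \<in> FL_ge2" and z: "z \<in> Car T" for x k z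
    using z unfolding T_def
  proof (rule Ro.tens_induct[OF o], unfold T_def[symmetric] t_def[symmetric])
    show "Act T (fl_scale k x) (t m n) = k \<odot>\<^bsub>UMod T\<^esub> Act T x (t m n)"
      if mn: "m \<in> Car M" "n \<in> Car N" for m n
      using mn xy by (simp add: FL at rM(2)[OF xy xy] rN(2)[OF xy xy] tl tc ca Tm.smult_r_distr)
    show "Act T (fl_scale k x) (u \<oplus>\<^bsub>UMod T\<^esub> v) = k \<odot>\<^bsub>UMod T\<^esub> Act T x (u \<oplus>\<^bsub>UMod T\<^esub> v)"
      if "u \<in> Car T" "v \<in> Car T" "Act T (fl_scale k x) u = k \<odot>\<^bsub>UMod T\<^esub> Act T x u"
        "Act T (fl_scale k x) v = k \<odot>\<^bsub>UMod T\<^esub> Act T x v" for u v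
      using that xy by (simp add: FL aT ca Tm.smult_r_distr)
  qed
  have 3: "Act T (fl_bracket x y) z = Act T x (Act T y z) \<oplus>\<^bsub>UMod T\<^esub> (- 1) \<odot>\<^bsub>UMod T\<^esub> Act T y (Act T x z)"
    if xy: "x \<in> FL_ge2" "y \<in> FL_ge2" and z: "z \<in> Car T" for x y z
    using z unfolding T_def
  proof (rule Ro.tens_induct[OF o], unfold T_def[symmetric] t_def[symmetric])
    show "Act T (fl_bracket x y) (t m n) = Act T x (Act T y (t m n)) \<oplus>\<^bsub>UMod T\<^esub> (- 1) \<odot>\<^bsub>UMod T\<^esub> Act T y (Act T x (t m n))"
      if mn: "m \<in> Car M" "n \<in> Car N" for m n
      \<comment> \<open>Coordinates turn the cancellation of mixed terms into arithmetic in the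
        field.\<close>
      by (rule cD(5)) (use mn xy in \<open>simp_all add: FL at rM rN tl tc ca aT cD(3,4)\<close>)
    show "Act T (fl_bracket x y) (u \<oplus>\<^bsub>UMod T\<^esub> v) = Act T x (Act T y (u \<oplus>\<^bsub>UMod T\<^esub> v)) \<oplus>\<^bsub>UMod T\<^esub>
        (- 1) \<odot>\<^bsub>UMod T\<^esub> Act T y (Act T x (u \<oplus>\<^bsub>UMod T\<^esub> v))"
      if "u \<in> Car T" "v \<in> Car T"
        "Act T (fl_bracket x y) u = Act T x (Act T y u) \<oplus>\<^bsub>UMod T\<^esub> (- 1) \<odot>\<^bsub>UMod T\<^esub> Act T y (Act T x u)"
        "Act T (fl_bracket x y) v = Act T x (Act T y v) \<oplus>\<^bsub>UMod T\<^esub> (- 1) \<odot>\<^bsub>UMod T\<^esub> Act T y (Act T x v)" for u v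
      by (rule cD(5)) (use that xy in \<open>simp_all add: FL aT ca cD(3,4)\<close>)
  qed
  show ?thesis using oT 1 2 3 unfolding rep_iff T_def[symmetric] by blast
qed

sublocale R: opmod_category \<kappa> "FL_ge2 :: ('k, 'n) free_lie set" "\<lambda>_ _. 0" representations "\<lambda>c. c"
proof unfold_locales
  show "unit_obj \<kappa> (\<lambda>_ _. 0) \<in> (representations :: ('k, 'w, ('k, 'n) free_lie) opmod set)"
    unfolding rep_iff using Ro.opm_unit by (auto simp: Ro.Car_unit Ro.unit_ops)
qed (use rep_tens in \<open>auto simp: rep_iff\<close>)

end

section \<open>Charts of a bundle\<close>

definition vsc :: "'k::field_char_0 \<Rightarrow> (nat \<Rightarrow> 'k) \<Rightarrow> nat \<Rightarrow> 'k" where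
  "vsc c v = (\<lambda>j. c * v j)"

interpretation V: series_space vsc
  by unfold_locales (auto simp: vsc_def fun_eq_iff algebra_simps)

definition sec_on :: "nat \<Rightarrow> (('n \<Rightarrow> nat) \<Rightarrow> nat \<Rightarrow> 'k::zero) set" where
  "sec_on N = {s. \<forall>a. \<forall>j\<ge>N. s a j = 0}"

definition cut :: "nat \<Rightarrow> (nat \<Rightarrow> 'k::zero) \<Rightarrow> nat \<Rightarrow> 'k" where
  "cut N v = (\<lambda>j. if j < N then v j else 0)"

abbreviation scut :: "nat \<Rightarrow> (('n \<Rightarrow> nat) \<Rightarrow> nat \<Rightarrow> 'k::zero) \<Rightarrow> ('n \<Rightarrow> nat) \<Rightarrow> nat \<Rightarrow> 'k" where
  "scut N s \<equiv> (\<lambda>a. cut N (s a))"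

lemma sec_on_iff: "s \<in> sec_on N \<longleftrightarrow> scut N s = s"
  by (auto simp: sec_on_def cut_def fun_eq_iff)

lemma cut_add: "cut N (v + w) = cut N v + cut N (w :: nat \<Rightarrow> 'k::field_char_0)"
  and cut_vsc: "cut N (vsc c v) = vsc c (cut N v)" and cut_cut: "cut N (cut N v) = cut N v"
  by (auto simp: cut_def fun_eq_iff vsc_def)

lemma vsc_linear_iff: "Vector_Spaces.linear vsc vsc T \<longleftrightarrow>
    (\<forall>x y. T (x + y) = T x + T y) \<and> (\<forall>c x. T (vsc c x) = vsc c (T x))"
  using V.VS by (auto simp: Vector_Spaces.linear_iff)

lemma V_smul_map:
  assumes "\<And>v w. T (v + w) = T v + T w" "\<And>c v. T (vsc c v) = vsc c (T v)"
  shows "(\<lambda>a. T (V.smul f s a)) = V.smul f (\<lambda>a. T (s a))"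
  by (rule ext) (simp add: V.smul_def conv_def case_prod_unfold V.additive_sum[of T, OF assms(1)] assms(2))

lemma V_pd_map:
  assumes "\<And>c v. T (vsc c v) = vsc c (T v)"
  shows "(\<lambda>a. T (pd vsc i s a)) = pd vsc i (\<lambda>a. T (s a))"
  by (simp add: pd_def assms fun_eq_iff)

lemma scut_add: "scut N (s + t) = scut N s + scut N (t :: ('n \<Rightarrow> nat) \<Rightarrow> nat \<Rightarrow> 'k::field_char_0)"
  by (simp add: fun_eq_iff cut_add)

lemma scut_smul: "scut N (V.smul f s) = V.smul f (scut N s)"
  by (rule V_smul_map[OF cut_add cut_vsc])

lemma scut_pd: "scut N (pd vsc i s) = pd vsc i (scut N s)"
  by (rule V_pd_map[OF cut_vsc])

text \<open>A vector of power series read as one series of vectors, to which the theory of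
  \<open>series_space\<close> applies. Vectors are padded by zeros from index \<open>N\<close> on,
  and \<open>sec_on N\<close> singles out the padded sections.\<close>

definition chart :: "(('k::field_char_0, 'n::finite) mps, 'u) module \<Rightarrow> nat \<Rightarrow> ('u \<Rightarrow> ('n \<Rightarrow> nat) \<Rightarrow> nat \<Rightarrow> 'k) \<Rightarrow> bool" where
  "chart M N \<Gamma> \<longleftrightarrow> bij_betw \<Gamma> (carrier M) (sec_on N) \<and>
     (\<forall>x \<in> carrier M. \<forall>y \<in> carrier M. \<Gamma> (x \<oplus>\<^bsub>M\<^esub> y) = \<Gamma> x + \<Gamma> y) \<and>
     (\<forall>f. \<forall>x \<in> carrier M. \<Gamma> (f \<odot>\<^bsub>M\<^esub> x) = V.smul f (\<Gamma> x))"

lemma coords_chart: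
  fixes \<gamma> :: "'u \<Rightarrow> nat \<Rightarrow> ('k::field_char_0, 'n::finite) mps"
  assumes c: "coords M {..<N} \<gamma>"
  shows "chart M N (\<lambda>x a j. mps_coeff (\<gamma> x j) a)"
proof -
  have sm: "(\<lambda>a j. mps_coeff (f * g j) a) = V.smul f (\<lambda>a j. mps_coeff (g j) a)"
    for f and g :: "nat \<Rightarrow> ('k, 'n) mps"
    by (intro ext) (simp add: V.smul_def mps_coeff_mult conv_def case_prod_unfold V.sum_fun_apply vsc_def)
  have "bij_betw (\<lambda>g a j. mps_coeff (g j) a) (supp_on {..<N} :: (nat \<Rightarrow> ('k, 'n) mps) set) (sec_on N)"
  proof (rule bij_betw_byWitness[where f' = "\<lambda>s j. Abs_mps (\<lambda>a. s a j)"])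
    have z: "mps_coeff (0 :: ('k, 'n) mps) a = 0" for a by (simp add: zero_mps.rep_eq)
    show "(\<lambda>g a j. mps_coeff (g j) a) ` (supp_on {..<N} :: (nat \<Rightarrow> ('k, 'n) mps) set) \<subseteq> sec_on N"
      by (auto simp: supp_on_def sec_on_def z)
    show "(\<lambda>s j. Abs_mps (\<lambda>a. s a j)) ` sec_on N \<subseteq> (supp_on {..<N} :: (nat \<Rightarrow> ('k, 'n) mps) set)"
      by (auto simp: supp_on_def sec_on_def zero_mps_def)
  qed (auto simp: mps_coeff_inverse Abs_mps_inverse)
  moreover have "bij_betw \<gamma> (carrier M) (supp_on {..<N})" using c by (simp add: coords_def)
  ultimately have bij: "bij_betw (\<lambda>x a j. mps_coeff (\<gamma> x j) a) (carrier M) (sec_on N)"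
    using bij_betw_trans[of \<gamma> "carrier M" "supp_on {..<N}"] by (simp add: comp_def)
  show ?thesis
    unfolding chart_def
  proof (intro conjI ballI allI bij)
    fix x y f assume x: "x \<in> carrier M"
    show "(\<lambda>a j. mps_coeff (\<gamma> (x \<oplus>\<^bsub>M\<^esub> y) j) a) = (\<lambda>a j. mps_coeff (\<gamma> x j) a) + (\<lambda>a j. mps_coeff (\<gamma> y j) a)"
      if "y \<in> carrier M"
      using x that by (intro ext) (simp add: coordsD(3)[OF c] plus_mps.rep_eq)
    show "(\<lambda>a j. mps_coeff (\<gamma> (f \<odot>\<^bsub>M\<^esub> x) j) a) = V.smul f (\<lambda>a j. mps_coeff (\<gamma> x j) a)"
      using x by (simp add: coordsD(4)[OF c] sm)
  qed
qed

lemma additive_finsum: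
  assumes M: "umod M" and N: "umod N" and h: "is_additive M N h" and I: "finite I" and f: "\<And>i. i \<in> I \<Longrightarrow> f i \<in> carrier M"
  shows "h (\<Oplus>\<^bsub>M\<^esub>i\<in>I. f i) = (\<Oplus>\<^bsub>N\<^esub>i\<in>I. h (f i))"
proof -
  interpret M: umod M by fact
  interpret N: umod N by fact
  have "h \<zero>\<^bsub>M\<^esub> \<oplus>\<^bsub>N\<^esub> h \<zero>\<^bsub>M\<^esub> = h \<zero>\<^bsub>M\<^esub>" using is_additiveD(2)[OF h, of "\<zero>\<^bsub>M\<^esub>" "\<zero>\<^bsub>M\<^esub>"] by simp
  then have z: "h \<zero>\<^bsub>M\<^esub> = \<zero>\<^bsub>N\<^esub>" using is_additiveD(1)[OF h, of "\<zero>\<^bsub>M\<^esub>"] by simp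
  show ?thesis using I f
  proof (induct I)
    case (insert i I)
    have "f \<in> I \<rightarrow> carrier M" "f i \<in> carrier M" using insert(4) by auto
    then show ?case
      using insert(1,2,3) insert(4) is_additiveD[OF h]
      by (simp add: M.finsum_insert N.finsum_insert Pi_def)
  qed (simp add: z)
qed

text \<open>The counterpart of \<open>lie_eval\<close> for the operations of a module record. It is
  computed in the bundle itself, so that it depends on no chart and can be compared along arrows and
  tensor products.\<close>

primrec cev :: "(('k::field, 'n::finite) mps, 'u, 'n) opmod \<Rightarrow> ('k, 'n) lie_term \<Rightarrow> 'u \<Rightarrow> 'u" where
  "cev E (Gen v) = (\<lambda>x. \<Oplus>\<^bsub>UMod E\<^esub>i\<in>UNIV. mps_const (vec_nth v i) \<odot>\<^bsub>UMod E\<^esub> Act E i x)"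
| "cev E Zero = (\<lambda>x. \<zero>\<^bsub>UMod E\<^esub>)"
| "cev E (Add s t) = (\<lambda>x. cev E s x \<oplus>\<^bsub>UMod E\<^esub> cev E t x)"
| "cev E (Scale c t) = (\<lambda>x. mps_const c \<odot>\<^bsub>UMod E\<^esub> cev E t x)"
| "cev E (Brk s t) = (\<lambda>x. cev E s (cev E t x) \<oplus>\<^bsub>UMod E\<^esub> (- 1) \<odot>\<^bsub>UMod E\<^esub> cev E t (cev E s x))"

text \<open>The submodule \<open>m M\<close>, for the maximal ideal \<open>m\<close> of the power series ring.\<close>

inductive_set vanish :: "(('k::field, 'n::finite) mps, 'u) module \<Rightarrow> 'u set" for M where
  zero: "\<zero>\<^bsub>M\<^esub> \<in> vanish M"
| add: "x \<in> vanish M \<Longrightarrow> y \<in> vanish M \<Longrightarrow> x \<oplus>\<^bsub>M\<^esub> y \<in> vanish M"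
| smult: "mps_coeff f idx0 = 0 \<Longrightarrow> x \<in> carrier M \<Longrightarrow> f \<odot>\<^bsub>M\<^esub> x \<in> vanish M"

lemma chartD:
  assumes "chart M N \<Gamma>"
  shows "x \<in> carrier M \<Longrightarrow> y \<in> carrier M \<Longrightarrow> \<Gamma> (x \<oplus>\<^bsub>M\<^esub> y) = \<Gamma> x + \<Gamma> y"
    "x \<in> carrier M \<Longrightarrow> \<Gamma> (f \<odot>\<^bsub>M\<^esub> x) = V.smul f (\<Gamma> x)"
    "x \<in> carrier M \<Longrightarrow> scut N (\<Gamma> x) = \<Gamma> x"
    "x \<in> carrier M \<Longrightarrow> y \<in> carrier M \<Longrightarrow> \<Gamma> x = \<Gamma> y \<Longrightarrow> x = y"
    "scut N s = s \<Longrightarrow> inv_into (carrier M) \<Gamma> s \<in> carrier M"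
    "scut N s = s \<Longrightarrow> \<Gamma> (inv_into (carrier M) \<Gamma> s) = s"
proof -
  have b: "bij_betw \<Gamma> (carrier M) (sec_on N)" using assms by (simp add: chart_def)
  show "x \<in> carrier M \<Longrightarrow> scut N (\<Gamma> x) = \<Gamma> x"
    using bij_betwE[OF b] by (simp add: sec_on_iff)
  show "x \<in> carrier M \<Longrightarrow> y \<in> carrier M \<Longrightarrow> \<Gamma> x = \<Gamma> y \<Longrightarrow> x = y"
    using b by (simp add: bij_betw_def inj_on_def)
  assume "scut N s = s"
  then have s: "s \<in> sec_on N" by (simp add: sec_on_iff)
  show "inv_into (carrier M) \<Gamma> s \<in> carrier M" using bij_betwE[OF bij_betw_inv_into[OF b]] s by simp
  show "\<Gamma> (inv_into (carrier M) \<Gamma> s) = s" by (rule bij_betw_inv_into_right[OF b s])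
qed (use assms in \<open>auto simp: chart_def\<close>)

lemma V_smul_minus1: "V.smul (- 1) s = - (s :: ('n::finite \<Rightarrow> nat) \<Rightarrow> nat \<Rightarrow> 'k::field_char_0)"
proof -
  have m: "(- 1 :: ('k, 'n) mps) = mps_const (- 1)"
    by (rule mps_eqI) (simp add: uminus_mps.rep_eq one_mps.rep_eq mps_const.rep_eq)
  show ?thesis unfolding m V.smul_const by (simp add: V.ssc_def vsc_def fun_eq_iff)
qed

lemma chart_zero:
  assumes "umod M" "chart M N \<Gamma>" shows "\<Gamma> \<zero>\<^bsub>M\<^esub> = 0"
proof -
  interpret umod M by fact
  show ?thesis using chartD(1)[OF assms(2), of "\<zero>\<^bsub>M\<^esub>" "\<zero>\<^bsub>M\<^esub>"] by simp
qed

lemma chart_finsum: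
  assumes M: "umod M" and c: "chart M N \<Gamma>" and I: "finite I" and f: "\<And>i. i \<in> I \<Longrightarrow> f i \<in> carrier M"
  shows "\<Gamma> (\<Oplus>\<^bsub>M\<^esub>i\<in>I. f i) = (\<Sum>i\<in>I. \<Gamma> (f i))"
proof -
  interpret umod M by fact
  show ?thesis using I f
  proof (induct I)
    case (insert i I)
    have "f \<in> I \<rightarrow> carrier M" "f i \<in> carrier M" using insert(4) by auto
    then show ?case using insert(1,2,3) insert(4) by (simp add: finsum_insert chartD(1)[OF c])
  qed (simp add: chart_zero[OF M c])
qed

lemma vanish_carrier:
  assumes "umod M" "x \<in> vanish M" shows "x \<in> carrier M"
proof -
  interpret umod M by fact
  show ?thesis using assms(2) by induct auto
qed

text \<open>Hadamard's lemma in the chart: a section with zero constant term is a combination of the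
  variables whose coefficients, given by \<open>shift\<close>, are again padded sections. So any
  chart detects the intrinsic submodule.\<close>

lemma vanish_chart:
  fixes M :: "(('k::field_char_0, 'n::finite) mps, 'u) module"
  assumes M: "umod M" and c: "chart M N \<Gamma>" and x: "x \<in> carrier M"
  shows "x \<in> vanish M \<longleftrightarrow> \<Gamma> x idx0 = 0"
proof
  interpret umod M by fact
  assume "x \<in> vanish M"
  then show "\<Gamma> x idx0 = 0"
  proof induct
    case zero
    show ?case by (simp add: chart_zero[OF M c])
  next
    case (add x y)
    then show ?case using vanish_carrier[OF M] by (simp add: chartD(1)[OF c])
  next
    case (smult f x)
    then show ?case by (simp add: chartD(2)[OF c] V.smul_0)
  qed
next
  interpret umod M by fact
  assume 0: "\<Gamma> x idx0 = 0"
  define y where "y i = inv_into (carrier M) \<Gamma> (V.shift i (\<Gamma> x))" for i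
  have sh: "scut N (V.shift i (\<Gamma> x)) = V.shift i (\<Gamma> x)" for i
    using fun_cong[OF chartD(3)[OF c x]] by (auto simp: V.shift_def fun_eq_iff cut_def)
  have y: "y i \<in> carrier M" "\<Gamma> (y i) = V.shift i (\<Gamma> x)" for i
    using chartD(5,6)[OF c sh] by (simp_all add: y_def)
  have cl: "mps_var i \<odot>\<^bsub>M\<^esub> y i \<in> carrier M" for i using y by simp
  have v: "mps_coeff (mps_var i) idx0 = (0 :: 'k)" for i :: 'n
    using inc_ne_idx0[of idx0 i] by (simp add: mps_var.rep_eq del: fun_upd_apply)
  have "\<Gamma> (\<Oplus>\<^bsub>M\<^esub>i\<in>UNIV. mps_var i \<odot>\<^bsub>M\<^esub> y i) = \<Gamma> x"
    using V.shift_decompose[of "\<Gamma> x", OF 0] by (simp add: chart_finsum[OF M c _ cl] chartD(2)[OF c] y)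
  then have "(\<Oplus>\<^bsub>M\<^esub>i\<in>UNIV. mps_var i \<odot>\<^bsub>M\<^esub> y i) = x"
    using x by (intro chartD(4)[OF c] finsum_closed) (auto simp: y)
  moreover have "(\<Oplus>\<^bsub>M\<^esub>i\<in>I. mps_var i \<odot>\<^bsub>M\<^esub> y i) \<in> vanish M" if "finite I" for I
    using that
  proof induct
    case (insert i I)
    have "mps_var i \<odot>\<^bsub>M\<^esub> y i \<in> vanish M" by (rule vanish.smult[OF v y(1)])
    then show ?case using vanish.add[OF _ insert(3)] insert(1,2) cl by (simp add: finsum_insert Pi_def)
  qed (simp add: vanish.zero)
  ultimately show "x \<in> vanish M" by (metis finite)
qed

text \<open>Bundles of all ranks are charted by series with values in \<open>nat \<Rightarrow> 'k\<close>; \<open>D\<close> extends the connection from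
  the first \<open>N\<close> coordinates to all of them.\<close>

locale bundle_chart =
  fixes E :: "(('k::field_char_0, 'n::finite) mps, 'u, 'n) opmod" and N :: nat
    and \<Gamma> :: "'u \<Rightarrow> ('n \<Rightarrow> nat) \<Rightarrow> nat \<Rightarrow> 'k" and D :: "'n \<Rightarrow> (('n \<Rightarrow> nat) \<Rightarrow> nat \<Rightarrow> 'k) \<Rightarrow> ('n \<Rightarrow> nat) \<Rightarrow> nat \<Rightarrow> 'k"
  assumes E: "E \<in> bundles" and chart: "chart (UMod E) N \<Gamma>" and conn_D: "V.conn D"
    and chart_Act: "x \<in> Car E \<Longrightarrow> \<Gamma> (Act E i x) = D i (\<Gamma> x)"
    and scut_D: "scut N (D i s) = D i (scut N s)"
begin

sublocale S: series_conn vsc D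
  by unfold_locales (rule conn_D)

lemma umod_E: "umod (UMod E)"
  using E by (auto simp: bundles_eq opm_def umod_def finite_free_is_module)

sublocale M: umod "UMod E" by (rule umod_E)

lemma Act_Car: "x \<in> Car E \<Longrightarrow> Act E i x \<in> Car E"
  using E by (auto simp: bundles_eq opm_def intro: is_derD(1))

lemma cev_Car: "x \<in> Car E \<Longrightarrow> cev E t x \<in> Car E"
  by (induct t arbitrary: x) (auto simp: Act_Car intro!: M.finsum_closed)

lemma chart_cev:
  "x \<in> Car E \<Longrightarrow> \<Gamma> (cev E t x) = lie_eval V.ssc D t (\<Gamma> x)"
proof (induct t arbitrary: x)
  case (Gen v)
  then show ?case
    by (simp add: chart_finsum[OF umod_E chart] Act_Car chartD(2)[OF chart] chart_Act V.smul_const)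
next
  case Zero
  then show ?case by (simp add: chart_zero[OF umod_E chart] zero_fun_def)
next
  case (Add s t)
  then show ?case by (simp add: chartD(1)[OF chart] cev_Car)
next
  case (Scale c t)
  then show ?case by (simp add: chartD(2)[OF chart] cev_Car V.smul_const)
next
  case (Brk s t)
  then show ?case by (simp add: chartD(1,2)[OF chart] cev_Car V_smul_minus1)
qed

lemma chart_lie_act: "x \<in> Car E \<Longrightarrow> \<Gamma> (cev E t x) = lie_act V.ssc D (abs_free_lie t) (\<Gamma> x)"
  by (simp add: chart_cev S.L.lie_act_abs)

lemma chart_fibre: "x \<in> Car E \<Longrightarrow> abs_free_lie t \<in> FL_ge2 \<Longrightarrow> \<Gamma> (cev E t x) idx0 = S.fibre (abs_free_lie t) (\<Gamma> x idx0)"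
  by (simp add: chart_lie_act S.lie_act_idx0)

lemma scut_lie_act: "scut N (lie_act V.ssc D y s) = lie_act V.ssc D y (scut N s)"
  unfolding lie_act_def
proof (rule lie_eval_intertwine[where h = "scut N"])
  show "scut N (V.ssc c s) = V.ssc c (scut N s)" for c and s :: "('n \<Rightarrow> nat) \<Rightarrow> nat \<Rightarrow> 'k"
    by (simp add: V.ssc_def cut_vsc)
  show "scut N (s + t) = scut N s + scut N t" for s t :: "('n \<Rightarrow> nat) \<Rightarrow> nat \<Rightarrow> 'k" by (rule scut_add)
  show "scut N (D i s) = D i (scut N s)" for i s by (rule scut_D)
qed

lemma cut_fibre: "cut N (S.fibre y v) = S.fibre y (cut N v)"
proof -
  have "scut N (V.cst v) = (V.cst (cut N v) :: ('n \<Rightarrow> nat) \<Rightarrow> nat \<Rightarrow> 'k)"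
    by (auto simp: V.cst_def fun_eq_iff cut_def)
  then show ?thesis using fun_cong[OF scut_lie_act[of y "V.cst v"], of idx0] by (simp add: S.fibre_def)
qed

lemma scut_taylor: "scut N (S.taylor s) = S.taylor (scut N s)"
proof -
  have "scut N (ord_pow D a s) = ord_pow D a (scut N s)" for a
    by (rule ord_pow_intertwine[where h = "scut N"]) (rule scut_D)
  note * = fun_cong[OF this, where x = idx0]
  show ?thesis by (rule ext) (simp only: S.taylor_def cut_vsc *)
qed

lemma chart_ord_pow: "x \<in> Car E \<Longrightarrow> ord_pow (Act E) a x \<in> Car E \<and> \<Gamma> (ord_pow (Act E) a x) = ord_pow D a (\<Gamma> x)"
  by (induct a arbitrary: x rule: idx_induct) (simp_all add: ord_pow.simps Act_Car chart_Act)

lemma section_exists: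
  assumes "cut N v = v" shows "\<exists>x \<in> Car E. \<Gamma> x idx0 = v"
proof -
  have s: "scut N (V.cst v) = (V.cst v :: ('n \<Rightarrow> nat) \<Rightarrow> nat \<Rightarrow> 'k)"
    using assms by (auto simp: V.cst_def fun_eq_iff cut_def)
  show ?thesis using chartD(5,6)[OF chart s] by (intro bexI[of _ "inv_into (Car E) \<Gamma> (V.cst v)"]) (simp_all add: V.cst_0)
qed

lemma cut_idx0: "x \<in> Car E \<Longrightarrow> cut N (\<Gamma> x idx0) = \<Gamma> x idx0"
  using fun_cong[OF chartD(3)[OF chart]] by simp

end

text \<open>The transported connection on the first \<open>N\<close> coordinates is completed by the
  trivial connection \<open>pd\<close> on the others. The sum satisfies Leibniz, commutes with the
  projection \<open>scut N\<close>, and is the given connection on padded sections.\<close>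

lemma bundle_chart_exists:
  fixes E :: "(('k::field_char_0, 'n::finite) mps, 'u, 'n) opmod"
  assumes E: "E \<in> bundles"
  shows "\<exists>N \<Gamma> D. bundle_chart E N \<Gamma> D"
proof -
  have ff: "finite_free (UMod E)" and der: "\<And>i. is_der (mps_deriv i) (UMod E) (Act E i)"
    using E by (auto simp: bundles_eq opm_def)
  interpret umod "UMod E" by unfold_locales (rule finite_free_is_module[OF ff])
  obtain N :: nat and \<gamma> where "coords (UMod E) {..<N} \<gamma>" using finite_free_nat_coords[OF ff] by blast
  then obtain \<Gamma> where c: "chart (UMod E) N (\<Gamma> :: 'u \<Rightarrow> ('n \<Rightarrow> nat) \<Rightarrow> nat \<Rightarrow> 'k)" using coords_chart by blast
  note cD = chartD[OF c] and dD = is_derD[OF der]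
  define G where "G = inv_into (Car E) \<Gamma>"
  have sc: "scut N (scut N s) = scut N s" for s :: "('n \<Rightarrow> nat) \<Rightarrow> nat \<Rightarrow> 'k" by (simp add: cut_cut)
  have G: "G (scut N s) \<in> Car E" "\<Gamma> (G (scut N s)) = scut N s" for s
    using cD(5,6)[OF sc] by (simp_all add: G_def)
  have G\<Gamma>: "G (\<Gamma> x) = x" if "x \<in> Car E" for x
    using G[of "\<Gamma> x"] cD(3)[OF that] that by (intro cD(4)) simp_all
  have Gadd: "G (scut N (s + t)) = G (scut N s) \<oplus>\<^bsub>UMod E\<^esub> G (scut N t)" for s t
  proof (rule cD(4)[OF G(1)])
    show "G (scut N s) \<oplus>\<^bsub>UMod E\<^esub> G (scut N t) \<in> Car E" using G(1) by simp
    show "\<Gamma> (G (scut N (s + t))) = \<Gamma> (G (scut N s) \<oplus>\<^bsub>UMod E\<^esub> G (scut N t))"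
      unfolding G(2) cD(1)[OF G(1) G(1)] by (rule scut_add)
  qed
  have Gsm: "G (scut N (V.smul f s)) = f \<odot>\<^bsub>UMod E\<^esub> G (scut N s)" for f s
  proof (rule cD(4)[OF G(1)])
    show "f \<odot>\<^bsub>UMod E\<^esub> G (scut N s) \<in> Car E" using G(1) by simp
    show "\<Gamma> (G (scut N (V.smul f s))) = \<Gamma> (f \<odot>\<^bsub>UMod E\<^esub> G (scut N s))"
      unfolding G(2) cD(2)[OF G(1)] by (rule scut_smul)
  qed
  define D where "D i s = \<Gamma> (Act E i (G (scut N s))) + pd vsc i (s - scut N s)" for i s
  have "V.conn D"
    unfolding V.conn_def
  proof (intro conjI allI)
    fix i f s t
    show "D i (s + t) = D i s + D i t"
    proof -
      have "s + t - scut N (s + t) = (s - scut N s) + (t - scut N t)"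
        unfolding scut_add by simp
      then show ?thesis unfolding D_def by (simp only: Gadd dD(1,2) G cD(1) V.pd_add) (simp only: ac_simps)
    qed
    show "D i (V.smul f s) = V.smul (mps_deriv i f) s + V.smul f (D i s)"
    proof -
      have "V.smul f s - scut N (V.smul f s) = V.smul f (s - scut N s)"
        unfolding scut_smul V.smul_diff by simp
      then have "D i (V.smul f s) = \<Gamma> (Act E i (f \<odot>\<^bsub>UMod E\<^esub> G (scut N s))) + pd vsc i (V.smul f (s - scut N s))"
        unfolding D_def Gsm by simp
      also have "\<dots> = (V.smul (mps_deriv i f) (scut N s) + V.smul f (\<Gamma> (Act E i (G (scut N s)))))
          + (V.smul (mps_deriv i f) (s - scut N s) + V.smul f (pd vsc i (s - scut N s)))"
        by (simp only: dD(1,3) G cD(1,2) smult_closed V.pd_smul)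
      also have "\<dots> = V.smul (mps_deriv i f) (scut N s + (s - scut N s)) + V.smul f (D i s)"
        unfolding D_def V.smul_add_right by (simp only: ac_simps)
      also have "scut N s + (s - scut N s) = s" by simp
      finally show ?thesis .
    qed
  qed
  moreover have "\<Gamma> (Act E i x) = D i (\<Gamma> x)" if "x \<in> Car E" for i x
  proof -
    have "pd vsc i (0 :: ('n \<Rightarrow> nat) \<Rightarrow> nat \<Rightarrow> 'k) = 0" by (simp add: pd_def vsc_def fun_eq_iff)
    moreover have "\<Gamma> x - scut N (\<Gamma> x) = 0" using cD(3)[OF that] by simp
    ultimately show ?thesis using G\<Gamma>[OF that] cD(3)[OF that] by (simp only: D_def add_0_right)
  qed
  moreover have "scut N (D i s) = D i (scut N s)" for i s
  proof -
    have "scut N (pd vsc i (s - scut N s)) = pd vsc i (scut N (s - scut N s))" by (rule scut_pd)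
    also have "scut N (s - scut N s) = 0" by (auto simp: fun_eq_iff cut_def)
    also have "pd vsc i (0 :: ('n \<Rightarrow> nat) \<Rightarrow> nat \<Rightarrow> 'k) = 0" by (simp add: pd_def vsc_def fun_eq_iff)
    finally have 1: "scut N (pd vsc i (s - scut N s)) = 0" .
    have 2: "scut N s - scut N (scut N s) = 0" unfolding sc by simp
    have "scut N (D i s) = scut N (\<Gamma> (Act E i (G (scut N s)))) + scut N (pd vsc i (s - scut N s))"
      unfolding D_def by (rule scut_add)
    also have "\<dots> = \<Gamma> (Act E i (G (scut N s))) + pd vsc i 0"
      unfolding 1 using cD(3)[OF dD(1)[OF G(1)]] \<open>pd vsc i 0 = 0\<close> by simp
    also have "\<dots> = D i (scut N s)" unfolding D_def 2 sc by simp
    finally show ?thesis .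
  qed
  ultimately have "bundle_chart E N \<Gamma> D" using E c by unfold_locales auto
  then show ?thesis by blast
qed

section \<open>Fibres at the origin\<close>

text \<open>The quotient of \<open>E\<close> by the maximal ideal with its action, characterised by
  the projection \<open>p\<close> instead of constructed. The relation is used in both directions:
  for a fibre of a given bundle and for a bundle with a given fibre.\<close>

definition is_fibre :: "(('k::field_char_0, 'n::finite) mps, 'u, 'n) opmod \<Rightarrow> ('k, 'w, ('k, 'n) free_lie) opmod
    \<Rightarrow> ('u \<Rightarrow> 'w) \<Rightarrow> bool" where
  "is_fibre E M p \<longleftrightarrow> E \<in> bundles \<and> M \<in> representations \<and> p ` Car E = Car M \<and>
     (\<forall>x\<in>Car E. \<forall>y\<in>Car E. p (x \<oplus>\<^bsub>UMod E\<^esub> y) = p x \<oplus>\<^bsub>UMod M\<^esub> p y) \<and>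
     (\<forall>f. \<forall>x\<in>Car E. p (f \<odot>\<^bsub>UMod E\<^esub> x) = mps_coeff f idx0 \<odot>\<^bsub>UMod M\<^esub> p x) \<and>
     (\<forall>x\<in>Car E. p x = \<zero>\<^bsub>UMod M\<^esub> \<longleftrightarrow> x \<in> vanish (UMod E)) \<and>
     (\<forall>t. abs_free_lie t \<in> FL_ge2 \<longrightarrow> (\<forall>x\<in>Car E. p (cev E t x) = Act M (abs_free_lie t) (p x)))"

lemma is_fibreD:
  assumes "is_fibre E M p"
  shows "E \<in> bundles" "M \<in> representations" "x \<in> Car E \<Longrightarrow> p x \<in> Car M"
    "m \<in> Car M \<Longrightarrow> \<exists>x\<in>Car E. p x = m"
    "x \<in> Car E \<Longrightarrow> y \<in> Car E \<Longrightarrow> p (x \<oplus>\<^bsub>UMod E\<^esub> y) = p x \<oplus>\<^bsub>UMod M\<^esub> p y"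
    "x \<in> Car E \<Longrightarrow> p (f \<odot>\<^bsub>UMod E\<^esub> x) = mps_coeff f idx0 \<odot>\<^bsub>UMod M\<^esub> p x"
    "x \<in> Car E \<Longrightarrow> p x = \<zero>\<^bsub>UMod M\<^esub> \<longleftrightarrow> x \<in> vanish (UMod E)"
    "abs_free_lie t \<in> FL_ge2 \<Longrightarrow> x \<in> Car E \<Longrightarrow> p (cev E t x) = Act M (abs_free_lie t) (p x)"
proof -
  have im: "p ` Car E = Car M" using assms by (simp add: is_fibre_def)
  show "m \<in> Car M \<Longrightarrow> \<exists>x\<in>Car E. p x = m" unfolding im[symmetric] by blast
  show "x \<in> Car E \<Longrightarrow> p x \<in> Car M" unfolding im[symmetric] by blast
qed (use assms in \<open>simp_all add: is_fibre_def\<close>)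

lemma supp_cut: "v \<in> supp_on {..<N} \<longleftrightarrow> cut N v = v"
  by (auto simp: supp_on_def cut_def fun_eq_iff)

lemma umod_eq_iff:
  fixes M :: "('r::comm_ring_1, 'u) module" (structure)
  assumes "umod M" "x \<in> carrier M" "y \<in> carrier M"
  shows "x \<oplus> (- 1) \<odot>\<^bsub>M\<^esub> y = \<zero> \<longleftrightarrow> x = y"
proof -
  interpret umod M by fact
  show ?thesis
  proof
    assume *: "x \<oplus> (- 1) \<odot>\<^bsub>M\<^esub> y = \<zero>"
    have "x = x \<oplus> ((- 1) \<odot>\<^bsub>M\<^esub> y \<oplus> y)"
      using assms(2,3) by (simp add: minus_eq_smult[symmetric] l_neg)
    also have "\<dots> = (x \<oplus> (- 1) \<odot>\<^bsub>M\<^esub> y) \<oplus> y" using assms(2,3) by (simp add: a_assoc)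
    also have "\<dots> = y" using * assms(3) by simp
    finally show "x = y" .
  next
    assume "x = y"
    then show "x \<oplus> (- 1) \<odot>\<^bsub>M\<^esub> y = \<zero>" using assms(3) by (simp add: minus_eq_smult[symmetric] r_neg)
  qed
qed

lemma mps_coeff_minus1: "mps_coeff (- 1 :: ('k::field_char_0, 'n::finite) mps) idx0 = - 1"
  by (simp add: uminus_mps.rep_eq one_mps.rep_eq idx0_def)

context disk begin

lemma fibre_exists:
  assumes "E \<in> bundles"
  shows "\<exists>M p. is_fibre (E :: (('k, 'n) mps, 'u, 'n) opmod) (M :: ('k, 'w, ('k, 'n) free_lie) opmod) p"
proof -
  obtain N \<Gamma> D where "bundle_chart E N \<Gamma> D" using bundle_chart_exists[OF assms] by blast
  then interpret bundle_chart E N \<Gamma> D .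
  obtain enc :: "(nat \<Rightarrow> 'k) \<Rightarrow> 'w" where enc: "inj_on enc (supp_on {..<N})"
    using encode_exists[OF inj_kappa infinite_UNIV_char_0, of "{..<N}"] by auto
  define dec where "dec = inv_into (supp_on {..<N}) enc"
  \<comment> \<open>The fibre as seen in the chart, on vectors supported below \<open>N\<close>,
    encoded in the universe of representations.\<close>
  define M where "M = \<lparr>UMod = free_mod enc {..<N}, Act = (\<lambda>y m. enc (S.fibre y (dec m)))\<rparr>"
  note fm = free_mod[OF enc finite_lessThan, folded dec_def]
  have UM: "UMod M = free_mod enc {..<N}" "Act M y m = enc (S.fibre y (dec m))" for y m by (simp_all add: M_def)
  have c: "coords (UMod M) {..<N} dec" using fm(2) by (simp add: UM)
  have Mm: "is_module (UMod M)" using fm(1) by (simp add: UM)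
  interpret Mm: umod "UMod M" by unfold_locales (rule Mm)
  have Car: "enc v \<in> Car M" "dec (enc v) = v" if "cut N v = v" for v
    using that fm(3) enc by (auto simp: UM supp_cut[symmetric] dec_def)
  have dec: "cut N (dec m) = dec m" if "m \<in> Car M" for m
    using that c by (auto simp: supp_cut[symmetric] coords_def bij_betw_def)
  have eqI: "m = m'" if "m \<in> Car M" "m' \<in> Car M" "dec m = dec m'" for m m'
    using coordsD(5)[OF c that(1,2)] that(3) by simp
  have decs: "dec (m \<oplus>\<^bsub>UMod M\<^esub> m') = dec m + dec m'" "dec (r \<odot>\<^bsub>UMod M\<^esub> m) = vsc r (dec m)"
    if "m \<in> Car M" "m' \<in> Car M" for m m' r
    using that by (auto simp: coordsD(3,4)[OF c] vsc_def)
  have act: "Act M y m \<in> Car M" "dec (Act M y m) = S.fibre y (dec m)" if "m \<in> Car M" for y m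
    using Car[of "S.fibre y (dec m)"] cut_fibre[of y "dec m"] dec[OF that] by (simp_all add: UM)
  have fl: "S.fibre y (v + w) = S.fibre y v + S.fibre y w" "S.fibre y (vsc k v) = vsc k (S.fibre y v)" for y v w k
    using S.linear_fibre[of y] by (auto simp: vsc_linear_iff)
  have z: "vsc 0 v = 0" for v :: "nat \<Rightarrow> 'k" by (simp add: vsc_def fun_eq_iff)
  have m1: "vsc (- 1) v = - v" for v :: "nat \<Rightarrow> 'k" by (simp add: vsc_def fun_eq_iff)
  have opm: "Ro.opmi M"
    unfolding opm_def is_der_def is_additive_def
  proof (intro conjI ballI allI funcsetI)
    show "finite_free (UMod M)" by (rule coords_finite_free[OF Mm c])
    fix y m m' r assume m: "m \<in> Car M"
    show "Act M y m \<in> Car M" by (rule act(1)[OF m])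
    show "Act M y (m \<oplus>\<^bsub>UMod M\<^esub> m') = Act M y m \<oplus>\<^bsub>UMod M\<^esub> Act M y m'" if "m' \<in> Car M"
      by (rule eqI) (use m that in \<open>simp_all add: act decs fl del: plus_fun_apply\<close>)
    show "Act M y (r \<odot>\<^bsub>UMod M\<^esub> m) = 0 \<odot>\<^bsub>UMod M\<^esub> m \<oplus>\<^bsub>UMod M\<^esub> r \<odot>\<^bsub>UMod M\<^esub> Act M y m"
      by (rule eqI) (use m act[OF m] decs[OF Mm.smult_closed[OF m] m] in \<open>simp_all add: act decs fl z\<close>)
  qed
  have "M \<in> representations"
    unfolding rep_iff
  proof (intro conjI opm ballI allI)
    fix m and x y :: "('k, 'n) free_lie" and c :: 'k
    assume m: "m \<in> Car M" and x: "x \<in> FL_ge2" and y: "y \<in> FL_ge2"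
    show "Act M (x + y) m = Act M x m \<oplus>\<^bsub>UMod M\<^esub> Act M y m"
      by (rule eqI) (use m x y in \<open>simp_all add: act decs S.F.rho_add\<close>)
    show "Act M (fl_scale c x) m = c \<odot>\<^bsub>UMod M\<^esub> Act M x m"
      by (rule eqI) (use m x y act[OF m] decs[OF act(1)[OF m] m] in \<open>simp_all add: S.F.rho_scale\<close>)
    have s: "dec ((- 1) \<odot>\<^bsub>UMod M\<^esub> Act M y (Act M x m)) = - dec (Act M y (Act M x m))"
      using decs(2)[OF act(1)[OF act(1)[OF m]] m] m1 by simp
    show "Act M (fl_bracket x y) m = Act M x (Act M y m) \<oplus>\<^bsub>UMod M\<^esub> (- 1) \<odot>\<^bsub>UMod M\<^esub> Act M y (Act M x m)"
      by (rule eqI) (use m x y s in \<open>simp_all add: act decs S.F.rho_bracket\<close>)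
  qed
  moreover define p where "p x = enc (\<Gamma> x idx0)" for x
  have p: "p x \<in> Car M" "dec (p x) = \<Gamma> x idx0" if "x \<in> Car E" for x
    using Car[OF cut_idx0[OF that]] by (simp_all add: p_def)
  have "is_fibre E M p"
    unfolding is_fibre_def
  proof (intro conjI ballI allI impI assms)
    show "M \<in> representations" by fact
    show "p ` Car E = Car M"
    proof (intro equalityI subsetI)
      fix m assume m: "m \<in> Car M"
      obtain x where x: "x \<in> Car E" "\<Gamma> x idx0 = dec m" using section_exists[OF dec[OF m]] by blast
      have "p x = m" by (rule eqI) (use p x m in auto)
      then show "m \<in> p ` Car E" using x by blast
    qed (use p in auto)
    fix x assume x: "x \<in> Car E"
    show "p (x \<oplus>\<^bsub>UMod E\<^esub> y) = p x \<oplus>\<^bsub>UMod M\<^esub> p y" if "y \<in> Car E" for y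
      by (rule eqI) (use x that in \<open>simp_all add: p decs chartD(1)[OF chart]\<close>)
    show "p (f \<odot>\<^bsub>UMod E\<^esub> x) = mps_coeff f idx0 \<odot>\<^bsub>UMod M\<^esub> p x" for f
      by (rule eqI) (use x p[OF x] decs(2)[OF p(1)[OF x] p(1)[OF x]] in \<open>simp_all add: p chartD(2)[OF chart] V.smul_0\<close>)
    show "p x = \<zero>\<^bsub>UMod M\<^esub> \<longleftrightarrow> x \<in> vanish (UMod E)"
    proof -
      have "dec \<zero>\<^bsub>UMod M\<^esub> = 0" using coords_zero[OF Mm c] by (simp add: fun_eq_iff)
      then have "p x = \<zero>\<^bsub>UMod M\<^esub> \<longleftrightarrow> \<Gamma> x idx0 = 0" using eqI[OF p(1)[OF x] Mm.zero_closed] p(2)[OF x] by auto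
      then show ?thesis using vanish_chart[OF umod_E chart x] by simp
    qed
    fix t :: "('k, 'n) lie_term" assume t: "abs_free_lie t \<in> FL_ge2"
    show "p (cev E t x) = Act M (abs_free_lie t) (p x)"
      by (rule eqI) (use x t in \<open>simp_all add: p act cev_Car chart_fibre\<close>)
  qed
  then show ?thesis by blast
qed

lemma bundle_with_fibre_exists:
  assumes M: "(M :: ('k, 'w, ('k, 'n) free_lie) opmod) \<in> representations"
  shows "\<exists>E p. is_fibre (E :: (('k, 'n) mps, 'u, 'n) opmod) M p"
proof -
  have opm: "Ro.opmi M" using M by (simp add: rep_iff)
  have Mm: "is_module (UMod M)" by (rule finite_free_is_module[OF Ro.opm_ff[OF opm]])
  interpret Mm: umod "UMod M" by unfold_locales (rule Mm)
  obtain N :: nat and c where c: "coords (UMod M) {..<N} c" using finite_free_nat_coords[OF Ro.opm_ff[OF opm]] by blast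
  \<comment> \<open>Since \<open>d\<close> cuts first it is total, and \<open>\<rho>\<close> will be
    the representation extended by zero to the coordinates from \<open>N\<close> on.\<close>
  define d where "d v = inv_into (Car M) c (cut N v)" for v
  have cb: "bij_betw c (Car M) (supp_on {..<N})" using c by (simp add: coords_def)
  have d: "d v \<in> Car M" "c (d v) = cut N v" for v
    using bij_betwE[OF bij_betw_inv_into[OF cb]] bij_betw_inv_into_right[OF cb, of "cut N v"]
    by (auto simp: d_def supp_cut cut_cut)
  have cc: "cut N (c m) = c m" if "m \<in> Car M" for m using bij_betwE[OF cb] that by (simp add: supp_cut)
  have eqI: "m = m'" if "m \<in> Car M" "m' \<in> Car M" "c m = c m'" for m m'
    using coordsD(5)[OF c that(1,2)] that(3) by simp
  have dc: "d (c m) = m" if "m \<in> Car M" for m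
    by (rule eqI) (use d cc that in auto)
  have cs: "c (m \<oplus>\<^bsub>UMod M\<^esub> m') = c m + c m'" "c (r \<odot>\<^bsub>UMod M\<^esub> m) = vsc r (c m)"
    if "m \<in> Car M" "m' \<in> Car M" for m m' r
    using that by (auto simp: coordsD(3,4)[OF c] vsc_def)
  have d_add: "d (v + w) = d v \<oplus>\<^bsub>UMod M\<^esub> d w" for v w
    by (rule eqI) (use d(1) in \<open>simp_all add: cs d(2) cut_add\<close>)
  have d_sc: "d (vsc r v) = r \<odot>\<^bsub>UMod M\<^esub> d v" for r v
    by (rule eqI) (use d(1) cs(2)[OF d(1)[of v] d(1)[of v]] in \<open>simp_all add: d(2) cut_vsc\<close>)
  define \<rho> where "\<rho> y v = c (Act M y (d v))" for y v
  have act: "Act M y m \<in> Car M" if "y \<in> FL_ge2" "m \<in> Car M" for y m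
    using Ro.Act_closed[OF opm that] .
  have ra: "Act M (x + y) m = Act M x m \<oplus>\<^bsub>UMod M\<^esub> Act M y m" "Act M (fl_scale k x) m = k \<odot>\<^bsub>UMod M\<^esub> Act M x m"
    "Act M (fl_bracket x y) m = Act M x (Act M y m) \<oplus>\<^bsub>UMod M\<^esub> (- 1) \<odot>\<^bsub>UMod M\<^esub> Act M y (Act M x m)"
    if "x \<in> FL_ge2" "y \<in> FL_ge2" "m \<in> Car M" for x y m k using M that by (auto simp: rep_iff)
  have m1: "vsc (- 1) v = - v" for v :: "nat \<Rightarrow> 'k" by (simp add: vsc_def fun_eq_iff)
  interpret R: fl_rep vsc \<rho>
  proof (intro fl_rep.intro V.series_space_axioms fl_rep_axioms.intro)
    fix x y :: "('k, 'n) free_lie" and k v assume x: "x \<in> FL_ge2"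
    have sm: "Act M x (k \<odot>\<^bsub>UMod M\<^esub> m) = k \<odot>\<^bsub>UMod M\<^esub> Act M x m" if "m \<in> Car M" for m k
      using Ro.Act_smult[OF opm x that, of k] that act[OF x that] by simp
    show "Vector_Spaces.linear vsc vsc (\<rho> x)"
      unfolding vsc_linear_iff \<rho>_def
      using x d(1) act[OF x d(1)] cs(2)[OF act[OF x d(1)] act[OF x d(1)]]
      by (auto simp: d_add d_sc Ro.Act_add[OF opm] sm cs(1) simp del: plus_fun_apply)
    show "\<rho> (fl_scale k x) v = vsc k (\<rho> x v)"
      using ra(2)[OF x x d(1)] cs(2)[OF act[OF x d(1)] d(1)] by (simp add: \<rho>_def)
    assume y: "y \<in> FL_ge2"
    show "\<rho> (x + y) v = \<rho> x v + \<rho> y v"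
      using ra(1)[OF x y d(1)] cs(1)[OF act[OF x d(1)] act[OF y d(1)]] by (simp add: \<rho>_def)
    have s: "c ((- 1) \<odot>\<^bsub>UMod M\<^esub> Act M y (Act M x (d v))) = - c (Act M y (Act M x (d v)))"
      using cs(2)[OF act[OF y act[OF x d(1)]] d(1)] m1 by simp
    show "\<rho> (fl_bracket x y) v = \<rho> x (\<rho> y v) - \<rho> y (\<rho> x v)"
      using ra(3)[OF x y d(1)] act[OF x act[OF y d(1)]] act[OF y act[OF x d(1)]] act[OF x d(1)] act[OF y d(1)] s
      by (simp add: \<rho>_def cs(1) dc)
  qed
  have dcut: "d (cut N v) = d v" for v by (simp add: d_def cut_cut)
  have cut_rho: "cut N (\<rho> y v) = \<rho> y v" "\<rho> y (cut N v) = \<rho> y v" if "y \<in> FL_ge2" for y v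
    using cc[OF act[OF that d(1)]] by (simp_all add: \<rho>_def dcut)
  have cz: "cut N 0 = (0 :: nat \<Rightarrow> 'k)" by (simp add: cut_def fun_eq_iff)
  \<comment> \<open>A gauge coefficient is zero or comes from an element of degree at least two,
    hence involves only the first \<open>N\<close> coordinates. So the standard connection preserves
    padded sections.\<close>
  have gauge: "cut N (R.gauge j a v) = R.gauge j a v" "R.gauge j a (cut N v) = R.gauge j a v" for j a v
  proof -
    have "a \<in> tail_idx j \<or> ord_pow fl_ad a (fl_var j) \<in> (FL_ge2 :: ('k, 'n) free_lie set)"
      using ord_pow_ad_var_FL idx0_tail by metis
    then show "cut N (R.gauge j a v) = R.gauge j a v" "R.gauge j a (cut N v) = R.gauge j a v"
      by (auto simp: R.gauge_def R.op_series_def cut_vsc cut_rho cz zero_fun_def[symmetric])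
  qed
  have scut_std: "scut N (R.std_conn i s) = R.std_conn i (scut N s)" for i s
  proof -
    have "scut N (conv (\<lambda>T. T) (R.gauge i) s) = conv (\<lambda>T. T) (R.gauge i) (scut N s)"
      by (rule ext) (simp add: conv_def case_prod_unfold V.additive_sum[of "cut N", OF cut_add] gauge)
    then show ?thesis unfolding R.std_conn_def scut_add scut_pd by simp
  qed
  obtain enc :: "(nat \<Rightarrow> ('k, 'n) mps) \<Rightarrow> 'u" where enc: "inj_on enc (supp_on {..<N})"
    using encode_exists[OF inj_iota infinite_mps, of "{..<N}"] by auto
  define T where "T = free_mod enc {..<N}"
  note fm = free_mod[OF enc finite_lessThan, folded T_def]
  obtain \<Gamma> where ch: "chart T N (\<Gamma> :: 'u \<Rightarrow> ('n \<Rightarrow> nat) \<Rightarrow> nat \<Rightarrow> 'k)" using coords_chart[OF fm(2)] by blast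
  note cD = chartD[OF ch]
  interpret Tm: umod T by unfold_locales (rule fm(1))
  \<comment> \<open>The standard connection of \<open>\<rho>\<close>, pulled back to a free module
    of rank \<open>N\<close> in the universe of bundles.\<close>
  define E where "E = \<lparr>UMod = T, Act = (\<lambda>i x. inv_into (carrier T) \<Gamma> (R.std_conn i (\<Gamma> x)))\<rparr>"
  have UE: "UMod E = T" by (simp add: E_def)
  have aE: "Act E i x \<in> carrier T" "\<Gamma> (Act E i x) = R.std_conn i (\<Gamma> x)" if "x \<in> carrier T" for i x
    using cD(5,6)[of "R.std_conn i (\<Gamma> x)"] cD(3)[OF that] scut_std[of i "\<Gamma> x"] by (simp_all add: E_def)
  interpret St: series_conn vsc R.std_conn by unfold_locales (rule R.conn_std_conn)
  have "opm UNIV mps_deriv E"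
    unfolding opm_def is_der_def is_additive_def UE
  proof (intro conjI ballI allI funcsetI)
    show "finite_free T" by (rule coords_finite_free[OF fm(1,2)])
    fix i x y f assume x: "x \<in> carrier T"
    show "Act E i x \<in> carrier T" by (rule aE(1)[OF x])
    show "Act E i (x \<oplus>\<^bsub>T\<^esub> y) = Act E i x \<oplus>\<^bsub>T\<^esub> Act E i y" if "y \<in> carrier T"
      by (rule cD(4)) (use x that aE(1) in \<open>simp_all add: aE(2) cD(1) St.D_add del: plus_fun_apply\<close>)
    show "Act E i (f \<odot>\<^bsub>T\<^esub> x) = mps_deriv i f \<odot>\<^bsub>T\<^esub> x \<oplus>\<^bsub>T\<^esub> f \<odot>\<^bsub>T\<^esub> Act E i x"
      by (rule cD(4)) (use x aE(1) in \<open>simp_all add: aE(2) cD(1,2) St.D_smul del: plus_fun_apply\<close>)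
  qed
  then have E: "E \<in> bundles" by (simp add: bundles_eq)
  interpret bundle_chart E N \<Gamma> R.std_conn
    by unfold_locales (use E ch aE scut_std R.conn_std_conn in \<open>auto simp: UE\<close>)
  define p where "p x = d (\<Gamma> x idx0)" for x
  have "is_fibre E M p"
    unfolding is_fibre_def
  proof (intro conjI ballI allI impI E M)
    show "p ` Car E = Car M"
    proof (intro equalityI subsetI)
      fix m assume m: "m \<in> Car M"
      obtain x where x: "x \<in> Car E" "\<Gamma> x idx0 = c m" using section_exists[OF cc[OF m]] by blast
      have "p x = m" using x m by (simp add: p_def dc)
      then show "m \<in> p ` Car E" using x by blast
    qed (use d(1) in \<open>auto simp: p_def\<close>)
    fix x assume x: "x \<in> Car E"
    show "p (x \<oplus>\<^bsub>UMod E\<^esub> y) = p x \<oplus>\<^bsub>UMod M\<^esub> p y" if "y \<in> Car E" for y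
      using x that by (simp add: p_def chartD(1)[OF chart] d_add)
    show "p (f \<odot>\<^bsub>UMod E\<^esub> x) = mps_coeff f idx0 \<odot>\<^bsub>UMod M\<^esub> p x" for f
      using x by (simp add: p_def chartD(2)[OF chart] V.smul_0 d_sc)
    show "p x = \<zero>\<^bsub>UMod M\<^esub> \<longleftrightarrow> x \<in> vanish (UMod E)"
    proof -
      have "c \<zero>\<^bsub>UMod M\<^esub> = 0" using coords_zero[OF Mm c] by (simp add: fun_eq_iff)
      then have "p x = \<zero>\<^bsub>UMod M\<^esub> \<longleftrightarrow> \<Gamma> x idx0 = 0"
        using eqI[OF d(1) Mm.zero_closed] d(2)[of "\<Gamma> x idx0"] cut_idx0[OF x] by (auto simp: p_def)
      then show ?thesis using vanish_chart[OF umod_E chart x] by simp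
    qed
    fix t :: "('k, 'n) lie_term" assume t: "abs_free_lie t \<in> FL_ge2"
    show "p (cev E t x) = Act M (abs_free_lie t) (p x)"
      using x t by (simp add: p_def chart_lie_act R.lie_act_std_conn_0) (simp add: \<rho>_def dc act d(1))
  qed
  then show ?thesis by blast
qed

section \<open>Faithfulness and fullness of the fibre functor\<close>

lemma fibre_eq_iff:
  assumes f: "is_fibre (E :: (('k, 'n) mps, 'u, 'n) opmod) (M :: ('k, 'w, ('k, 'n) free_lie) opmod) p"
    and ch: "bundle_chart E N \<Gamma> D" and z: "z \<in> Car E" "z' \<in> Car E"
  shows "p z = p z' \<longleftrightarrow> \<Gamma> z idx0 = \<Gamma> z' idx0"
proof -
  interpret bundle_chart E N \<Gamma> D by fact
  have uM: "umod (UMod M)" using is_fibreD(2)[OF f] by (intro R.Obs_umod) simp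
  \<comment> \<open>The projection and evaluation at the origin in the chart have the same kernel;
    the claim is this fact for the difference of the two sections.\<close>
  define w where "w = z \<oplus>\<^bsub>UMod E\<^esub> (- 1) \<odot>\<^bsub>UMod E\<^esub> z'"
  have w: "w \<in> Car E" using z by (simp add: w_def)
  have "p w = p z \<oplus>\<^bsub>UMod M\<^esub> (- 1) \<odot>\<^bsub>UMod M\<^esub> p z'"
    using z by (simp add: w_def is_fibreD(5,6)[OF f] mps_coeff_minus1)
  then have "p z = p z' \<longleftrightarrow> p w = \<zero>\<^bsub>UMod M\<^esub>"
    using umod_eq_iff[OF uM is_fibreD(3)[OF f z(1)] is_fibreD(3)[OF f z(2)]] by simp
  also have "\<dots> \<longleftrightarrow> \<Gamma> w idx0 = 0"
    using is_fibreD(7)[OF f w] vanish_chart[OF umod_E chart w] by simp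
  also have "\<Gamma> w idx0 = \<Gamma> z idx0 - \<Gamma> z' idx0"
    using z by (simp add: w_def chartD(1,2)[OF chart] V_smul_minus1)
  also have "\<Gamma> z idx0 - \<Gamma> z' idx0 = 0 \<longleftrightarrow> \<Gamma> z idx0 = \<Gamma> z' idx0" by (rule right_minus_eq)
  finally show ?thesis .
qed

text \<open>An arrow commutes with ordered covariant derivatives, so the Taylor coefficients of the
  image of \<open>x\<close> come from values at the origin of images of derivatives of
  \<open>x\<close>. The fibres determine these values, and \<open>taylor_inj\<close> recovers the
  section.\<close>

lemma fibre_functor_faithful:
  fixes E E' :: "(('k, 'n) mps, 'u, 'n) opmod" and M' :: "('k, 'w, ('k, 'n) free_lie) opmod"
  assumes f': "is_fibre E' M' p'"
    and f: "B.arr f1" "B.arr f2" "Source f1 = E" "Source f2 = E" "Target f1 = E'" "Target f2 = E'"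
    and eq: "\<And>x. x \<in> Car E \<Longrightarrow> p' (Fun f1 x) = p' (Fun f2 x)"
  shows "f1 = f2"
proof (rule B.arr_eqI)
  have EO: "E \<in> bundles" using B.arrD(1)[OF f(1)] f by simp
  obtain N \<Gamma> D where ch: "bundle_chart E N \<Gamma> D" using bundle_chart_exists[OF EO] by blast
  then interpret E: bundle_chart E N \<Gamma> D .
  obtain N' \<Gamma>' D' where ch': "bundle_chart E' N' \<Gamma>' D'" using bundle_chart_exists[OF is_fibreD(1)[OF f']] by blast
  then interpret E': bundle_chart E' N' \<Gamma>' D' .
  fix x assume "x \<in> Car (Source f1)"
  then have x: "x \<in> Car E" using f by simp
  have pw: "Fun g (ord_pow (Act E) a x) = ord_pow (Act E') a (Fun g x)" if "B.arr g" "Source g = E" "Target g = E'" "x \<in> Car E" for g a x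
    using that
    by (induct a arbitrary: x rule: idx_induct) (simp_all add: ord_pow.simps B.Fun_Act E.Act_Car)
  have cl: "Fun f1 y \<in> Car E'" "Fun f2 y \<in> Car E'" if "y \<in> Car E" for y
    using B.Fun_closed[OF f(1,5), of y] B.Fun_closed[OF f(2,6), of y] that by (simp_all only: f(3,4))
  have "E'.S.taylor (\<Gamma>' (Fun f1 x)) a = E'.S.taylor (\<Gamma>' (Fun f2 x)) a" for a
  proof -
    note c = cl[OF x]
    have xa: "ord_pow (Act E) a x \<in> Car E" using E.chart_ord_pow[OF x] by blast
    have "p' (Fun f1 (ord_pow (Act E) a x)) = p' (Fun f2 (ord_pow (Act E) a x))" by (rule eq[OF xa])
    then have "\<Gamma>' (Fun f1 (ord_pow (Act E) a x)) idx0 = \<Gamma>' (Fun f2 (ord_pow (Act E) a x)) idx0"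
      by (rule iffD1[OF fibre_eq_iff[OF f' ch' cl(1)[OF xa] cl(2)[OF xa]]])
    then have "ord_pow D' a (\<Gamma>' (Fun f1 x)) idx0 = ord_pow D' a (\<Gamma>' (Fun f2 x)) idx0"
      using E'.chart_ord_pow[OF c(1), of a] E'.chart_ord_pow[OF c(2), of a]
      by (simp add: pw[OF f(1,3,5) x] pw[OF f(2,4,6) x])
    then show ?thesis by (simp add: E'.S.taylor_def)
  qed
  then have e: "\<Gamma>' (Fun f1 x) = \<Gamma>' (Fun f2 x)" by (rule E'.S.taylor_inj[OF ext])
  show "Fun f1 x = Fun f2 x" by (rule chartD(4)[OF E'.chart cl(1)[OF x] cl(2)[OF x] e])
qed (use f in simp_all)

text \<open>In Taylor coordinates the extension is the fibre map applied coefficientwise: the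
  standard connections are built from the representations, with which this map commutes. Conjugation
  by the Taylor maps gives an arrow for the given connections.\<close>

lemma fibre_functor_full:
  fixes E E' :: "(('k, 'n) mps, 'u, 'n) opmod" and M M' :: "('k, 'w, ('k, 'n) free_lie) opmod"
  assumes fE: "is_fibre E M p" and fE': "is_fibre E' M' p'"
    and g: "R.arr g" "Source g = M" "Target g = M'"
  shows "\<exists>f. B.arr f \<and> Source f = E \<and> Target f = E' \<and> (\<forall>x\<in>Car E. p' (Fun f x) = Fun g (p x))"
proof -
  obtain N \<Gamma> D where ch: "bundle_chart E N \<Gamma> D" using bundle_chart_exists[OF is_fibreD(1)[OF fE]] by blast
  then interpret E: bundle_chart E N \<Gamma> D .
  obtain N' \<Gamma>' D' where ch': "bundle_chart E' N' \<Gamma>' D'" using bundle_chart_exists[OF is_fibreD(1)[OF fE']] by blast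
  then interpret E': bundle_chart E' N' \<Gamma>' D' .
  note pE = is_fibreD[OF fE] and pE' = is_fibreD[OF fE']
  \<comment> \<open>The map \<open>g\<close> in chart coordinates, through lifts of fibre vectors to
    sections; \<open>cut N\<close> extends it to all vectors.\<close>
  define h where "h v = \<Gamma>' (SOME z'. z' \<in> Car E' \<and> (\<exists>z\<in>Car E. \<Gamma> z idx0 = cut N v \<and> p' z' = Fun g (p z))) idx0" for v
  have h: "h (\<Gamma> z idx0) = \<Gamma>' z' idx0" if z: "z \<in> Car E" and z': "z' \<in> Car E'" and eq: "p' z' = Fun g (p z)" for z z'
  proof -
    define w where "w = (SOME z'. z' \<in> Car E' \<and> (\<exists>z0\<in>Car E. \<Gamma> z0 idx0 = cut N (\<Gamma> z idx0) \<and> p' z' = Fun g (p z0)))"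
    have "w \<in> Car E' \<and> (\<exists>z0\<in>Car E. \<Gamma> z0 idx0 = cut N (\<Gamma> z idx0) \<and> p' w = Fun g (p z0))"
      unfolding w_def by (rule someI[of _ z']) (use z z' eq E.cut_idx0[OF z] in auto)
    then obtain z0 where w: "w \<in> Car E'" "z0 \<in> Car E" "\<Gamma> z0 idx0 = \<Gamma> z idx0" "p' w = Fun g (p z0)"
      using E.cut_idx0[OF z] by auto
    have "p z0 = p z" by (rule iffD2[OF fibre_eq_iff[OF fE ch w(2) z] w(3)])
    then have "p' w = p' z'" using w(4) eq by simp
    then have "\<Gamma>' w idx0 = \<Gamma>' z' idx0" by (rule iffD1[OF fibre_eq_iff[OF fE' ch' w(1) z']])
    then show ?thesis unfolding h_def w_def .
  qed
  have hcut: "h (cut N v) = h v" for v by (simp add: h_def cut_cut)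
  have rep: "\<exists>z\<in>Car E. \<exists>z'\<in>Car E'. \<Gamma> z idx0 = cut N v \<and> p' z' = Fun g (p z) \<and> h v = \<Gamma>' z' idx0" for v
  proof -
    obtain z where z: "z \<in> Car E" "\<Gamma> z idx0 = cut N v" using E.section_exists[OF cut_cut] by blast
    have "Fun g (p z) \<in> Car M'" using g pE(3)[OF z(1)] by simp
    then obtain z' where z': "z' \<in> Car E'" "p' z' = Fun g (p z)" using pE'(4) by blast
    have "h v = \<Gamma>' z' idx0" unfolding h[OF z(1) z', symmetric] z(2) hcut ..
    show ?thesis by (intro bexI[OF _ z(1)] bexI[OF _ z'(1)] conjI z(2) z'(2)) fact
  qed
  have h_add: "h (v + w) = h v + h w" for v w
  proof -
    obtain z z' where z: "z \<in> Car E" "z' \<in> Car E'" "\<Gamma> z idx0 = cut N v" "p' z' = Fun g (p z)" "h v = \<Gamma>' z' idx0"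
      using rep[of v] by blast
    obtain y y' where y: "y \<in> Car E" "y' \<in> Car E'" "\<Gamma> y idx0 = cut N w" "p' y' = Fun g (p y)" "h w = \<Gamma>' y' idx0"
      using rep[of w] by blast
    have "h (\<Gamma> (z \<oplus>\<^bsub>UMod E\<^esub> y) idx0) = \<Gamma>' (z' \<oplus>\<^bsub>UMod E'\<^esub> y') idx0"
      by (rule h) (use z y g pE(3) in \<open>simp_all add: pE(5) pE'(5) R.Fun_add\<close>)
    then have "h (cut N (v + w)) = h v + h w"
      using z y by (simp add: chartD(1)[OF E.chart] chartD(1)[OF E'.chart] cut_add)
    then show ?thesis by (simp add: hcut)
  qed
  have h_sc: "h (vsc k v) = vsc k (h v)" for k v
  proof -
    obtain z z' where z: "z \<in> Car E" "z' \<in> Car E'" "\<Gamma> z idx0 = cut N v" "p' z' = Fun g (p z)" "h v = \<Gamma>' z' idx0"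
      using rep[of v] by blast
    have k: "mps_coeff (mps_const k :: ('k, 'n) mps) idx0 = k" by (simp add: mps_const.rep_eq idx0_def)
    have "h (\<Gamma> (mps_const k \<odot>\<^bsub>UMod E\<^esub> z) idx0) = \<Gamma>' (mps_const k \<odot>\<^bsub>UMod E'\<^esub> z') idx0"
      by (rule h) (use z g pE(3) in \<open>simp_all add: pE(6) pE'(6) R.Fun_smult k\<close>)
    then have "h (cut N (vsc k v)) = vsc k (h v)"
      using z by (simp add: chartD(2)[OF E.chart] chartD(2)[OF E'.chart] V.smul_0 k cut_vsc)
    then show ?thesis by (simp add: hcut)
  qed
  have h_rep: "h (E.S.fibre y v) = E'.S.fibre y (h v)" if y: "y \<in> FL_ge2" for y v
  proof -
    obtain z z' where z: "z \<in> Car E" "z' \<in> Car E'" "\<Gamma> z idx0 = cut N v" "p' z' = Fun g (p z)" "h v = \<Gamma>' z' idx0"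
      using rep[of v] by blast
    define t where "t = rep_free_lie y"
    have t: "abs_free_lie t = y" by (simp add: t_def abs_rep_free_lie)
    have yt: "abs_free_lie t \<in> FL_ge2" using y t by simp
    have "h (\<Gamma> (cev E t z) idx0) = \<Gamma>' (cev E' t z') idx0"
    proof (rule h)
      show "cev E t z \<in> Car E" "cev E' t z' \<in> Car E'" using z by (simp_all add: E.cev_Car E'.cev_Car)
      show "p' (cev E' t z') = Fun g (p (cev E t z))"
        using z g pE(3)[OF z(1)] yt y by (simp add: pE(8)[OF yt] pE'(8)[OF yt] R.Fun_Act t)
    qed
    then have "h (E.S.fibre y (cut N v)) = E'.S.fibre y (h v)"
      using z by (simp add: E.chart_fibre[OF _ yt] E'.chart_fibre[OF _ yt] t)
    then have "h (cut N (E.S.fibre y v)) = E'.S.fibre y (h v)" by (simp add: E.cut_fibre)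
    then show ?thesis by (simp add: hcut)
  qed
  have h_range: "cut N' (h v) = h v" for v
  proof -
    obtain z' where "z' \<in> Car E'" "h v = \<Gamma>' z' idx0" using rep[of v] by blast
    then show ?thesis using E'.cut_idx0 by simp
  qed
  define hs where "hs s = (\<lambda>a. h (s a))" for s :: "('n \<Rightarrow> nat) \<Rightarrow> nat \<Rightarrow> 'k"
  have h_0: "h 0 = 0" using h_add[of 0 0] by simp
  have hs_gauge: "h (E.S.F.gauge j a v) = E'.S.F.gauge j a (h v)" for j a v
  proof -
    have "a \<in> tail_idx j \<or> ord_pow fl_ad a (fl_var j) \<in> (FL_ge2 :: ('k, 'n) free_lie set)"
      using ord_pow_ad_var_FL idx0_tail by metis
    then show ?thesis
      by (auto simp: E.S.F.gauge_def E'.S.F.gauge_def E.S.F.op_series_def E'.S.F.op_series_def h_sc h_rep h_0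
          zero_fun_def[symmetric])
  qed
  have hs_std: "hs (E.S.F.std_conn j s) = E'.S.F.std_conn j (hs s)" for j s
  proof (rule ext)
    fix a
    have "h (conv (\<lambda>T. T) (E.S.F.gauge j) s a) = conv (\<lambda>T. T) (E'.S.F.gauge j) (hs s) a"
      by (simp add: conv_def case_prod_unfold V.additive_sum[of h, OF h_add] hs_gauge hs_def)
    moreover have "h (pd vsc j s a) = pd vsc j (hs s) a" by (simp add: pd_def h_sc hs_def)
    ultimately show "hs (E.S.F.std_conn j s) a = E'.S.F.std_conn j (hs s) a"
      by (simp add: E.S.F.std_conn_def E'.S.F.std_conn_def h_add) (simp add: hs_def E.S.F.std_conn_def h_add)
  qed
  have hs_smul: "hs (V.smul f s) = V.smul f (hs s)" for f s
    unfolding hs_def by (rule V_smul_map[OF h_add h_sc])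
  have hs_add: "hs (s + t) = hs s + hs t" for s t by (simp add: hs_def fun_eq_iff h_add)
  \<comment> \<open>Well defined by bijectivity of the Taylor map of \<open>E'\<close>; each
    property of \<open>F\<close> is checked after applying that map.\<close>
  define F where "F s = (SOME t. E'.S.taylor t = hs (E.S.taylor s))" for s
  have F: "E'.S.taylor (F s) = hs (E.S.taylor s)" for s
    unfolding F_def by (rule someI_ex[OF E'.S.taylor_surj])
  have F_eq: "F s = t" if "E'.S.taylor t = hs (E.S.taylor s)" for s t
    by (rule E'.S.taylor_inj) (simp only: F that)
  have F_add: "F (s + t) = F s + F t" for s t
    by (rule F_eq) (simp only: E.S.taylor_add E'.S.taylor_add F hs_add)
  have F_smul: "F (V.smul f s) = V.smul f (F s)" for f s
    by (rule F_eq) (simp only: E.S.taylor_smul E'.S.taylor_smul F hs_smul)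
  have F_D: "F (D j s) = D' j (F s)" for j s
  proof (rule F_eq)
    have "E.S.taylor (D j s) = E.S.F.std_conn j (E.S.taylor s)" by (rule ext) (rule E.S.taylor_D)
    moreover have "E'.S.taylor (D' j (F s)) = E'.S.F.std_conn j (E'.S.taylor (F s))" by (rule ext) (rule E'.S.taylor_D)
    ultimately show "E'.S.taylor (D' j (F s)) = hs (E.S.taylor (D j s))" by (simp only: F hs_std)
  qed
  \<comment> \<open>To return through the chart of \<open>E'\<close> the values of \<open>F\<close>
    must be padded sections, and they are because \<open>h\<close> takes values in the first
    \<open>N'\<close> coordinates.\<close>
  have F_cut: "scut N' (F s) = F s" for s
  proof (rule F_eq[symmetric])
    have "E'.S.taylor (scut N' (F s)) = scut N' (E'.S.taylor (F s))" by (rule E'.scut_taylor[symmetric])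
    also have "\<dots> = hs (E.S.taylor s)" unfolding F by (simp add: hs_def h_range)
    finally show "E'.S.taylor (scut N' (F s)) = hs (E.S.taylor s)" .
  qed
  define f0 where "f0 x = inv_into (Car E') \<Gamma>' (F (\<Gamma> x))" for x
  have f0: "f0 x \<in> Car E'" "\<Gamma>' (f0 x) = F (\<Gamma> x)" for x
    using chartD(5,6)[OF E'.chart F_cut] by (simp_all add: f0_def)
  define f where "f = \<lparr>Source = E, Target = E', Fun = restrict f0 (Car E)\<rparr>"
  have fs: "Source f = E" "Target f = E'" "x \<in> Car E \<Longrightarrow> Fun f x = f0 x" "Fun f \<in> extensional (Car E)" for x
    by (auto simp: f_def)
  have "B.arr f"
  proof (rule B.arrI, unfold fs(1,2))
    show "is_linear (UMod E) (UMod E') (Fun f)"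
    proof (rule is_linearI)
      fix x y r assume x: "x \<in> Car E"
      show "Fun f x \<in> Car E'" using x f0 fs by simp
      show "Fun f (x \<oplus>\<^bsub>UMod E\<^esub> y) = Fun f x \<oplus>\<^bsub>UMod E'\<^esub> Fun f y" if "y \<in> Car E"
        by (rule chartD(4)[OF E'.chart])
           (use x that f0(1) in \<open>simp_all add: fs f0(2) chartD(1)[OF E.chart] chartD(1)[OF E'.chart] F_add del: plus_fun_apply\<close>)
      show "Fun f (r \<odot>\<^bsub>UMod E\<^esub> x) = r \<odot>\<^bsub>UMod E'\<^esub> Fun f x"
        by (rule chartD(4)[OF E'.chart])
           (use x f0(1) in \<open>simp_all add: fs f0(2) chartD(2)[OF E.chart] chartD(2)[OF E'.chart] F_smul\<close>)
    qed
    show "Fun f (Act E i x) = Act E' i (Fun f x)" if "x \<in> Car E" for i x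
      by (rule chartD(4)[OF E'.chart])
         (use that f0(1) in \<open>simp_all add: fs f0(2) E.Act_Car E'.Act_Car E.chart_Act E'.chart_Act F_D\<close>)
  qed (use pE(1) pE'(1) fs(4) in auto)
  moreover have "p' (Fun f x) = Fun g (p x)" if x: "x \<in> Car E" for x
  proof -
    have "Fun g (p x) \<in> Car M'" using g pE(3)[OF x] by simp
    then obtain z' where z': "z' \<in> Car E'" "p' z' = Fun g (p x)" using pE'(4) by blast
    have "\<Gamma>' (f0 x) idx0 = h (\<Gamma> x idx0)"
      using fun_cong[OF F[of "\<Gamma> x"], where x = idx0] by (simp add: f0 E'.S.taylor_0 E.S.taylor_0 hs_def)
    also have "\<dots> = \<Gamma>' z' idx0" by (rule h[OF x z'])
    finally have "p' (f0 x) = p' z'" by (rule iffD2[OF fibre_eq_iff[OF fE' ch' f0(1) z'(1)]])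
    then show ?thesis using x z' by (simp add: fs)
  qed
  ultimately show ?thesis using fs by blast
qed

end

section \<open>Tensor structure of the fibre functor\<close>

text \<open>Restriction of scalars along evaluation at the origin. Maps from a bundle to fibre
  vectors become linear over one ring, which brings them under the universal property of tensor
  products of bundles.\<close>

definition at_origin :: "('k::field_char_0, 'w) module \<Rightarrow> (('k, 'n::finite) mps, 'w) module" where
  "at_origin M = \<lparr>carrier = carrier M, monoid.mult = monoid.mult M, one = one M, ring.zero = ring.zero M, add = add M,
     module.smult = (\<lambda>f. module.smult M (mps_coeff f idx0))\<rparr>"

lemma at_origin_simps [simp]:
  "carrier (at_origin M) = carrier M" "x \<oplus>\<^bsub>at_origin M\<^esub> y = x \<oplus>\<^bsub>M\<^esub> y" "\<zero>\<^bsub>at_origin M\<^esub> = \<zero>\<^bsub>M\<^esub>"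
  "f \<odot>\<^bsub>at_origin M\<^esub> x = mps_coeff f idx0 \<odot>\<^bsub>M\<^esub> x"
  by (simp_all add: at_origin_def)

lemma mps_coeff_mult_0: "mps_coeff (f * g) idx0 = mps_coeff f idx0 * mps_coeff g idx0"
  for f g :: "('k::field_char_0, 'n::finite) mps"
proof -
  have "splittings (idx0 :: 'n \<Rightarrow> nat) = {(idx0, idx0)}" by (auto simp: splittings_def idx0_def)
  then show ?thesis by (simp add: times_mps.rep_eq)
qed

lemma mps_coeff_0_simps:
  fixes f g :: "('k::field_char_0, 'n::finite) mps"
  shows "mps_coeff (f + g) a = mps_coeff f a + mps_coeff g a" "mps_coeff (mps_const c :: ('k, 'n) mps) idx0 = c"
    "mps_coeff (1 :: ('k, 'n) mps) idx0 = 1" "mps_coeff (0 :: ('k, 'n) mps) a = 0"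
  by (simp_all add: plus_mps.rep_eq mps_const.rep_eq one_mps.rep_eq zero_mps.rep_eq idx0_def)

lemma at_origin_module:
  assumes "umod M" shows "is_module (at_origin M :: (('k::field_char_0, 'n::finite) mps, 'w) module)"
proof -
  interpret umod M by fact
  show ?thesis
    by (rule is_moduleI)
       (auto simp: mps_coeff_0_simps mps_coeff_minus1 mps_coeff_mult_0 a_ac smult_l_distr smult_r_distr
          smult_assoc minus_eq_smult[symmetric] l_neg r_neg)
qed

section \<open>Maps out of a fibre\<close>

context disk begin

text \<open>A scalar without constant term acts as zero on \<open>at_origin N\<close>, so
  \<open>h\<close> kills the kernel of \<open>p\<close>.\<close>

lemma fibre_cong:
  assumes f: "is_fibre (E :: (('k, 'n) mps, 'u, 'n) opmod) (M :: ('k, 'w, ('k, 'n) free_lie) opmod) p"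
    and N: "umod N" and h: "is_linear (UMod E) (at_origin N) h"
    and x: "x \<in> Car E" "x' \<in> Car E" "p x = p x'"
  shows "h x = h x'"
proof -
  interpret E: umod "UMod E" by (rule B.Obs_umod[OF is_fibreD(1)[OF f]])
  interpret N: umod N by fact
  note hl = is_linearD[OF h, simplified]
  have uM: "umod (UMod M)" by (rule R.Obs_umod[OF is_fibreD(2)[OF f]])
  have k: "h v = \<zero>\<^bsub>N\<^esub>" if "v \<in> vanish (UMod E)" for v
    using that
  proof induct
    case zero
    have "h \<zero>\<^bsub>UMod E\<^esub> \<oplus>\<^bsub>N\<^esub> h \<zero>\<^bsub>UMod E\<^esub> = h \<zero>\<^bsub>UMod E\<^esub>" using hl(2)[of "\<zero>\<^bsub>UMod E\<^esub>" "\<zero>\<^bsub>UMod E\<^esub>"] by simp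
    then show ?case using hl(1)[of "\<zero>\<^bsub>UMod E\<^esub>"] by simp
  next
    case (add x y)
    then show ?case using vanish_carrier[OF E.umod_axioms] by (simp add: hl(2))
  next
    case (smult f x)
    then show ?case by (simp add: hl)
  qed
  define w where "w = x \<oplus>\<^bsub>UMod E\<^esub> (- 1) \<odot>\<^bsub>UMod E\<^esub> x'"
  have w: "w \<in> Car E" using x by (simp add: w_def)
  have "p w = p x \<oplus>\<^bsub>UMod M\<^esub> (- 1) \<odot>\<^bsub>UMod M\<^esub> p x'"
    using x(1,2) by (simp add: w_def is_fibreD(5,6)[OF f] mps_coeff_minus1)
  then have "p w = \<zero>\<^bsub>UMod M\<^esub>"
    using iffD2[OF umod_eq_iff[OF uM is_fibreD(3)[OF f x(1)] is_fibreD(3)[OF f x(2)]] x(3)] by simp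
  then have "h w = \<zero>\<^bsub>N\<^esub>" by (intro k iffD1[OF is_fibreD(7)[OF f w]])
  then have "h x \<oplus>\<^bsub>N\<^esub> (- 1) \<odot>\<^bsub>N\<^esub> h x' = \<zero>\<^bsub>N\<^esub>"
    using x(1,2) by (simp add: w_def hl mps_coeff_minus1)
  then show ?thesis by (rule iffD1[OF umod_eq_iff[OF N hl(1)[OF x(1)] hl(1)[OF x(2)]]])
qed

text \<open>The universal property of the quotient by the maximal ideal; by
  \<open>fibre_cong\<close> the choice of lifts of fibre vectors does not matter.\<close>

lemma fibre_descend:
  assumes f: "is_fibre (E :: (('k, 'n) mps, 'u, 'n) opmod) (M :: ('k, 'w, ('k, 'n) free_lie) opmod) p"
    and N: "umod N" and h: "is_linear (UMod E) (at_origin N) h"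
  shows "\<exists>g\<in>linear_maps (UMod M) N. \<forall>x\<in>Car E. g (p x) = h x"
proof -
  note fD = is_fibreD[OF f] and hl = is_linearD[OF h, simplified]
  have uM: "umod (UMod M)" by (rule R.Obs_umod[OF fD(2)])
  define s where "s m = (SOME x. x \<in> Car E \<and> p x = m)" for m
  have s: "s m \<in> Car E" "p (s m) = m" if "m \<in> Car M" for m
    using someI_ex[of "\<lambda>x. x \<in> Car E \<and> p x = m"] fD(4)[OF that] by (auto simp: s_def)
  define g where "g = restrict (\<lambda>m. h (s m)) (Car M)"
  have g: "g (p x) = h x" if "x \<in> Car E" for x
    using fibre_cong[OF f N h s(1)[OF fD(3)[OF that]] that s(2)[OF fD(3)[OF that]]] fD(3)[OF that] by (simp add: g_def)
  have "is_linear (UMod M) N g"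
  proof (rule is_linearI)
    fix m m' r assume "m \<in> Car M"
    then obtain x where x: "x \<in> Car E" "m = p x" using fD(4) by blast
    show "g m \<in> carrier N" using x by (simp add: g hl)
    show "g (r \<odot>\<^bsub>UMod M\<^esub> m) = r \<odot>\<^bsub>N\<^esub> g m"
      using x g[of "mps_const r \<odot>\<^bsub>UMod E\<^esub> x"] is_fibreD(1)[OF f] by (simp add: g hl fD(6) mps_coeff_0_simps)
    assume "m' \<in> Car M"
    then obtain y where y: "y \<in> Car E" "m' = p y" using fD(4) by blast
    show "g (m \<oplus>\<^bsub>UMod M\<^esub> m') = g m \<oplus>\<^bsub>N\<^esub> g m'"
      using x y g[of "x \<oplus>\<^bsub>UMod E\<^esub> y"] is_fibreD(1)[OF f] by (simp add: g hl fD(5))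
  qed
  then have "g \<in> linear_maps (UMod M) N" by (rule linear_mapsI) (simp add: g_def)
  then show ?thesis using g by blast
qed

lemma cev_closed:
  assumes "E \<in> bundles" "x \<in> Car E" shows "cev (E :: (('k, 'n) mps, 'u, 'n) opmod) t x \<in> Car E"
proof -
  obtain N \<Gamma> D where "bundle_chart E N \<Gamma> D" using bundle_chart_exists[OF assms(1)] by blast
  then show ?thesis using assms(2) by (rule bundle_chart.cev_Car)
qed

lemma fibre_descend_arr:
  assumes f: "is_fibre (E :: (('k, 'n) mps, 'u, 'n) opmod) (M :: ('k, 'w, ('k, 'n) free_lie) opmod) p"
    and N: "N \<in> representations" and h: "is_linear (UMod E) (at_origin (UMod N)) h"
    and e: "\<And>t x. abs_free_lie t \<in> FL_ge2 \<Longrightarrow> x \<in> Car E \<Longrightarrow> h (cev E t x) = Act N (abs_free_lie t) (h x)"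
  shows "\<exists>g. R.arr g \<and> Source g = M \<and> Target g = N \<and> (\<forall>x\<in>Car E. Fun g (p x) = h x)"
proof -
  obtain g where g: "g \<in> linear_maps (UMod M) (UMod N)" "\<And>x. x \<in> Car E \<Longrightarrow> g (p x) = h x"
    using fibre_descend[OF f R.Obs_umod[OF N] h] by blast
  have "R.arr \<lparr>Source = M, Target = N, Fun = g\<rparr>"
  proof (rule R.arrI)
    fix y m assume y: "y \<in> (FL_ge2 :: ('k, 'n) free_lie set)" and "m \<in> Car (Source \<lparr>Source = M, Target = N, Fun = g\<rparr>)"
    then obtain x where x: "x \<in> Car E" "m = p x" using is_fibreD(4)[OF f] by auto
    define t where "t = rep_free_lie y"
    have t: "y = abs_free_lie t" by (simp add: t_def abs_rep_free_lie)
    have "g (Act M y m) = Act N y (g m)"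
      using y x e[of t x] g(2)[OF cev_closed[OF is_fibreD(1)[OF f] x(1)], of t] is_fibreD(8)[OF f, of t x] by (simp add: g(2) t)
    then show "Fun \<lparr>Source = M, Target = N, Fun = g\<rparr> (Act (Source \<lparr>Source = M, Target = N, Fun = g\<rparr>) y m)
      = Act (Target \<lparr>Source = M, Target = N, Fun = g\<rparr>) y (Fun \<lparr>Source = M, Target = N, Fun = g\<rparr> m)" by simp
  qed (use g(1) is_fibreD(2)[OF f] N in \<open>simp_all add: linear_maps_def\<close>)
  then show ?thesis using g(2) by (intro exI conjI) auto
qed

section \<open>Lie expressions under arrows and tensor products\<close>

lemma cev_add:
  assumes "E \<in> bundles" "x \<in> Car E" "y \<in> Car E"
  shows "cev (E :: (('k, 'n) mps, 'u, 'n) opmod) t (x \<oplus>\<^bsub>UMod E\<^esub> y) = cev E t x \<oplus>\<^bsub>UMod E\<^esub> cev E t y"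
proof -
  obtain N \<Gamma> D where "bundle_chart E N \<Gamma> D" using bundle_chart_exists[OF assms(1)] by blast
  then interpret bundle_chart E N \<Gamma> D .
  show ?thesis
    by (rule chartD(4)[OF chart]) (use assms in \<open>simp_all add: cev_Car chartD(1)[OF chart] chart_cev S.L.lie_eval_add\<close>)
qed

lemma cev_Fun:
  assumes f: "B.arr f" "Source f = E" "Target f = E'" and x: "x \<in> Car E"
  shows "Fun f (cev E t x) = cev E' t (Fun f x)"
proof -
  have O: "E \<in> bundles" "E' \<in> bundles" using B.arrD(1,2)[OF f(1)] f by simp_all
  have u: "umod (UMod E)" "umod (UMod E')" by (rule B.Obs_umod[OF O(1)], rule B.Obs_umod[OF O(2)])
  have l: "is_linear (UMod E) (UMod E') (Fun f)" using B.arrD(4)[OF f(1)] f by simp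
  note ld = is_linearD[OF l] and la = is_linear_additive[OF l]
  have z: "Fun f \<zero>\<^bsub>UMod E\<^esub> = \<zero>\<^bsub>UMod E'\<^esub>"
    by (rule is_linear_zero[OF umod.is_module[OF u(1)] umod.is_module[OF u(2)] l])
  have act: "Fun f (Act E i y) = Act E' i (Fun f y)" if "y \<in> Car E" for i y
    using B.Fun_Act[OF f(1,2) UNIV_I that] f(3) by simp
  show ?thesis
    using x
  proof (induct t arbitrary: x)
    case (Gen v)
    then show ?case
      using additive_finsum[OF u la, of UNIV "\<lambda>i. mps_const (vec_nth v i) \<odot>\<^bsub>UMod E\<^esub> Act E i x"] O
      by (simp add: ld(3) act)
  next
    case (Brk s t)
    then show ?case using O by (simp add: ld cev_closed)
  qed (use O in \<open>simp_all add: ld cev_closed z\<close>)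
qed

text \<open>Operators with a Leibniz rule on the tensor product are closed under commutators, since
  the mixed terms cancel. Expressions of degree one are included because the induction passes
  through the generators.\<close>

lemma cev_tens:
  fixes E F :: "(('k, 'n) mps, 'u, 'n) opmod"
  assumes O: "E \<in> bundles" "F \<in> bundles" and x: "x \<in> Car E" "y \<in> Car F"
  shows "cev (tens_obj E F) t (tens E F x y)
     = tens E F (cev E t x) y \<oplus>\<^bsub>UMod (tens_obj E F)\<^esub> tens E F x (cev F t y)"
proof -
  define T where "T = tens_obj E F"
  define h where "h = tens E F"
  have OT: "T \<in> bundles" using B.Obs_tens[OF O] by (simp add: T_def)
  obtain N \<Gamma> D where "bundle_chart T N \<Gamma> D" using bundle_chart_exists[OF OT] by blast
  then interpret T: bundle_chart T N \<Gamma> D .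
  note tl = B.tens_rules[OF O, folded T_def h_def]
  have tc: "h x y \<in> Car T" if "x \<in> Car E" "y \<in> Car F" for x y
    using B.tens_closedO[OF O that] by (simp add: T_def h_def)
  have u: "umod (UMod E)" "umod (UMod F)" by (rule B.Obs_umod[OF O(1)], rule B.Obs_umod[OF O(2)])
  note cD = chartD[OF T.chart]
  have z: "h \<zero>\<^bsub>UMod E\<^esub> y = \<zero>\<^bsub>UMod T\<^esub>" "h x \<zero>\<^bsub>UMod F\<^esub> = \<zero>\<^bsub>UMod T\<^esub>" if "x \<in> Car E" "y \<in> Car F" for x y
  proof -
    interpret E: umod "UMod E" by (rule u(1))
    interpret F: umod "UMod F" by (rule u(2))
    show "h \<zero>\<^bsub>UMod E\<^esub> y = \<zero>\<^bsub>UMod T\<^esub>" using tl(3)[of "\<zero>\<^bsub>UMod E\<^esub>" y 0] that tc by simp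
    show "h x \<zero>\<^bsub>UMod F\<^esub> = \<zero>\<^bsub>UMod T\<^esub>" using tl(4)[of x "\<zero>\<^bsub>UMod F\<^esub>" 0] that tc by simp
  qed
  have "cev T t (h x y) = h (cev E t x) y \<oplus>\<^bsub>UMod T\<^esub> h x (cev F t y)"
    using x
  proof (induct t arbitrary: x y)
    case (Gen v)
    define a where "a i = mps_const (vec_nth v i) \<odot>\<^bsub>UMod E\<^esub> Act E i x" for i
    define b where "b i = mps_const (vec_nth v i) \<odot>\<^bsub>UMod F\<^esub> Act F i y" for i
    have ab: "a i \<in> Car E" "b i \<in> Car F" for i using Gen O by (simp_all add: a_def b_def)
    have "is_additive (UMod E) (UMod T) (\<lambda>x. h x y)" "is_additive (UMod F) (UMod T) (h x)"
      using Gen tc tl(1,2) by (auto simp: is_additive_def)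
    note 1 = additive_finsum[OF u(1) T.umod_E this(1) finite[of UNIV], of a] and 2 = additive_finsum[OF u(2) T.umod_E this(2) finite[of UNIV], of b]
    have "mps_const (vec_nth v i) \<odot>\<^bsub>UMod T\<^esub> Act T i (h x y) = h (a i) y \<oplus>\<^bsub>UMod T\<^esub> h x (b i)" for i
      using Gen O by (simp add: tl a_def b_def T.M.smult_r_distr tc)
    then have "cev T (Gen v) (h x y) = (\<Oplus>\<^bsub>UMod T\<^esub>i\<in>UNIV. h (a i) y \<oplus>\<^bsub>UMod T\<^esub> h x (b i))" by simp
    also have "\<dots> = (\<Oplus>\<^bsub>UMod T\<^esub>i\<in>UNIV. h (a i) y) \<oplus>\<^bsub>UMod T\<^esub> (\<Oplus>\<^bsub>UMod T\<^esub>i\<in>UNIV. h x (b i))"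
      by (rule T.M.finsum_addf) (use ab Gen tc in auto)
    also have "\<dots> = h (cev E (Gen v) x) y \<oplus>\<^bsub>UMod T\<^esub> h x (cev F (Gen v) y)"
      using 1 2 ab by (simp add: a_def b_def)
    finally show ?case .
  next
    case Zero
    then show ?case by (simp add: z)
  next
    case (Add s t)
    note c = cev_closed[OF O(1) Add(3)] cev_closed[OF O(2) Add(4)]
    show ?case using Add c by (simp add: tl tc T.M.a_ac)
  next
    case (Scale r t)
    note c = cev_closed[OF O(1) Scale(2)] cev_closed[OF O(2) Scale(3)]
    show ?case using Scale c by (simp add: tl tc T.M.smult_r_distr)
  next
    case (Brk s t)
    note c = cev_closed[OF O(1)] cev_closed[OF O(2)]
    note a = cev_add[OF OT]
    have sm: "r \<odot>\<^bsub>UMod E\<^esub> x \<in> Car E" "r' \<odot>\<^bsub>UMod F\<^esub> y \<in> Car F" if "x \<in> Car E" "y \<in> Car F" for x y r r'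
      using that O by simp_all
    show ?case
      by (rule cD(4)) (use Brk O in \<open>simp_all add: c a tl tc sm cD(1,2) V_smul_minus1 V.smul_add_right T.cev_Car\<close>)
  qed
  then show ?thesis by (simp only: T_def h_def)
qed

lemma fibre_linear:
  assumes f: "is_fibre (E :: (('k, 'n) mps, 'u, 'n) opmod) (M :: ('k, 'w, ('k, 'n) free_lie) opmod) p"
  shows "is_linear (UMod E) (at_origin (UMod M)) p"
  by (rule is_linearI) (use is_fibreD[OF f] in auto)

text \<open>Reduction modulo the maximal ideal commutes with tensor products. One direction comes
  from the universal property over the field, the inverse from the one over the power series
  followed by descent to the fibre; equivariance rests on \<open>cev_tens\<close>.\<close>

lemma fibre_tensor:
  fixes E F :: "(('k, 'n) mps, 'u, 'n) opmod" and M N W :: "('k, 'w, ('k, 'n) free_lie) opmod"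
  assumes f: "is_fibre E M p" "is_fibre F N q" and t: "is_fibre (tens_obj E F) W r"
  shows "\<exists>g. is_iso R.C (tens_obj M N) W g \<and> (\<forall>x\<in>Car E. \<forall>y\<in>Car F. Fun g (tens M N (p x) (q y)) = r (tens E F x y))"
proof -
  note pD = is_fibreD[OF f(1)] and qD = is_fibreD[OF f(2)] and rD = is_fibreD[OF t]
  note OB = pD(1) qD(1) and OR = pD(2) qD(2)
  define T where "T = tens_obj E F"
  define h where "h = tens E F"
  note t = t[folded T_def] and rD = rD[folded T_def]
  note tl = B.tens_rules[OF OB, folded T_def h_def] and tc = B.tens_closedO[OF OB, folded T_def h_def]
  have uW: "umod (UMod W)" by (rule R.Obs_umod[OF rD(2)])
  have lin: "is_linear (UMod E) (at_origin (UMod W)) (\<lambda>x. r (h x y))" if "y \<in> Car F" for y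
    by (rule is_linearI) (use that tc rD(3) in \<open>simp_all add: tl rD(5,6)\<close>)
  have lin': "is_linear (UMod F) (at_origin (UMod W)) (\<lambda>y. r (h x y))" if "x \<in> Car E" for x
    by (rule is_linearI) (use that tc rD(3) in \<open>simp_all add: tl rD(5,6)\<close>)
  define s where "s m = (SOME x. x \<in> Car E \<and> p x = m)" for m
  define s' where "s' n = (SOME y. y \<in> Car F \<and> q y = n)" for n
  have s: "s m \<in> Car E" "p (s m) = m" if "m \<in> Car M" for m
    using someI_ex[of "\<lambda>x. x \<in> Car E \<and> p x = m"] pD(4)[OF that] by (auto simp: s_def)
  have s': "s' n \<in> Car F" "q (s' n) = n" if "n \<in> Car N" for n
    using someI_ex[of "\<lambda>y. y \<in> Car F \<and> q y = n"] qD(4)[OF that] by (auto simp: s'_def)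
  \<comment> \<open>Both arguments are lifted to sections; \<open>fibre_cong\<close> in each
    argument shows that the result depends only on the fibre vectors.\<close>
  define b where "b m n = r (h (s m) (s' n))" for m n
  have b: "b (p x) (q y) = r (h x y)" if x: "x \<in> Car E" and y: "y \<in> Car F" for x y
  proof -
    note sx = s[OF pD(3)[OF x]] and sy = s'[OF qD(3)[OF y]]
    have "r (h (s (p x)) (s' (q y))) = r (h x (s' (q y)))"
      by (rule fibre_cong[OF f(1) uW lin[OF sy(1)] sx(1) x sx(2)])
    also have "\<dots> = r (h x y)"
      by (rule fibre_cong[OF f(2) uW lin'[OF x] sy(1) y sy(2)])
    finally show ?thesis by (simp add: b_def)
  qed
  have bil: "is_bilinear (UMod M) (UMod N) (UMod W) b"
    unfolding is_bilinear_def
  proof (intro conjI ballI is_linearI)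
    fix m n assume "m \<in> Car M" "n \<in> Car N"
    then obtain x y where x: "x \<in> Car E" "m = p x" and y: "y \<in> Car F" "n = q y" using pD(4) qD(4) by metis
    show "b m n \<in> Car W" "b m n \<in> Car W" using x y tc rD(3) by (simp_all add: b)
    show "b m (c \<odot>\<^bsub>UMod N\<^esub> n) = c \<odot>\<^bsub>UMod W\<^esub> b m n" for c
      using x y b[of x "mps_const c \<odot>\<^bsub>UMod F\<^esub> y"] OB tc by (simp add: b qD(6) rD(6) mps_coeff_0_simps tl)
    show "b (c \<odot>\<^bsub>UMod M\<^esub> m) n = c \<odot>\<^bsub>UMod W\<^esub> b m n" for c
      using x y b[of "mps_const c \<odot>\<^bsub>UMod E\<^esub> x" y] OB tc by (simp add: b pD(6) rD(6) mps_coeff_0_simps tl)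
    show "b m (n \<oplus>\<^bsub>UMod N\<^esub> n') = b m n \<oplus>\<^bsub>UMod W\<^esub> b m n'" if n': "n' \<in> Car N" for n'
    proof -
      obtain y' where y': "y' \<in> Car F" "n' = q y'" using qD(4)[OF n'] by metis
      show ?thesis using x y y' b[of x "y \<oplus>\<^bsub>UMod F\<^esub> y'"] OB tc by (simp add: b qD(5) rD(5) tl)
    qed
    show "b (m \<oplus>\<^bsub>UMod M\<^esub> m') n = b m n \<oplus>\<^bsub>UMod W\<^esub> b m' n" if m': "m' \<in> Car M" for m'
    proof -
      obtain x' where x': "x' \<in> Car E" "m' = p x'" using pD(4)[OF m'] by metis
      show ?thesis using x y x' b[of "x \<oplus>\<^bsub>UMod E\<^esub> x'" y] OB tc by (simp add: b pD(5) rD(5) tl)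
    qed
  qed
  obtain g where g: "g \<in> linear_maps (UMod (tens_obj M N)) (UMod W)"
    and gb: "\<And>m n. m \<in> Car M \<Longrightarrow> n \<in> Car N \<Longrightarrow> g (tens M N m n) = b m n"
    using R.tens_liftO[OF OR rD(2) bil] by blast
  note gl = is_linearD[OF linear_mapsD(1)[OF g]]
  have gt: "g (tens M N (p x) (q y)) = r (h x y)" if "x \<in> Car E" "y \<in> Car F" for x y
    using that gb[OF pD(3) qD(3)] b by simp
  have arr: "R.arr \<lparr>Source = tens_obj M N, Target = W, Fun = g\<rparr>"
  proof (rule R.arr_tensI[OF OR rD(2) g])
    fix z m n assume z: "z \<in> (FL_ge2 :: ('k, 'n) free_lie set)" and "m \<in> Car M" "n \<in> Car N"
    then obtain x y where x: "x \<in> Car E" "m = p x" and y: "y \<in> Car F" "n = q y" using pD(4) qD(4) by metis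
    define t where "t = rep_free_lie z"
    have t: "abs_free_lie t = z" by (simp add: t_def abs_rep_free_lie)
    have tz: "abs_free_lie t \<in> FL_ge2" using t z by simp
    note c = cev_closed[OF OB(1) x(1), of t] cev_closed[OF OB(2) y(1), of t]
    have a: "Act M z (p x) = p (cev E t x)" "Act N z (q y) = q (cev F t y)"
      using pD(8)[OF tz x(1)] qD(8)[OF tz y(1)] t by simp_all
    have "g (Act (tens_obj M N) z (tens M N m n)) = g (tens M N (p (cev E t x)) (q y)) \<oplus>\<^bsub>UMod W\<^esub> g (tens M N (p x) (q (cev F t y)))"
      using x y z c OR pD(3) qD(3) by (simp add: R.tens_rules a gl(2))
    also have "\<dots> = r (h (cev E t x) y \<oplus>\<^bsub>UMod T\<^esub> h x (cev F t y))"
      using x y c tc by (simp add: gt rD(5))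
    also have "\<dots> = r (cev T t (h x y))"
      using cev_tens[OF OB x(1) y(1), of t] by (simp only: T_def h_def)
    also have "\<dots> = Act W z (g (tens M N m n))"
      using rD(8)[OF tz tc[OF x(1) y(1)]] x y t by (simp add: gt)
    finally show "g (Act (tens_obj M N) z (tens M N m n)) = Act W z (g (tens M N m n))" .
  qed
  have uMN: "umod (UMod (tens_obj M N))" using R.Obs_umod[OF R.Obs_tens[OF OR]] .
  have "is_bilinear (UMod E) (UMod F) (at_origin (UMod (tens_obj M N))) (\<lambda>x y. tens M N (p x) (q y))"
    unfolding is_bilinear_def
    by (intro conjI ballI is_linearI) (use OR pD(3) qD(3) in \<open>simp_all add: pD(5,6) qD(5,6) R.tens_rules\<close>)
  \<comment> \<open>The target lies in the universe of representations, so the universal property is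
    used across universes.\<close>
  note lift = Bo.tens_lift[OF B.Obs_opm[OF OB(1)] B.Obs_opm[OF OB(2)] at_origin_module[OF uMN] this]
  obtain l where l: "l \<in> linear_maps (UMod T) (at_origin (UMod (tens_obj M N)))"
    and lt: "\<And>x y. x \<in> Car E \<Longrightarrow> y \<in> Car F \<Longrightarrow> l (h x y) = tens M N (p x) (q y)"
    using ex1_implies_ex[OF lift] unfolding T_def h_def by blast
  obtain k where k: "k \<in> linear_maps (UMod W) (UMod (tens_obj M N))" and kr: "\<And>z. z \<in> Car T \<Longrightarrow> k (r z) = l z"
    using fibre_descend[OF t uMN linear_mapsD(1)[OF l]] by blast
  note kl = is_linearD[OF linear_mapsD(1)[OF k]] and ll = is_linearD[OF linear_mapsD(1)[OF l], simplified]
  have kg: "k (g z) = z" if "z \<in> Car (tens_obj M N)" for z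
  proof (rule R.tens_additive_eq[OF OR that, where Y = "UMod (tens_obj M N)"])
    fix m n assume "m \<in> Car M" "n \<in> Car N"
    then obtain x y where x: "x \<in> Car E" "m = p x" and y: "y \<in> Car F" "n = q y" using pD(4) qD(4) by metis
    then show "k (g (tens M N m n)) = tens M N m n" using tc by (simp add: gt kr lt)
  qed (simp_all add: gl kl)
  have gk: "g (k w) = w" if w: "w \<in> Car W" for w
  proof -
    obtain z where z: "z \<in> Car T" "w = r z" using rD(4)[OF w] by blast
    have "g (l z) = r z"
      by (rule B.tens_additive_eq[OF OB z(1)[unfolded T_def], where Y = "at_origin (UMod W)", folded T_def h_def])
         (simp_all add: ll gl rD(5) lt gt)
    then show ?thesis using z by (simp add: kr)
  qed
  have "bij_betw g (Car (tens_obj M N)) (Car W)"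
    by (rule bij_betw_byWitness[where f' = k]) (use kg gk gl(1) kl(1) in auto)
  then have "is_iso R.C (tens_obj M N) W \<lparr>Source = tens_obj M N, Target = W, Fun = g\<rparr>"
    by (intro R.arr_bij_iso arr) simp_all
  then show ?thesis using gt by (intro exI conjI) (auto simp: h_def)
qed

lemma cev_unit: "cev (unit_obj \<iota> mps_deriv) t (\<iota> f) = \<iota> (lie_eval mps_scale mps_deriv t f)"
proof (induct t arbitrary: f)
  case (Gen v)
  interpret U: umod "UMod (unit_obj \<iota> mps_deriv)" by (rule B.Obs_umod[OF B.Obs_unit])
  have "(\<Oplus>\<^bsub>UMod (unit_obj \<iota> mps_deriv)\<^esub>i\<in>I. \<iota> (a i)) = \<iota> (\<Sum>i\<in>I. a i)" if "finite I" for I :: "'n set" and a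
    using that by induct (simp_all add: U.finsum_insert Bo.unit_ops Bo.Car_unit Pi_def)
  then show ?case by (simp add: Bo.unit_ops)
qed (simp_all add: Bo.unit_ops)

text \<open>The subalgebra annihilates power series (\<open>mps_lie_FL_ge2\<close>), so the fibre of
  the unit bundle is the trivial representation, spanned by the class of the section
  \<open>1\<close>.\<close>

lemma fibre_unit:
  fixes W :: "('k, 'w, ('k, 'n) free_lie) opmod"
  assumes f: "is_fibre (unit_obj \<iota> mps_deriv) W r"
  shows "\<exists>g. is_iso R.C (unit_obj \<kappa> (\<lambda>_ _. 0)) W g \<and> (\<forall>c. Fun g (\<kappa> c) = r (\<iota> (mps_const c)))"
proof -
  define U where "U = unit_obj \<iota> mps_deriv"
  define K :: "('k, 'w, ('k, 'n) free_lie) opmod" where "K = unit_obj \<kappa> (\<lambda>_ _. 0)"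
  note f = f[folded U_def]
  note rD = is_fibreD[OF f] and u = Bo.unit_ops[folded U_def] and v = Ro.unit_ops[folded K_def]
  have cU: "Car U = range \<iota>" and cK: "Car K = range \<kappa>" by (simp_all add: U_def K_def Bo.Car_unit Ro.Car_unit)
  have i: "\<iota> a \<in> Car U" "\<kappa> c \<in> Car K" for a c by (simp_all add: cU cK)
  have OK: "K \<in> representations" by (simp add: K_def)
  interpret W: umod "UMod W" by (rule R.Obs_umod[OF rD(2)])
  have uK: "umod (UMod K)" by (rule R.Obs_umod[OF OK])
  have r: "r (\<iota> a) = mps_coeff a idx0 \<odot>\<^bsub>UMod W\<^esub> r (\<iota> 1)" for a
    using rD(6)[OF i(1), of a 1] by (simp add: u)
  define g where "g = restrict (\<lambda>z. the_inv \<kappa> z \<odot>\<^bsub>UMod W\<^esub> r (\<iota> 1)) (Car K)"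
  have g: "g (\<kappa> c) = c \<odot>\<^bsub>UMod W\<^esub> r (\<iota> 1)" for c by (simp add: g_def i the_inv_f_f[OF inj_kappa])
  have zero: "\<iota> 0 = \<zero>\<^bsub>UMod U\<^esub>" by (simp add: u)
  have arr: "R.arr \<lparr>Source = K, Target = W, Fun = g\<rparr>"
  proof (rule R.arrI)
    show "is_linear (UMod (Source \<lparr>Source = K, Target = W, Fun = g\<rparr>)) (UMod (Target \<lparr>Source = K, Target = W, Fun = g\<rparr>))
        (Fun \<lparr>Source = K, Target = W, Fun = g\<rparr>)"
      by (rule is_linearI)
         (auto simp: cK g v rD(3) i W.smult_l_distr W.smult_assoc)
    fix y z assume y: "y \<in> (FL_ge2 :: ('k, 'n) free_lie set)" and "z \<in> Car (Source \<lparr>Source = K, Target = W, Fun = g\<rparr>)"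
    then obtain c where c: "z = \<kappa> c" by (auto simp: cK)
    define t where "t = rep_free_lie y"
    have t: "abs_free_lie t = y" by (simp add: t_def abs_rep_free_lie)
    have "Act W y (g z) = Act W y (r (\<iota> (mps_const c)))"
      by (simp add: c g r[of "mps_const c"] mps_coeff_0_simps)
    also have "\<dots> = r (cev U t (\<iota> (mps_const c)))" using rD(8)[of t, OF _ i(1)] y t by simp
    also have "cev U t (\<iota> (mps_const c)) = \<iota> 0"
      using mps_lie_FL_ge2[OF y, of "mps_const c"] by (simp add: U_def cev_unit) (simp add: t_def lie_act_def)
    also have "r (\<iota> 0) = g (Act K y z)"
      by (simp add: c v g) (simp add: r[of 0] mps_coeff_0_simps rD(3) i)
    finally show "Fun \<lparr>Source = K, Target = W, Fun = g\<rparr> (Act (Source \<lparr>Source = K, Target = W, Fun = g\<rparr>) y z)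
      = Act (Target \<lparr>Source = K, Target = W, Fun = g\<rparr>) y (Fun \<lparr>Source = K, Target = W, Fun = g\<rparr> z)" by simp
  qed (use rD(2) OK in \<open>simp_all add: g_def\<close>)
  have "is_linear (UMod U) (at_origin (UMod K)) (\<lambda>z. \<kappa> (mps_coeff (the_inv \<iota> z) idx0))"
    by (rule is_linearI) (auto simp: cU u v i the_inv_f_f[OF inj_iota] mps_coeff_0_simps mps_coeff_mult_0)
  then obtain k where k: "k \<in> linear_maps (UMod W) (UMod K)"
    and kr: "\<And>z. z \<in> Car U \<Longrightarrow> k (r z) = \<kappa> (mps_coeff (the_inv \<iota> z) idx0)"
    using fibre_descend[OF f uK] by blast
  have gc: "g (\<kappa> c) = r (\<iota> (mps_const c))" for c
    by (simp add: g r[of "mps_const c"] mps_coeff_0_simps)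
  have kg: "k (g z) = z" if "z \<in> Car K" for z
    using that i by (auto simp: cK gc kr the_inv_f_f[OF inj_iota] mps_coeff_0_simps)
  have gk: "g (k w) = w" if w: "w \<in> Car W" for w
  proof -
    obtain a where a: "w = r (\<iota> a)" using rD(4)[OF w] by (auto simp: cU)
    have "g (k (r (\<iota> a))) = r (\<iota> a)" unfolding kr[OF i(1)] the_inv_f_f[OF inj_iota] g by (rule r[symmetric])
    then show ?thesis by (simp only: a)
  qed
  have gC: "g z \<in> Car W" if "z \<in> Car K" for z using that by (auto simp: cK g rD(3) i)
  have "bij_betw g (Car K) (Car W)"
    by (rule bij_betw_byWitness[where f' = k])
       (use kg gk gC is_linearD(1)[OF linear_mapsD(1)[OF k]] in auto)
  then have "is_iso R.C K W \<lparr>Source = K, Target = W, Fun = g\<rparr>"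
    by (intro R.arr_bij_iso arr) simp_all
  then show ?thesis using gc by (intro exI conjI) (auto simp: K_def)
qed

section \<open>The fibre functor and its tensor structure\<close>

definition chosen_fibre :: "(('k, 'n) mps, 'u, 'n) opmod \<Rightarrow> ('k, 'w, ('k, 'n) free_lie) opmod \<times> ('u \<Rightarrow> 'w)" where
  "chosen_fibre E = (SOME q. is_fibre E (fst q) (snd q))"

abbreviation Fib where "Fib E \<equiv> fst (chosen_fibre E)"
abbreviation pr where "pr E \<equiv> snd (chosen_fibre E)"

lemma Fib: "E \<in> bundles \<Longrightarrow> is_fibre E (Fib E) (pr E)"
proof -
  assume "E \<in> bundles"
  then obtain M :: "('k, 'w, ('k, 'n) free_lie) opmod" and p where "is_fibre E M p" using fibre_exists by blast
  then have "is_fibre E (fst (M, p)) (snd (M, p))" by simp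
  then show ?thesis unfolding chosen_fibre_def by (rule someI[of "\<lambda>q. is_fibre E (fst q) (snd q)"])
qed

lemmas FibD = is_fibreD[OF Fib]

lemma Fib_rep [simp]: "E \<in> bundles \<Longrightarrow> Fib E \<in> representations"
  by (rule FibD(2))

lemma pr_closed [simp]: "E \<in> bundles \<Longrightarrow> x \<in> Car E \<Longrightarrow> pr E x \<in> Car (Fib E)"
  by (rule FibD(3))

text \<open>The square with the two projections determines the arrow (\<open>fibre_arr_eqI\<close>),
  so the choice is harmless.\<close>

definition fibre_map :: "((('k, 'n) mps, 'u, 'n) opmod, 'u) arrow \<Rightarrow> (('k, 'w, ('k, 'n) free_lie) opmod, 'w) arrow" where
  "fibre_map f = (SOME g. R.arr g \<and> Source g = Fib (Source f) \<and> Target g = Fib (Target f) \<and>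
     (\<forall>x\<in>Car (Source f). Fun g (pr (Source f) x) = pr (Target f) (Fun f x)))"

lemma fibre_map:
  assumes f: "B.arr f"
  shows "R.arr (fibre_map f)" "Source (fibre_map f) = Fib (Source f)" "Target (fibre_map f) = Fib (Target f)"
    "x \<in> Car (Source f) \<Longrightarrow> Fun (fibre_map f) (pr (Source f) x) = pr (Target f) (Fun f x)"
proof -
  define E where "E = Source f"
  define E' where "E' = Target f"
  have s: "Source f = E" "Target f = E'" by (simp_all add: E_def E'_def)
  have O: "E \<in> bundles" "E' \<in> bundles" using B.arrD(1,2)[OF f] by (simp_all add: E_def E'_def)
  have c: "Fun f x \<in> Car E'" if "x \<in> Car E" for x using B.Fun_closed[OF f s(2)] that s by simp
  have "is_linear (UMod E) (at_origin (UMod (Fib E'))) (\<lambda>x. pr E' (Fun f x))"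
    by (rule is_linearI)
       (use O c in \<open>simp_all add: B.Fun_add[OF f s(1)] B.Fun_smult[OF f s(1)] s FibD(5,6)\<close>)
  moreover have "pr E' (Fun f (cev E t x)) = Act (Fib E') (abs_free_lie t) (pr E' (Fun f x))"
    if "abs_free_lie t \<in> FL_ge2" "x \<in> Car E" for t x
    using that c O by (simp add: cev_Fun[OF f s] FibD(8))
  ultimately have "\<exists>g. R.arr g \<and> Source g = Fib (Source f) \<and> Target g = Fib (Target f) \<and>
     (\<forall>x\<in>Car (Source f). Fun g (pr (Source f) x) = pr (Target f) (Fun f x))"
    unfolding s by (rule fibre_descend_arr[OF Fib[OF O(1)] Fib_rep[OF O(2)]])
  from someI_ex[OF this, folded fibre_map_def]
  show "R.arr (fibre_map f)" "Source (fibre_map f) = Fib (Source f)" "Target (fibre_map f) = Fib (Target f)"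
    "x \<in> Car (Source f) \<Longrightarrow> Fun (fibre_map f) (pr (Source f) x) = pr (Target f) (Fun f x)"
    by simp_all
qed

text \<open>Projections are surjective. With its tensor versions this reduces diagrams of fibres to
  computations with sections of the bundles.\<close>

lemma fibre_arr_eqI:
  assumes g: "R.arr g" "R.arr g'" "Source g = Fib E" "Source g' = Fib E" "Target g = Target g'" and E: "E \<in> bundles"
    and eq: "\<And>x. x \<in> Car E \<Longrightarrow> Fun g (pr E x) = Fun g' (pr E x)"
  shows "g = g'"
proof (rule R.arr_eqI)
  fix m assume "m \<in> Car (Source g)"
  then obtain x where "x \<in> Car E" "pr E x = m" using FibD(4)[OF E] g by auto
  then show "Fun g m = Fun g' m" using eq by auto
qed (use g in auto)

lemma fibre_arr_eq_tensI:
  assumes g: "R.arr g" "R.arr g'" "Source g = tens_obj (Fib E) (Fib F)" "Source g' = tens_obj (Fib E) (Fib F)"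
      "Target g = Target g'" and O: "E \<in> bundles" "F \<in> bundles"
    and eq: "\<And>x y. x \<in> Car E \<Longrightarrow> y \<in> Car F \<Longrightarrow>
      Fun g (tens (Fib E) (Fib F) (pr E x) (pr F y)) = Fun g' (tens (Fib E) (Fib F) (pr E x) (pr F y))"
  shows "g = g'"
proof (rule R.arr_eq_tensI[OF g])
  fix m n assume "m \<in> Car (Fib E)" "n \<in> Car (Fib F)"
  then obtain x y where "x \<in> Car E" "pr E x = m" "y \<in> Car F" "pr F y = n" using FibD(4) O by metis
  then show "Fun g (tens (Fib E) (Fib F) m n) = Fun g' (tens (Fib E) (Fib F) m n)" using eq by auto
qed (use O in auto)

lemma fibre_arr_eq_tens3I:
  assumes g: "R.arr g" "R.arr g'" "Source g = tens_obj (tens_obj (Fib E) (Fib F)) (Fib G)"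
      "Source g' = tens_obj (tens_obj (Fib E) (Fib F)) (Fib G)"
      "Target g = Target g'" and O: "E \<in> bundles" "F \<in> bundles" "G \<in> bundles"
    and eq: "\<And>x y z. x \<in> Car E \<Longrightarrow> y \<in> Car F \<Longrightarrow> z \<in> Car G \<Longrightarrow>
      Fun g (tens (tens_obj (Fib E) (Fib F)) (Fib G) (tens (Fib E) (Fib F) (pr E x) (pr F y)) (pr G z))
      = Fun g' (tens (tens_obj (Fib E) (Fib F)) (Fib G) (tens (Fib E) (Fib F) (pr E x) (pr F y)) (pr G z))"
  shows "g = g'"
proof (rule R.arr_eq_tens3I[OF g])
  fix m n l assume "m \<in> Car (Fib E)" "n \<in> Car (Fib F)" "l \<in> Car (Fib G)"
  then obtain x y z where "x \<in> Car E" "pr E x = m" "y \<in> Car F" "pr F y = n" "z \<in> Car G" "pr G z = l"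
    using FibD(4) O by metis
  then show "Fun g (tens (tens_obj (Fib E) (Fib F)) (Fib G) (tens (Fib E) (Fib F) m n) l)
    = Fun g' (tens (tens_obj (Fib E) (Fib F)) (Fib G) (tens (Fib E) (Fib F) m n) l)" using eq by auto
qed (use O in auto)

definition fibre_tens_arr :: "(('k, 'n) mps, 'u, 'n) opmod \<Rightarrow> (('k, 'n) mps, 'u, 'n) opmod
    \<Rightarrow> (('k, 'w, ('k, 'n) free_lie) opmod, 'w) arrow" where
  "fibre_tens_arr E F = (SOME g. is_iso R.C (tens_obj (Fib E) (Fib F)) (Fib (tens_obj E F)) g \<and>
     (\<forall>x\<in>Car E. \<forall>y\<in>Car F. Fun g (tens (Fib E) (Fib F) (pr E x) (pr F y)) = pr (tens_obj E F) (tens E F x y)))"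

lemma fibre_tens_arr:
  assumes O: "E \<in> bundles" "F \<in> bundles"
  shows "is_iso R.C (tens_obj (Fib E) (Fib F)) (Fib (tens_obj E F)) (fibre_tens_arr E F)"
    "R.arr (fibre_tens_arr E F)" "Source (fibre_tens_arr E F) = tens_obj (Fib E) (Fib F)" "Target (fibre_tens_arr E F) = Fib (tens_obj E F)"
    "x \<in> Car E \<Longrightarrow> y \<in> Car F \<Longrightarrow> Fun (fibre_tens_arr E F) (tens (Fib E) (Fib F) (pr E x) (pr F y)) = pr (tens_obj E F) (tens E F x y)"
proof -
  have "tens_obj E F \<in> bundles" using O by simp
  note * = someI_ex[OF fibre_tensor[OF Fib[OF O(1)] Fib[OF O(2)] Fib[OF this]], folded fibre_tens_arr_def]
  show i: "is_iso R.C (tens_obj (Fib E) (Fib F)) (Fib (tens_obj E F)) (fibre_tens_arr E F)"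
    and "x \<in> Car E \<Longrightarrow> y \<in> Car F \<Longrightarrow> Fun (fibre_tens_arr E F) (tens (Fib E) (Fib F) (pr E x) (pr F y)) = pr (tens_obj E F) (tens E F x y)"
    using * by simp_all
  show "R.arr (fibre_tens_arr E F)" "Source (fibre_tens_arr E F) = tens_obj (Fib E) (Fib F)" "Target (fibre_tens_arr E F) = Fib (tens_obj E F)"
    using R.is_isoD[OF i] by simp_all
qed

definition fibre_unit_arr :: "(('k, 'w, ('k, 'n) free_lie) opmod, 'w) arrow" where
  "fibre_unit_arr = (SOME g. is_iso R.C (unit_obj \<kappa> (\<lambda>_ _. 0)) (Fib (unit_obj \<iota> mps_deriv)) g \<and>
     (\<forall>c. Fun g (\<kappa> c) = pr (unit_obj \<iota> mps_deriv) (\<iota> (mps_const c))))"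

lemma fibre_unit_arr:
  "is_iso R.C (unit_obj \<kappa> (\<lambda>_ _. 0)) (Fib (unit_obj \<iota> mps_deriv)) fibre_unit_arr"
  "R.arr fibre_unit_arr" "Source fibre_unit_arr = unit_obj \<kappa> (\<lambda>_ _. 0)" "Target fibre_unit_arr = Fib (unit_obj \<iota> mps_deriv)"
  "Fun fibre_unit_arr (\<kappa> c) = pr (unit_obj \<iota> mps_deriv) (\<iota> (mps_const c))"
proof -
  note * = someI_ex[OF fibre_unit[OF Fib[OF B.Obs_unit]], folded fibre_unit_arr_def]
  show i: "is_iso R.C (unit_obj \<kappa> (\<lambda>_ _. 0)) (Fib (unit_obj \<iota> mps_deriv)) fibre_unit_arr"
    and "Fun fibre_unit_arr (\<kappa> c) = pr (unit_obj \<iota> mps_deriv) (\<iota> (mps_const c))"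
    using * by simp_all
  show "R.arr fibre_unit_arr" "Source fibre_unit_arr = unit_obj \<kappa> (\<lambda>_ _. 0)" "Target fibre_unit_arr = Fib (unit_obj \<iota> mps_deriv)"
    using R.is_isoD[OF i] by simp_all
qed

lemma fibre_map': "B.arr f \<Longrightarrow> Source f = E \<Longrightarrow> Target f = E' \<Longrightarrow> x \<in> Car E \<Longrightarrow>
    Fun (fibre_map f) (pr E x) = pr E' (Fun f x)"
  using fibre_map(4) by blast

lemmas fib_simps = fibre_map(1-3) fibre_map' fibre_tens_arr(2-5) fibre_unit_arr(2-5)

lemma fibre_category_functor: "category_functor B.C R.C Fib fibre_map"
proof (intro category_functor.intro B.category_C R.category_C category_functor_axioms.intro)
  fix A A' A'' f g
  show "A \<in> Obj B.C \<Longrightarrow> Fib A \<in> Obj R.C" by simp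
  show "f \<in> homset B.C A A' \<Longrightarrow> fibre_map f \<in> homset R.C (Fib A) (Fib A')"
    by (auto simp: B.homset_iff R.homset_iff fib_simps)
  show "A \<in> Obj B.C \<Longrightarrow> fibre_map (Ident B.C A) = Ident R.C (Fib A)"
    by (rule fibre_arr_eqI[of _ _ A]) (auto simp: fib_simps)
  show "f \<in> homset B.C A A' \<Longrightarrow> g \<in> homset B.C A' A'' \<Longrightarrow>
      fibre_map (Comp B.C g f) = Comp R.C (fibre_map g) (fibre_map f)"
    unfolding B.homset_iff by (rule fibre_arr_eqI[of _ _ A]) (auto simp: fib_simps B.arrD)
qed

text \<open>Two fibres of one bundle are isomorphic, because each projection descends along the
  other. Here these are the chosen fibre and \<open>M\<close>, for a bundle constructed with fibre
  \<open>M\<close>.\<close>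

lemma Fib_iso:
  assumes M: "M \<in> representations"
  shows "\<exists>E e. E \<in> bundles \<and> is_iso R.C (Fib E) M e"
proof -
  obtain E :: "(('k, 'n) mps, 'u, 'n) opmod" and p where f: "is_fibre E M p" using bundle_with_fibre_exists[OF M] by blast
  have E: "E \<in> bundles" by (rule is_fibreD(1)[OF f])
  obtain g where g: "R.arr g" "Source g = Fib E" "Target g = M" "\<And>x. x \<in> Car E \<Longrightarrow> Fun g (pr E x) = p x"
    using fibre_descend_arr[OF Fib[OF E] M fibre_linear[OF f] is_fibreD(8)[OF f]] by blast
  obtain g' where g': "R.arr g'" "Source g' = M" "Target g' = Fib E" "\<And>x. x \<in> Car E \<Longrightarrow> Fun g' (p x) = pr E x"
    using fibre_descend_arr[OF f Fib_rep[OF E] fibre_linear[OF Fib[OF E]] FibD(8)[OF E]] by blast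
  have "is_iso R.C (Fib E) M g"
  proof (rule R.arr_isoI[OF g(1) g'(1) g(2,3) g'(2,3)])
    fix m assume "m \<in> Car (Fib E)"
    then obtain x where "x \<in> Car E" "pr E x = m" using FibD(4)[OF E] by blast
    then show "Fun g' (Fun g m) = m" using g(4) g'(4) by auto
  next
    fix m assume "m \<in> Car M"
    then obtain x where "x \<in> Car E" "p x = m" using is_fibreD(4)[OF f] by blast
    then show "Fun g (Fun g' m) = m" using g(4) g'(4) by auto
  qed
  then show ?thesis using E by blast
qed

lemma fibre_is_equivalence: "is_equivalence B.C R.C Fib fibre_map"
proof (rule ff_ess_surj_is_equivalence[OF fibre_category_functor])
  fix A A' g assume "A \<in> Obj B.C" "A' \<in> Obj B.C" and g: "g \<in> homset R.C (Fib A) (Fib A')"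
  then have O: "A \<in> bundles" "A' \<in> bundles" by simp_all
  have g': "R.arr g" "Source g = Fib A" "Target g = Fib A'" using g by (simp_all add: R.homset_iff)
  obtain f where f: "B.arr f" "Source f = A" "Target f = A'" "\<And>x. x \<in> Car A \<Longrightarrow> pr A' (Fun f x) = Fun g (pr A x)"
    using fibre_functor_full[OF Fib[OF O(1)] Fib[OF O(2)] g'] by blast
  have "fibre_map f = g" by (rule fibre_arr_eqI[of _ _ A]) (use f g' O in \<open>auto simp: fib_simps\<close>)
  then show "\<exists>f\<in>homset B.C A A'. fibre_map f = g" using f by (auto simp: B.homset_iff)
next
  fix A A' f f' assume f: "f \<in> homset B.C A A'" "f' \<in> homset B.C A A'" and eq: "fibre_map f = fibre_map f'"
  have f1: "B.arr f" "Source f = A" "Target f = A'" and f2: "B.arr f'" "Source f' = A" "Target f' = A'"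
    using f by (simp_all add: B.homset_iff)
  have A': "A' \<in> bundles" using B.arrD(2)[OF f1(1)] f1 by simp
  show "f = f'"
  proof (rule fibre_functor_faithful[OF Fib[OF A'] f1(1) f2(1) f1(2) f2(2) f1(3) f2(3)])
    fix x assume "x \<in> Car A"
    then show "pr A' (Fun f x) = pr A' (Fun f' x)"
      using fibre_map'[OF f1] fibre_map'[OF f2] eq by simp
  qed
next
  fix M :: "('k, 'w, ('k, 'n) free_lie) opmod" assume "M \<in> Obj R.C"
  then show "\<exists>A e. A \<in> Obj B.C \<and> is_iso R.C (Fib A) M e" using Fib_iso by simp
qed

text \<open>On projected elementary tensors each structure arrow acts by the formula it has on
  sections, and the two sides of every diagram then coincide. For the unit laws, power series act on
  a fibre through their constant term.\<close>

lemma fibre_tensor_functor: "tensor_functor B.C R.C Fib fibre_map fibre_tens_arr fibre_unit_arr"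
proof (intro tensor_functor.intro B.tensor_category_C R.tensor_category_C fibre_category_functor tensor_functor_axioms.intro)
  note h = B.homset_iff
  let ?u = "unit_obj \<iota> mps_deriv" and ?v = "unit_obj \<kappa> (\<lambda>_ _. 0) :: ('k, 'w, ('k, 'n) free_lie) opmod"
  have i: "\<iota> a \<in> Car ?u" "\<kappa> c \<in> Car ?v" for a c by (simp_all add: Bo.Car_unit Ro.Car_unit)
  fix A A' B' D D' E f g and c :: 'k
  show "f \<in> homset B.C A A' \<Longrightarrow> g \<in> homset B.C A A' \<Longrightarrow>
      fibre_map (AddM B.C f g) = AddM R.C (fibre_map f) (fibre_map g)"
    unfolding h by (rule fibre_arr_eqI[of _ _ A]) (auto simp: fib_simps B.arrD FibD(5))
  show "f \<in> homset B.C A A' \<Longrightarrow> fibre_map (ScaleM B.C c f) = ScaleM R.C c (fibre_map f)"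
    unfolding h by (rule fibre_arr_eqI[of _ _ A]) (auto simp: fib_simps B.arrD FibD(6) mps_coeff_0_simps)
  show "A \<in> Obj B.C \<Longrightarrow> D \<in> Obj B.C \<Longrightarrow>
      is_iso R.C (TensO R.C (Fib A) (Fib D)) (Fib (TensO B.C A D)) (fibre_tens_arr A D)"
    using fibre_tens_arr(1) by simp
  show "f \<in> homset B.C A A' \<Longrightarrow> g \<in> homset B.C D D' \<Longrightarrow>
      Comp R.C (fibre_tens_arr A' D') (TensM R.C (fibre_map f) (fibre_map g)) = Comp R.C (fibre_map (TensM B.C f g)) (fibre_tens_arr A D)"
    unfolding h by (rule fibre_arr_eq_tensI[of _ _ A D]) (auto simp: fib_simps B.arrD)
  show "is_iso R.C (UnitO R.C) (Fib (UnitO B.C)) fibre_unit_arr" using fibre_unit_arr(1) by simp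
  show "A \<in> Obj B.C \<Longrightarrow> D \<in> Obj B.C \<Longrightarrow> E \<in> Obj B.C \<Longrightarrow>
      Comp R.C (fibre_map (Assoc B.C A D E)) (Comp R.C (fibre_tens_arr (TensO B.C A D) E) (TensM R.C (fibre_tens_arr A D) (Ident R.C (Fib E))))
      = Comp R.C (fibre_tens_arr A (TensO B.C D E)) (Comp R.C (TensM R.C (Ident R.C (Fib A)) (fibre_tens_arr D E))
          (Assoc R.C (Fib A) (Fib D) (Fib E)))"
    by (rule fibre_arr_eq_tens3I[of _ _ A D E]) (auto simp: fib_simps)
  show "A \<in> Obj B.C \<Longrightarrow> Comp R.C (fibre_map (LUnit B.C A)) (Comp R.C (fibre_tens_arr (UnitO B.C) A)
      (TensM R.C fibre_unit_arr (Ident R.C (Fib A)))) = LUnit R.C (Fib A)"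
  proof (rule R.arr_eq_tensI[of _ _ ?v "Fib A"])
    fix u m assume A: "A \<in> Obj B.C" and "u \<in> Car ?v" "m \<in> Car (Fib A)"
    then obtain r x where "u = \<kappa> r" "x \<in> Car A" "m = pr A x" using FibD(4)[of A m] by (auto simp: Ro.Car_unit)
    then show "Fun (Comp R.C (fibre_map (LUnit B.C A)) (Comp R.C (fibre_tens_arr (UnitO B.C) A)
      (TensM R.C fibre_unit_arr (Ident R.C (Fib A))))) (tens ?v (Fib A) u m) = Fun (LUnit R.C (Fib A)) (tens ?v (Fib A) u m)"
      using A i by (simp add: fib_simps FibD(6) mps_coeff_0_simps)
  qed (auto simp: fib_simps)
  show "A \<in> Obj B.C \<Longrightarrow> Comp R.C (fibre_map (RUnit B.C A)) (Comp R.C (fibre_tens_arr A (UnitO B.C))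
      (TensM R.C (Ident R.C (Fib A)) fibre_unit_arr)) = RUnit R.C (Fib A)"
  proof (rule R.arr_eq_tensI[of _ _ "Fib A" ?v])
    fix u m assume A: "A \<in> Obj B.C" and "u \<in> Car ?v" "m \<in> Car (Fib A)"
    then obtain r x where "u = \<kappa> r" "x \<in> Car A" "m = pr A x" using FibD(4)[of A m] by (auto simp: Ro.Car_unit)
    then show "Fun (Comp R.C (fibre_map (RUnit B.C A)) (Comp R.C (fibre_tens_arr A (UnitO B.C))
      (TensM R.C (Ident R.C (Fib A)) fibre_unit_arr))) (tens (Fib A) ?v m u) = Fun (RUnit R.C (Fib A)) (tens (Fib A) ?v m u)"
      using A i by (simp add: fib_simps FibD(6) mps_coeff_0_simps)
  qed (auto simp: fib_simps)
  show "A \<in> Obj B.C \<Longrightarrow> D \<in> Obj B.C \<Longrightarrow>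
      Comp R.C (fibre_map (Braid B.C A D)) (fibre_tens_arr A D) = Comp R.C (fibre_tens_arr D A) (Braid R.C (Fib A) (Fib D))"
    by (rule fibre_arr_eq_tensI[of _ _ A D]) (auto simp: fib_simps)
qed

end

declare [[coercion_enabled]]

theorem theorem4p4p3:
  fixes \<iota> :: "('k::field_char_0, 'n::finite) mps \<Rightarrow> 'u"
    and \<kappa> :: "'k \<Rightarrow> 'w"
  assumes "inj \<iota>" and "inj \<kappa>"
  shows "tensor_equivalent (Bun_conn \<iota>) (Rep_FL_ge2 TYPE('n) \<kappa>)"
proof -
  interpret disk \<iota> \<kappa> using assms by unfold_locales
  show ?thesis
    unfolding tensor_equivalent_def Bun_conn_def Rep_FL_ge2_def
    using fibre_tensor_functor fibre_is_equivalence by blast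
qed

end
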